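(* Let $n\ge 3$, $s\in(0,1)$, $2^*=\frac{2n}{n-2}$, and let $\Omega\subset\mathbb{R}^n$ be a nonempty open and bounded set. For $\lambda\in\mathbb{R}$ consider the problem $$(P_\lambda)\qquad\begin{cases}-\Delta u+(-\Delta)^s u=u^{2^*-1}+\lambda u&\text{in }\Omega,\\ u\gneqq 0&\text{in }\Omega,\\ u\equiv 0&\text{in }\mathbb{R}^n\setminus\Omega.\end{cases}$$ There exists some $\lambda^*\in[\lambda_{1,s},\lambda_1)$ such that problem $(P_\lambda)$ possesses at least one solution if $\lambda^*<\lambda<\lambda_1$. Moreover, the following facts hold: (1) there do not exist solutions to problem $(P_\lambda)$ if $\lambda\ge\lambda_1$; (2) for every $0<\lambda\le\lambda_{1,s}$ there do not exist solutions to problem $(P_\lambda)$ belonging to the closed ball $$\mathcal{B}:=\{u\in L^{2^*}(\mathbb{R}^n):\ \|u\|_{L^{2^*}(\mathbb{R}^n)}\le \mathcal{S}_n^{(n-2)/4}\}.$$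
   Context: For measurable $u:\mathbb{R}^n\to\mathbb{R}$ set $[u]_s:=\Big(\iint_{\mathbb{R}^{2n}}\frac{|u(x)-u(y)|^2}{|x-y|^{n+2s}}\,dx\,dy\Big)^{1/2}$ and $\rho(u)^2:=\|\nabla u\|^2_{L^2(\mathbb{R}^n)}+[u]_s^2$. Functions in $C_0^\infty(\Omega)$ are extended by zero to $\mathbb{R}^n$. The first Dirichlet eigenvalues in $\Omega$ of $(-\Delta)^s$ and of $-\Delta+(-\Delta)^s$ are $$\lambda_{1,s}:=\inf\{[u]_s^2:u\in C_0^\infty(\Omega),\ \|u\|_{L^2(\mathbb{R}^n)}=1\},\qquad \lambda_1:=\inf\{\rho(u)^2:u\in C_0^\infty(\Omega),\ \|u\|_{L^2(\mathbb{R}^n)}=1\}.$$ The classical best Sobolev constant is $\mathcal{S}_n:=\inf\{\|\nabla u\|^2_{L^2(\mathbb{R}^n)}:u\in C_0^\infty(\mathbb{R}^n),\ \|u\|_{L^{2^*}(\mathbb{R}^n)}=1\}$. Let $\mathcal{X}^{1,2}(\Omega)=\{u\in H^1(\mathbb{R}^n): u|_\Omega\in H^1_0(\Omega),\ u\equiv0\text{ a.e. in }\mathbb{R}^n\setminus\Omega\}$. A solution of $(P_\lambda)$ is a function $u\in\mathcal{X}^{1,2}(\Omega)$ with $u\ge0$ a.e. in $\Omega$, $|\{x\in\Omega:u(x)>0\}|>0$, such that for every $v\in\mathcal{X}^{1,2}(\Omega)$ $$\int_\Omega\nabla u\cdot\nabla v\,dx+\iint_{\mathbb{R}^{2n}}\frac{(u(x)-u(y))(v(x)-v(y))}{|x-y|^{n+2s}}\,dx\,dy=\int_\Omega(u^{2^*-1}+\lambda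 u)v\,dx .$$ *)

theory Defs
  imports "HOL-Analysis.Analysis"
begin

text \<open>
  All measure-theoretic notions refer to Lebesgue measure \<^term>\<open>lebesgue\<close>, on \<^typ>\<open>real ^ 'n\<close>
  or, for the double integrals, on \<^typ>\<open>(real ^ 'n) \<times> (real ^ 'n)\<close>.  Functions are not
  identified up to null sets.
\<close>

definition partial :: "'n \<Rightarrow> (real ^ 'n \<Rightarrow> real) \<Rightarrow> real ^ 'n \<Rightarrow> real" where
  "partial i f x = frechet_derivative f (at x) (axis i 1)"

definition grad :: "(real ^ 'n \<Rightarrow> real) \<Rightarrow> real ^ 'n \<Rightarrow> real ^ 'n" where
  "grad f x = (\<chi> i. partial i f x)"

primrec C_k :: "nat \<Rightarrow> (real ^ 'n \<Rightarrow> real) \<Rightarrow> bool" where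
  "C_k 0 f \<longleftrightarrow> continuous_on UNIV f"
| "C_k (Suc k) f \<longleftrightarrow> (\<forall>x. f differentiable (at x)) \<and> (\<forall>i. C_k k (partial i f))"

text \<open>The space $C_0^\infty(\Omega)$, its elements being extended by zero to the whole space.\<close>

definition test_functions :: "(real ^ 'n) set \<Rightarrow> (real ^ 'n \<Rightarrow> real) set" where
  "test_functions \<Omega> = {\<phi>. (\<forall>k. C_k k \<phi>) \<and>
     compact (closure {x. \<phi> x \<noteq> 0}) \<and> closure {x. \<phi> x \<noteq> 0} \<subseteq> \<Omega>}"

definition Lp :: "real \<Rightarrow> (real ^ 'n) set \<Rightarrow> (real ^ 'n \<Rightarrow> 'b::euclidean_space) set" where
  "Lp p \<Omega> = {f. set_borel_measurable lebesgue \<Omega> f \<and>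
                set_integrable lebesgue \<Omega> (\<lambda>x. norm (f x) powr p)}"

text \<open>Meaningful on \<^term>\<open>Lp p \<Omega>\<close> only: a divergent integral evaluates to 0.\<close>

definition Lp_norm :: "real \<Rightarrow> (real ^ 'n) set \<Rightarrow> (real ^ 'n \<Rightarrow> 'b::euclidean_space) \<Rightarrow> real" where
  "Lp_norm p \<Omega> f = (LINT x:\<Omega>|lebesgue. norm (f x) powr p) powr (1 / p)"

definition locally_integrable :: "(real ^ 'n) set \<Rightarrow> (real ^ 'n \<Rightarrow> 'b::euclidean_space) \<Rightarrow> bool" where
  "locally_integrable \<Omega> f \<longleftrightarrow> (\<forall>K. compact K \<and> K \<subseteq> \<Omega> \<longrightarrow> set_integrable lebesgue K f)"

definition weak_gradient ::
  "(real ^ 'n) set \<Rightarrow> (real ^ 'n \<Rightarrow> real) \<Rightarrow> (real ^ 'n \<Rightarrow> real ^ 'n) \<Rightarrow> bool" where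
  "weak_gradient \<Omega> u g \<longleftrightarrow> locally_integrable \<Omega> u \<and> locally_integrable \<Omega> g \<and>
     (\<forall>\<phi>\<in>test_functions \<Omega>. \<forall>i.
        (LINT x:\<Omega>|lebesgue. u x * partial i \<phi> x) = - (LINT x:\<Omega>|lebesgue. g x $ i * \<phi> x))"

text \<open>If a weak gradient exists, it is unique up to a null set of \<open>\<Omega>\<close>; its values outside
  \<open>\<Omega>\<close> are unspecified.\<close>

definition wgrad :: "(real ^ 'n) set \<Rightarrow> (real ^ 'n \<Rightarrow> real) \<Rightarrow> real ^ 'n \<Rightarrow> real ^ 'n" where
  "wgrad \<Omega> u = (SOME g. weak_gradient \<Omega> u g)"

definition H1 :: "(real ^ 'n) set \<Rightarrow> (real ^ 'n \<Rightarrow> real) set" where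
  "H1 \<Omega> = {u \<in> Lp 2 \<Omega>. \<exists>g\<in>Lp 2 \<Omega>. weak_gradient \<Omega> u g}"

definition H1_norm :: "(real ^ 'n) set \<Rightarrow> (real ^ 'n \<Rightarrow> real) \<Rightarrow> real" where
  "H1_norm \<Omega> u = sqrt ((Lp_norm 2 \<Omega> u)\<^sup>2 + (Lp_norm 2 \<Omega> (wgrad \<Omega> u))\<^sup>2)"

text \<open>The closure of $C_0^\infty(\Omega)$ in $H^1(\Omega)$.  Membership depends only on the values on
  \<open>\<Omega>\<close>, so that no explicit restriction $u|_\Omega$ is needed.\<close>

definition H10 :: "(real ^ 'n) set \<Rightarrow> (real ^ 'n \<Rightarrow> real) set" where
  "H10 \<Omega> = {u \<in> H1 \<Omega>. \<exists>\<phi>. (\<forall>k. \<phi> k \<in> test_functions \<Omega>) \<and>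
     (\<lambda>k::nat. H1_norm \<Omega> (\<lambda>x. u x - \<phi> k x)) \<longlonglongrightarrow> 0}"

definition X12 :: "(real ^ 'n) set \<Rightarrow> (real ^ 'n \<Rightarrow> real) set" where
  "X12 \<Omega> = {u \<in> H1 UNIV. u \<in> H10 \<Omega> \<and> (AE x in lebesgue. x \<notin> \<Omega> \<longrightarrow> u x = 0)}"

text \<open>The squared quantities $[u]_s^2$, $\|\nabla u\|_{L^2}^2$ and $\rho(u)^2$, with values in
  $[0,\infty]$.  The gradient is the classical one, as the last two are applied to smooth
  functions only.  On the null set $x = y$ the quotient is $0/0 = 0$.\<close>

definition gagliardo_sq :: "real \<Rightarrow> (real ^ 'n \<Rightarrow> real) \<Rightarrow> ennreal" where
  "gagliardo_sq s u =
     (\<integral>\<^sup>+ (x, y). ennreal (\<bar>u x - u y\<bar>\<^sup>2 / norm (x - y) powr (real CARD('n) + 2 * s)) \<partial>lebesgue)"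

definition dirichlet_sq :: "(real ^ 'n \<Rightarrow> real) \<Rightarrow> ennreal" where
  "dirichlet_sq u = (\<integral>\<^sup>+ x. ennreal ((norm (grad u x))\<^sup>2) \<partial>lebesgue)"

definition rho_sq :: "real \<Rightarrow> (real ^ 'n \<Rightarrow> real) \<Rightarrow> ennreal" where
  "rho_sq s u = dirichlet_sq u + gagliardo_sq s u"

definition lambda_1s :: "real \<Rightarrow> (real ^ 'n) set \<Rightarrow> real" where
  "lambda_1s s \<Omega> =
     enn2real (INF u \<in> {u \<in> test_functions \<Omega>. Lp_norm 2 UNIV u = 1}. gagliardo_sq s u)"

definition lambda_1 :: "real \<Rightarrow> (real ^ 'n) set \<Rightarrow> real" where
  "lambda_1 s \<Omega> =
     enn2real (INF u \<in> {u \<in> test_functions \<Omega>. Lp_norm 2 UNIV u = 1}. rho_sq s u)"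

text \<open>$2^* = 2n/(n-2)$.\<close>

definition crit_exp :: "nat \<Rightarrow> real" where
  "crit_exp n = 2 * real n / (real n - 2)"

definition sobolev_const :: "'n::finite itself \<Rightarrow> real" where
  "sobolev_const _ =
     enn2real (INF u \<in> {u \<in> test_functions (UNIV :: (real ^ 'n) set).
                          Lp_norm (crit_exp CARD('n)) UNIV u = 1}. dirichlet_sq u)"

text \<open>For bounded \<open>\<Omega>\<close>, \<open>n \<ge> 3\<close> and \<open>0 < s < 1\<close>, all integrals below converge
  absolutely, so the Bochner integrals carry no spurious default values.\<close>

definition is_solution :: "real \<Rightarrow> (real ^ 'n) set \<Rightarrow> real \<Rightarrow> (real ^ 'n \<Rightarrow> real) \<Rightarrow> bool" where
  "is_solution s \<Omega> lam u \<longleftrightarrow>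
     u \<in> X12 \<Omega> \<and>
     (AE x in lebesgue. x \<in> \<Omega> \<longrightarrow> u x \<ge> 0) \<and>
     emeasure lebesgue {x \<in> \<Omega>. u x > 0} > 0 \<and>
     (\<forall>v \<in> X12 \<Omega>.
        (LINT x:\<Omega>|lebesgue. wgrad UNIV u x \<bullet> wgrad UNIV v x)
        + (LINT (x, y)|lebesgue. (u x - u y) * (v x - v y)
              / norm (x - y) powr (real CARD('n) + 2 * s))
        = (LINT x:\<Omega>|lebesgue. (u x powr (crit_exp CARD('n) - 1) + lam * u x) * v x))"

end

theory Submission
  imports Defs "HOL-Library.Diagonal_Subsequence"
begin

text \<open>Notation: \<open>\<rho>(u)\<^sup>2\<close> is the sum of the Dirichlet and the fractional energy, \<open>\<lambda>\<^sub>1\<close> and \<open>\<lambda>\<^sub>1\<^sub>s\<close> are the two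
  eigenvalues, \<open>S\<close> is the best Sobolev constant and \<open>p = 2n/(n - 2)\<close>.

  \<^bold>\<open>The function space.\<close>  All arguments take place in the closure of the test functions for the norm
  of \<open>u\<close> and \<open>\<nabla>u\<close> in \<open>L\<^sup>2\<close>.  Its elements are pairs \<open>(u, G)\<close> of limits of test functions and of their
  gradients (\<open>approx\<close>), and it coincides with \<open>X12 \<Omega>\<close> (\<open>approx_imp_X12\<close>, \<open>X12_imp_approx\<close>).  The
  fractional energy is continuous on it, because it is dominated by the \<open>H\<^sup>1\<close> norm (\<open>gagliardo_bound\<close>),
  and inequalities for the critical norm pass to the limit by Fatou's lemma (\<open>pint_approx\<close>).

  \<^bold>\<open>The gap \<open>\<lambda>\<^sub>1\<^sub>s < \<lambda>\<^sub>1\<close>.\<close>  On a bounded set the Sobolev inequality bounds the Dirichlet energy of an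
  \<open>L\<^sup>2\<close>-normalized test function away from zero, so the full energy exceeds the fractional one by a
  fixed amount (\<open>lambda_gap\<close>).

  \<^bold>\<open>Existence below \<open>\<lambda>\<^sub>1\<close>.\<close>  A minimizer of \<open>\<rho>(u)\<^sup>2 - \<lambda>\<parallel>u\<parallel>\<^sub>2\<^sup>2\<close> on the unit sphere of \<open>L\<^sup>p\<close> is, up to scaling, a
  solution (\<open>euler_lagrange\<close>).  The embedding into \<open>L\<^sup>p\<close> is not compact, but the infimum tends to zero
  as \<open>\<lambda>\<close> tends to \<open>\<lambda>\<^sub>1\<close>, and for small infimum minimizing sequences converge strongly.  Indeed, let
  \<open>a, b \<ge> 0\<close> be almost minimizers.  The \<open>p\<close>-th power of the critical norm of their midpoint is at least
  \<open>1 - C\<parallel>a - b\<parallel>\<^sub>p\<^sup>2\<close>, since \<open>t\<^sup>p\<close> is twice differentiable, and the parallelogram identity turns this into a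
  bound for the energy of \<open>a - b\<close> by
  \<open>level \<sqdot> C\<parallel>a - b\<parallel>\<^sub>p\<^sup>2 + \<lambda>\<parallel>a - b\<parallel>\<^sub>2\<^sup>2\<close> up to small errors and factors.  If the level is small, the Sobolev
  inequality absorbs the first term.  The second one is a compact term, so a subsequence of a minimizing
  sequence is Cauchy in energy (\<open>almost_minimizers_close\<close>, \<open>minimizer_exists\<close>).

  \<^bold>\<open>Nonexistence for \<open>\<lambda> \<ge> \<lambda>\<^sub>1\<close>.\<close>  For a solution \<open>u\<close>, Picone's inequality, that is, testing the equation
  with \<open>\<phi>\<^sup>2/u\<close>, yields \<open>\<integral>(u\<^sup>p\<^sup>-\<^sup>2 + \<lambda>)\<phi>\<^sup>2 \<le> \<rho>(\<phi>)\<^sup>2\<close> for all test functions \<open>\<phi>\<close> (\<open>linearized_bound\<close>).  Along a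
  minimizing sequence for \<open>\<lambda>\<^sub>1\<close> this forces \<open>\<integral>u\<^sup>p\<^sup>-\<^sup>2\<phi>\<^sub>k\<^sup>2 \<rightarrow> 0\<close>, which contradicts the positivity of \<open>u\<close>,
  as the sequence is compact in \<open>L\<^sup>2\<close>.  Positivity comes from the nonlocal part
  of the energy: if \<open>u\<close> vanished on a subset of \<open>\<Omega>\<close> of positive measure, the nonlocal remainder in
  Picone's inequality would blow up (\<open>positive_on_test\<close>).  To stay within the function space, \<open>u\<close> is replaced in the denominator by a
  smooth function \<open>reg \<epsilon> u\<close> that increases at least as fast as \<open>u\<close>.

  \<^bold>\<open>Nonexistence in the ball.\<close>  Testing with \<open>u\<close> itself and using \<open>\<lambda> \<le> \<lambda>\<^sub>1\<^sub>s\<close> gives \<open>\<parallel>\<nabla>u\<parallel>\<^sub>2\<^sup>2 \<le> \<parallel>u\<parallel>\<^sub>p\<^sup>p\<close>, and the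
  radius of the ball is such that the right-hand side is at most \<open>S\<parallel>u\<parallel>\<^sub>p\<^sup>2\<close>.  Hence \<open>u\<close> would attain the
  Sobolev constant.  This is impossible for a nonzero nonnegative function with bounded support: adding
  \<open>t\<eta>\<close>, where \<open>\<eta> = 1\<close> on \<open>\<Omega>\<close>, costs energy of order \<open>t\<^sup>2\<close> only, whereas the critical norm grows linearly
  in \<open>t\<close> (\<open>sobolev_strict\<close>).

  The Sobolev inequality and the compactness theorem are derived from elementary mean value estimates:
  the former by comparing superlevel sets (\<open>superlevel_decay\<close>), the latter by averaging over cubes
  (\<open>cell_estimate\<close>).\<close>

section \<open>Smooth functions\<close>

definition smooth :: "(real ^ 'n \<Rightarrow> real) \<Rightarrow> bool" where
  "smooth f \<longleftrightarrow> (\<forall>k. C_k k f)"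

lemma smooth_differentiable: "smooth f \<Longrightarrow> f differentiable (at x)"
  unfolding smooth_def by (metis C_k.simps(2))

lemma smooth_partial: "smooth f \<Longrightarrow> smooth (partial i f)"
  unfolding smooth_def by (metis C_k.simps(2))

lemma smooth_continuous: "smooth f \<Longrightarrow> continuous_on A f"
  unfolding smooth_def by (metis C_k.simps(1) continuous_on_subset top_greatest)

text \<open>To prove smoothness it suffices to exhibit a class of differentiable functions that is closed under
  partial derivatives.\<close>

lemma smooth_coinduct:
  fixes f :: "real ^ 'n \<Rightarrow> real"
  assumes "P f"
    and step: "\<And>g. P g \<Longrightarrow> (\<forall>x. g differentiable (at x)) \<and> (\<forall>i. P (partial i g))"
  shows "smooth f"
proof -
  have "P g \<Longrightarrow> C_k k g" for k and g :: "real ^ 'n \<Rightarrow> real"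
  proof (induction k arbitrary: g)
    case 0
    then show ?case
      using step by (auto simp: continuous_on_eq_continuous_at differentiable_imp_continuous_within)
  next
    case (Suc k)
    then show ?case using step by auto
  qed
  with assms(1) show ?thesis by (auto simp: smooth_def)
qed

lemma partial_eqI: "(f has_derivative f') (at x) \<Longrightarrow> partial i f x = f' (axis i 1)"
  unfolding partial_def by (metis frechet_derivative_at)

lemma smooth_has_derivative:
  assumes "smooth f"
  shows "(f has_derivative (\<lambda>h. grad f x \<bullet> h)) (at x)"
proof -
  obtain f' where f': "(f has_derivative f') (at x)"
    using smooth_differentiable[OF assms] unfolding differentiable_def by blast
  interpret bounded_linear f' using f' by (rule has_derivative_bounded_linear)
  have "f' h = grad f x \<bullet> h" for h
  proof -
    have "f' h = f' (\<Sum>i\<in>UNIV. h $ i *\<^sub>R axis i 1)"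
      using basis_expansion[of h] by (simp add: scalar_mult_eq_scaleR)
    also have "\<dots> = (\<Sum>i\<in>UNIV. h $ i * f' (axis i 1))" by (simp add: sum scaleR)
    also have "\<dots> = grad f x \<bullet> h"
      using partial_eqI[OF f'] by (simp add: grad_def inner_vec_def mult.commute)
    finally show ?thesis .
  qed
  then have "f' = (\<lambda>h. grad f x \<bullet> h)" by auto
  with f' show ?thesis by simp
qed

text \<open>The derivative of \<open>exp (- 1 / t)\<close> and all its higher derivatives are combinations of the functions
  \<open>exp (- 1 / t) / t ^ m\<close>; with the parameter \<open>m\<close> the family is closed under differentiation.\<close>

definition flat :: "nat \<Rightarrow> real \<Rightarrow> real" where
  "flat m t = (if t > 0 then exp (- (1 / t)) / t ^ m else 0)"

lemma flat_right_limit: "(flat m \<longlongrightarrow> 0) (at_right 0)"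
proof -
  have "((\<lambda>t::real. (inverse t) ^ m / exp (inverse t)) \<longlongrightarrow> 0) (at_right 0)"
    by (rule filterlim_compose[OF tendsto_power_div_exp_0 filterlim_inverse_at_top_right])
  then show ?thesis
    apply (rule Lim_transform_eventually)
    unfolding flat_def eventually_at_right_field
    by (auto simp: exp_minus field_simps intro!: exI[of _ 1])
qed

lemma flat_DERIV: "(flat m has_real_derivative (flat (m + 2) t - real m * flat (m + 1) t)) (at t)"
proof -
  consider "t > 0" | "t < 0" | "t = 0" by linarith
  then show ?thesis
  proof cases
    case 1
    define y where "y = 1 / t"
    have fl: "flat k t = exp (- y) * y ^ k" for k
      using 1 by (simp add: flat_def y_def power_divide)
    have y: "((\<lambda>t. 1 / t) has_real_derivative - (y ^ 2)) (at t)"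
      using 1 by (auto intro!: derivative_eq_intros simp: y_def power2_eq_square)
    have "((\<lambda>t. exp (- (1 / t)) * (1 / t) ^ m) has_real_derivative
       exp (- y) * y ^ 2 * y ^ m - exp (- y) * (real m * y ^ (m - 1) * y ^ 2)) (at t)"
      using DERIV_mult[OF DERIV_fun_exp[OF DERIV_minus[OF y]] DERIV_power[OF y, of m]]
      unfolding y_def[symmetric] by (simp add: mult_ac)
    also have "exp (- y) * y ^ 2 * y ^ m - exp (- y) * (real m * y ^ (m - 1) * y ^ 2)
        = flat (m + 2) t - real m * flat (m + 1) t"
      unfolding fl by (cases m) (simp_all add: power2_eq_square mult_ac)
    finally have "((\<lambda>t. exp (- (1 / t)) / t ^ m) has_real_derivative
       (flat (m + 2) t - real m * flat (m + 1) t)) (at t)"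
      by (simp add: power_divide)
    moreover have "\<forall>\<^sub>F x in nhds t. flat m x = exp (- (1 / x)) / x ^ m"
      using 1 by (auto simp: eventually_nhds flat_def intro!: exI[of _ "{0<..}"])
    ultimately show ?thesis by (subst DERIV_cong_ev[OF refl _ refl]) auto
  next
    case 2
    have "((\<lambda>t. 0) has_real_derivative (flat (m + 2) t - real m * flat (m + 1) t)) (at t)"
      using 2 by (auto simp: flat_def)
    moreover have "\<forall>\<^sub>F x in nhds t. flat m x = 0"
      using 2 by (auto simp: eventually_nhds flat_def intro!: exI[of _ "{..<0}"])
    ultimately show ?thesis by (subst DERIV_cong_ev[OF refl _ refl]) auto
  next
    case 3
    have "((\<lambda>h. flat (m + 1) h) \<longlongrightarrow> 0) (at 0)"
    proof (subst filterlim_at_split, safe)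
      show "(flat (m + 1) \<longlongrightarrow> 0) (at_left 0)"
        by (rule Lim_transform_eventually[OF tendsto_const])
          (auto simp: eventually_at_left_field flat_def intro!: exI[of _ "-1"])
    qed (rule flat_right_limit)
    moreover have "flat m h / h = flat (m + 1) h" for h by (auto simp: flat_def)
    ultimately have "((\<lambda>h. (flat m (0 + h) - flat m 0) / h) \<longlongrightarrow> 0) (at 0)"
      by (simp add: flat_def[of m 0])
    then show ?thesis unfolding DERIV_def 3 by (simp add: flat_def)
  qed
qed

text \<open>Closure of the smooth functions under the operations that occur in bumps, cutoffs and
  regularized quotients.  The class is designed so that each operation is differentiated into
  other members of the class; smoothness of all of them then follows at once by coinduction.\<close>

inductive elementary :: "(real ^ 'n \<Rightarrow> real) \<Rightarrow> bool" where
  elementary_smooth: "smooth f \<Longrightarrow> elementary f"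
| elementary_const: "elementary (\<lambda>x. c)"
| elementary_nth: "elementary (\<lambda>x. x $ i)"
| elementary_add: "elementary f \<Longrightarrow> elementary g \<Longrightarrow> elementary (\<lambda>x. f x + g x)"
| elementary_mult: "elementary f \<Longrightarrow> elementary g \<Longrightarrow> elementary (\<lambda>x. f x * g x)"
| elementary_inverse: "elementary f \<Longrightarrow> (\<And>x. f x \<noteq> 0) \<Longrightarrow> elementary (\<lambda>x. inverse (f x))"
| elementary_sqrt: "elementary f \<Longrightarrow> (\<And>x. f x > 0) \<Longrightarrow> elementary (\<lambda>x. sqrt (f x))"
| elementary_arctan: "elementary f \<Longrightarrow> elementary (\<lambda>x. arctan (f x))"
| elementary_flat: "elementary f \<Longrightarrow> elementary (\<lambda>x. flat m (f x))"

lemma chain_partial: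
  fixes f :: "real ^ 'n \<Rightarrow> real"
  assumes "(\<phi> has_real_derivative d) (at (f x))" and "f differentiable (at x)"
  shows "(\<lambda>x. \<phi> (f x)) differentiable (at x)" "partial i (\<lambda>x. \<phi> (f x)) x = d * partial i f x"
proof -
  obtain f' where f': "(f has_derivative f') (at x)"
    using assms(2) unfolding differentiable_def by blast
  have *: "((\<lambda>x. \<phi> (f x)) has_derivative (\<lambda>h. d * f' h)) (at x)"
    using has_derivative_compose[OF f' assms(1)[unfolded has_field_derivative_def]] by simp
  then show "(\<lambda>x. \<phi> (f x)) differentiable (at x)" unfolding differentiable_def by blast
  show "partial i (\<lambda>x. \<phi> (f x)) x = d * partial i f x"
    by (simp add: partial_eqI[OF *] partial_eqI[OF f'])
qed

lemma partial_add:
  assumes "f differentiable (at x)" "g differentiable (at x)"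
  shows "partial i (\<lambda>x. f x + g x) x = partial i f x + partial i g x"
proof -
  obtain f' g' where d: "(f has_derivative f') (at x)" "(g has_derivative g') (at x)"
    using assms unfolding differentiable_def by blast
  show ?thesis
    using partial_eqI[OF has_derivative_add[OF d]] d[THEN partial_eqI] by simp
qed

lemma partial_mult:
  assumes "f differentiable (at x)" "g differentiable (at x)"
  shows "partial i (\<lambda>x. f x * g x) x = f x * partial i g x + g x * partial i f x"
proof -
  obtain f' g' where d: "(f has_derivative f') (at x)" "(g has_derivative g') (at x)"
    using assms unfolding differentiable_def by blast
  show ?thesis
    using partial_eqI[OF has_derivative_mult[OF d]] d[THEN partial_eqI] by (simp add: mult.commute)
qed

lemma partial_nth: "partial i (\<lambda>x::real^'n. x $ j) = (\<lambda>x. if i = j then 1 else 0)"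
proof
  fix x :: "real^'n"
  have "((\<lambda>x::real^'n. x $ j) has_derivative (\<lambda>h. h $ j)) (at x)"
    by (rule bounded_linear_imp_has_derivative[OF bounded_linear_vec_nth])
  from partial_eqI[OF this] show "partial i (\<lambda>x. x $ j) x = (if i = j then 1 else 0)"
    by (auto simp: axis_def)
qed

lemma partial_const: "partial i (\<lambda>x. c) = (\<lambda>x. 0)"
  by (rule ext) (simp add: partial_eqI[OF has_derivative_const])

lemmas elementary_ops = elementary_const elementary_nth elementary_add elementary_mult elementary_inverse elementary_sqrt elementary_arctan elementary_flat

lemma elementary_step_chain:
  assumes f: "(\<forall>x. f differentiable (at x)) \<and> (\<forall>i. elementary (partial i f))"
    and d: "\<And>x. (\<phi> has_real_derivative \<phi>' (f x)) (at (f x))" and e: "elementary (\<lambda>x. \<phi>' (f x))"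
  shows "(\<forall>x. (\<lambda>x. \<phi> (f x)) differentiable (at x)) \<and> (\<forall>i. elementary (partial i (\<lambda>x. \<phi> (f x))))"
proof -
  have "partial i (\<lambda>x. \<phi> (f x)) = (\<lambda>x. \<phi>' (f x) * partial i f x)" for i
    using f by (intro ext chain_partial(2)[where f = f, OF d]) auto
  then show ?thesis using f e chain_partial(1)[where f = f, OF d] by (simp add: elementary_mult)
qed

lemma elementary_step:
  assumes "elementary f"
  shows "(\<forall>x. f differentiable (at x)) \<and> (\<forall>i. elementary (partial i f))"
  using assms
proof induction
  case (elementary_smooth f)
  then show ?case using smooth_differentiable smooth_partial elementary.elementary_smooth by blast
next
  case (elementary_const c)
  show ?case by (auto simp: partial_const intro: elementary_ops)
next
  case (elementary_nth i)
  have "(\<lambda>x::real^'a. x $ i) differentiable at x" for x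
    using bounded_linear_imp_has_derivative[OF bounded_linear_vec_nth] differentiable_def by blast
  then show ?case by (auto simp: partial_nth intro: elementary_ops)
next
  case (elementary_add f g)
  then have "partial i (\<lambda>x. f x + g x) = (\<lambda>x. partial i f x + partial i g x)" for i
    by (auto intro!: ext partial_add)
  with elementary_add show ?case by (auto intro!: elementary_ops)
next
  case (elementary_mult f g)
  then have "partial i (\<lambda>x. f x * g x) = (\<lambda>x. f x * partial i g x + g x * partial i f x)" for i
    by (auto intro!: ext partial_mult)
  with elementary_mult show ?case by (auto intro!: elementary_ops)
next
  case (elementary_inverse f)
  show ?case
  proof (rule elementary_step_chain[OF elementary_inverse(3), where \<phi>' = "\<lambda>t. - (1) * (inverse t * inverse t)"])
    show "(inverse has_real_derivative - (1) * (inverse (f x) * inverse (f x))) (at (f x))" for x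
      using DERIV_inverse[OF elementary_inverse(2), of x] by (simp add: power2_eq_square)
    show "elementary (\<lambda>x. - (1) * (inverse (f x) * inverse (f x)))"
      by (intro elementary_ops) (use elementary_inverse in auto)
  qed
next
  case (elementary_sqrt f)
  show ?case
  proof (rule elementary_step_chain[OF elementary_sqrt(3), where \<phi>' = "\<lambda>t. (1/2) * inverse (sqrt t)"])
    show "(sqrt has_real_derivative (1/2) * inverse (sqrt (f x))) (at (f x))" for x
      using DERIV_real_sqrt[OF elementary_sqrt(2), of x] by (simp add: field_simps)
    show "elementary (\<lambda>x. (1/2) * inverse (sqrt (f x)))"
      by (intro elementary_ops) (use elementary_sqrt in \<open>auto simp: less_imp_neq[symmetric]\<close>)
  qed
next
  case (elementary_arctan f)
  show ?case
  proof (rule elementary_step_chain[OF elementary_arctan(2), where \<phi>' = "\<lambda>t. inverse (1 + t * t)"])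
    show "(arctan has_real_derivative inverse (1 + f x * f x)) (at (f x))" for x
      using DERIV_arctan[of "f x"] by (simp add: power2_eq_square)
    have "1 + f x * f x \<noteq> 0" for x by (metis add_pos_nonneg less_irrefl zero_le_square zero_less_one)
    then show "elementary (\<lambda>x. inverse (1 + f x * f x))"
      by (intro elementary_ops) (use elementary_arctan in auto)
  qed
next
  case (elementary_flat f m)
  show ?case
  proof (rule elementary_step_chain[OF elementary_flat(2), where \<phi>' = "\<lambda>t. flat (m + 2) t + - real m * flat (m + 1) t"])
    show "(flat m has_real_derivative flat (m + 2) (f x) + - real m * flat (m + 1) (f x)) (at (f x))" for x
      using flat_DERIV[of m "f x"] by simp
    show "elementary (\<lambda>x. flat (m + 2) (f x) + - real m * flat (m + 1) (f x))"
      by (intro elementary_ops) (use elementary_flat in auto)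
  qed
qed

lemma elementary_imp_smooth: "elementary f \<Longrightarrow> smooth f"
  by (rule smooth_coinduct[of elementary, OF _ elementary_step])

lemmas smooth_intros =
  elementary_imp_smooth[OF elementary_const] elementary_imp_smooth[OF elementary_nth]
  elementary_imp_smooth[OF elementary_add[OF elementary_smooth elementary_smooth]]
  elementary_imp_smooth[OF elementary_mult[OF elementary_smooth elementary_smooth]]
  elementary_imp_smooth[OF elementary_inverse[OF elementary_smooth]]
  elementary_imp_smooth[OF elementary_sqrt[OF elementary_smooth]]
  elementary_imp_smooth[OF elementary_arctan[OF elementary_smooth]]
  elementary_imp_smooth[OF elementary_flat[OF elementary_smooth]]

lemma smooth_cmult: "smooth f \<Longrightarrow> smooth (\<lambda>x. c * f x)"
  by (intro smooth_intros)

lemma smooth_minus: "smooth f \<Longrightarrow> smooth (\<lambda>x. - f x)"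
  using smooth_cmult[of f "-1"] by simp

lemma smooth_diff: "smooth f \<Longrightarrow> smooth g \<Longrightarrow> smooth (\<lambda>x. f x - g x)"
  using smooth_intros(3)[OF _ smooth_minus, of f g] by simp

lemma smooth_power2: "smooth f \<Longrightarrow> smooth (\<lambda>x. (f x)\<^sup>2)"
  unfolding power2_eq_square by (intro smooth_intros)

lemma smooth_sum:
  assumes "finite I" "\<And>i. i \<in> I \<Longrightarrow> smooth (f i)"
  shows "smooth (\<lambda>x. \<Sum>i\<in>I. f i x)"
  using assms by (induction I rule: finite_induct) (auto intro!: smooth_intros)

lemma smooth_prod:
  assumes "finite I" "\<And>i. i \<in> I \<Longrightarrow> smooth (f i)"
  shows "smooth (\<lambda>x. \<Prod>i\<in>I. f i x)"
  using assms by (induction I rule: finite_induct) (auto intro!: smooth_intros)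

lemma grad_eqI:
  assumes "(f has_derivative (\<lambda>h. w \<bullet> h)) (at x)"
  shows "grad f x = w"
  unfolding grad_def by (simp add: vec_eq_iff partial_eqI[OF assms] inner_axis)

lemma grad_add: "smooth f \<Longrightarrow> smooth g \<Longrightarrow> grad (\<lambda>x. f x + g x) x = grad f x + grad g x"
  by (simp add: grad_def vec_eq_iff partial_add smooth_differentiable)

lemma grad_mult: "smooth f \<Longrightarrow> smooth g \<Longrightarrow> grad (\<lambda>x. f x * g x) x = f x *\<^sub>R grad g x + g x *\<^sub>R grad f x"
  by (simp add: grad_def vec_eq_iff partial_mult smooth_differentiable)

lemma grad_cmult: "smooth f \<Longrightarrow> grad (\<lambda>x. c * f x) x = c *\<^sub>R grad f x"
  using grad_mult[of "\<lambda>x. c" f x] by (simp add: smooth_intros grad_def partial_const zero_vec_def[symmetric])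

lemma grad_diff: "smooth f \<Longrightarrow> smooth g \<Longrightarrow> grad (\<lambda>x. f x - g x) x = grad f x - grad g x"
  using grad_add[of f "\<lambda>x. (-1) * g x" x] grad_cmult[of g "-1" x] smooth_cmult[of g "-1"] by simp

lemma grad_chain:
  "smooth f \<Longrightarrow> (\<phi> has_real_derivative d) (at (f x)) \<Longrightarrow> grad (\<lambda>x. \<phi> (f x)) x = d *\<^sub>R grad f x"
  by (simp add: grad_def vec_eq_iff chain_partial(2) smooth_differentiable)

lemma continuous_on_grad: "smooth f \<Longrightarrow> continuous_on A (grad f)"
  unfolding grad_def[abs_def] by (intro continuous_on_vec_lambda smooth_continuous smooth_partial)

section \<open>Test functions\<close>

lemma test_smooth: "\<phi> \<in> test_functions \<Omega> \<Longrightarrow> smooth \<phi>"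
  by (simp add: test_functions_def smooth_def)

lemma test_support: "\<phi> \<in> test_functions \<Omega> \<Longrightarrow> x \<notin> \<Omega> \<Longrightarrow> \<phi> x = 0"
  using closure_subset[of "{x. \<phi> x \<noteq> 0}"] by (auto simp: test_functions_def)

lemma test_mono: "\<phi> \<in> test_functions \<Omega> \<Longrightarrow> \<Omega> \<subseteq> \<Omega>' \<Longrightarrow> \<phi> \<in> test_functions \<Omega>'"
  by (auto simp: test_functions_def)

lemma test_UNIV: "\<phi> \<in> test_functions \<Omega> \<Longrightarrow> \<phi> \<in> test_functions UNIV"
  using test_mono by blast

lemma testI:
  assumes "smooth \<phi>" "compact K" "K \<subseteq> \<Omega>" "\<And>x. x \<notin> K \<Longrightarrow> \<phi> x = 0"
  shows "\<phi> \<in> test_functions \<Omega>"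
proof -
  have "closure {x. \<phi> x \<noteq> 0} \<subseteq> K"
    using assms by (intro closure_minimal) (auto simp: compact_imp_closed)
  moreover from this have "compact (closure {x. \<phi> x \<noteq> 0})"
    using compact_Int_closed[OF assms(2) closed_closure, of "{x. \<phi> x \<noteq> 0}"] by (simp add: Int_absorb1)
  ultimately show ?thesis using assms unfolding test_functions_def smooth_def by auto
qed

lemma test_compactE:
  assumes "\<phi> \<in> test_functions \<Omega>"
  obtains K where "compact K" "K \<subseteq> \<Omega>" "\<And>x. x \<notin> K \<Longrightarrow> \<phi> x = 0" "\<And>x. x \<notin> K \<Longrightarrow> grad \<phi> x = 0"
proof
  let ?K = "closure {x. \<phi> x \<noteq> 0}"
  show "compact ?K" "?K \<subseteq> \<Omega>" using assms by (auto simp: test_functions_def)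
  show z: "\<phi> x = 0" if "x \<notin> ?K" for x using that closure_subset[of "{x. \<phi> x \<noteq> 0}"] by auto
  show "grad \<phi> x = 0" if "x \<notin> ?K" for x
  proof (rule grad_eqI, rule has_derivative_transform_within_open[of "\<lambda>_. 0" _ x UNIV "- ?K"])
    show "((\<lambda>_. 0) has_derivative (\<lambda>h. 0 \<bullet> h)) (at x within UNIV)" by simp
    show "open (- ?K)" by (rule open_Compl[OF closed_closure])
    show "x \<in> - ?K" using that by simp
    show "0 = \<phi> y" if "y \<in> - ?K" for y using z[of y] that by (metis ComplD)
  qed
qed

lemma test_grad_support: "\<phi> \<in> test_functions \<Omega> \<Longrightarrow> x \<notin> \<Omega> \<Longrightarrow> grad \<phi> x = 0"
  by (meson subset_iff test_compactE)

lemma test_mult: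
  assumes "\<phi> \<in> test_functions \<Omega>" "smooth f"
  shows "(\<lambda>x. f x * \<phi> x) \<in> test_functions \<Omega>"
proof -
  obtain K where "compact K" "K \<subseteq> \<Omega>" "\<And>x. x \<notin> K \<Longrightarrow> \<phi> x = 0"
    using test_compactE[OF assms(1)] by metis
  then show ?thesis
    by (intro testI[of _ K] smooth_intros assms(2) test_smooth[OF assms(1)]) auto
qed

lemma test_cmult: "\<phi> \<in> test_functions \<Omega> \<Longrightarrow> (\<lambda>x. c * \<phi> x) \<in> test_functions \<Omega>"
  by (rule test_mult) (auto intro: smooth_intros)

lemma test_add:
  assumes "\<phi> \<in> test_functions \<Omega>" "\<psi> \<in> test_functions \<Omega>"
  shows "(\<lambda>x. \<phi> x + \<psi> x) \<in> test_functions \<Omega>"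
proof -
  obtain K where K: "compact K" "K \<subseteq> \<Omega>" "\<And>x. x \<notin> K \<Longrightarrow> \<phi> x = 0" using test_compactE[OF assms(1)] by metis
  obtain K' where K': "compact K'" "K' \<subseteq> \<Omega>" "\<And>x. x \<notin> K' \<Longrightarrow> \<psi> x = 0" using test_compactE[OF assms(2)] by metis
  show ?thesis
    by (rule testI[of _ "K \<union> K'"]) (use K K' assms in \<open>auto intro!: smooth_intros simp: test_smooth\<close>)
qed

lemma test_diff:
  assumes "\<phi> \<in> test_functions \<Omega>" "\<psi> \<in> test_functions \<Omega>"
  shows "(\<lambda>x. \<phi> x - \<psi> x) \<in> test_functions \<Omega>"
  using test_add[OF assms(1) test_cmult[OF assms(2), of "-1"]] by simp

lemma test_partial:
  assumes "\<phi> \<in> test_functions \<Omega>"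
  shows "partial i \<phi> \<in> test_functions \<Omega>"
proof -
  obtain K where K: "compact K" "K \<subseteq> \<Omega>" "\<And>x. x \<notin> K \<Longrightarrow> grad \<phi> x = 0" using test_compactE[OF assms(1)] by metis
  have "partial i \<phi> x = grad \<phi> x $ i" for x by (simp add: grad_def)
  with K show ?thesis
    by (intro testI[of _ K]) (auto intro: smooth_partial test_smooth[OF assms])
qed

lemma test_zero: "(\<lambda>x. 0) \<in> test_functions \<Omega>"
  by (rule testI[of _ "{}"]) (auto intro: smooth_intros)

lemma integrable_compact_support:
  fixes f :: "'a::euclidean_space \<Rightarrow> 'b::euclidean_space"
  assumes "compact K" "continuous_on UNIV f" "\<And>x. x \<notin> K \<Longrightarrow> f x = 0"
  shows "integrable lborel f" "integrable lebesgue f"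
proof -
  have "(\<lambda>x. indicator K x *\<^sub>R f x) = f" using assms(3) by (auto simp: fun_eq_iff indicator_def)
  then show *: "integrable lborel f"
    using borel_integrable_compact[OF assms(1) continuous_on_subset[OF assms(2)]] by auto
  then show "integrable lebesgue f" by (simp add: integrable_completion borel_measurable_integrable)
qed

lemma bounded_compact_support:
  fixes f :: "'a::euclidean_space \<Rightarrow> 'b::euclidean_space"
  assumes "compact K" "continuous_on UNIV f" "\<And>x. x \<notin> K \<Longrightarrow> f x = 0"
  obtains B where "B > 0" "\<And>x. norm (f x) \<le> B"
proof -
  have "bounded (f ` K)"
    by (meson assms(1,2) compact_continuous_image compact_imp_bounded continuous_on_subset top_greatest)
  then obtain B where B: "B > 0" "\<And>x. x \<in> K \<Longrightarrow> norm (f x) \<le> B"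
    unfolding bounded_pos by auto
  then have "norm (f x) \<le> B" for x using assms(3)[of x] by (cases "x \<in> K") auto
  with B(1) show ?thesis using that by blast
qed

lemma test_continuous: "\<phi> \<in> test_functions \<Omega> \<Longrightarrow> continuous_on A \<phi>"
  by (simp add: smooth_continuous test_smooth)

lemma test_borel: "\<phi> \<in> test_functions \<Omega> \<Longrightarrow> \<phi> \<in> borel_measurable borel"
  by (rule borel_measurable_continuous_onI[OF test_continuous])

lemma test_grad_borel: "\<phi> \<in> test_functions \<Omega> \<Longrightarrow> grad \<phi> \<in> borel_measurable borel"
  by (rule borel_measurable_continuous_onI[OF continuous_on_grad[OF test_smooth]])

lemma borel_lebesgue: "f \<in> borel_measurable borel \<Longrightarrow> f \<in> borel_measurable lebesgue"
  by (rule measurable_completion) simp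

lemma test_measurable:
  assumes "\<phi> \<in> test_functions \<Omega>"
  shows "\<phi> \<in> borel_measurable lebesgue" "grad \<phi> \<in> borel_measurable lebesgue"
    "partial i \<phi> \<in> borel_measurable lebesgue"
  using assms by (auto intro!: borel_lebesgue test_borel test_grad_borel test_partial)

lemma test_bounded:
  assumes "\<phi> \<in> test_functions \<Omega>"
  obtains B where "B > 0" "\<And>x. \<bar>\<phi> x\<bar> \<le> B" "\<And>x. norm (grad \<phi> x) \<le> B"
proof -
  obtain K where K: "compact K" "\<And>x. x \<notin> K \<Longrightarrow> \<phi> x = 0" "\<And>x. x \<notin> K \<Longrightarrow> grad \<phi> x = 0"
    using test_compactE[OF assms(1)] by metis
  obtain B1 where "B1 > 0" "\<And>x. norm (\<phi> x) \<le> B1"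
    using bounded_compact_support[OF K(1) test_continuous[OF assms] K(2)] by blast
  moreover obtain B2 where "B2 > 0" "\<And>x. norm (grad \<phi> x) \<le> B2"
    using bounded_compact_support[OF K(1) continuous_on_grad[OF test_smooth[OF assms]] K(3)] by blast
  ultimately show ?thesis using that[of "max B1 B2"] by (simp add: le_max_iff_disj)
qed

lemma test_integrable:
  assumes "\<phi> \<in> test_functions \<Omega>" "continuous_on UNIV g"
  shows "integrable lebesgue (\<lambda>x. \<phi> x * g x)" "integrable lborel (\<lambda>x. \<phi> x * g x)"
proof -
  obtain K where K: "compact K" "\<And>x. x \<notin> K \<Longrightarrow> \<phi> x = 0"
    using test_compactE[OF assms(1)] by metis
  show "integrable lebesgue (\<lambda>x. \<phi> x * g x)" "integrable lborel (\<lambda>x. \<phi> x * g x)"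
    using integrable_compact_support[OF K(1), of "\<lambda>x. \<phi> x * g x"] K(2) assms(2) test_continuous[OF assms(1)]
    by (auto intro!: continuous_intros)
qed

subsection \<open>Translations and integration by parts\<close>

lemma integral_lborel_translation:
  fixes f :: "'a::euclidean_space \<Rightarrow> 'b::{banach,second_countable_topology}"
  assumes "f \<in> borel_measurable borel"
  shows "(\<integral>x. f (x + a) \<partial>lborel) = (\<integral>x. f x \<partial>lborel)"
proof -
  have "(\<integral>x. f x \<partial>lborel) = (\<integral>x. f x \<partial>(distr lborel borel ((+) a)))"
    by (simp add: lborel_distr_plus)
  also have "\<dots> = (\<integral>x. f (a + x) \<partial>lborel)"
    using assms by (intro integral_distr) auto
  finally show ?thesis by (simp add: add.commute)
qed

lemma nn_integral_lborel_translation: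
  assumes "f \<in> borel_measurable borel"
  shows "(\<integral>\<^sup>+x. f (x + a) \<partial>lborel) = (\<integral>\<^sup>+x. f x \<partial>lborel)"
proof -
  have "(\<integral>\<^sup>+x. f x \<partial>lborel) = (\<integral>\<^sup>+x. f x \<partial>(distr lborel borel ((+) a)))"
    by (simp add: lborel_distr_plus)
  also have "\<dots> = (\<integral>\<^sup>+x. f (a + x) \<partial>lborel)"
    using assms by (intro nn_integral_distr) auto
  finally show ?thesis by (simp add: add.commute)
qed

lemma test_lipschitz:
  assumes "smooth \<phi>" "\<And>x. norm (grad \<phi> x) \<le> B"
  shows "\<bar>\<phi> y - \<phi> x\<bar> \<le> B * norm (y - x)"
proof -
  have "norm (\<phi> y - \<phi> x) \<le> B * norm (y - x)"
  proof (rule differentiable_bound[of UNIV])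
    show "(\<phi> has_derivative (\<lambda>h. grad \<phi> z \<bullet> h)) (at z within UNIV)" for z
      using smooth_has_derivative[OF assms(1)] by simp
    show "onorm (\<lambda>h. grad \<phi> z \<bullet> h) \<le> B" for z
    proof (rule onorm_le)
      fix h
      show "norm (grad \<phi> z \<bullet> h) \<le> B * norm h"
        using Cauchy_Schwarz_ineq2[of "grad \<phi> z" h] mult_right_mono[OF assms(2)[of z], of "norm h"] by simp
    qed
  qed auto
  then show ?thesis by simp
qed

text \<open>By translation invariance all difference quotients have integral zero.\<close>

lemma integral_partial_test:
  fixes \<phi> :: "real ^ 'n \<Rightarrow> real"
  assumes "\<phi> \<in> test_functions \<Omega>"
  shows "(\<integral>x. partial i \<phi> x \<partial>lebesgue) = 0"
proof -
  define e :: "real ^ 'n" where "e = axis i 1"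
  have e: "norm e = 1" by (simp add: e_def)
  obtain K where K: "compact K" "\<And>x. x \<notin> K \<Longrightarrow> \<phi> x = 0" using test_compactE[OF assms(1)] by metis
  obtain R where R: "\<And>x. x \<in> K \<Longrightarrow> norm x \<le> R" 
    using compact_imp_bounded[OF K(1)] unfolding bounded_iff by blast
  obtain B where B: "B > 0" "\<And>x. norm (grad \<phi> x) \<le> B" using test_bounded[OF assms] by metis
  define t where "t k = 1 / real (Suc k)" for k
  have t: "t k > 0" "t k \<le> 1" for k by (auto simp: t_def)
  define f where "f k x = (\<phi> (x + t k *\<^sub>R e) - \<phi> x) / t k" for k x
  have [measurable]: "\<phi> \<in> borel_measurable borel" "partial i \<phi> \<in> borel_measurable borel"
    using assms by (auto intro: test_borel test_partial)
  have "(\<lambda>k. \<integral>x. f k x \<partial>lborel) \<longlonglongrightarrow> (\<integral>x. partial i \<phi> x \<partial>lborel)"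
  proof (rule integral_dominated_convergence[where w = "\<lambda>x. indicator (cball 0 (R + 1)) x * B"])
    show "integrable lborel (\<lambda>x. indicat_real (cball (0::real^'n) (R + 1)) x * B)"
      by (intro integrable_mult_left integrable_real_indicator)
        (use emeasure_lborel_cball_finite[of "0::real^'n" "R + 1"] in simp_all)
    show "AE x in lborel. norm (f k x) \<le> indicator (cball 0 (R + 1)) x * B" for k
    proof (intro AE_I2)
      fix x
      show "norm (f k x) \<le> indicator (cball 0 (R + 1)) x * B"
      proof (cases "norm x \<le> R + 1")
        case True
        have "\<bar>\<phi> (x + t k *\<^sub>R e) - \<phi> x\<bar> \<le> B * t k"
          using test_lipschitz[OF test_smooth[OF assms] B(2), of "x + t k *\<^sub>R e" x] t[of k] by (simp add: e)
        with True t[of k] show ?thesis by (simp add: f_def divide_le_eq)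
      next
        case False
        have "norm x \<le> norm (x + t k *\<^sub>R e) + norm (t k *\<^sub>R e)" by (metis add_diff_cancel_right' norm_triangle_ineq4)
        then have "norm (x + t k *\<^sub>R e) > R" using False t[of k] e by simp
        then have "x + t k *\<^sub>R e \<notin> K" "x \<notin> K" using R False by fastforce+
        then show ?thesis by (simp add: f_def K(2) False)
      qed
    qed
    show "AE x in lborel. (\<lambda>k. f k x) \<longlonglongrightarrow> partial i \<phi> x"
    proof (intro AE_I2)
      fix x
      have "(\<phi> has_derivative (\<lambda>h. grad \<phi> x \<bullet> h)) (at (x + 0 *\<^sub>R e))" 
        using smooth_has_derivative[OF test_smooth[OF assms]] by simp
      then have "((\<lambda>r. \<phi> (x + r *\<^sub>R e)) has_derivative (\<lambda>r. grad \<phi> x \<bullet> (r *\<^sub>R e))) (at 0)"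
        by (rule has_derivative_compose[rotated]) (auto intro!: derivative_eq_intros)
      then have "((\<lambda>r. \<phi> (x + r *\<^sub>R e)) has_real_derivative (partial i \<phi> x)) (at 0)"
        unfolding has_field_derivative_def
        by (simp add: e_def inner_axis grad_def mult_commute_abs)
      then have lim: "((\<lambda>h. (\<phi> (x + h *\<^sub>R e) - \<phi> x) / h) \<longlongrightarrow> partial i \<phi> x) (at 0)"
        by (simp add: DERIV_def)
      have "t \<longlonglongrightarrow> 0" unfolding t_def by (rule LIMSEQ_Suc[OF lim_1_over_n])
      then have "filterlim t (at 0) sequentially"
        using t(1) less_imp_neq[OF t(1), symmetric] by (simp add: filterlim_at)
      from filterlim_compose[OF lim this] show "(\<lambda>k. f k x) \<longlonglongrightarrow> partial i \<phi> x"
        by (simp add: f_def)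
    qed
  qed (simp_all add: f_def)
  moreover have "(\<integral>x. f k x \<partial>lborel) = 0" for k
  proof -
    have int: "integrable lborel \<phi>" using test_integrable(2)[OF assms, of "\<lambda>_. 1"] by simp
    then have int': "integrable lborel (\<lambda>x. \<phi> (x + t k *\<^sub>R e))"
    proof -
      have "integrable (distr lborel borel ((+) (t k *\<^sub>R e))) \<phi>" using int by (simp add: lborel_distr_plus)
      then show ?thesis by (simp add: integrable_distr_eq add.commute)
    qed
    show ?thesis unfolding f_def using int int' integral_lborel_translation[of \<phi> "t k *\<^sub>R e"] by simp
  qed
  ultimately have "(\<integral>x. partial i \<phi> x \<partial>lborel) = 0"
    by (simp add: LIMSEQ_const_iff)
  then show ?thesis by (simp add: integral_completion)
qed

text \<open>The product of a test function with a smooth function is a test function, and the integral of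
  its derivative vanishes.\<close>

lemma integration_by_parts:
  assumes "\<phi> \<in> test_functions \<Omega>" "smooth f"
  shows "(\<integral>x. f x * partial i \<phi> x \<partial>lebesgue) = - (\<integral>x. partial i f x * \<phi> x \<partial>lebesgue)"
proof -
  have "partial i (\<lambda>x. f x * \<phi> x) = (\<lambda>x. partial i \<phi> x * f x + \<phi> x * partial i f x)"
    using partial_mult[of f _ \<phi>] assms by (auto simp: smooth_differentiable test_smooth mult.commute)
  moreover have "(\<integral>x. partial i (\<lambda>x. f x * \<phi> x) x \<partial>lebesgue) = 0"
    by (rule integral_partial_test[OF test_mult[OF assms]])
  ultimately have "(\<integral>x. partial i \<phi> x * f x \<partial>lebesgue) + (\<integral>x. \<phi> x * partial i f x \<partial>lebesgue) = 0"
    using test_integrable(1)[OF test_partial[OF assms(1)], of f i]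
      test_integrable(1)[OF assms(1), of "partial i f"] assms(2)
    by (simp add: smooth_continuous smooth_partial)
  then show ?thesis by (simp add: mult.commute)
qed

subsection \<open>Bumps and cutoffs\<close>

text \<open>A sequence of test functions that increases to the indicator function of the open box.\<close>

definition box_bump :: "real ^ 'n \<Rightarrow> real ^ 'n \<Rightarrow> nat \<Rightarrow> real ^ 'n \<Rightarrow> real" where
  "box_bump a b k x = (\<Prod>i\<in>UNIV. flat 0 (real (Suc k) * (x $ i - a $ i)) * flat 0 (real (Suc k) * (b $ i - x $ i)))"

lemma flat0: "0 \<le> flat 0 t" "flat 0 t \<le> 1" "0 < flat 0 t \<longleftrightarrow> 0 < t" "flat 0 t = 0 \<longleftrightarrow> t \<le> 0"
  by (auto simp: flat_def)

lemma smooth_box_bump: "smooth (box_bump a b k)"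
  unfolding box_bump_def[abs_def]
  by (intro smooth_prod smooth_intros smooth_cmult smooth_diff) auto

lemma box_bump_bounds: "0 \<le> box_bump a b k x" "box_bump a b k x \<le> 1"
  unfolding box_bump_def by (auto intro!: prod_nonneg prod_le_1 mult_nonneg_nonneg mult_le_one simp: flat0)

lemma mem_box_nth: "x \<in> box a b \<longleftrightarrow> (\<forall>i. a $ i < x $ i \<and> x $ i < b $ i)" for x :: "real ^ 'n"
  by (simp add: mem_box_cart)

lemma box_bump_pos: "box_bump a b k x \<noteq> 0 \<longleftrightarrow> x \<in> box a b"
  unfolding box_bump_def mem_box_nth
  by (auto simp: prod_zero_iff flat0 not_le zero_less_mult_iff mult_le_0_iff)

lemma box_bump_test: "cbox a b \<subseteq> \<Omega> \<Longrightarrow> box_bump a b k \<in> test_functions \<Omega>"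
  using box_subset_cbox box_bump_pos by (intro testI[OF smooth_box_bump compact_cbox]) blast+

lemma box_bump_limit: "(\<lambda>k. box_bump a b k x) \<longlonglongrightarrow> indicator (box a b) x"
proof (cases "x \<in> box a b")
  case True
  have f: "(\<lambda>k. flat 0 (real (Suc k) * t)) \<longlonglongrightarrow> 1" if "t > 0" for t :: real
  proof -
    have "(\<lambda>k. exp (- ((1 / t) * (1 / real (Suc k))))) \<longlonglongrightarrow> exp (- ((1 / t) * 0))"
      by (intro tendsto_intros LIMSEQ_Suc[OF lim_1_over_n])
    moreover have "flat 0 (real (Suc k) * t) = exp (- ((1 / t) * (1 / real (Suc k))))" for k
      unfolding flat_def using that by (simp add: mult.commute)
    ultimately show ?thesis by simp
  qed
  have "(\<lambda>k. box_bump a b k x) \<longlonglongrightarrow> (\<Prod>i\<in>(UNIV::'a set). 1 * 1)"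
    unfolding box_bump_def using True by (intro tendsto_prod tendsto_mult f) (auto simp: mem_box_nth)
  then show ?thesis using True by simp
next
  case False
  then have "box_bump a b k x = 0" for k using box_bump_pos by blast
  then show ?thesis using False by simp
qed

lemma cutoff_exists:
  fixes S :: "(real ^ 'n) set"
  assumes "bounded S"
  obtains \<eta> where "\<eta> \<in> test_functions UNIV" "\<And>x. x \<in> S \<Longrightarrow> \<eta> x = 1" "\<And>x. x \<in> S \<Longrightarrow> grad \<eta> x = 0"
    "\<And>x. 0 \<le> \<eta> x"
proof -
  obtain R where R: "R > 0" "\<And>x. x \<in> S \<Longrightarrow> norm x < R"
    using assms unfolding bounded_pos_less by auto
  \<comment> \<open>\<open>A\<close> lives in the ball of radius \<open>2R\<close> and \<open>B\<close> outside the ball of radius \<open>R\<close>, so that the quotient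
      \<open>A / (A + B)\<close> is 1 on the inner ball and 0 outside the outer one.\<close>
  define A where "A x = flat 0 (4 * R\<^sup>2 - x \<bullet> x)" for x :: "real ^ 'n"
  define B where "B x = flat 0 (x \<bullet> x - R\<^sup>2)" for x :: "real ^ 'n"
  have dot: "smooth (\<lambda>x::real^'n. x \<bullet> x)"
    unfolding inner_vec_def inner_real_def by (intro smooth_sum smooth_intros) auto
  have pos: "A x + B x > 0" for x
  proof -
    have "4 * R\<^sup>2 - x \<bullet> x > 0 \<or> x \<bullet> x - R\<^sup>2 > 0" 
      using R(1) zero_less_power[of R 2] by linarith
    then show ?thesis unfolding A_def B_def using flat0(1,3) by (metis add_nonneg_pos add_pos_nonneg)
  qed
  have sm: "smooth A" "smooth B"
    unfolding A_def B_def by (intro smooth_intros smooth_diff dot)+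
  define \<eta> where "\<eta> x = A x * inverse (A x + B x)" for x
  have sm\<eta>: "smooth \<eta>" unfolding \<eta>_def 
    by (intro smooth_intros sm) (use pos in \<open>auto simp: less_imp_neq[symmetric]\<close>)
  show ?thesis
  proof
    show "\<eta> \<in> test_functions UNIV"
    proof (rule testI[OF sm\<eta> compact_cball])
      fix x :: "real ^ 'n" assume "x \<notin> cball 0 (2 * R)"
      then have "(2 * R)\<^sup>2 \<le> (norm x)\<^sup>2" using R(1) by (intro power_mono) auto
      then show "\<eta> x = 0" by (simp add: \<eta>_def A_def flat0 power2_norm_eq_inner power_mult_distrib)
    qed auto
    have one: "\<eta> x = 1" if "norm x < R" for x
    proof -
      have "(norm x)\<^sup>2 \<le> R\<^sup>2" using that by (intro power_mono) auto
      then have "B x = 0" by (simp add: B_def flat0 power2_norm_eq_inner)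
      then show ?thesis using pos[of x] by (simp add: \<eta>_def)
    qed
    then show "\<eta> x = 1" if "x \<in> S" for x using R that by blast
    show "grad \<eta> x = 0" if "x \<in> S" for x
    proof (rule grad_eqI, rule has_derivative_transform_within_open[of "\<lambda>_. 1" _ x UNIV "ball 0 R"])
      show "((\<lambda>_. 1) has_derivative (\<lambda>h. 0 \<bullet> h)) (at x within UNIV)" by simp
    qed (use that R one in auto)
    show "0 \<le> \<eta> x" for x using pos[of x] flat0(1) by (simp add: \<eta>_def A_def)
  qed
qed

section \<open>Square-integrable functions\<close>

text \<open>Square-integrable functions are kept as functions rather than as equivalence classes, and the
  measure is a parameter, because the space is used over \<open>\<real>\<^sup>n\<close> and over \<open>\<real>\<^sup>n \<times> \<real>\<^sup>n\<close>, with values in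
  \<open>\<real>\<close> and in \<open>\<real>\<^sup>n\<close>.\<close>

definition L2 :: "'a measure \<Rightarrow> ('a \<Rightarrow> 'b::euclidean_space) set" where
  "L2 M = {f \<in> borel_measurable M. integrable M (\<lambda>x. (norm (f x))\<^sup>2)}"

definition sqn :: "'a measure \<Rightarrow> ('a \<Rightarrow> 'b::euclidean_space) \<Rightarrow> real" where
  "sqn M f = (\<integral>x. (norm (f x))\<^sup>2 \<partial>M)"

definition ip :: "'a measure \<Rightarrow> ('a \<Rightarrow> 'b::euclidean_space) \<Rightarrow> ('a \<Rightarrow> 'b) \<Rightarrow> real" where
  "ip M f g = (\<integral>x. f x \<bullet> g x \<partial>M)"

lemma L2_measurable: "f \<in> L2 M \<Longrightarrow> f \<in> borel_measurable M"
  by (simp add: L2_def)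

lemma L2_integrable: "f \<in> L2 M \<Longrightarrow> integrable M (\<lambda>x. (norm (f x))\<^sup>2)"
  by (simp add: L2_def)

lemma sqn_nonneg: "0 \<le> sqn M f"
  by (simp add: sqn_def)

lemma L2_nn: "f \<in> L2 M \<Longrightarrow> (\<integral>\<^sup>+x. ennreal ((norm (f x))\<^sup>2) \<partial>M) = ennreal (sqn M f)"
  unfolding sqn_def by (rule nn_integral_eq_integral[OF L2_integrable]) auto

lemma L2_I:
  assumes "f \<in> borel_measurable M" "(\<integral>\<^sup>+x. ennreal ((norm (f x))\<^sup>2) \<partial>M) \<le> ennreal c" "0 \<le> c"
  shows "f \<in> L2 M" "sqn M f \<le> c"
proof -
  have [measurable]: "f \<in> borel_measurable M" by (fact assms(1))
  have "integrable M (\<lambda>x. (norm (f x))\<^sup>2)"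
  proof (rule integrableI_nonneg)
    show "(\<integral>\<^sup>+x. ennreal ((norm (f x))\<^sup>2) \<partial>M) < \<infinity>"
      using assms(2) by (rule order_le_less_trans) simp
  qed auto
  then show *: "f \<in> L2 M" using assms(1) by (simp add: L2_def)
  show "sqn M f \<le> c" using assms(2,3) by (simp add: L2_nn[OF *])
qed

lemma norm_add_sq_le: "(norm (a + b))\<^sup>2 \<le> 2 * (norm a)\<^sup>2 + 2 * (norm b)\<^sup>2" for a b :: "'a::real_inner"
proof -
  have "0 \<le> (norm (a - b))\<^sup>2" by simp
  then show ?thesis by (simp add: power2_norm_eq_inner inner_simps inner_commute)
qed

lemma abs_inner_le_sq: "\<bar>a \<bullet> b\<bar> \<le> (norm a)\<^sup>2 + (norm b)\<^sup>2" for a b :: "'a::real_inner"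
proof -
  have "\<bar>a \<bullet> b\<bar> \<le> norm a * norm b" by (rule Cauchy_Schwarz_ineq2)
  also have "\<dots> \<le> (norm a)\<^sup>2 + (norm b)\<^sup>2"
    using sum_squares_bound[of "norm a" "norm b"] mult_nonneg_nonneg[OF norm_ge_zero[of a] norm_ge_zero[of b]]
    by linarith
  finally show ?thesis .
qed

lemma L2_add:
  assumes "f \<in> L2 M" "g \<in> L2 M"
  shows "(\<lambda>x. f x + g x) \<in> L2 M"
proof -
  have [measurable]: "f \<in> borel_measurable M" "g \<in> borel_measurable M"
    using assms by (auto simp: L2_def)
  have "integrable M (\<lambda>x. 2 * (norm (f x))\<^sup>2 + 2 * (norm (g x))\<^sup>2)"
    using assms by (auto simp: L2_def)
  then have "integrable M (\<lambda>x. (norm (f x + g x))\<^sup>2)"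
    by (rule Bochner_Integration.integrable_bound) (auto intro!: AE_I2 norm_add_sq_le)
  then show ?thesis by (simp add: L2_def)
qed

lemma L2_scale: "f \<in> L2 M \<Longrightarrow> (\<lambda>x. c *\<^sub>R f x) \<in> L2 M"
  by (auto simp: L2_def power_mult_distrib)

lemma L2_diff:
  assumes "f \<in> L2 M" "g \<in> L2 M"
  shows "(\<lambda>x. f x - g x) \<in> L2 M"
  using L2_add[OF assms(1) L2_scale[OF assms(2), of "-1"]] by simp

lemma L2_ip:
  assumes "f \<in> L2 M" "g \<in> L2 M"
  shows "integrable M (\<lambda>x. f x \<bullet> g x)"
proof -
  have [measurable]: "f \<in> borel_measurable M" "g \<in> borel_measurable M"
    using assms by (auto simp: L2_def)
  have "integrable M (\<lambda>x. (norm (f x))\<^sup>2 + (norm (g x))\<^sup>2)"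
    using assms by (auto simp: L2_def)
  then show ?thesis
    by (rule Bochner_Integration.integrable_bound) (auto intro!: AE_I2 abs_inner_le_sq)
qed

lemma ip_self: "ip M f f = sqn M f"
  by (simp add: ip_def sqn_def power2_norm_eq_inner)

lemma ip_commute: "ip M f g = ip M g f"
  by (simp add: ip_def inner_commute)

lemma ip_add: "f \<in> L2 M \<Longrightarrow> g \<in> L2 M \<Longrightarrow> h \<in> L2 M \<Longrightarrow> ip M (\<lambda>x. f x + g x) h = ip M f h + ip M g h"
  by (simp add: ip_def inner_add_left L2_ip)

lemma ip_diff: "f \<in> L2 M \<Longrightarrow> g \<in> L2 M \<Longrightarrow> h \<in> L2 M \<Longrightarrow> ip M (\<lambda>x. f x - g x) h = ip M f h - ip M g h"
  by (simp add: ip_def inner_diff_left L2_ip)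

lemma ip_diff_right: "f \<in> L2 M \<Longrightarrow> g \<in> L2 M \<Longrightarrow> h \<in> L2 M \<Longrightarrow> ip M h (\<lambda>x. f x - g x) = ip M h f - ip M h g"
  by (simp add: ip_def inner_diff_right L2_ip)

lemma ip_scale: "ip M (\<lambda>x. c *\<^sub>R f x) h = c * ip M f h"
  by (simp add: ip_def)

lemma sqn_scale: "sqn M (\<lambda>x. c *\<^sub>R f x) = c\<^sup>2 * sqn M f"
  by (simp add: sqn_def power_mult_distrib)

lemma sqn_cmult: "sqn M (\<lambda>x. c * f x) = c\<^sup>2 * sqn M f" for f :: "_ \<Rightarrow> real"
  using sqn_scale[of M c f] by simp

lemma sqn_add:
  assumes "f \<in> L2 M" "g \<in> L2 M"
  shows "sqn M (\<lambda>x. f x + g x) = sqn M f + 2 * ip M f g + sqn M g"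
proof -
  note L = assms L2_add[OF assms]
  have "sqn M (\<lambda>x. f x + g x) = ip M f (\<lambda>x. f x + g x) + ip M g (\<lambda>x. f x + g x)"
    unfolding ip_self[symmetric] by (rule ip_add) (use L in auto)
  also have "\<dots> = (ip M f f + ip M g f) + (ip M f g + ip M g g)"
    using L by (simp only: ip_commute[of M f "\<lambda>x. f x + g x"] ip_commute[of M g "\<lambda>x. f x + g x"] ip_add)
  finally show ?thesis by (simp add: ip_self ip_commute[of M g f])
qed

lemma sqn_add_scaled:
  assumes "f \<in> L2 M" "g \<in> L2 M"
  shows "sqn M (\<lambda>x. f x + t *\<^sub>R g x) = sqn M f + 2 * t * ip M f g + t\<^sup>2 * sqn M g"
  using sqn_add[OF assms(1) L2_scale[OF assms(2)]]
  by (simp add: sqn_scale ip_commute[of M f "\<lambda>x. t *\<^sub>R g x"] ip_scale ip_commute[of M g f])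

lemma sqn_diff:
  assumes "f \<in> L2 M" "g \<in> L2 M"
  shows "sqn M (\<lambda>x. f x - g x) = sqn M f - 2 * ip M f g + sqn M g"
  using sqn_add_scaled[OF assms, of "-1"] by simp

lemma sqn_diff_commute: "sqn M (\<lambda>x. f x - g x) = sqn M (\<lambda>x. g x - f x)"
  by (simp add: sqn_def norm_minus_commute)

text \<open>The quadratic polynomial \<open>t \<mapsto> \<parallel>f + t g\<parallel>\<^sup>2\<close> is nonnegative, hence its discriminant is not positive;
  the degenerate case of vanishing leading coefficient is separate.\<close>

lemma ip_Cauchy_Schwarz:
  assumes "f \<in> L2 M" "g \<in> L2 M"
  shows "\<bar>ip M f g\<bar> \<le> sqrt (sqn M f) * sqrt (sqn M g)"
proof -
  have q: "0 \<le> sqn M f + 2 * t * ip M f g + t\<^sup>2 * sqn M g" for t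
    using sqn_add_scaled[OF assms, of t] sqn_nonneg by metis
  have "(ip M f g)\<^sup>2 \<le> sqn M f * sqn M g"
  proof (cases "sqn M g = 0")
    case True
    have "ip M f g = 0"
    proof (rule ccontr)
      assume i: "ip M f g \<noteq> 0"
      define t where "t = - (sqn M f + 1) / ip M f g"
      have "t * ip M f g = - (sqn M f + 1)" using i by (simp add: t_def)
      moreover have "0 \<le> sqn M f + 2 * (t * ip M f g)" using q[of t] True by (simp add: mult.assoc)
      ultimately have "0 \<le> sqn M f - 2 * (sqn M f + 1)" by simp
      then show False using sqn_nonneg[of M f] by simp
    qed
    then show ?thesis by (simp add: True)
  next
    case False
    then have pos: "sqn M g > 0" using sqn_nonneg[of M g] by simp
    have "0 \<le> (sqn M f + 2 * (- ip M f g / sqn M g) * ip M f g + (- ip M f g / sqn M g)\<^sup>2 * sqn M g) * sqn M g"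
      using mult_nonneg_nonneg[OF q[of "- ip M f g / sqn M g"], of "sqn M g"] pos by simp
    also have "\<dots> = sqn M f * sqn M g - (ip M f g)\<^sup>2"
      using pos by (simp add: field_simps power2_eq_square)
    finally show ?thesis by simp
  qed
  then show ?thesis using real_sqrt_le_mono[of "(ip M f g)\<^sup>2" "sqn M f * sqn M g"] by (simp add: real_sqrt_mult)
qed

lemma sqn_add_le:
  assumes "f \<in> L2 M" "g \<in> L2 M"
  shows "sqn M (\<lambda>x. f x + g x) \<le> 2 * sqn M f + 2 * sqn M g"
proof -
  have "sqn M (\<lambda>x. f x + g x) + sqn M (\<lambda>x. f x - g x) = 2 * sqn M f + 2 * sqn M g"
    using sqn_add[OF assms] sqn_diff[OF assms] by simp
  then show ?thesis using sqn_nonneg[of M "\<lambda>x. f x - g x"] by linarith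
qed

subsection \<open>Convergence and completeness\<close>

text \<open>Fatou's lemma in the form in which all lower semicontinuity arguments use it.\<close>

lemma nn_integral_fatou_limit:
  fixes f :: "nat \<Rightarrow> 'a \<Rightarrow> real"
  assumes [measurable]: "\<And>j. f j \<in> borel_measurable M" 
    and lim: "AE x in M. (\<lambda>j. f j x) \<longlonglongrightarrow> F x"
    and le: "\<And>j. (\<integral>\<^sup>+x. ennreal (f j x) \<partial>M) \<le> ennreal (c j)" and c: "c \<longlonglongrightarrow> C"
  shows "(\<integral>\<^sup>+x. ennreal (F x) \<partial>M) \<le> ennreal C"
proof -
  have "(\<integral>\<^sup>+x. ennreal (F x) \<partial>M) = (\<integral>\<^sup>+x. liminf (\<lambda>j. ennreal (f j x)) \<partial>M)"
  proof (rule nn_integral_cong_AE, use lim in eventually_elim)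
    case (elim x)
    then have "(\<lambda>j. ennreal (f j x)) \<longlonglongrightarrow> ennreal (F x)" by (rule tendsto_ennrealI)
    from lim_imp_Liminf[OF _ this] show ?case by simp
  qed
  also have "\<dots> \<le> liminf (\<lambda>j. \<integral>\<^sup>+x. ennreal (f j x) \<partial>M)"
    by (rule nn_integral_liminf) simp
  also have "\<dots> \<le> liminf (\<lambda>j. ennreal (c j))"
    by (rule Liminf_mono) (simp add: le)
  also have "\<dots> = ennreal C"
    by (rule lim_imp_Liminf) (use c in \<open>auto intro: tendsto_ennrealI\<close>)
  finally show ?thesis .
qed

definition L2conv :: "'a measure \<Rightarrow> (nat \<Rightarrow> 'a \<Rightarrow> 'b::euclidean_space) \<Rightarrow> ('a \<Rightarrow> 'b) \<Rightarrow> bool" where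
  "L2conv M f F \<longleftrightarrow> (\<forall>k. f k \<in> L2 M) \<and> F \<in> L2 M \<and> (\<lambda>k. sqn M (\<lambda>x. f k x - F x)) \<longlonglongrightarrow> 0"

lemma L2convD:
  assumes "L2conv M f F"
  shows "f k \<in> L2 M" "F \<in> L2 M" "(\<lambda>k. sqn M (\<lambda>x. f k x - F x)) \<longlonglongrightarrow> 0"
  using assms by (auto simp: L2conv_def)

lemma ip_tendsto:
  assumes "L2conv M f F" "L2conv M g G"
  shows "(\<lambda>k. ip M (f k) (g k)) \<longlonglongrightarrow> ip M F G"
proof -
  note L = L2convD(1,2)[OF assms(1)] L2convD(1,2)[OF assms(2)]
  have z: "(\<lambda>k. sqrt (sqn M (\<lambda>x. f k x - F x))) \<longlonglongrightarrow> 0" "(\<lambda>k. sqrt (sqn M (\<lambda>x. g k x - G x))) \<longlonglongrightarrow> 0"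
    using tendsto_real_sqrt[OF L2convD(3)[OF assms(1)]] tendsto_real_sqrt[OF L2convD(3)[OF assms(2)]] by auto
  have eq: "ip M (f k) (g k) - ip M F G = ip M (\<lambda>x. f k x - F x) (\<lambda>x. g k x - G x)
      + ip M (\<lambda>x. f k x - F x) G + ip M F (\<lambda>x. g k x - G x)" for k
    using L by (simp add: ip_diff ip_diff_right L2_diff)
  have "(\<lambda>k. ip M (f k) (g k) - ip M F G) \<longlonglongrightarrow> 0"
  proof (rule tendsto_rabs_zero_cancel, rule tendsto_sandwich[OF _ _ tendsto_const])
    show "\<forall>\<^sub>F k in sequentially. \<bar>ip M (f k) (g k) - ip M F G\<bar>
      \<le> sqrt (sqn M (\<lambda>x. f k x - F x)) * sqrt (sqn M (\<lambda>x. g k x - G x))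
       + sqrt (sqn M (\<lambda>x. f k x - F x)) * sqrt (sqn M G) + sqrt (sqn M F) * sqrt (sqn M (\<lambda>x. g k x - G x))"
      unfolding eq using L
      by (intro always_eventually allI order_trans[OF abs_triangle_ineq] add_mono ip_Cauchy_Schwarz L2_diff) auto
    have "(\<lambda>k. sqrt (sqn M (\<lambda>x. f k x - F x)) * sqrt (sqn M (\<lambda>x. g k x - G x))
       + sqrt (sqn M (\<lambda>x. f k x - F x)) * sqrt (sqn M G) + sqrt (sqn M F) * sqrt (sqn M (\<lambda>x. g k x - G x)))
      \<longlonglongrightarrow> 0 * 0 + 0 * sqrt (sqn M G) + sqrt (sqn M F) * 0"
      by (intro tendsto_add tendsto_mult z tendsto_const)
    then show "(\<lambda>k. sqrt (sqn M (\<lambda>x. f k x - F x)) * sqrt (sqn M (\<lambda>x. g k x - G x))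
       + sqrt (sqn M (\<lambda>x. f k x - F x)) * sqrt (sqn M G) + sqrt (sqn M F) * sqrt (sqn M (\<lambda>x. g k x - G x)))
      \<longlonglongrightarrow> 0" by simp
  qed auto
  then show ?thesis by (simp add: LIM_zero_iff)
qed

lemma sqn_tendsto: "L2conv M f F \<Longrightarrow> (\<lambda>k. sqn M (f k)) \<longlonglongrightarrow> sqn M F"
  using ip_tendsto[of M f F f F] by (simp add: ip_self)

lemma L2conv_const: "F \<in> L2 M \<Longrightarrow> L2conv M (\<lambda>k. F) F"
  by (simp add: L2conv_def sqn_def)

lemma L2conv_add:
  assumes "L2conv M f F" "L2conv M g G"
  shows "L2conv M (\<lambda>k x. f k x + g k x) (\<lambda>x. F x + G x)"
proof -
  note L = L2convD(1,2)[OF assms(1)] L2convD(1,2)[OF assms(2)]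
  have "(\<lambda>k. sqn M (\<lambda>x. f k x + g k x - (F x + G x))) \<longlonglongrightarrow> 0"
  proof (rule tendsto_sandwich[OF _ _ tendsto_const])
    show "\<forall>\<^sub>F k in sequentially. sqn M (\<lambda>x. f k x + g k x - (F x + G x))
       \<le> 2 * sqn M (\<lambda>x. f k x - F x) + 2 * sqn M (\<lambda>x. g k x - G x)"
      using sqn_add_le[of "\<lambda>x. f _ x - F x" M "\<lambda>x. g _ x - G x"] L
      by (intro always_eventually) (auto simp: L2_diff algebra_simps)
    show "(\<lambda>k. 2 * sqn M (\<lambda>x. f k x - F x) + 2 * sqn M (\<lambda>x. g k x - G x)) \<longlonglongrightarrow> 0"
      using tendsto_add[OF tendsto_mult_left[OF L2convD(3)[OF assms(1)], of 2] tendsto_mult_left[OF L2convD(3)[OF assms(2)], of 2]] by simp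
  qed (auto simp: sqn_nonneg)
  then show ?thesis using L by (simp add: L2conv_def L2_add)
qed

lemma L2conv_scale:
  assumes "L2conv M f F"
  shows "L2conv M (\<lambda>k x. c *\<^sub>R f k x) (\<lambda>x. c *\<^sub>R F x)"
proof -
  have "(\<lambda>k. c\<^sup>2 * sqn M (\<lambda>x. f k x - F x)) \<longlonglongrightarrow> 0"
    using tendsto_mult_left[OF L2convD(3)[OF assms], of "c\<^sup>2"] by simp
  moreover have "sqn M (\<lambda>x. c *\<^sub>R f k x - c *\<^sub>R F x) = c\<^sup>2 * sqn M (\<lambda>x. f k x - F x)" for k
    using sqn_scale[of M c "\<lambda>x. f k x - F x"] by (simp add: scaleR_diff_right)
  ultimately show ?thesis using L2convD(1,2)[OF assms] by (simp add: L2conv_def L2_scale)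
qed

lemma L2conv_subseq: "L2conv M f F \<Longrightarrow> strict_mono r \<Longrightarrow> L2conv M (\<lambda>k. f (r k)) F"
  unfolding L2conv_def using LIMSEQ_subseq_LIMSEQ[of "\<lambda>k. sqn M (\<lambda>x. f k x - F x)" 0 r] by (simp add: o_def)

lemma L2conv_AE_subseq:
  assumes "L2conv M f F"
  obtains r where "strict_mono r" "AE x in M. (\<lambda>k. f (r k) x) \<longlonglongrightarrow> F x"
proof -
  note L = L2convD(1,2)[OF assms]
  have "(\<lambda>k. \<integral>x. norm ((norm (f k x - F x))\<^sup>2) \<partial>M) \<longlonglongrightarrow> 0"
    using L2convD(3)[OF assms] by (simp add: sqn_def)
  from tendsto_L1_AE_subseq[OF L2_integrable[OF L2_diff[OF L]] this]
  obtain r where r: "strict_mono r" "AE x in M. (\<lambda>k. (norm (f (r k) x - F x))\<^sup>2) \<longlonglongrightarrow> 0" by blast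
  have "AE x in M. (\<lambda>k. f (r k) x) \<longlonglongrightarrow> F x"
    using r(2)
  proof eventually_elim
    case (elim x)
    from tendsto_real_sqrt[OF elim] have "(\<lambda>k. norm (f (r k) x - F x)) \<longlonglongrightarrow> 0" by simp
    then show ?case by (simp add: LIM_zero_iff tendsto_norm_zero_iff)
  qed
  with r(1) that show ?thesis by blast
qed

text \<open>The integrals of the squared increments are summable even after multiplication by \<open>2\<^sup>k\<close>, so that almost everywhere they are
  dominated by a geometric sequence.\<close>

lemma L2_rapid_AE_convergent:
  fixes g :: "nat \<Rightarrow> 'a \<Rightarrow> 'b::euclidean_space"
  assumes "\<And>k. g k \<in> L2 M" "\<And>k. sqn M (\<lambda>x. g (Suc k) x - g k x) \<le> (1/4) ^ k"
  shows "AE x in M. convergent (\<lambda>k. g k x)"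
proof -
  have [measurable]: "\<And>k. g k \<in> borel_measurable M" using assms(1) by (auto simp: L2_def)
  define d where "d k x = (norm (g (Suc k) x - g k x))\<^sup>2" for k x
  have [measurable]: "\<And>k. d k \<in> borel_measurable M" unfolding d_def by measurable
  have "(\<integral>\<^sup>+x. (\<Sum>k. ennreal (2 ^ k * d k x)) \<partial>M) = (\<Sum>k. \<integral>\<^sup>+x. ennreal (2 ^ k * d k x) \<partial>M)"
    by (rule nn_integral_suminf) simp
  also have "\<dots> \<le> (\<Sum>k. ennreal ((1/2) ^ k))"
  proof (rule suminf_le)
    fix k
    have "(\<integral>\<^sup>+x. ennreal (2 ^ k * d k x) \<partial>M) = ennreal (2 ^ k) * (\<integral>\<^sup>+x. ennreal (d k x) \<partial>M)"
      by (simp add: ennreal_mult d_def nn_integral_cmult)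
    also have "\<dots> = ennreal (2 ^ k * sqn M (\<lambda>x. g (Suc k) x - g k x))"
      unfolding d_def by (simp add: L2_nn L2_diff assms(1) ennreal_mult sqn_nonneg)
    also have "\<dots> \<le> ennreal (2 ^ k * (1/4) ^ k)" by (intro ennreal_leI mult_left_mono assms(2)) auto
    also have "2 ^ k * (1/4) ^ k = (1/2 :: real) ^ k" by (simp flip: power_mult_distrib)
    finally show "(\<integral>\<^sup>+x. ennreal (2 ^ k * d k x) \<partial>M) \<le> ennreal ((1/2) ^ k)" .
  qed auto
  also have "\<dots> < \<infinity>"
    by (subst suminf_ennreal2) auto
  finally have "AE x in M. (\<Sum>k. ennreal (2 ^ k * d k x)) \<noteq> \<infinity>"
    by (intro nn_integral_PInf_AE) auto
  then show ?thesis
  proof eventually_elim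
    case (elim x)
    have "ennreal (2 ^ k * d k x) \<le> (\<Sum>k. ennreal (2 ^ k * d k x))" for k
      using sum_le_suminf[of "\<lambda>k. ennreal (2 ^ k * d k x)" "{k}"] by simp
    moreover obtain C where C: "C \<ge> 0" "(\<Sum>k. ennreal (2 ^ k * d k x)) = ennreal C"
      using elim by (cases "\<Sum>k. ennreal (2 ^ k * d k x)") auto
    ultimately have "2 ^ k * d k x \<le> C" for k by (metis ennreal_le_iff)
    then have "d k x \<le> C * (1/2) ^ k" for k by (simp add: field_simps)
    then have "sqrt (d k x) \<le> sqrt (C * (1/2) ^ k)" for k by (rule real_sqrt_le_mono)
    then have "norm (g (Suc k) x - g k x) \<le> sqrt C * sqrt (1/2) ^ k" for k
      by (simp add: d_def real_sqrt_mult real_sqrt_power)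
    moreover have "summable (\<lambda>k. sqrt C * sqrt (1/2) ^ k)"
      by (intro summable_mult summable_geometric) (simp add: real_sqrt_divide)
    ultimately have "summable (\<lambda>k. g (Suc k) x - g k x)"
      using summable_comparison_test'[of "\<lambda>k. sqrt C * sqrt (1/2) ^ k" 0 "\<lambda>k. g (Suc k) x - g k x"] by blast
    then have "convergent (\<lambda>n. g 0 x + (\<Sum>k<n. g (Suc k) x - g k x))"
      by (intro convergent_add convergent_const) (simp add: summable_iff_convergent)
    moreover have "g 0 x + (\<Sum>k<n. g (Suc k) x - g k x) = g n x" for n
      using sum_lessThan_telescope[of "\<lambda>k. g k x" n] by simp
    ultimately show ?case by simp
  qed
qed

text \<open>A rapidly converging subsequence has a pointwise limit; Fatou's lemma identifies it as the limit
  of the whole sequence.\<close>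

lemma L2_complete:
  fixes f :: "nat \<Rightarrow> 'a \<Rightarrow> 'b::euclidean_space"
  assumes f: "\<And>k. f k \<in> L2 M"
    and cauchy: "\<And>e. e > 0 \<Longrightarrow> \<exists>N. \<forall>k\<ge>N. \<forall>l\<ge>N. sqn M (\<lambda>x. f k x - f l x) < e"
  obtains F where "L2conv M f F"
proof -
  have [measurable]: "\<And>k. f k \<in> borel_measurable M" using f by (auto simp: L2_def)
  have "\<exists>N. \<forall>k\<ge>N. \<forall>l\<ge>N. sqn M (\<lambda>x. f k x - f l x) < (1/4) ^ j" for j
    by (rule cauchy) simp
  then obtain N where N: "\<And>j k l. k \<ge> N j \<Longrightarrow> l \<ge> N j \<Longrightarrow> sqn M (\<lambda>x. f k x - f l x) < (1/4) ^ j"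
    by metis
  define r where "r j = (\<Sum>i\<le>j. N i) + j" for j
  have r: "strict_mono r" by (auto simp: strict_mono_Suc_iff r_def)
  have rN: "N j \<le> r j" for j unfolding r_def
    by (metis atMost_iff finite_atMost le_add1 le_trans member_le_sum order_refl zero_le)
  have "sqn M (\<lambda>x. f (r (Suc j)) x - f (r j) x) \<le> (1/4) ^ j" for j
    using N[of j "r (Suc j)" "r j"] rN[of j] strict_mono_less_eq[OF r, of j "Suc j"] by simp
  from L2_rapid_AE_convergent[of "\<lambda>j. f (r j)", OF f this]
  have conv: "AE x in M. convergent (\<lambda>j. f (r j) x)" .
  define F where "F x = lim (\<lambda>j. f (r j) x)" for x
  have [measurable]: "F \<in> borel_measurable M"
    unfolding F_def[abs_def] by (rule borel_measurable_lim_metric) simp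
  have lim: "AE x in M. (\<lambda>j. f (r j) x) \<longlonglongrightarrow> F x"
    using conv by eventually_elim (simp add: F_def convergent_LIMSEQ_iff)
  have bound: "(\<lambda>x. f k x - F x) \<in> L2 M \<and> sqn M (\<lambda>x. f k x - F x) \<le> (1/4) ^ j" if "k \<ge> N j" for k j
  proof -
    define q where "q i = r (i + j)" for i
    have "(\<integral>\<^sup>+x. ennreal ((norm (f k x - F x))\<^sup>2) \<partial>M) \<le> ennreal ((1/4) ^ j)"
    proof (rule nn_integral_fatou_limit[of "\<lambda>i x. (norm (f k x - f (q i) x))\<^sup>2" _ _ "\<lambda>_. (1/4) ^ j"])
      show "AE x in M. (\<lambda>i. (norm (f k x - f (q i) x))\<^sup>2) \<longlonglongrightarrow> (norm (f k x - F x))\<^sup>2"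
        using lim unfolding q_def
        by eventually_elim (intro tendsto_intros LIMSEQ_ignore_initial_segment)
      have "q i \<ge> N j" for i
        using rN[of j] strict_mono_less_eq[OF r, of j "i + j"] by (simp add: q_def)
      then show "(\<integral>\<^sup>+x. ennreal ((norm (f k x - f (q i) x))\<^sup>2) \<partial>M) \<le> ennreal ((1/4) ^ j)" for i
        using N[OF that, of "q i"] by (simp add: L2_nn L2_diff f ennreal_leI)
    qed auto
    from L2_I[OF _ this] show ?thesis by simp
  qed
  have FL: "F \<in> L2 M"
    using L2_diff[OF f[of "N 0"], of "\<lambda>x. f (N 0) x - F x"] bound[of 0 "N 0"] by simp
  have "(\<lambda>k. sqn M (\<lambda>x. f k x - F x)) \<longlonglongrightarrow> 0"
  proof (rule LIMSEQ_I)
    fix e :: real assume "e > 0"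
    then obtain j where "(1/4) ^ j < e" using real_arch_pow_inv[of e "1/4"] by auto
    then have "norm (sqn M (\<lambda>x. f k x - F x) - 0) < e" if "k \<ge> N j" for k
      using bound[OF that] sqn_nonneg[of M "\<lambda>x. f k x - F x"] by simp
    then show "\<exists>no. \<forall>k\<ge>no. norm (sqn M (\<lambda>x. f k x - F x) - 0) < e" by blast
  qed
  with f FL have "L2conv M f F" by (simp add: L2conv_def)
  with that show ?thesis .
qed

section \<open>Weak gradients and the space of weak solutions\<close>

text \<open>Boxes generate the Borel sets, so the positive and the negative part of \<open>f\<close> are densities of the
  same measure.\<close>

lemma AE_zero_if_box_integrals_zero:
  fixes f :: "'a::euclidean_space \<Rightarrow> real"
  assumes int: "integrable lebesgue f"
    and zero: "\<And>c d. (\<integral>x. indicator (box c d) x * f x \<partial>lebesgue) = 0"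
  shows "AE x in lebesgue. f x = 0"
proof -
  obtain g where g[measurable]: "g \<in> borel_measurable borel" and fg: "AE x in lborel. f x = g x"
    using completion_ex_borel_measurable_real[of f lborel] int by auto
  have fg': "AE x in lebesgue. f x = g x" using fg by (rule AE_completion)
  have ig: "integrable lborel g"
    using int fg' integrable_cong_AE[of f lebesgue g] borel_lebesgue[OF g]
    by (simp add: integrable_completion)
  let ?P = "density lborel (\<lambda>x. ennreal (g x))" and ?N = "density lborel (\<lambda>x. ennreal (- g x))"
  have eqb: "emeasure ?P (box c d) = emeasure ?N (box c d)" for c d
  proof -
    let ?h = "\<lambda>x. indicator (box c d) x * g x"
    have ih: "integrable lborel ?h" using integrable_mult_indicator[OF _ ig, of "box c d"] by simp
    have "(\<integral>x. ?h x \<partial>lborel) = (\<integral>x. ?h x \<partial>lebesgue)"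
      by (simp add: integral_completion)
    also have "\<dots> = (\<integral>x. indicator (box c d) x * f x \<partial>lebesgue)"
    proof (rule integral_cong_AE)
      show "(\<lambda>x. indicator (box c d) x * f x) \<in> borel_measurable lebesgue"
        by (intro borel_measurable_times borel_measurable_integrable[OF int] borel_lebesgue borel_measurable_indicator) auto
      show "?h \<in> borel_measurable lebesgue" by (rule borel_lebesgue) simp
    qed (use fg' in \<open>auto elim: eventually_mono\<close>)
    finally have z: "(\<integral>x. ?h x \<partial>lborel) = 0" using zero by simp
    have "(\<integral>\<^sup>+x. ennreal (?h x) \<partial>lborel) = (\<integral>\<^sup>+x. ennreal (- ?h x) \<partial>lborel)"
    proof -
      have "enn2real (\<integral>\<^sup>+x. ennreal (?h x) \<partial>lborel) = enn2real (\<integral>\<^sup>+x. ennreal (- ?h x) \<partial>lborel)"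
        using real_lebesgue_integral_def[OF ih] z by simp
      moreover have "(\<integral>\<^sup>+x. ennreal (?h x) \<partial>lborel) \<noteq> \<infinity>" "(\<integral>\<^sup>+x. ennreal (- ?h x) \<partial>lborel) \<noteq> \<infinity>"
        using ih by (auto simp: real_integrable_def)
      ultimately show ?thesis
        by (cases "\<integral>\<^sup>+x. ennreal (?h x) \<partial>lborel"; cases "\<integral>\<^sup>+x. ennreal (- ?h x) \<partial>lborel") simp_all
    qed
    moreover have "emeasure ?P (box c d) = (\<integral>\<^sup>+x. ennreal (?h x) \<partial>lborel)"
      by (subst emeasure_density) (auto intro!: nn_integral_cong simp: indicator_def)
    moreover have "emeasure ?N (box c d) = (\<integral>\<^sup>+x. ennreal (- ?h x) \<partial>lborel)"
      by (subst emeasure_density) (auto intro!: nn_integral_cong simp: indicator_def)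
    ultimately show ?thesis by simp
  qed
  have "?P = ?N"
  proof (rule measure_eqI_generator_eq[where \<Omega> = UNIV and E = "range (\<lambda>(a, b). box a b :: 'a set)"
        and A = "\<lambda>n. box (- (real n *\<^sub>R One)) (real n *\<^sub>R One)"])
    show "Int_stable (range (\<lambda>(a, b). box a b :: 'a set))"
      by (auto simp: Int_stable_def box_Int_box)
    show "sets ?P = sigma_sets UNIV (range (\<lambda>(a, b). box a b))"
      "sets ?N = sigma_sets UNIV (range (\<lambda>(a, b). box a b))"
      by (simp_all add: borel_eq_box)
    show "(\<Union>i. box (- (real i *\<^sub>R One)) (real i *\<^sub>R One)) = (UNIV :: 'a set)"
      using UN_box_eq_UNIV by simp
    fix i
    let ?B = "box (- (real i *\<^sub>R One)) (real i *\<^sub>R One) :: 'a set"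
    have "emeasure ?P ?B \<le> (\<integral>\<^sup>+x. ennreal (g x) \<partial>lborel)"
      by (subst emeasure_density) (auto intro!: nn_integral_mono simp: indicator_def)
    also have "\<dots> < \<infinity>" using ig by (simp add: real_integrable_def less_top)
    finally show "emeasure ?P ?B \<noteq> \<infinity>" by simp
  qed (auto simp: eqb)
  then have "AE x in lborel. ennreal (g x) = ennreal (- g x)"
    by (simp add: sigma_finite_measure.density_unique_iff[OF sigma_finite_lborel])
  then have g0: "AE x in lborel. g x = 0"
  proof eventually_elim
    case (elim x)
    show ?case
    proof (cases "0 \<le> g x")
      case True
      then have "ennreal (g x) = 0" using elim by (simp add: ennreal_neg)
      with True show ?thesis by (simp add: ennreal_eq_0_iff)
    next
      case False
      then have "ennreal (- g x) = 0" using elim by (simp add: ennreal_neg)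
      with False show ?thesis by (simp add: ennreal_eq_0_iff)
    qed
  qed
  show ?thesis using AE_completion[OF g0] fg' by eventually_elim simp
qed

text \<open>An open set is a countable union of boxes.\<close>

lemma AE_zero_on_open_if_local:
  fixes \<Omega> :: "'a::euclidean_space set"
  assumes "open \<Omega>"
    and loc: "\<And>a b. cbox a b \<subseteq> \<Omega> \<Longrightarrow> AE x in lebesgue. x \<in> box a b \<longrightarrow> P x"
  shows "AE x in lebesgue. x \<in> \<Omega> \<longrightarrow> P x"
proof -
  have "\<forall>x\<in>\<Omega>. \<exists>U. open U \<and> x \<in> U \<and> (\<exists>a b. U = box a b \<and> cbox a b \<subseteq> \<Omega>)"
    using assms(1) open_contains_cbox by (metis open_box)
  then obtain U where U: "\<And>x. x \<in> \<Omega> \<Longrightarrow> open (U x) \<and> x \<in> U x \<and> (\<exists>a b. U x = box a b \<and> cbox a b \<subseteq> \<Omega>)"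
    by metis
  obtain F where F: "F \<subseteq> U ` \<Omega>" "countable F" "\<Union>F = \<Union>(U ` \<Omega>)"
    using Lindelof[of "U ` \<Omega>"] U by (metis imageE)
  have "AE x in lebesgue. x \<in> V \<longrightarrow> P x" if V: "V \<in> F" for V
  proof -
    obtain y where "y \<in> \<Omega>" "V = U y" using F(1) V by auto
    then obtain a b where "V = box a b" "cbox a b \<subseteq> \<Omega>" using U by metis
    then show ?thesis using loc by simp
  qed
  then have "AE x in lebesgue. \<forall>V\<in>F. x \<in> V \<longrightarrow> P x"
    unfolding AE_ball_countable[OF F(2)] by blast
  then show ?thesis
  proof eventually_elim
    case (elim x)
    have "x \<in> \<Omega> \<Longrightarrow> x \<in> \<Union>F" using F(3) U by blast
    with elim show ?case by blast
  qed
qed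

text \<open>The bumps of a box converge boundedly to its indicator function, so the integral of \<open>f\<close> over every
  box inside \<open>\<Omega>\<close> vanishes.\<close>

lemma fundamental_lemma:
  fixes f :: "real ^ 'n \<Rightarrow> real"
  assumes "open \<Omega>" and int: "\<And>K. compact K \<Longrightarrow> K \<subseteq> \<Omega> \<Longrightarrow> integrable lebesgue (\<lambda>x. indicator K x * f x)"
    and zero: "\<And>\<phi>. \<phi> \<in> test_functions \<Omega> \<Longrightarrow> (\<integral>x. f x * \<phi> x \<partial>lebesgue) = 0"
  shows "AE x in lebesgue. x \<in> \<Omega> \<longrightarrow> f x = 0"
proof (rule AE_zero_on_open_if_local[OF assms(1)])
  fix a b :: "real ^ 'n" assume ab: "cbox a b \<subseteq> \<Omega>"
  have intab: "integrable lebesgue (\<lambda>x. indicator (cbox a b) x * f x)" using ab by (intro int) auto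
  have box0: "(\<integral>x. indicator (box c d) x * f x \<partial>lebesgue) = 0" if "cbox c d \<subseteq> \<Omega>" for c d
  proof -
    have i: "integrable lebesgue (\<lambda>x. indicator (cbox c d) x * f x)" using that by (intro int) auto
    then have m: "(\<lambda>x. indicator (cbox c d) x * f x) \<in> borel_measurable lebesgue"
      by (rule borel_measurable_integrable)
    have e1: "f x * box_bump c d k x = (indicator (cbox c d) x * f x) * box_bump c d k x" for k x
      using box_bump_pos[of c d k x] box_subset_cbox[of c d] by (auto simp: indicator_def)
    have e2: "indicator (box c d) x * f x = (indicator (cbox c d) x * f x) * indicator (box c d) x" for x
      using box_subset_cbox[of c d] by (auto simp: indicator_def)
    have "(\<lambda>k. \<integral>x. (indicator (cbox c d) x * f x) * box_bump c d k x \<partial>lebesgue)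
        \<longlonglongrightarrow> (\<integral>x. (indicator (cbox c d) x * f x) * indicator (box c d) x \<partial>lebesgue)"
    proof (rule integral_dominated_convergence[OF _ _ integrable_norm[OF i]])
      show "(\<lambda>x. (indicator (cbox c d) x * f x) * indicator (box c d) x) \<in> borel_measurable lebesgue"
        by (intro borel_measurable_times[OF m] borel_lebesgue borel_measurable_indicator) auto
      show "(\<lambda>x. (indicator (cbox c d) x * f x) * box_bump c d k x) \<in> borel_measurable lebesgue" for k
        by (rule borel_measurable_times[OF m test_measurable(1)[OF box_bump_test[OF that]]])
      show "AE x in lebesgue. norm ((indicator (cbox c d) x * f x) * box_bump c d k x) 
         \<le> norm (indicator (cbox c d) x * f x)" for k
        using box_bump_bounds[of c d k] by (auto intro!: AE_I2 mult_right_le_one_le simp: abs_mult)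
    qed (intro AE_I2 tendsto_intros box_bump_limit)
    moreover have "(\<integral>x. f x * box_bump c d k x \<partial>lebesgue) = 0" for k
      by (rule zero[OF box_bump_test[OF that]])
    ultimately show ?thesis unfolding e2 e1 by (simp add: LIMSEQ_const_iff)
  qed
  have "AE x in lebesgue. indicator (box a b) x * f x = 0"
  proof (rule AE_zero_if_box_integrals_zero)
    show "integrable lebesgue (\<lambda>x. indicator (box a b) x * f x)"
      using integrable_mult_indicator[OF _ intab, of "box a b"] box_subset_cbox[of a b]
      by (simp add: indicator_inter_arith[symmetric] mult.assoc[symmetric] Int_absorb2)
    fix c d :: "real ^ 'n"
    obtain c' d' where cd: "box c d \<inter> box a b = box c' d'" "cbox c d \<inter> cbox a b = cbox c' d'"
      by (simp add: box_Int_box Int_interval)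
    have "(\<integral>x. indicator (box c' d') x * f x \<partial>lebesgue) = 0"
      using cd ab by (intro box0) auto
    then show "(\<integral>x. indicator (box c d) x * (indicator (box a b) x * f x) \<partial>lebesgue) = 0"
      unfolding cd(1)[symmetric] by (simp add: indicator_inter_arith mult.assoc)
  qed
  then show "AE x in lebesgue. x \<in> box a b \<longrightarrow> f x = 0"
    by eventually_elim auto
qed

lemma set_integral_support:
  assumes "\<And>x. x \<notin> \<Omega> \<Longrightarrow> h x = 0"
  shows "(LINT x:\<Omega>|M. h x) = (\<integral>x. h x \<partial>M)"
  unfolding set_lebesgue_integral_def using assms
  by (intro Bochner_Integration.integral_cong) (auto simp: indicator_def)

lemma weak_gradient_iff:
  "weak_gradient \<Omega> u g \<longleftrightarrow> locally_integrable \<Omega> u \<and> locally_integrable \<Omega> g \<and>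
     (\<forall>\<phi>\<in>test_functions \<Omega>. \<forall>i.
        (\<integral>x. u x * partial i \<phi> x \<partial>lebesgue) = - (\<integral>x. g x $ i * \<phi> x \<partial>lebesgue))"
proof -
  have "(LINT x:\<Omega>|lebesgue. u x * partial i \<phi> x) = (\<integral>x. u x * partial i \<phi> x \<partial>lebesgue)"
    "(LINT x:\<Omega>|lebesgue. g x $ i * \<phi> x) = (\<integral>x. g x $ i * \<phi> x \<partial>lebesgue)"
    if "\<phi> \<in> test_functions \<Omega>" for \<phi> i
    using test_support[OF that] test_support[OF test_partial[OF that]]
    by (auto intro!: set_integral_support)
  then show ?thesis unfolding weak_gradient_def by auto
qed

lemma locally_integrable_times_test:
  fixes f :: "real ^ 'n \<Rightarrow> real"
  assumes "locally_integrable \<Omega> f" "\<phi> \<in> test_functions \<Omega>"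
  shows "integrable lebesgue (\<lambda>x. f x * \<phi> x)"
proof -
  obtain K where K: "compact K" "K \<subseteq> \<Omega>" "\<And>x. x \<notin> K \<Longrightarrow> \<phi> x = 0" using test_compactE[OF assms(2)] by metis
  obtain B where B: "B > 0" "\<And>x. \<bar>\<phi> x\<bar> \<le> B" using test_bounded[OF assms(2)] by metis
  have i: "integrable lebesgue (\<lambda>x. indicator K x *\<^sub>R f x)"
    using assms(1) K(1,2) by (auto simp: locally_integrable_def set_integrable_def)
  have "integrable lebesgue (\<lambda>x. (indicator K x *\<^sub>R f x) * \<phi> x)"
  proof (rule Bochner_Integration.integrable_bound[OF integrable_mult_left[OF i, of B]])
    show "(\<lambda>x. (indicator K x *\<^sub>R f x) * \<phi> x) \<in> borel_measurable lebesgue"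
      by (intro borel_measurable_times borel_measurable_integrable[OF i] test_measurable(1)[OF assms(2)])
    show "AE x in lebesgue. norm (indicator K x *\<^sub>R f x * \<phi> x) \<le> norm (indicator K x *\<^sub>R f x * B)"
      using B by (intro AE_I2) (auto simp: abs_mult intro!: mult_left_mono)
  qed
  moreover have "(\<lambda>x. (indicator K x *\<^sub>R f x) * \<phi> x) = (\<lambda>x. f x * \<phi> x)"
    using K(3) by (auto simp: indicator_def fun_eq_iff)
  ultimately show ?thesis by (simp only:)
qed

lemma locally_integrable_nth:
  fixes g :: "real ^ 'n \<Rightarrow> real ^ 'm"
  assumes "locally_integrable \<Omega> g"
  shows "locally_integrable \<Omega> (\<lambda>x. g x $ i)"
  unfolding locally_integrable_def set_integrable_def
proof (intro allI impI)
  fix K :: "(real ^ 'n) set" assume "compact K \<and> K \<subseteq> \<Omega>"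
  with assms have "integrable lebesgue (\<lambda>x. indicator K x *\<^sub>R g x)"
    by (auto simp: locally_integrable_def set_integrable_def)
  from integrable_inner_left[OF this, of "axis i 1"]
  show "integrable lebesgue (\<lambda>x. indicator K x *\<^sub>R g x $ i)" by (simp add: inner_axis)
qed

lemma locally_integrable_diff:
  "locally_integrable \<Omega> f \<Longrightarrow> locally_integrable \<Omega> g \<Longrightarrow> locally_integrable \<Omega> (\<lambda>x. f x - g x)"
  by (auto simp: locally_integrable_def)

lemma locally_integrable_subset: "locally_integrable \<Omega>' f \<Longrightarrow> \<Omega> \<subseteq> \<Omega>' \<Longrightarrow> locally_integrable \<Omega> f"
  by (auto simp: locally_integrable_def)

text \<open>The components of the difference satisfy the hypothesis of the fundamental lemma.\<close>

lemma weak_gradient_unique: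
  fixes \<Omega> :: "(real ^ 'n) set"
  assumes "open \<Omega>" and g: "weak_gradient \<Omega> u g" and h: "weak_gradient \<Omega> u h"
  shows "AE x in lebesgue. x \<in> \<Omega> \<longrightarrow> g x = h x"
proof -
  have "AE x in lebesgue. x \<in> \<Omega> \<longrightarrow> g x $ i - h x $ i = 0" for i
  proof (rule fundamental_lemma[OF assms(1)])
    have l: "locally_integrable \<Omega> (\<lambda>x. g x $ i)" "locally_integrable \<Omega> (\<lambda>x. h x $ i)"
      using g h by (auto simp: weak_gradient_def intro: locally_integrable_nth)
    show "integrable lebesgue (\<lambda>x. indicator K x * (g x $ i - h x $ i))" if "compact K" "K \<subseteq> \<Omega>" for K
      using locally_integrable_diff[OF l] that by (auto simp: locally_integrable_def set_integrable_def)
    fix \<phi> assume \<phi>: "\<phi> \<in> test_functions \<Omega>"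
    have "(\<integral>x. g x $ i * \<phi> x \<partial>lebesgue) = (\<integral>x. h x $ i * \<phi> x \<partial>lebesgue)"
      using g h \<phi> by (simp add: weak_gradient_iff)
    then show "(\<integral>x. (g x $ i - h x $ i) * \<phi> x \<partial>lebesgue) = 0"
      using l[THEN locally_integrable_times_test[OF _ \<phi>]] by (simp add: left_diff_distrib)
  qed
  then have "AE x in lebesgue. \<forall>i. x \<in> \<Omega> \<longrightarrow> g x $ i - h x $ i = 0"
    unfolding AE_all_countable by blast
  then show ?thesis by eventually_elim (auto simp: vec_eq_iff)
qed

lemma weak_gradient_wgrad: "weak_gradient \<Omega> u g \<Longrightarrow> weak_gradient \<Omega> u (wgrad \<Omega> u)"
  unfolding wgrad_def by (rule someI[of "weak_gradient \<Omega> u"])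

lemma weak_gradient_subset:
  assumes "weak_gradient \<Omega>' u g" "\<Omega> \<subseteq> \<Omega>'"
  shows "weak_gradient \<Omega> u g"
  using assms test_mono[OF _ assms(2)] unfolding weak_gradient_iff
  by (auto intro: locally_integrable_subset[OF _ assms(2)])

lemma weak_gradient_diff:
  assumes g: "weak_gradient \<Omega> u g" and h: "weak_gradient \<Omega> v h"
  shows "weak_gradient \<Omega> (\<lambda>x. u x - v x) (\<lambda>x. g x - h x)"
  unfolding weak_gradient_iff
proof (intro conjI ballI allI)
  show "locally_integrable \<Omega> (\<lambda>x. u x - v x)" "locally_integrable \<Omega> (\<lambda>x. g x - h x)"
    using g h by (auto simp: weak_gradient_def intro: locally_integrable_diff)
  fix \<phi> i assume \<phi>: "\<phi> \<in> test_functions \<Omega>"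
  have l: "locally_integrable \<Omega> u" "locally_integrable \<Omega> v"
    "locally_integrable \<Omega> (\<lambda>x. g x $ i)" "locally_integrable \<Omega> (\<lambda>x. h x $ i)"
    using g h by (auto simp: weak_gradient_def intro: locally_integrable_nth)
  note I = l(1,2)[THEN locally_integrable_times_test[OF _ test_partial[OF \<phi>]], of i]
    l(3,4)[THEN locally_integrable_times_test[OF _ \<phi>]]
  show "(\<integral>x. (u x - v x) * partial i \<phi> x \<partial>lebesgue) = - (\<integral>x. (g x - h x) $ i * \<phi> x \<partial>lebesgue)"
    using I g h \<phi> by (simp add: left_diff_distrib weak_gradient_iff)
qed

lemma L2_locally_integrable:
  fixes f :: "real ^ 'n \<Rightarrow> 'b::euclidean_space"
  assumes "f \<in> L2 lebesgue"
  shows "locally_integrable \<Omega> f"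
  unfolding locally_integrable_def set_integrable_def
proof (intro allI impI)
  fix K :: "(real ^ 'n) set" assume "compact K \<and> K \<subseteq> \<Omega>"
  then have K: "compact K" by simp
  have iK: "integrable lebesgue (\<lambda>x. indicator K x :: real)"
    using lmeasurable_compact[OF K] by (intro integrable_real_indicator) (auto simp: fmeasurable_def)
  show "integrable lebesgue (\<lambda>x. indicator K x *\<^sub>R f x)"
  proof (rule Bochner_Integration.integrable_bound[OF Bochner_Integration.integrable_add[OF iK L2_integrable[OF assms]]])
    show "(\<lambda>x. indicator K x *\<^sub>R f x) \<in> borel_measurable lebesgue"
      using L2_measurable[OF assms] fmeasurableD[OF lmeasurable_compact[OF K]]
      by (intro borel_measurable_scaleR borel_measurable_indicator)
    have "norm (f x) \<le> 1 + (norm (f x))\<^sup>2" for x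
    proof -
      have "2 * norm (f x) \<le> (norm (f x))\<^sup>2 + 1" using sum_squares_bound[of "norm (f x)" 1] by simp
      then show ?thesis using norm_ge_zero[of "f x"] by linarith
    qed
    then show "AE x in lebesgue. norm (indicator K x *\<^sub>R f x) \<le> norm (indicator K x + (norm (f x))\<^sup>2)"
      by (intro AE_I2) (auto simp: indicator_def)
  qed
qed

lemma test_L2:
  assumes "\<phi> \<in> test_functions \<Omega>"
  shows "\<phi> \<in> L2 lebesgue" "grad \<phi> \<in> L2 lebesgue"
proof -
  obtain K where K: "compact K" "\<And>x. x \<notin> K \<Longrightarrow> \<phi> x = 0" "\<And>x. x \<notin> K \<Longrightarrow> grad \<phi> x = 0"
    using test_compactE[OF assms] by metis
  show "\<phi> \<in> L2 lebesgue"
    unfolding L2_def using K test_measurable(1)[OF assms] test_continuous[OF assms]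
    by (auto intro!: integrable_compact_support[OF K(1)] continuous_intros)
  show "grad \<phi> \<in> L2 lebesgue"
    unfolding L2_def using K test_measurable(2)[OF assms] continuous_on_grad[OF test_smooth[OF assms]]
    by (auto intro!: integrable_compact_support[OF K(1)] continuous_intros)
qed

text \<open>Membership in the closure of the test functions, with the approximating sequence as a witness and
  the limit of the gradients named.  Elements of \<open>X12 \<Omega>\<close> are exactly the functions \<open>u\<close> that occur
  here, and \<open>G\<close> is then the weak gradient on the whole space, not only in \<open>\<Omega>\<close>.  This form avoids
  the choice operator behind \<^const>\<open>wgrad\<close> in all later arguments.\<close>

definition approx :: "(real ^ 'n) set \<Rightarrow> (real ^ 'n \<Rightarrow> real) \<Rightarrow> (real ^ 'n \<Rightarrow> real ^ 'n)
    \<Rightarrow> (nat \<Rightarrow> real ^ 'n \<Rightarrow> real) \<Rightarrow> bool" where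
  "approx \<Omega> u G \<phi> \<longleftrightarrow> (\<forall>k. \<phi> k \<in> test_functions \<Omega>) \<and> L2conv lebesgue \<phi> u \<and> L2conv lebesgue (\<lambda>k. grad (\<phi> k)) G"

lemma approxD:
  assumes "approx \<Omega> u G \<phi>"
  shows "\<phi> k \<in> test_functions \<Omega>" "L2conv lebesgue \<phi> u" "L2conv lebesgue (\<lambda>k. grad (\<phi> k)) G"
    "u \<in> L2 lebesgue" "G \<in> L2 lebesgue"
  using assms by (auto simp: approx_def L2conv_def)

lemma approx_AE_outside:
  assumes "approx \<Omega> u G \<phi>"
  shows "AE x in lebesgue. x \<notin> \<Omega> \<longrightarrow> u x = 0" "AE x in lebesgue. x \<notin> \<Omega> \<longrightarrow> G x = 0"
proof -
  obtain r where "strict_mono r" and r: "AE x in lebesgue. (\<lambda>k. \<phi> (r k) x) \<longlonglongrightarrow> u x"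
    by (rule L2conv_AE_subseq[OF approxD(2)[OF assms]])
  show "AE x in lebesgue. x \<notin> \<Omega> \<longrightarrow> u x = 0"
    using r
  proof eventually_elim
    case (elim x)
    then show ?case using test_support[OF approxD(1)[OF assms], of x] by (auto simp: LIMSEQ_const_iff)
  qed
  obtain q where "strict_mono q" and q: "AE x in lebesgue. (\<lambda>k. grad (\<phi> (q k)) x) \<longlonglongrightarrow> G x"
    by (rule L2conv_AE_subseq[OF approxD(3)[OF assms]])
  show "AE x in lebesgue. x \<notin> \<Omega> \<longrightarrow> G x = 0"
    using q
  proof eventually_elim
    case (elim x)
    then show ?case using test_grad_support[OF approxD(1)[OF assms], of x] by (auto simp: LIMSEQ_const_iff)
  qed
qed

lemma approx_weak_gradient:
  assumes "approx \<Omega> u G \<phi>"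
  shows "weak_gradient UNIV u G"
  unfolding weak_gradient_iff
proof (intro conjI ballI allI)
  show "locally_integrable UNIV u" "locally_integrable UNIV G"
    using approxD[OF assms] by (auto intro: L2_locally_integrable)
  fix \<psi> :: "real ^ 'a \<Rightarrow> real" and i assume \<psi>: "\<psi> \<in> test_functions UNIV"
  define e :: "real ^ 'a" where "e = axis i 1"
  have "norm e = 1" by (simp add: e_def)
  then have L: "(\<lambda>x. \<psi> x *\<^sub>R e) \<in> L2 lebesgue"
    using test_L2(1)[OF \<psi>] by (auto simp: L2_def intro!: borel_measurable_scaleR)
  have 1: "(\<lambda>k. ip lebesgue (\<phi> k) (partial i \<psi>)) \<longlonglongrightarrow> ip lebesgue u (partial i \<psi>)"
    by (intro ip_tendsto approxD(2)[OF assms] L2conv_const test_L2(1)[OF test_partial[OF \<psi>]])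
  have 2: "(\<lambda>k. ip lebesgue (grad (\<phi> k)) (\<lambda>x. \<psi> x *\<^sub>R e)) \<longlonglongrightarrow> ip lebesgue G (\<lambda>x. \<psi> x *\<^sub>R e)"
    by (intro ip_tendsto approxD(3)[OF assms] L2conv_const L)
  have 3: "ip lebesgue (\<phi> k) (partial i \<psi>) = - ip lebesgue (grad (\<phi> k)) (\<lambda>x. \<psi> x *\<^sub>R e)" for k
    using integration_by_parts[OF \<psi> test_smooth[OF approxD(1)[OF assms]], where i = i]
    by (simp add: ip_def e_def inner_axis grad_def mult.commute)
  have "ip lebesgue u (partial i \<psi>) = - ip lebesgue G (\<lambda>x. \<psi> x *\<^sub>R e)"
    by (rule LIMSEQ_unique[OF 1]) (use tendsto_minus[OF 2] in \<open>simp only: 3\<close>)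
  then show "(\<integral>x. u x * partial i \<psi> x \<partial>lebesgue) = - (\<integral>x. G x $ i * \<psi> x \<partial>lebesgue)"
    by (simp add: ip_def e_def inner_axis mult.commute)
qed

lemma test_approx: "\<phi> \<in> test_functions \<Omega> \<Longrightarrow> approx \<Omega> \<phi> (grad \<phi>) (\<lambda>k. \<phi>)"
  by (simp add: approx_def L2conv_const test_L2)

lemma L2_imp_Lp2:
  fixes f :: "real ^ 'n \<Rightarrow> 'b::euclidean_space"
  assumes "f \<in> L2 lebesgue" "\<Omega> \<in> sets lebesgue"
  shows "f \<in> Lp 2 \<Omega>"
proof -
  have "(\<lambda>x. indicat_real \<Omega> x *\<^sub>R f x) \<in> borel_measurable lebesgue"
    using assms L2_measurable by (intro borel_measurable_scaleR borel_measurable_indicator) auto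
  then show ?thesis
    using integrable_mult_indicator[OF assms(2) L2_integrable[OF assms(1)]]
    unfolding Lp_def set_borel_measurable_def set_integrable_def by simp
qed

lemma Lp2_UNIV_imp_L2: "f \<in> Lp 2 UNIV \<Longrightarrow> f \<in> L2 lebesgue"
  unfolding Lp_def L2_def set_borel_measurable_def set_integrable_def by simp

lemma Lp_norm2_sq: "(Lp_norm 2 \<Omega> f)\<^sup>2 = (LINT x:\<Omega>|lebesgue. (norm (f x))\<^sup>2)"
proof -
  have "0 \<le> (LINT x:\<Omega>|lebesgue. (norm (f x))\<^sup>2)"
    unfolding set_lebesgue_integral_def by (intro integral_nonneg_AE) auto
  then show ?thesis by (simp add: Lp_norm_def powr_half_sqrt)
qed

lemma set_integral_norm_le_sqn:
  assumes "f \<in> L2 lebesgue" "\<Omega> \<in> sets lebesgue"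
  shows "(LINT x:\<Omega>|lebesgue. (norm (f x))\<^sup>2) \<le> sqn lebesgue f"
  unfolding set_lebesgue_integral_def sqn_def
  using integrable_mult_indicator[OF assms(2) L2_integrable[OF assms(1)]] L2_integrable[OF assms(1)]
  by (intro integral_mono) (auto simp: indicator_def)

lemma set_integral_norm_cong:
  fixes f g :: "real ^ 'n \<Rightarrow> 'b::euclidean_space"
  assumes "AE x in lebesgue. x \<in> \<Omega> \<longrightarrow> f x = g x" "\<Omega> \<in> sets lebesgue"
    "g \<in> borel_measurable lebesgue"
  shows "(LINT x:\<Omega>|lebesgue. (norm (f x))\<^sup>2) = (LINT x:\<Omega>|lebesgue. (norm (g x))\<^sup>2)"
proof -
  let ?f = "\<lambda>x. indicat_real \<Omega> x *\<^sub>R (norm (f x))\<^sup>2" and ?g = "\<lambda>x. indicat_real \<Omega> x *\<^sub>R (norm (g x))\<^sup>2"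
  have ae: "AE x in lebesgue. ?g x = ?f x"
    using assms(1) by eventually_elim (auto simp: indicator_def)
  have g: "?g \<in> borel_measurable lebesgue"
    using assms(2,3) by (intro borel_measurable_scaleR borel_measurable_indicator) auto
  have "?f \<in> borel_measurable lebesgue"
    by (rule borel_measurable_AE[OF g ae])
  with g ae show ?thesis unfolding set_lebesgue_integral_def by (intro integral_cong_AE) (auto elim: eventually_mono)
qed

lemma approx_wgrad:
  assumes "approx \<Omega> u G \<phi>"
  shows "AE x in lebesgue. wgrad UNIV u x = G x"
  using weak_gradient_unique[OF open_UNIV weak_gradient_wgrad[OF approx_weak_gradient[OF assms]]
      approx_weak_gradient[OF assms]] by simp

lemma approx_add_scaled:
  assumes "approx \<Omega> u G \<phi>" "approx \<Omega> v H \<psi>"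
  shows "approx \<Omega> (\<lambda>x. u x + t * v x) (\<lambda>x. G x + t *\<^sub>R H x) (\<lambda>k x. \<phi> k x + t * \<psi> k x)"
proof -
  have "L2conv lebesgue (\<lambda>k x. \<phi> k x + t * \<psi> k x) (\<lambda>x. u x + t * v x)"
    using L2conv_add[OF approxD(2)[OF assms(1)] L2conv_scale[OF approxD(2)[OF assms(2)], of t]] by simp
  moreover have "grad (\<lambda>x. \<phi> k x + t * \<psi> k x) = (\<lambda>x. grad (\<phi> k) x + t *\<^sub>R grad (\<psi> k) x)" for k
    using test_smooth[OF approxD(1)[OF assms(1)]] test_smooth[OF approxD(1)[OF assms(2)]]
    by (simp add: fun_eq_iff grad_add grad_cmult smooth_cmult)
  then have "L2conv lebesgue (\<lambda>k. grad (\<lambda>x. \<phi> k x + t * \<psi> k x)) (\<lambda>x. G x + t *\<^sub>R H x)"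
    using L2conv_add[OF approxD(3)[OF assms(1)] L2conv_scale[OF approxD(3)[OF assms(2)], of t]] by simp
  ultimately show ?thesis using approxD(1)[OF assms(1)] approxD(1)[OF assms(2)]
    by (simp add: approx_def test_add test_cmult)
qed

lemma approx_diff:
  assumes "approx \<Omega> u G \<phi>" "approx \<Omega> v H \<psi>"
  shows "approx \<Omega> (\<lambda>x. u x - v x) (\<lambda>x. G x - H x) (\<lambda>k x. \<phi> k x - \<psi> k x)"
  using approx_add_scaled[OF assms, of "-1"] by simp

lemma H1_norm_sq: "(H1_norm \<Omega> u)\<^sup>2
    = (LINT x:\<Omega>|lebesgue. (norm (u x))\<^sup>2) + (LINT x:\<Omega>|lebesgue. (norm (wgrad \<Omega> u x))\<^sup>2)"
  unfolding H1_norm_def Lp_norm2_sq[symmetric] by simp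

text \<open>The weak gradient of \<open>u - \<phi>\<^sub>k\<close> in \<open>\<Omega>\<close> is \<open>G - \<nabla>\<phi>\<^sub>k\<close> by uniqueness, so the \<open>H\<^sup>1\<close> norm over \<open>\<Omega>\<close> is bounded by
  the norms over the whole space.\<close>

lemma approx_imp_X12:
  assumes "open \<Omega>" and a: "approx \<Omega> u G \<phi>"
  shows "u \<in> X12 \<Omega>"
proof -
  have \<Omega>: "\<Omega> \<in> sets lebesgue" using assms(1) by (simp add: borel_open)
  have H1U: "u \<in> H1 UNIV"
    unfolding H1_def using L2_imp_Lp2[OF approxD(4)[OF a]] L2_imp_Lp2[OF approxD(5)[OF a]] approx_weak_gradient[OF a] by auto
  have H1: "u \<in> H1 \<Omega>"
    unfolding H1_def using L2_imp_Lp2[OF approxD(4)[OF a] \<Omega>] L2_imp_Lp2[OF approxD(5)[OF a] \<Omega>]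
      weak_gradient_subset[OF approx_weak_gradient[OF a], of \<Omega>] by auto
  have "(H1_norm \<Omega> (\<lambda>x. u x - \<phi> k x))\<^sup>2
      \<le> sqn lebesgue (\<lambda>x. \<phi> k x - u x) + sqn lebesgue (\<lambda>x. grad (\<phi> k) x - G x)" for k
  proof -
    let ?w = "\<lambda>x. u x - \<phi> k x" and ?g = "\<lambda>x. G x - grad (\<phi> k) x"
    have b: "approx \<Omega> ?w ?g (\<lambda>j x. \<phi> j x - \<phi> k x)"
      using approx_diff[OF a test_approx[OF approxD(1)[OF a]]] .
    have wg: "weak_gradient \<Omega> ?w ?g" using weak_gradient_subset[OF approx_weak_gradient[OF b]] by simp
    have "AE x in lebesgue. x \<in> \<Omega> \<longrightarrow> wgrad \<Omega> ?w x = ?g x"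
      by (rule weak_gradient_unique[OF assms(1) weak_gradient_wgrad[OF wg] wg])
    then have "(LINT x:\<Omega>|lebesgue. (norm (wgrad \<Omega> ?w x))\<^sup>2) = (LINT x:\<Omega>|lebesgue. (norm (?g x))\<^sup>2)"
      by (rule set_integral_norm_cong[OF _ \<Omega> L2_measurable[OF approxD(5)[OF b]]])
    then show ?thesis
      using set_integral_norm_le_sqn[OF approxD(4)[OF b] \<Omega>] set_integral_norm_le_sqn[OF approxD(5)[OF b] \<Omega>]
      unfolding H1_norm_sq by (simp add: sqn_diff_commute[of _ u] sqn_diff_commute[of _ G])
  qed
  then have B: "H1_norm \<Omega> (\<lambda>x. u x - \<phi> k x)
      \<le> sqrt (sqn lebesgue (\<lambda>x. \<phi> k x - u x) + sqn lebesgue (\<lambda>x. grad (\<phi> k) x - G x))" for k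
    by (rule real_le_rsqrt)
  have C: "(\<lambda>k. sqrt (sqn lebesgue (\<lambda>x. \<phi> k x - u x) + sqn lebesgue (\<lambda>x. grad (\<phi> k) x - G x))) \<longlonglongrightarrow> sqrt (0 + 0)"
    by (intro tendsto_real_sqrt tendsto_add L2convD(3) approxD(2,3)[OF a])
  have lim: "(\<lambda>k. H1_norm \<Omega> (\<lambda>x. u x - \<phi> k x)) \<longlonglongrightarrow> 0"
  proof (rule tendsto_sandwich[OF _ _ tendsto_const])
    show "\<forall>\<^sub>F k in sequentially. 0 \<le> H1_norm \<Omega> (\<lambda>x. u x - \<phi> k x)"
      by (simp add: H1_norm_def)
    show "\<forall>\<^sub>F k in sequentially. H1_norm \<Omega> (\<lambda>x. u x - \<phi> k x)
      \<le> sqrt (sqn lebesgue (\<lambda>x. \<phi> k x - u x) + sqn lebesgue (\<lambda>x. grad (\<phi> k) x - G x))"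
      using B by (rule always_eventually[OF allI])
    show "(\<lambda>k. sqrt (sqn lebesgue (\<lambda>x. \<phi> k x - u x) + sqn lebesgue (\<lambda>x. grad (\<phi> k) x - G x))) \<longlonglongrightarrow> 0"
      using C by simp
  qed
  have "u \<in> H10 \<Omega>"
    unfolding H10_def by (intro CollectI conjI exI[of _ \<phi>] allI H1 approxD(1)[OF a] lim)
  with H1U approx_AE_outside(1)[OF a] show ?thesis by (simp add: X12_def)
qed

text \<open>The sequence given by membership in \<open>H10 \<Omega>\<close> converges in \<open>\<Omega>\<close> only.  Since \<open>u\<close> and the test functions
  vanish outside \<open>\<Omega>\<close>, it converges on the whole space, and its gradients converge to the weak
  gradient cut off outside \<open>\<Omega>\<close>.  By uniqueness the weak gradient already vanishes there.\<close>

lemma X12_imp_approx: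
  assumes "open \<Omega>" and u: "u \<in> X12 \<Omega>"
  obtains \<phi> where "approx \<Omega> u (wgrad UNIV u) \<phi>"
proof -
  have \<Omega>: "\<Omega> \<in> sets lebesgue" using assms(1) by (simp add: borel_open)
  obtain g where g: "g \<in> Lp 2 UNIV" "weak_gradient UNIV u g" and uL: "u \<in> Lp 2 UNIV"
    using u by (auto simp: X12_def H1_def)
  have out: "AE x in lebesgue. x \<notin> \<Omega> \<longrightarrow> u x = 0" using u by (simp add: X12_def)
  obtain \<phi> where \<phi>: "\<And>k. \<phi> k \<in> test_functions \<Omega>" and lim: "(\<lambda>k::nat. H1_norm \<Omega> (\<lambda>x. u x - \<phi> k x)) \<longlonglongrightarrow> 0"
    using u by (auto simp: X12_def H10_def)
  have uL2: "u \<in> L2 lebesgue" and gL2: "g \<in> L2 lebesgue"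
    using uL g(1) by (auto intro: Lp2_UNIV_imp_L2)
  \<comment> \<open>The boundary of \<open>\<Omega>\<close> may have positive measure, so that \<open>g = 0\<close> outside \<open>\<Omega>\<close> is not evident.\<close>
  define G where "G x = indicator \<Omega> x *\<^sub>R g x" for x
  have Gm: "G \<in> borel_measurable lebesgue"
    unfolding G_def using \<Omega> L2_measurable[OF gL2] by (intro borel_measurable_scaleR borel_measurable_indicator)
  have "integrable lebesgue (\<lambda>x. indicator \<Omega> x *\<^sub>R (norm (g x))\<^sup>2)"
    by (rule integrable_mult_indicator[OF \<Omega> L2_integrable[OF gL2]])
  moreover have "indicator \<Omega> x *\<^sub>R (norm (g x))\<^sup>2 = (norm (G x))\<^sup>2" for x by (simp add: G_def indicator_def)
  ultimately have GL2: "G \<in> L2 lebesgue" using Gm by (simp add: L2_def)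
  have le: "sqn lebesgue (\<lambda>x. \<phi> k x - u x) + sqn lebesgue (\<lambda>x. grad (\<phi> k) x - G x)
      = (H1_norm \<Omega> (\<lambda>x. u x - \<phi> k x))\<^sup>2" for k
  proof -
    let ?w = "\<lambda>x. u x - \<phi> k x" and ?g = "\<lambda>x. g x - grad (\<phi> k) x"
    have wg: "weak_gradient \<Omega> ?w ?g"
      using weak_gradient_subset[OF weak_gradient_diff[OF g(2) approx_weak_gradient[OF test_approx[OF \<phi>]]]] by simp
    have wm: "?w \<in> borel_measurable lebesgue" "?g \<in> borel_measurable lebesgue"
      using L2_measurable[OF uL2] L2_measurable[OF gL2] test_measurable[OF \<phi>] by auto
    have "AE x in lebesgue. x \<in> \<Omega> \<longrightarrow> wgrad \<Omega> ?w x = ?g x"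
      by (rule weak_gradient_unique[OF assms(1) weak_gradient_wgrad[OF wg] wg])
    then have 1: "(LINT x:\<Omega>|lebesgue. (norm (wgrad \<Omega> ?w x))\<^sup>2) = (LINT x:\<Omega>|lebesgue. (norm (?g x))\<^sup>2)"
      by (rule set_integral_norm_cong[OF _ \<Omega> wm(2)])
    have 2: "(LINT x:\<Omega>|lebesgue. (norm (?g x))\<^sup>2) = sqn lebesgue (\<lambda>x. grad (\<phi> k) x - G x)"
      unfolding set_lebesgue_integral_def sqn_def G_def using test_grad_support[OF \<phi>]
      by (intro Bochner_Integration.integral_cong) (auto simp: indicator_def norm_minus_commute)
    have 3: "(LINT x:\<Omega>|lebesgue. (norm (?w x))\<^sup>2) = sqn lebesgue (\<lambda>x. \<phi> k x - u x)"
      unfolding set_lebesgue_integral_def sqn_def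
    proof (rule integral_cong_AE)
      show "AE x in lebesgue. indicat_real \<Omega> x *\<^sub>R (norm (u x - \<phi> k x))\<^sup>2 = (norm (\<phi> k x - u x))\<^sup>2"
        using out by eventually_elim (use test_support[OF \<phi>] in \<open>auto simp: indicator_def power2_commute\<close>)
      show "(\<lambda>x. indicat_real \<Omega> x *\<^sub>R (norm (u x - \<phi> k x))\<^sup>2) \<in> borel_measurable lebesgue"
        using \<Omega> wm(1) by (intro borel_measurable_scaleR borel_measurable_indicator) auto
      show "(\<lambda>x. (norm (\<phi> k x - u x))\<^sup>2) \<in> borel_measurable lebesgue"
        using L2_measurable[OF uL2] test_measurable(1)[OF \<phi>] by auto
    qed
    show ?thesis unfolding H1_norm_sq 1 2 3 by simp
  qed
  have lim2: "(\<lambda>k. (H1_norm \<Omega> (\<lambda>x. u x - \<phi> k x))\<^sup>2) \<longlonglongrightarrow> 0"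
    using tendsto_power[OF lim, of 2] by simp
  have "(\<lambda>k. sqn lebesgue (\<lambda>x. \<phi> k x - u x)) \<longlonglongrightarrow> 0"
    by (rule tendsto_sandwich[OF _ _ tendsto_const lim2]) (auto simp: le[symmetric] sqn_nonneg)
  moreover have "(\<lambda>k. sqn lebesgue (\<lambda>x. grad (\<phi> k) x - G x)) \<longlonglongrightarrow> 0"
    by (rule tendsto_sandwich[OF _ _ tendsto_const lim2]) (auto simp: le[symmetric] sqn_nonneg)
  ultimately have a: "approx \<Omega> u G \<phi>"
    using \<phi> uL2 GL2 test_L2[OF \<phi>] by (simp add: approx_def L2conv_def)
  have ae: "AE x in lebesgue. wgrad UNIV u x = G x" by (rule approx_wgrad[OF a])
  \<comment> \<open>Measurability of the chosen gradient comes from its local integrability.\<close>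
  have wm: "wgrad UNIV u \<in> borel_measurable lebesgue"
  proof (rule borel_measurable_LIMSEQ_metric)
    have "locally_integrable UNIV (wgrad UNIV u)"
      using weak_gradient_wgrad[OF g(2)] by (simp add: weak_gradient_def)
    then show "(\<lambda>x. indicator (cball 0 (real k)) x *\<^sub>R wgrad UNIV u x) \<in> borel_measurable lebesgue" for k
      by (intro borel_measurable_integrable) (simp add: locally_integrable_def set_integrable_def)
    show "(\<lambda>k. indicator (cball 0 (real k)) x *\<^sub>R wgrad UNIV u x) \<longlonglongrightarrow> wgrad UNIV u x" for x
    proof (rule tendsto_eventually)
      obtain N where "norm x \<le> real N" using real_arch_simple by blast
      then show "\<forall>\<^sub>F k in sequentially. indicator (cball 0 (real k)) x *\<^sub>R wgrad UNIV u x = wgrad UNIV u x"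
        by (auto simp: eventually_sequentially indicator_def intro!: exI[of _ N])
    qed
  qed
  have wL: "wgrad UNIV u \<in> L2 lebesgue"
  proof -
    have "integrable lebesgue (\<lambda>x. (norm (wgrad UNIV u x))\<^sup>2)"
      using L2_integrable[OF GL2] ae wm Gm
      by (subst integrable_cong_AE[where g = "\<lambda>x. (norm (G x))\<^sup>2"]) (auto elim: eventually_mono)
    with wm show ?thesis by (simp add: L2_def)
  qed
  have "sqn lebesgue (\<lambda>x. grad (\<phi> k) x - wgrad UNIV u x) = sqn lebesgue (\<lambda>x. grad (\<phi> k) x - G x)" for k
    unfolding sqn_def using ae wm Gm test_measurable(2)[OF \<phi>]
    by (intro integral_cong_AE) (auto elim: eventually_mono)
  then have "approx \<Omega> u (wgrad UNIV u) \<phi>"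
    using a wL by (simp add: approx_def L2conv_def)
  then show ?thesis by (rule that)
qed

section \<open>The fractional energy\<close>

subsection \<open>Difference quotients in the mean\<close>

text \<open>The fundamental theorem of calculus on the segment from \<open>x\<close> to \<open>x + h\<close>; the square of a mean is at
  most the mean of the squares.\<close>

lemma increment_sq_le:
  fixes v :: "'a::euclidean_space \<Rightarrow> real"
  assumes d: "\<And>x. (v has_derivative (\<lambda>k. g x \<bullet> k)) (at x)" and g: "continuous_on UNIV g"
  shows "ennreal ((v (x + h) - v x)\<^sup>2)
    \<le> (\<integral>\<^sup>+t. ennreal ((g (x + t *\<^sub>R h) \<bullet> h)\<^sup>2) * indicator {0..1} t \<partial>lborel)"
proof -
  define f where "f t = g (x + t *\<^sub>R h) \<bullet> h" for t :: real
  define c where "c = v (x + h) - v x"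
  have cf: "continuous_on UNIV f"
    unfolding f_def by (intro continuous_intros continuous_on_compose2[OF g]) auto
  have isf: "isCont f t" for t using cf by (simp add: continuous_on_eq_continuous_at)
  have "((\<lambda>t. v (x + t *\<^sub>R h)) has_derivative (\<lambda>r. g (x + t *\<^sub>R h) \<bullet> (r *\<^sub>R h))) (at t)" for t
    by (rule has_derivative_compose[OF _ d]) (auto intro!: derivative_eq_intros)
  then have "((\<lambda>t. v (x + t *\<^sub>R h)) has_real_derivative f t) (at t)" for t
    by (simp add: has_field_derivative_def f_def mult_commute_abs)
  then have "has_bochner_integral lborel (\<lambda>t. f t * indicator {0..1} t) (v (x + 1 *\<^sub>R h) - v (x + 0 *\<^sub>R h))"
    by (intro has_bochner_integral_FTC_Icc_real isf) auto
  then have i1: "has_bochner_integral lborel (\<lambda>t. f t * indicator {0..1} t) c" by (simp add: c_def)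
  have i2: "integrable lborel (\<lambda>t. (f t)\<^sup>2 * indicator {0..1} t)"
    by (intro borel_integrable_atLeastAtMost) (auto intro!: continuous_intros isf)
  have i3: "has_bochner_integral lborel (indicator {0..1} :: real \<Rightarrow> real) 1"
    using has_bochner_integral_real_indicator[of "{0..1::real}" lborel] by simp
  have "0 \<le> (\<integral>t. ((f t - c)\<^sup>2) * indicator {0..1} t \<partial>lborel)" by (intro integral_nonneg_AE) auto
  also have "(\<lambda>t. ((f t - c)\<^sup>2) * indicator {0..1} t) = (\<lambda>t. (f t)\<^sup>2 * indicator {0..1} t
      - 2 * c * (f t * indicator {0..1} t) + c\<^sup>2 * indicator {0..1} t)"
    by (auto simp: fun_eq_iff power2_eq_square algebra_simps)
  also have "(\<integral>t. \<dots> t \<partial>lborel) = (\<integral>t. (f t)\<^sup>2 * indicator {0..1} t \<partial>lborel) - 2 * c * c + c\<^sup>2 * 1"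
    using i1 i2 i3 by (simp add: has_bochner_integral_iff)
  finally have "c\<^sup>2 \<le> (\<integral>t. (f t)\<^sup>2 * indicator {0..1} t \<partial>lborel)" by (simp add: power2_eq_square)
  then have "ennreal (c\<^sup>2) \<le> ennreal (\<integral>t. (f t)\<^sup>2 * indicator {0..1} t \<partial>lborel)" by (rule ennreal_leI)
  also have "\<dots> = (\<integral>\<^sup>+t. ennreal ((f t)\<^sup>2 * indicator {0..1} t) \<partial>lborel)"
    by (rule nn_integral_eq_integral[OF i2, symmetric]) auto
  also have "\<dots> = (\<integral>\<^sup>+t. ennreal ((f t)\<^sup>2) * indicator {0..1} t \<partial>lborel)"
    by (intro nn_integral_cong) (auto simp: indicator_def)
  finally show ?thesis by (simp add: c_def f_def)
qed

text \<open>Integration of the preceding bound over \<open>x\<close>; every translate of \<open>g\<close> has the same norm.\<close>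

lemma translation_estimate:
  fixes v :: "'a::euclidean_space \<Rightarrow> real"
  assumes d: "\<And>x. (v has_derivative (\<lambda>k. g x \<bullet> k)) (at x)" and g: "continuous_on UNIV g"
  shows "(\<integral>\<^sup>+x. ennreal ((v (x + h) - v x)\<^sup>2) \<partial>lborel)
    \<le> ennreal ((norm h)\<^sup>2) * (\<integral>\<^sup>+x. ennreal ((norm (g x))\<^sup>2) \<partial>lborel)"
proof -
  have [measurable]: "g \<in> borel_measurable borel" by (rule borel_measurable_continuous_onI[OF g])
  let ?D = "\<integral>\<^sup>+x. ennreal ((norm (g x))\<^sup>2) \<partial>lborel"
  have "(\<integral>\<^sup>+x. ennreal ((v (x + h) - v x)\<^sup>2) \<partial>lborel)
     \<le> (\<integral>\<^sup>+x. \<integral>\<^sup>+t. ennreal ((g (x + t *\<^sub>R h) \<bullet> h)\<^sup>2) * indicator {0..1} t \<partial>lborel \<partial>lborel)"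
    by (intro nn_integral_mono increment_sq_le[OF d g])
  also have "\<dots> = (\<integral>\<^sup>+t. \<integral>\<^sup>+x. ennreal ((g (x + t *\<^sub>R h) \<bullet> h)\<^sup>2) * indicator {0..1} t \<partial>lborel \<partial>lborel)"
    by (rule lborel_pair.Fubini'[symmetric]) measurable
  also have "\<dots> \<le> (\<integral>\<^sup>+t. (ennreal ((norm h)\<^sup>2) * ?D) * indicator {0..1::real} t \<partial>lborel)"
  proof (rule nn_integral_mono)
    fix t :: real
    have "(\<integral>\<^sup>+x. ennreal ((g (x + t *\<^sub>R h) \<bullet> h)\<^sup>2) * indicator {0..1} t \<partial>lborel)
       \<le> (\<integral>\<^sup>+x. (ennreal ((norm h)\<^sup>2) * indicator {0..1} t) * ennreal ((norm (g (x + t *\<^sub>R h)))\<^sup>2) \<partial>lborel)"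
    proof (rule nn_integral_mono)
      fix x
      have "(g (x + t *\<^sub>R h) \<bullet> h)\<^sup>2 \<le> (norm (g (x + t *\<^sub>R h)) * norm h)\<^sup>2"
        using Cauchy_Schwarz_ineq2[of "g (x + t *\<^sub>R h)" h] power_mono[of "\<bar>g (x + t *\<^sub>R h) \<bullet> h\<bar>" _ 2] by simp
      then have "ennreal ((g (x + t *\<^sub>R h) \<bullet> h)\<^sup>2) \<le> ennreal ((norm h)\<^sup>2 * (norm (g (x + t *\<^sub>R h)))\<^sup>2)"
        by (intro ennreal_leI) (simp add: power_mult_distrib mult.commute)
      then show "ennreal ((g (x + t *\<^sub>R h) \<bullet> h)\<^sup>2) * indicator {0..1} t
        \<le> (ennreal ((norm h)\<^sup>2) * indicator {0..1} t) * ennreal ((norm (g (x + t *\<^sub>R h)))\<^sup>2)"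
        by (simp add: ennreal_mult indicator_def)
    qed
    also have "\<dots> = (ennreal ((norm h)\<^sup>2) * indicator {0..1} t) * (\<integral>\<^sup>+x. ennreal ((norm (g (x + t *\<^sub>R h)))\<^sup>2) \<partial>lborel)"
      by (rule nn_integral_cmult) measurable
    also have "(\<integral>\<^sup>+x. ennreal ((norm (g (x + t *\<^sub>R h)))\<^sup>2) \<partial>lborel) = ?D"
      by (rule nn_integral_lborel_translation[of "\<lambda>x. ennreal ((norm (g x))\<^sup>2)"]) measurable
    finally show "(\<integral>\<^sup>+x. ennreal ((g (x + t *\<^sub>R h) \<bullet> h)\<^sup>2) * indicator {0..1} t \<partial>lborel)
       \<le> (ennreal ((norm h)\<^sup>2) * ?D) * indicator {0..1} t" by (simp add: mult_ac)
  qed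
  also have "\<dots> = ennreal ((norm h)\<^sup>2) * ?D"
    by (simp add: nn_integral_cmult_indicator)
  finally show ?thesis .
qed

subsection \<open>Integrability of the kernel\<close>

text \<open>Comparison of a singular or slowly decaying function with a geometric series: in the applications
  \<open>B k\<close> is a ball containing the \<open>k\<close>-th dyadic shell, and \<open>a k\<close> bounds the function on this shell.\<close>

lemma nn_integral_le_shells:
  fixes a :: "nat \<Rightarrow> real"
  assumes [measurable]: "\<And>k. B k \<in> sets M" and pos: "\<And>k. 0 \<le> a k"
    and cover: "\<And>x. x \<in> space M \<Longrightarrow> f x = 0 \<or> (\<exists>k. x \<in> B k \<and> f x \<le> ennreal (a k))"
    and meas: "\<And>k. ennreal (a k) * emeasure M (B k) \<le> ennreal (c * q ^ k)"
    and q: "0 \<le> c" "0 \<le> q" "q < 1"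
  shows "(\<integral>\<^sup>+x. f x \<partial>M) < \<infinity>"
proof -
  have "(\<integral>\<^sup>+x. f x \<partial>M) \<le> (\<integral>\<^sup>+x. (\<Sum>k. ennreal (a k) * indicator (B k) x) \<partial>M)"
  proof (rule nn_integral_mono)
    fix x assume "x \<in> space M"
    from cover[OF this] show "f x \<le> (\<Sum>k. ennreal (a k) * indicator (B k) x)"
    proof
      assume "\<exists>k. x \<in> B k \<and> f x \<le> ennreal (a k)"
      then obtain k where k: "x \<in> B k" "f x \<le> ennreal (a k)" by blast
      define S where "S k = ennreal (a k) * indicator (B k) x" for k
      have "S k \<le> (\<Sum>k. S k)" using sum_le_suminf[of S "{k}"] by simp
      moreover have "f x \<le> S k" using k by (simp add: S_def)
      ultimately show ?thesis unfolding S_def by (rule order_trans[rotated])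
    qed simp
  qed
  also have "\<dots> = (\<Sum>k. ennreal (a k) * emeasure M (B k))"
    by (subst nn_integral_suminf) (auto simp: nn_integral_cmult_indicator)
  also have "\<dots> \<le> (\<Sum>k. ennreal (c * q ^ k))"
    by (intro suminf_le meas) auto
  also have "\<dots> < \<infinity>"
    using q by (subst suminf_ennreal2) (auto intro!: summable_mult summable_geometric)
  finally show ?thesis .
qed

lemma kernel_near:
  fixes \<beta> :: real
  assumes "0 \<le> \<beta>" "\<beta> < real DIM('a)"
  shows "(\<integral>\<^sup>+h. ennreal (norm h powr (-\<beta>)) * indicator (cball 0 1) h \<partial>(lborel :: 'a::euclidean_space measure)) < \<infinity>"
proof (rule nn_integral_le_shells)
  let ?n = "real DIM('a)"
  define a where "a k = 2 powr ((real k + 1) * \<beta>)" for k :: nat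
  define B where "B k = cball (0::'a) (2 powr (- real k))" for k :: nat
  show "B k \<in> sets lborel" "0 \<le> a k" for k by (auto simp: B_def a_def)
  let ?f = "\<lambda>h::'a. ennreal (norm h powr (-\<beta>)) * indicator (cball 0 1) h"
  show "?f h = 0 \<or> (\<exists>k. h \<in> B k \<and> ?f h \<le> ennreal (a k))" for h
  proof (cases "h = 0 \<or> h \<notin> cball 0 1")
    case False
    define L where "L = - log 2 (norm h)"
    have nh: "norm h = 2 powr (-L)" using False by (simp add: L_def)
    have L0: "L \<ge> 0" using False by (simp add: L_def log_le_zero_cancel_iff)
    define k where "k = nat \<lfloor>L\<rfloor>"
    have k: "real k \<le> L" "L < real k + 1" using L0 by (auto simp: k_def)
    have "h \<in> B k" using k by (simp add: B_def nh)
    moreover have "norm h powr (-\<beta>) \<le> a k"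
      using k(2) assms(1) by (simp add: nh a_def powr_powr mult_right_mono)
    ultimately show ?thesis using False by (auto intro!: exI[of _ k] ennreal_leI)
  qed auto
  let ?c = "unit_ball_vol ?n * 2 powr \<beta>" and ?q = "2 powr (\<beta> - ?n)"
  show "ennreal (a k) * emeasure lborel (B k) \<le> ennreal (?c * ?q ^ k)" for k
  proof -
    have "2 powr ((real k + 1) * \<beta>) * 2 powr (?n * - real k) = 2 powr \<beta> * 2 powr (real k * (\<beta> - ?n))"
      unfolding powr_add[symmetric] by (simp add: algebra_simps)
    then have eq: "a k * (unit_ball_vol ?n * (2 powr (- real k)) ^ DIM('a)) = ?c * ?q ^ k"
      by (simp add: a_def powr_power)
    have "ennreal (a k) * emeasure lborel (B k) = ennreal (a k * (unit_ball_vol ?n * (2 powr (- real k)) ^ DIM('a)))"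
      by (simp add: B_def emeasure_cball ennreal_mult a_def)
    then show ?thesis unfolding eq by simp
  qed
  show "0 \<le> ?c" "0 \<le> ?q" by auto
  show "?q < 1" using assms(2) by (simp add: powr_less_one)
qed

lemma kernel_far:
  fixes \<beta> :: real
  assumes "\<beta> > real DIM('a)"
  shows "(\<integral>\<^sup>+h. ennreal (norm h powr (-\<beta>)) * indicator (- cball 0 1) h \<partial>(lborel :: 'a::euclidean_space measure)) < \<infinity>"
proof (rule nn_integral_le_shells)
  let ?n = "real DIM('a)"
  define a where "a k = 2 powr (- real k * \<beta>)" for k :: nat
  define B where "B k = cball (0::'a) (2 powr (real k + 1))" for k :: nat
  show "B k \<in> sets lborel" "0 \<le> a k" for k by (auto simp: B_def a_def)
  let ?f = "\<lambda>h::'a. ennreal (norm h powr (-\<beta>)) * indicator (- cball 0 1) h"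
  show "?f h = 0 \<or> (\<exists>k. h \<in> B k \<and> ?f h \<le> ennreal (a k))" for h
  proof (cases "h \<in> cball 0 1")
    case False
    then have h1: "norm h > 1" by simp
    define L where "L = log 2 (norm h)"
    have nh: "norm h = 2 powr L" unfolding L_def using h1 by (intro powr_log_cancel[symmetric]) auto
    have "norm h > 0" using h1 by linarith
    then have L0: "L \<ge> 0" unfolding L_def using h1 by (subst zero_le_log_cancel_iff) linarith+
    define k where "k = nat \<lfloor>L\<rfloor>"
    have k: "real k \<le> L" "L < real k + 1" using L0 by (auto simp: k_def)
    have "h \<in> B k" using k by (simp add: B_def nh)
    moreover have "norm h powr (-\<beta>) \<le> a k"
      using k(1) assms by (simp add: nh a_def powr_powr mult_right_mono)
    ultimately show ?thesis using False by (auto intro!: exI[of _ k] ennreal_leI)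
  qed auto
  let ?c = "unit_ball_vol ?n * 2 powr ?n" and ?q = "2 powr (?n - \<beta>)"
  show "ennreal (a k) * emeasure lborel (B k) \<le> ennreal (?c * ?q ^ k)" for k
  proof -
    have "2 powr (- real k * \<beta>) * 2 powr (?n * (real k + 1)) = 2 powr ?n * 2 powr (real k * (?n - \<beta>))"
      unfolding powr_add[symmetric] by (simp add: algebra_simps)
    then have eq: "a k * (unit_ball_vol ?n * (2 powr (real k + 1)) ^ DIM('a)) = ?c * ?q ^ k"
      by (simp add: a_def powr_power)
    have "ennreal (a k) * emeasure lborel (B k) = ennreal (a k * (unit_ball_vol ?n * (2 powr (real k + 1)) ^ DIM('a)))"
      by (simp add: B_def emeasure_cball ennreal_mult a_def)
    then show ?thesis unfolding eq by simp
  qed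
  show "0 \<le> ?c" "0 \<le> ?q" by auto
  show "?q < 1" using assms by (simp add: powr_less_one)
qed

subsection \<open>The nonlocal difference operator\<close>

text \<open>The square root of the Gagliardo density.  With it the fractional energy is a squared \<open>L\<^sup>2\<close> norm on
  \<open>\<real>\<^sup>n \<times> \<real>\<^sup>n\<close> and its bilinear form an inner product, so that the general facts on square-integrable
  functions apply to it in the same way as to the gradient.\<close>

definition nl :: "real \<Rightarrow> (real ^ 'n \<Rightarrow> real) \<Rightarrow> (real ^ 'n) \<times> (real ^ 'n) \<Rightarrow> real" where
  "nl s u = (\<lambda>(x, y). (u x - u y) / norm (x - y) powr ((real CARD('n) + 2 * s) / 2))"

lemma powr_half_mult_self: "r powr (a / 2) * r powr (a / 2) = r powr a" for r a :: real
  by (simp flip: powr_add)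

lemma nl_mult: "nl s u (x, y) * nl s v (x, y) = (u x - u y) * (v x - v y) / norm (x - y) powr (real CARD('n) + 2 * s)"
  for u v :: "real ^ 'n \<Rightarrow> real"
  by (simp add: nl_def powr_half_mult_self)

lemma nl_sq: "(nl s u (x, y))\<^sup>2 = (u x - u y)\<^sup>2 / norm (x - y) powr (real CARD('n) + 2 * s)"
  for u :: "real ^ 'n \<Rightarrow> real"
  using nl_mult[of s u x y u] by (simp add: power2_eq_square)

lemma gagliardo_nl: "gagliardo_sq s u = (\<integral>\<^sup>+z. ennreal ((norm (nl s u z))\<^sup>2) \<partial>lebesgue)"
  unfolding gagliardo_sq_def by (intro nn_integral_cong) (auto simp: nl_sq split: prod.splits)

lemma nl_ip: "(LINT (x, y)|lebesgue. (u x - u y) * (v x - v y) / norm (x - y) powr (real CARD('n) + 2 * s))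
   = ip lebesgue (nl s u) (nl s v)" for u v :: "real ^ 'n \<Rightarrow> real"
  unfolding ip_def by (intro Bochner_Integration.integral_cong) (auto simp: nl_mult split: prod.splits)

lemma nl_add_scaled: "nl s (\<lambda>x. u x + t * v x) = (\<lambda>z. nl s u z + t *\<^sub>R nl s v z)"
  by (auto simp: nl_def fun_eq_iff add_divide_distrib[symmetric] algebra_simps)

lemma nl_diff: "nl s (\<lambda>x. u x - v x) = (\<lambda>z. nl s u z - nl s v z)"
  using nl_add_scaled[of s u "-1" v] by simp

lemma nl_scale: "nl s (\<lambda>x. t * u x) = (\<lambda>z. t * nl s u z)"
  by (auto simp: nl_def fun_eq_iff right_diff_distrib[symmetric])

lemma nl_borel:
  assumes [measurable]: "u \<in> borel_measurable borel"
  shows "nl s u \<in> borel_measurable borel"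
proof -
  have "nl s u \<in> borel_measurable (borel \<Otimes>\<^sub>M borel)"
    unfolding nl_def by measurable
  then show ?thesis by (simp add: borel_prod)
qed

text \<open>Sections of Lebesgue measurable functions of two variables need not be measurable; Fubini arguments
  therefore use Borel representatives.\<close>

lemma borel_representative:
  fixes u :: "'a::euclidean_space \<Rightarrow> real"
  assumes "u \<in> borel_measurable lebesgue"
  obtains v where "v \<in> borel_measurable borel" "AE x in lebesgue. u x = v x"
  using completion_ex_borel_measurable_real[OF assms] AE_completion by fastforce

lemma AE_product:
  fixes P :: "'a::euclidean_space \<Rightarrow> bool" and Q :: "'b::euclidean_space \<Rightarrow> bool"
  assumes "AE x in lebesgue. P x" "AE y in lebesgue. Q y"
  shows "AE z in lebesgue. P (fst z) \<and> Q (snd z)"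
proof -
  have "AE x in lborel. P x" "AE x in lborel. Q x" using assms by (simp_all only: AE_completion_iff)
  then obtain N N' where N: "{x. \<not> P x} \<subseteq> N" "N \<in> null_sets lborel"
    and N': "{x. \<not> Q x} \<subseteq> N'" "N' \<in> null_sets lborel"
    by (auto simp: eventually_ae_filter)
  have s[measurable]: "N \<in> sets borel" "N' \<in> sets borel" using N N' by auto
  have "emeasure (lborel \<Otimes>\<^sub>M lborel) (N \<times> (UNIV :: 'b set)) = 0"
    using N(2) s by (subst lborel.emeasure_pair_measure_Times) auto
  moreover have "emeasure (lborel \<Otimes>\<^sub>M lborel) ((UNIV :: 'a set) \<times> N') = 0"
    using N'(2) s by (subst lborel.emeasure_pair_measure_Times) auto
  ultimately have "N \<times> (UNIV :: 'b set) \<union> (UNIV :: 'a set) \<times> N' \<in> null_sets (lborel \<Otimes>\<^sub>M lborel)"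
    by (intro null_sets.Un null_setsI) auto
  then have "AE z in lborel. P (fst z) \<and> Q (snd z)"
    unfolding lborel_prod using N(1) N'(1) by (intro AE_I'[where N = "N \<times> (UNIV :: 'b set) \<union> (UNIV :: 'a set) \<times> N'"]) auto
  then show ?thesis by (rule AE_completion)
qed

lemma nl_AE_cong:
  assumes "AE x in lebesgue. u x = v x"
  shows "AE z in lebesgue. nl s u z = nl s v z"
  using AE_product[OF assms assms] by eventually_elim (auto simp: nl_def split: prod.splits)

lemma nl_measurable:
  assumes "u \<in> borel_measurable lebesgue"
  shows "nl s u \<in> borel_measurable lebesgue"
proof -
  obtain v where v: "v \<in> borel_measurable borel" "AE x in lebesgue. u x = v x"
    using borel_representative[OF assms] .
  have "AE z in lebesgue. nl s v z = nl s u z"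
    using nl_AE_cong[OF v(2), of s] by eventually_elim simp
  then show ?thesis
    by (rule borel_measurable_AE[OF borel_lebesgue[OF nl_borel[OF v(1)]]])
qed

subsection \<open>The fractional energy is controlled by the Sobolev norm\<close>

text \<open>After the substitution \<open>y = x + h\<close> the integral over \<open>x\<close> is at most \<open>|h|\<^sup>2\<parallel>\<nabla>\<phi>\<parallel>\<^sup>2\<close>, which is used for
  \<open>|h| \<le> 1\<close>, and at most \<open>4\<parallel>\<phi>\<parallel>\<^sup>2\<close>, which is used for \<open>|h| > 1\<close>.  The remaining kernels
  \<open>|h|\<^sup>2\<^sup>-\<^sup>n\<^sup>-\<^sup>2\<^sup>s\<close> near the origin and \<open>|h|\<^sup>-\<^sup>n\<^sup>-\<^sup>2\<^sup>s\<close> at infinity are integrable because \<open>0 < s < 1\<close>.\<close>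

lemma gagliardo_bound:
  assumes n: "CARD('n::finite) \<ge> 3" and s: "0 < s" "s < 1"
  obtains C where "C \<ge> 0"
    "\<And>\<Omega> \<phi>. \<phi> \<in> test_functions (\<Omega> :: (real ^ 'n) set)
       \<Longrightarrow> gagliardo_sq s \<phi> \<le> ennreal (C * (sqn lebesgue \<phi> + sqn lebesgue (grad \<phi>)))"
proof -
  let ?n = "real CARD('n)"
  let ?\<alpha> = "?n + 2 * s"
  define kA where "kA h = ennreal (norm h powr (-(?\<alpha> - 2))) * indicator (cball 0 1) h" for h :: "real ^ 'n"
  define kB where "kB h = ennreal (norm h powr (-?\<alpha>)) * indicator (- cball 0 1) h" for h :: "real ^ 'n"
  have [measurable]: "cball (0 :: real ^ 'n) 1 \<in> sets borel" by simp
  have [measurable]: "kA \<in> borel_measurable borel" unfolding kA_def[abs_def] by measurable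
  have [measurable]: "kB \<in> borel_measurable borel" unfolding kB_def[abs_def] by measurable
  have "(\<integral>\<^sup>+h. kA h \<partial>lborel) < \<infinity>" unfolding kA_def using n s by (intro kernel_near) auto
  then obtain a where a: "0 \<le> a" "(\<integral>\<^sup>+h. kA h \<partial>lborel) = ennreal a"
    by (cases "\<integral>\<^sup>+h. kA h \<partial>lborel") auto
  have "(\<integral>\<^sup>+h. kB h \<partial>lborel) < \<infinity>" unfolding kB_def using n s by (intro kernel_far) auto
  then obtain b where b: "0 \<le> b" "(\<integral>\<^sup>+h. kB h \<partial>lborel) = ennreal b"
    by (cases "\<integral>\<^sup>+h. kB h \<partial>lborel") auto
  define C where "C = a + 4 * b"
  show ?thesis
  proof
    show "C \<ge> 0" using a b by (simp add: C_def)
    fix \<Omega> \<phi> assume \<phi>: "\<phi> \<in> test_functions (\<Omega> :: (real ^ 'n) set)"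
    have m[measurable]: "\<phi> \<in> borel_measurable borel" by (rule test_borel[OF \<phi>])
    define N where "N = (\<integral>\<^sup>+x. ennreal ((\<phi> x)\<^sup>2) \<partial>lborel)"
    define D where "D = (\<integral>\<^sup>+x. ennreal ((norm (grad \<phi> x))\<^sup>2) \<partial>lborel)"
    have N: "N = ennreal (sqn lebesgue \<phi>)"
      using L2_nn[OF test_L2(1)[OF \<phi>]] by (simp add: N_def nn_integral_completion)
    have D: "D = ennreal (sqn lebesgue (grad \<phi>))"
      using L2_nn[OF test_L2(2)[OF \<phi>]] by (simp add: D_def nn_integral_completion)
    let ?F = "\<lambda>x y. ennreal ((\<phi> x - \<phi> y)\<^sup>2 / norm (x - y) powr ?\<alpha>)"
    have "gagliardo_sq s \<phi> = (\<integral>\<^sup>+z. ?F (fst z) (snd z) \<partial>(lborel \<Otimes>\<^sub>M lborel))"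
      unfolding gagliardo_sq_def lborel_prod by (simp add: nn_integral_completion split_beta')
    also have "\<dots> = (\<integral>\<^sup>+x. \<integral>\<^sup>+y. ?F x y \<partial>lborel \<partial>lborel)"
      by (subst lborel.nn_integral_fst[symmetric]) auto
    also have "\<dots> = (\<integral>\<^sup>+x. \<integral>\<^sup>+h. ?F x (h + x) \<partial>lborel \<partial>lborel)"
      by (intro nn_integral_cong nn_integral_lborel_translation[symmetric]) measurable
    also have "\<dots> = (\<integral>\<^sup>+h. \<integral>\<^sup>+x. ?F x (h + x) \<partial>lborel \<partial>lborel)"
      by (rule lborel_pair.Fubini'[symmetric]) measurable
    also have "\<dots> \<le> (\<integral>\<^sup>+h. D * kA h + (4 * N) * kB h \<partial>lborel)"
    proof (rule nn_integral_mono)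
      fix h :: "real ^ 'n"
      have "(\<integral>\<^sup>+x. ?F x (h + x) \<partial>lborel)
          = (\<integral>\<^sup>+x. ennreal (norm h powr (-?\<alpha>)) * ennreal ((\<phi> (x + h) - \<phi> x)\<^sup>2) \<partial>lborel)"
        unfolding powr_minus
        by (intro nn_integral_cong) (simp add: ennreal_mult[symmetric] divide_inverse power2_commute add.commute mult.commute)
      also have "\<dots> = ennreal (norm h powr (-?\<alpha>)) * (\<integral>\<^sup>+x. ennreal ((\<phi> (x + h) - \<phi> x)\<^sup>2) \<partial>lborel)"
        by (rule nn_integral_cmult) measurable
      finally have eq: "(\<integral>\<^sup>+x. ?F x (h + x) \<partial>lborel)
        = ennreal (norm h powr (-?\<alpha>)) * (\<integral>\<^sup>+x. ennreal ((\<phi> (x + h) - \<phi> x)\<^sup>2) \<partial>lborel)" .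
      show "(\<integral>\<^sup>+x. ?F x (h + x) \<partial>lborel) \<le> D * kA h + (4 * N) * kB h"
      proof (cases "h \<in> cball 0 1")
        case True
        have "(\<integral>\<^sup>+x. ?F x (h + x) \<partial>lborel) \<le> ennreal (norm h powr (-?\<alpha>)) * (ennreal ((norm h)\<^sup>2) * D)"
          unfolding eq D_def
          by (intro mult_left_mono translation_estimate smooth_has_derivative continuous_on_grad test_smooth[OF \<phi>]) auto
        also have "\<dots> = D * ennreal (norm h powr (-?\<alpha>) * (norm h)\<^sup>2)"
          by (simp add: ennreal_mult mult_ac)
        also have "norm h powr (-?\<alpha>) * (norm h)\<^sup>2 = norm h powr (-(?\<alpha> - 2))"
        proof -
          have "(norm h)\<^sup>2 = norm h powr 2" by simp
          then show ?thesis by (simp only: powr_add[symmetric]) (simp add: algebra_simps)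
        qed
        finally show ?thesis using True by (simp add: kA_def kB_def)
      next
        case False
        have "(\<integral>\<^sup>+x. ennreal ((\<phi> (x + h) - \<phi> x)\<^sup>2) \<partial>lborel)
           \<le> (\<integral>\<^sup>+x. 2 * ennreal ((\<phi> (x + h))\<^sup>2) + 2 * ennreal ((\<phi> x)\<^sup>2) \<partial>lborel)"
        proof (rule nn_integral_mono)
          fix x
          have "(\<phi> (x + h) - \<phi> x)\<^sup>2 \<le> 2 * (\<phi> (x + h))\<^sup>2 + 2 * (\<phi> x)\<^sup>2"
            using norm_add_sq_le[of "\<phi> (x + h)" "- \<phi> x"] by simp
          then have "ennreal ((\<phi> (x + h) - \<phi> x)\<^sup>2) \<le> ennreal (2 * (\<phi> (x + h))\<^sup>2 + 2 * (\<phi> x)\<^sup>2)" by (rule ennreal_leI)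
          then show "ennreal ((\<phi> (x + h) - \<phi> x)\<^sup>2) \<le> 2 * ennreal ((\<phi> (x + h))\<^sup>2) + 2 * ennreal ((\<phi> x)\<^sup>2)"
            by (simp add: ennreal_mult)
        qed
        also have "\<dots> = 2 * (\<integral>\<^sup>+x. ennreal ((\<phi> (x + h))\<^sup>2) \<partial>lborel) + 2 * N"
          unfolding N_def by (subst nn_integral_add) (auto simp: nn_integral_cmult)
        also have "(\<integral>\<^sup>+x. ennreal ((\<phi> (x + h))\<^sup>2) \<partial>lborel) = N"
          unfolding N_def by (rule nn_integral_lborel_translation[of "\<lambda>x. ennreal ((\<phi> x)\<^sup>2)"]) measurable
        also have "2 * N + 2 * N = 4 * N" unfolding distrib_right[symmetric] by simp
        finally have "(\<integral>\<^sup>+x. ?F x (h + x) \<partial>lborel) \<le> ennreal (norm h powr (-?\<alpha>)) * (4 * N)"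
          unfolding eq by (rule mult_left_mono) simp
        then show ?thesis using False by (simp add: kA_def kB_def mult_ac)
      qed
    qed
    also have "\<dots> = D * ennreal a + (4 * N) * ennreal b"
      by (simp add: nn_integral_add nn_integral_cmult a(2) b(2))
    also have "\<dots> = ennreal (sqn lebesgue (grad \<phi>) * a + (4 * sqn lebesgue \<phi>) * b)"
      unfolding N D using a(1) b(1) by (simp add: ennreal_mult sqn_nonneg)
    also have "\<dots> \<le> ennreal (C * (sqn lebesgue \<phi> + sqn lebesgue (grad \<phi>)))"
    proof (rule ennreal_leI)
      have "0 \<le> a * sqn lebesgue \<phi>" "0 \<le> b * sqn lebesgue (grad \<phi>)"
        using a(1) b(1) by (auto simp: sqn_nonneg)
      then show "sqn lebesgue (grad \<phi>) * a + (4 * sqn lebesgue \<phi>) * b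
         \<le> C * (sqn lebesgue \<phi> + sqn lebesgue (grad \<phi>))"
        unfolding C_def by (simp add: algebra_simps)
    qed
    finally show "gagliardo_sq s \<phi> \<le> ennreal (C * (sqn lebesgue \<phi> + sqn lebesgue (grad \<phi>)))" .
  qed
qed

lemma approx_nl_bound:
  assumes C: "0 \<le> C" "\<forall>\<phi>\<in>test_functions (\<Omega> :: (real ^ 'n) set).
       gagliardo_sq s \<phi> \<le> ennreal (C * (sqn lebesgue \<phi> + sqn lebesgue (grad \<phi>)))"
    and a: "approx \<Omega> u G \<phi>"
  shows "nl s u \<in> L2 lebesgue" "sqn lebesgue (nl s u) \<le> C * (sqn lebesgue u + sqn lebesgue G)"
proof -
  obtain r where r: "strict_mono r" "AE x in lebesgue. (\<lambda>k. \<phi> (r k) x) \<longlonglongrightarrow> u x"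
    by (rule L2conv_AE_subseq[OF approxD(2)[OF a]])
  have "(\<integral>\<^sup>+z. ennreal ((norm (nl s u z))\<^sup>2) \<partial>lebesgue) \<le> ennreal (C * (sqn lebesgue u + sqn lebesgue G))"
  proof (rule nn_integral_fatou_limit)
    show "(\<lambda>z. (norm (nl s (\<phi> (r j)) z))\<^sup>2) \<in> borel_measurable lebesgue" for j
      using nl_measurable[OF test_measurable(1)[OF approxD(1)[OF a]]] by simp
    show "AE z in lebesgue. (\<lambda>j. (norm (nl s (\<phi> (r j)) z))\<^sup>2) \<longlonglongrightarrow> (norm (nl s u z))\<^sup>2"
      using AE_product[OF r(2) r(2)]
    proof eventually_elim
      case (elim z)
      then have "(\<lambda>j. nl s (\<phi> (r j)) z) \<longlonglongrightarrow> nl s u z"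
        unfolding nl_def split_beta divide_inverse by (intro tendsto_mult tendsto_diff tendsto_const) auto
      then show ?case by (intro tendsto_intros)
    qed
    show "(\<integral>\<^sup>+z. ennreal ((norm (nl s (\<phi> (r j)) z))\<^sup>2) \<partial>lebesgue)
       \<le> ennreal (C * (sqn lebesgue (\<phi> (r j)) + sqn lebesgue (grad (\<phi> (r j)))))" for j
      using C(2) approxD(1)[OF a] by (simp add: gagliardo_nl)
    show "(\<lambda>j. C * (sqn lebesgue (\<phi> (r j)) + sqn lebesgue (grad (\<phi> (r j)))))
      \<longlonglongrightarrow> C * (sqn lebesgue u + sqn lebesgue G)"
      by (rule tendsto_mult[OF tendsto_const tendsto_add[OF
          sqn_tendsto[OF L2conv_subseq[OF approxD(2)[OF a] r(1)]]
          sqn_tendsto[OF L2conv_subseq[OF approxD(3)[OF a] r(1)]]]])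
  qed
  moreover have "0 \<le> C * (sqn lebesgue u + sqn lebesgue G)"
    using C(1) by (simp add: sqn_nonneg)
  ultimately show "nl s u \<in> L2 lebesgue" "sqn lebesgue (nl s u) \<le> C * (sqn lebesgue u + sqn lebesgue G)"
    using L2_I[OF nl_measurable[OF L2_measurable[OF approxD(4)[OF a]]]] by blast+
qed

lemma approx_nl:
  fixes \<Omega> :: "(real ^ 'n) set"
  assumes n: "CARD('n) \<ge> 3" and s: "0 < s" "s < 1" and a: "approx \<Omega> u G \<phi>"
  shows "L2conv lebesgue (\<lambda>k. nl s (\<phi> k)) (nl s u)"
proof -
  obtain C where C: "C \<ge> 0" "\<And>\<Omega> \<phi>. \<phi> \<in> test_functions (\<Omega> :: (real ^ 'n) set)
       \<Longrightarrow> gagliardo_sq s \<phi> \<le> ennreal (C * (sqn lebesgue \<phi> + sqn lebesgue (grad \<phi>)))"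
    using gagliardo_bound[OF n s] by metis
  have "\<forall>\<phi>\<in>test_functions \<Omega>. gagliardo_sq s \<phi> \<le> ennreal (C * (sqn lebesgue \<phi> + sqn lebesgue (grad \<phi>)))"
    using C(2) by blast
  note b = approx_nl_bound[OF C(1) this]
  have "sqn lebesgue (\<lambda>z. nl s (\<phi> k) z - nl s u z)
      \<le> C * (sqn lebesgue (\<lambda>x. \<phi> k x - u x) + sqn lebesgue (\<lambda>x. grad (\<phi> k) x - G x))" for k
    using b(2)[OF approx_diff[OF test_approx[OF approxD(1)[OF a]] a]] by (simp add: nl_diff)
  moreover have "(\<lambda>k. C * (sqn lebesgue (\<lambda>x. \<phi> k x - u x) + sqn lebesgue (\<lambda>x. grad (\<phi> k) x - G x))) \<longlonglongrightarrow> C * (0 + 0)"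
    by (intro tendsto_intros L2convD(3) approxD(2,3)[OF a])
  ultimately have "(\<lambda>k. sqn lebesgue (\<lambda>z. nl s (\<phi> k) z - nl s u z)) \<longlonglongrightarrow> 0"
    by (intro tendsto_sandwich[OF always_eventually[OF allI[OF sqn_nonneg]] always_eventually[OF allI] tendsto_const]) simp_all
  then show ?thesis
    using b(1)[OF a] b(1)[OF test_approx[OF approxD(1)[OF a]]] by (simp add: L2conv_def)
qed

section \<open>The Sobolev inequality\<close>

text \<open>A continuously differentiable transition from 0 on \<open>(-\<infinity>, 0]\<close> to 1 on \<open>[1, \<infinity>)\<close>, built from
  \<open>t \<mapsto> (max 0 t)\<^sup>2\<close>.\<close>

definition step :: "real \<Rightarrow> real" where
  "step t = 1 - (max 0 (1 - (max 0 t)\<^sup>2))\<^sup>2"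

definition step' :: "real \<Rightarrow> real" where
  "step' t = 4 * max 0 (1 - (max 0 t)\<^sup>2) * max 0 t"

lemma max0_sq_DERIV: "((\<lambda>t. (max 0 t)\<^sup>2) has_real_derivative 2 * max 0 t) (at t)"
proof -
  consider "t > 0" | "t < 0" | "t = 0" by linarith
  then show ?thesis
  proof cases
    case 1
    have "((\<lambda>t. t\<^sup>2) has_real_derivative 2 * max 0 t) (at t)"
      using 1 by (auto intro!: derivative_eq_intros)
    moreover have "\<forall>\<^sub>F x in nhds t. (max 0 x)\<^sup>2 = x\<^sup>2"
      using 1 by (auto simp: eventually_nhds intro!: exI[of _ "{0<..}"])
    ultimately show ?thesis by (subst DERIV_cong_ev[OF refl _ refl]) auto
  next
    case 2
    have "((\<lambda>t. 0) has_real_derivative 2 * max 0 t) (at t)" using 2 by simp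
    moreover have "\<forall>\<^sub>F x in nhds t. (max 0 x)\<^sup>2 = 0"
      using 2 by (auto simp: eventually_nhds max_def intro!: exI[of _ "{..<0}"])
    ultimately show ?thesis by (subst DERIV_cong_ev[OF refl _ refl]) auto
  next
    case 3
    have "((\<lambda>h. max 0 h) \<longlongrightarrow> max 0 (0::real)) (at 0)" by (intro tendsto_intros)
    moreover have "((max 0 (0 + h))\<^sup>2 - (max 0 (0::real))\<^sup>2) / h = max 0 h" for h :: real
      by (auto simp: max_def power2_eq_square)
    ultimately show ?thesis unfolding 3 DERIV_def by simp
  qed
qed

lemma step_DERIV: "(step has_real_derivative step' t) (at t)"
proof -
  have "((\<lambda>t. 1 - (max 0 t)\<^sup>2) has_real_derivative - (2 * max 0 t)) (at t)"
    using DERIV_diff[OF DERIV_const[of 1] max0_sq_DERIV[of t]] by simp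
  from DERIV_chain2[OF max0_sq_DERIV this]
  have "((\<lambda>t. (max 0 (1 - (max 0 t)\<^sup>2))\<^sup>2) has_real_derivative
     2 * max 0 (1 - (max 0 t)\<^sup>2) * - (2 * max 0 t)) (at t)" .
  from DERIV_diff[OF DERIV_const[of 1] this] show ?thesis
    unfolding step_def[abs_def] step'_def by (simp add: mult_ac)
qed

lemma max0_one_minus_sq:
  assumes "1 \<le> t"
  shows "max 0 (1 - (max 0 t)\<^sup>2) = (0::real)"
proof -
  have m: "max 0 t = t" using assms by simp
  have "1 \<le> t\<^sup>2" by (rule one_le_power[OF assms])
  then show ?thesis unfolding m by (intro max_absorb1) linarith
qed

lemma step_values: "t \<le> 0 \<Longrightarrow> step t = 0" "1 \<le> t \<Longrightarrow> step t = 1"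
  by (simp add: step_def max_def) (simp add: step_def max0_one_minus_sq)

lemma step'_bounds: "\<bar>step' t\<bar> \<le> 4" "t \<le> 0 \<or> 1 \<le> t \<Longrightarrow> step' t = 0"
proof -
  show z: "t \<le> 0 \<or> 1 \<le> t \<Longrightarrow> step' t = 0"
    by (auto simp: step'_def max0_one_minus_sq)
  show "\<bar>step' t\<bar> \<le> 4"
  proof (cases "t \<le> 0 \<or> 1 \<le> t")
    case False
    then have "max 0 (1 - (max 0 t)\<^sup>2) * max 0 t \<le> 1 * 1"
      by (intro mult_mono) (auto simp: max_def)
    then show ?thesis by (auto simp: step'_def abs_mult mult.assoc)
  qed (simp add: z)
qed

text \<open>The identities behind the scaling invariance of the Sobolev inequality; they make the powers of
  the level cancel in its proof.\<close>

lemma crit_exp_facts: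
  assumes "n \<ge> 3"
  shows "crit_exp n > 2" "crit_exp n * (2 / real n) = crit_exp n - 2" "1 / (1 - 2 / real n) = crit_exp n / 2"
  using assms by (auto simp: crit_exp_def field_simps)

text \<open>Truncate \<open>\<phi>\<close> to a function \<open>v\<close> that is 0 where \<open>|\<phi>| \<le> a\<close> and 1 where \<open>|\<phi>| \<ge> 2a\<close>.  Choose the
  radius \<open>r\<close> such that a ball has twice the measure of \<open>{a < |\<phi>|}\<close>: around any point of
  \<open>{2a < |\<phi>|}\<close>, at least half of the ball consists of points with \<open>v = 0\<close>.  Thus the integral of
  \<open>(v(x + h) - v(x))\<^sup>2\<close> over \<open>x\<close> and \<open>|h| < r\<close> is at least \<open>m(a) m(2a)\<close>, while the translation estimate
  bounds it by \<open>r\<^sup>2\<parallel>\<nabla>v\<parallel>\<^sup>2 \<sqdot> 2m(a)\<close>.  The gradient of \<open>v\<close> only involves the part of \<open>\<nabla>\<phi>\<close> between the two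
  levels, so that the estimates for a sequence of levels can be added up.\<close>

lemma superlevel_decay:
  fixes \<phi> :: "real ^ 'n \<Rightarrow> real"
  defines "m \<equiv> \<lambda>a. measure lborel {x. a < \<bar>\<phi> x\<bar>}"
  assumes \<phi>: "\<phi> \<in> test_functions \<Omega>" and a: "a > 0"
  shows "m (2 * a) \<le> 58 * (2 / unit_ball_vol (real CARD('n))) powr (2 / real CARD('n)) * m a powr (2 / real CARD('n)) / a\<^sup>2
     * (\<integral>x. indicator {x. a < \<bar>\<phi> x\<bar> \<and> \<bar>\<phi> x\<bar> < 2 * a} x * (norm (grad \<phi> x))\<^sup>2 \<partial>lborel)"
    (is "_ \<le> _ * _ / _ * ?E")
proof -
  let ?n = "real CARD('n)" and ?\<omega> = "unit_ball_vol (real CARD('n))"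
  have [measurable]: "\<phi> \<in> borel_measurable borel" "grad \<phi> \<in> borel_measurable borel"
    using test_borel[OF \<phi>] test_grad_borel[OF \<phi>] .
  obtain K where K: "compact K" "\<And>x. x \<notin> K \<Longrightarrow> \<phi> x = 0" "\<And>x. x \<notin> K \<Longrightarrow> grad \<phi> x = 0"
    using test_compactE[OF \<phi>] by metis
  have fin: "emeasure lborel {x. b < \<bar>\<phi> x\<bar>} = ennreal (m b)" if "b > 0" for b
  proof -
    have "emeasure lborel {x. b < \<bar>\<phi> x\<bar>} \<le> emeasure lborel K"
      using K that by (intro emeasure_mono) (auto simp: borel_compact, metis abs_zero not_less_iff_gr_or_eq)
    also have "\<dots> < \<infinity>" using emeasure_bounded_finite[OF compact_imp_bounded[OF K(1)]] by simp
    finally show ?thesis unfolding m_def by (simp add: emeasure_eq_ennreal_measure)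
  qed
  have m0: "0 \<le> m b" for b by (simp add: m_def)
  have E0: "0 \<le> ?E" by (intro integral_nonneg_AE) auto
  have iE: "integrable lborel (\<lambda>x. indicator {x. a < \<bar>\<phi> x\<bar> \<and> \<bar>\<phi> x\<bar> < 2 * a} x * (norm (grad \<phi> x))\<^sup>2)"
  proof -
    have "integrable lborel (\<lambda>x. (norm (grad \<phi> x))\<^sup>2)"
      using K by (intro integrable_compact_support[OF K(1)] continuous_intros continuous_on_grad test_smooth[OF \<phi>]) auto
    from integrable_mult_indicator[OF _ this, of "{x. a < \<bar>\<phi> x\<bar> \<and> \<bar>\<phi> x\<bar> < 2 * a}"] show ?thesis by simp
  qed
  show ?thesis
  proof (cases "m a = 0")
    case True
    have "ennreal (m (2 * a)) \<le> ennreal (m a)"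
      using a unfolding fin[symmetric, OF a] fin[symmetric, of "2 * a", simplified, OF a] by (intro emeasure_mono) auto
    then have "m (2 * a) = 0" using True m0[of "2 * a"] by simp
    then show ?thesis using True E0 by simp
  next
    case False
    then have ma: "m a > 0" using m0[of a] by simp
    have \<omega>: "?\<omega> > 0" "?\<omega> \<noteq> 0"
      by (simp, rule less_imp_neq[OF unit_ball_vol_pos[OF of_nat_0_le_iff], symmetric])
    define r where "r = (2 * m a / ?\<omega>) powr (1 / ?n)"
    have r: "r > 0" using ma \<omega> by (simp add: r_def)
    have rn: "?\<omega> * r ^ CARD('n) = 2 * m a"
      using ma \<omega> by (simp add: r_def powr_power)
    \<comment> \<open>Working with \<open>\<phi>\<^sup>2\<close> avoids the modulus; \<open>w\<close> runs from 0 to 1 as \<open>|\<phi>|\<close> runs from \<open>a\<close> to \<open>2a\<close>.\<close>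
    define w where "w x = ((\<phi> x)\<^sup>2 - a\<^sup>2) / (3 * a\<^sup>2)" for x
    define v where "v x = step (w x)" for x
    define g where "g x = (step' (w x) * (2 * \<phi> x / (3 * a\<^sup>2))) *\<^sub>R grad \<phi> x" for x
    have w0: "w x \<le> 0 \<longleftrightarrow> \<bar>\<phi> x\<bar> \<le> a" for x
      using a abs_le_square_iff[of "\<phi> x" a] by (simp add: w_def divide_le_0_iff)
    have w1: "1 \<le> w x \<longleftrightarrow> 2 * a \<le> \<bar>\<phi> x\<bar>" for x
      using a abs_le_square_iff[of "2 * a" "\<phi> x"] by (simp add: w_def le_divide_eq power_mult_distrib)
    have dv: "(v has_derivative (\<lambda>k. g x \<bullet> k)) (at x)" for x
    proof -
      have "((\<lambda>x. (1 / (3 * a\<^sup>2)) * ((\<phi> x)\<^sup>2 - a\<^sup>2)) has_derivative (\<lambda>k. (1 / (3 * a\<^sup>2)) * (2 * \<phi> x * (grad \<phi> x \<bullet> k)))) (at x)"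
        by (rule has_derivative_mult_right)
          (auto intro!: derivative_eq_intros smooth_has_derivative[OF test_smooth[OF \<phi>]])
      then have "(w has_derivative (\<lambda>k. (2 * \<phi> x * (grad \<phi> x \<bullet> k)) / (3 * a\<^sup>2))) (at x)"
        by (simp add: w_def[abs_def])
      from has_derivative_compose[OF this step_DERIV[unfolded has_field_derivative_def]]
      show ?thesis unfolding v_def[abs_def] g_def by (simp add: mult_ac)
    qed
    have cg: "continuous_on UNIV g"
      unfolding g_def step'_def w_def using a
      by (intro continuous_intros test_continuous[OF \<phi>] continuous_on_grad test_smooth[OF \<phi>]) auto
    have [measurable]: "v \<in> borel_measurable borel"
    proof (rule borel_measurable_continuous_onI)
      show "continuous_on UNIV v"
        using has_derivative_continuous[OF dv] by (simp add: continuous_on_eq_continuous_at)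
    qed
    \<comment> \<open>The chain rule gives the factor \<open>4 \<sqdot> 4a/(3a\<^sup>2)\<close>, and \<open>256/9 < 29\<close>.  The factor
        58 of the result is twice this, as the ball has twice the measure of the superlevel set.\<close>
    have gb: "(norm (g x))\<^sup>2 \<le> 29 / a\<^sup>2 * (indicator {x. a < \<bar>\<phi> x\<bar> \<and> \<bar>\<phi> x\<bar> < 2 * a} x * (norm (grad \<phi> x))\<^sup>2)" for x
    proof (cases "a < \<bar>\<phi> x\<bar> \<and> \<bar>\<phi> x\<bar> < 2 * a")
      case True
      have "\<bar>step' (w x) * (2 * \<phi> x / (3 * a\<^sup>2))\<bar> \<le> 4 * (2 * (2 * a) / (3 * a\<^sup>2))"
        unfolding abs_mult using True a
        by (intro mult_mono step'_bounds(1)) (auto simp: abs_mult divide_right_mono)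
      also have "\<dots> = 16 / (3 * a)" using a by (simp add: field_simps power2_eq_square)
      finally have "(norm (g x))\<^sup>2 \<le> (16 / (3 * a) * norm (grad \<phi> x))\<^sup>2"
        unfolding g_def norm_scaleR by (intro power_mono mult_right_mono) auto
      also have "\<dots> = 256 / (9 * a\<^sup>2) * (norm (grad \<phi> x))\<^sup>2" by (simp add: power_mult_distrib power_divide)
      also have "\<dots> \<le> 29 / a\<^sup>2 * (norm (grad \<phi> x))\<^sup>2"
        using a by (intro mult_right_mono) (auto simp: field_simps)
      finally show ?thesis using True by simp
    next
      case False
      then have "step' (w x) = 0" using w0[of x] w1[of x] by (intro step'_bounds(2)) auto
      then show ?thesis using False by (simp add: g_def)
    qed
    have G: "(\<integral>\<^sup>+x. ennreal ((norm (g x))\<^sup>2) \<partial>lborel) \<le> ennreal (29 / a\<^sup>2 * ?E)"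
    proof -
      have "(\<integral>\<^sup>+x. ennreal ((norm (g x))\<^sup>2) \<partial>lborel)
        \<le> (\<integral>\<^sup>+x. ennreal (29 / a\<^sup>2 * (indicator {x. a < \<bar>\<phi> x\<bar> \<and> \<bar>\<phi> x\<bar> < 2 * a} x * (norm (grad \<phi> x))\<^sup>2)) \<partial>lborel)"
        by (intro nn_integral_mono ennreal_leI gb)
      also have "\<dots> = ennreal (29 / a\<^sup>2 * ?E)"
        using iE by (subst nn_integral_eq_integral) auto
      finally show ?thesis .
    qed
    let ?B = "ball (0 :: real ^ 'n) r"
    have [measurable]: "?B \<in> sets borel" by simp
    have eB: "emeasure lborel ?B = ennreal (2 * m a)"
      using emeasure_ball[of r "0 :: real ^ 'n"] r rn by simp
    have "ennreal (m a) * ennreal (m (2 * a))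
       \<le> (\<integral>\<^sup>+x. \<integral>\<^sup>+h. indicator ?B h * ennreal ((v (x + h) - v x)\<^sup>2) \<partial>lborel \<partial>lborel)"
    proof -
      have "ennreal (m a) * ennreal (m (2 * a)) = (\<integral>\<^sup>+x. ennreal (m a) * indicator {x. 2 * a < \<bar>\<phi> x\<bar>} x \<partial>lborel)"
        using a by (simp add: nn_integral_cmult_indicator fin)
      also have "\<dots> \<le> (\<integral>\<^sup>+x. \<integral>\<^sup>+h. indicator ?B h * ennreal ((v (x + h) - v x)\<^sup>2) \<partial>lborel \<partial>lborel)"
      proof (rule nn_integral_mono)
        fix x
        show "ennreal (m a) * indicator {x. 2 * a < \<bar>\<phi> x\<bar>} x
          \<le> (\<integral>\<^sup>+h. indicator ?B h * ennreal ((v (x + h) - v x)\<^sup>2) \<partial>lborel)"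
        proof (cases "2 * a < \<bar>\<phi> x\<bar>")
          case True
          then have vx: "v x = 1" using w1[of x] by (simp add: v_def step_values)
          let ?S = "{h. a < \<bar>\<phi> (x + h)\<bar>}"
          have eS: "emeasure lborel ?S = ennreal (m a)"
          proof -
            have "emeasure lborel ?S = (\<integral>\<^sup>+h. indicator ?S h \<partial>lborel)"
              by (rule nn_integral_indicator[symmetric]) measurable
            also have "\<dots> = (\<integral>\<^sup>+h. indicator {x. a < \<bar>\<phi> x\<bar>} (h + x) \<partial>lborel)"
              by (intro nn_integral_cong) (simp add: indicator_def add.commute)
            also have "\<dots> = (\<integral>\<^sup>+h. indicator {x. a < \<bar>\<phi> x\<bar>} h \<partial>lborel)"
              by (rule nn_integral_lborel_translation) measurable
            also have "\<dots> = ennreal (m a)" using a by (simp add: fin)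
            finally show ?thesis .
          qed
          have "ennreal (2 * m a) = emeasure lborel ?B" by (simp add: eB)
          also have "\<dots> \<le> emeasure lborel ((?B - ?S) \<union> ?S)" by (intro emeasure_mono) auto
          also have "\<dots> \<le> emeasure lborel (?B - ?S) + emeasure lborel ?S" by (intro emeasure_subadditive) auto
          finally have "ennreal (m a) + ennreal (m a) \<le> emeasure lborel (?B - ?S) + ennreal (m a)"
            using m0 by (simp add: eS ennreal_plus[symmetric] del: ennreal_plus)
          then have "ennreal (m a) \<le> emeasure lborel (?B - ?S)"
            by (simp add: ennreal_add_left_cancel_le add.commute)
          also have "\<dots> = (\<integral>\<^sup>+h. indicator (?B - ?S) h \<partial>lborel)" by (rule nn_integral_indicator[symmetric]) simp
          also have "\<dots> \<le> (\<integral>\<^sup>+h. indicator ?B h * ennreal ((v (x + h) - v x)\<^sup>2) \<partial>lborel)"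
          proof (rule nn_integral_mono)
            fix h
            show "indicator (?B - ?S) h \<le> indicator ?B h * ennreal ((v (x + h) - v x)\<^sup>2)"
            proof (cases "h \<in> ?B - ?S")
              case True
              then have "v (x + h) = 0" using w0[of "x + h"] by (simp add: v_def step_values)
              with True show ?thesis by (simp add: vx)
            qed simp
          qed
          finally show ?thesis using True by simp
        qed simp
      qed
      finally show ?thesis .
    qed
    also have "\<dots> = (\<integral>\<^sup>+h. \<integral>\<^sup>+x. indicator ?B h * ennreal ((v (x + h) - v x)\<^sup>2) \<partial>lborel \<partial>lborel)"
      by (rule lborel_pair.Fubini'[symmetric]) measurable
    also have "\<dots> \<le> (\<integral>\<^sup>+h. ennreal (r\<^sup>2 * (29 / a\<^sup>2 * ?E)) * indicator ?B h \<partial>lborel)"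
    proof (rule nn_integral_mono)
      fix h :: "real ^ 'n"
      show "(\<integral>\<^sup>+x. indicator ?B h * ennreal ((v (x + h) - v x)\<^sup>2) \<partial>lborel) \<le> ennreal (r\<^sup>2 * (29 / a\<^sup>2 * ?E)) * indicator ?B h"
      proof (cases "h \<in> ?B")
        case True
        have "(\<integral>\<^sup>+x. ennreal ((v (x + h) - v x)\<^sup>2) \<partial>lborel)
          \<le> ennreal ((norm h)\<^sup>2) * (\<integral>\<^sup>+x. ennreal ((norm (g x))\<^sup>2) \<partial>lborel)"
          by (rule translation_estimate[OF dv cg])
        also have "\<dots> \<le> ennreal (r\<^sup>2) * ennreal (29 / a\<^sup>2 * ?E)"
          using True by (intro mult_mono G ennreal_leI power_mono) auto
        also have "\<dots> = ennreal (r\<^sup>2 * (29 / a\<^sup>2 * ?E))"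
          using E0 by (intro ennreal_mult[symmetric]) auto
        finally show ?thesis using True by simp
      qed simp
    qed
    also have "\<dots> = ennreal (r\<^sup>2 * (29 / a\<^sup>2 * ?E)) * ennreal (2 * m a)"
      by (simp add: nn_integral_cmult_indicator eB)
    finally have "m a * m (2 * a) \<le> r\<^sup>2 * (29 / a\<^sup>2 * ?E) * (2 * m a)"
      using m0 E0 by (simp add: ennreal_mult[symmetric])
    then have "m a * m (2 * a) \<le> m a * (58 * r\<^sup>2 / a\<^sup>2 * ?E)" by (simp add: mult_ac)
    then have "m (2 * a) \<le> 58 * r\<^sup>2 / a\<^sup>2 * ?E" by (rule mult_left_le_imp_le[OF _ ma])
    also have "r\<^sup>2 = (2 / ?\<omega>) powr (2 / ?n) * m a powr (2 / ?n)"
    proof -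
      have "r\<^sup>2 = (2 * m a / ?\<omega>) powr (2 / ?n)"
        by (simp add: r_def power2_eq_square powr_add[symmetric])
      also have "2 * m a / ?\<omega> = (2 / ?\<omega>) * m a" by simp
      also have "((2 / ?\<omega>) * m a) powr (2 / ?n) = (2 / ?\<omega>) powr (2 / ?n) * m a powr (2 / ?n)"
        by (rule powr_mult)
      finally show ?thesis .
    qed
    finally show ?thesis by (simp add: mult_ac)
  qed
qed

text \<open>Either the first summand dominates, or \<open>W\<close> is bounded by \<open>2cW\<^sup>\<theta>\<close> and the power can be divided out.\<close>

lemma self_improving_bound:
  fixes W :: real
  assumes "W \<le> b + c * W powr \<theta>" "0 \<le> W" "0 \<le> b" "0 \<le> c" "0 < \<theta>" "\<theta> < 1"
  shows "W \<le> 2 * b + (2 * c) powr (1 / (1 - \<theta>))"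
proof (cases "W \<le> 2 * b")
  case True
  then show ?thesis by (simp add: add_increasing2)
next
  case False
  then have W: "W > 0" using assms by linarith
  have "W \<le> 2 * (c * W powr \<theta>)" using False assms(1) by linarith
  moreover have "W = W powr (1 - \<theta>) * W powr \<theta>" using W by (simp flip: powr_add)
  ultimately have "W powr (1 - \<theta>) * W powr \<theta> \<le> (2 * c) * W powr \<theta>" by simp
  then have "W powr (1 - \<theta>) \<le> 2 * c" using W by simp
  then have "(W powr (1 - \<theta>)) powr (1 / (1 - \<theta>)) \<le> (2 * c) powr (1 / (1 - \<theta>))"
    using assms by (intro powr_mono2) auto
  then show ?thesis using W assms by (simp add: powr_powr)
qed

lemma dyadic_cover:
  fixes t :: real
  assumes "0 < \<alpha>" "\<alpha> < t" "t \<le> \<alpha> * 2 ^ M"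
  obtains j where "j \<le> M" "\<alpha> * 2 ^ j < t" "t \<le> 2 * (\<alpha> * 2 ^ j)"
proof -
  define j where "j = (LEAST j. t \<le> \<alpha> * 2 ^ Suc j)"
  have M: "t \<le> \<alpha> * 2 ^ Suc M" using assms by simp
  have "t \<le> \<alpha> * 2 ^ Suc j" unfolding j_def by (rule LeastI[of _ M]) (rule M)
  moreover have "j \<le> M" unfolding j_def by (rule Least_le) (rule M)
  moreover have "\<alpha> * 2 ^ j < t"
  proof (cases j)
    case (Suc i)
    then have "\<not> t \<le> \<alpha> * 2 ^ Suc i" using not_less_Least[of i "\<lambda>j. t \<le> \<alpha> * 2 ^ Suc j"] by (simp add: j_def)
    then show ?thesis by (simp add: Suc)
  qed (use assms in simp)
  ultimately show ?thesis using that[of j] by simp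
qed

text \<open>Put \<open>b\<^sub>j = (2\<^sup>j\<alpha>)\<^sup>p m(2\<^sup>j\<alpha>)\<close>, where \<open>m\<close> is the measure of the superlevel sets.  The sum \<open>W\<close> of the
  \<open>b\<^sub>j\<close> controls the integral of \<open>|\<phi>|\<^sup>p\<close> over \<open>{|\<phi>| > \<alpha>}\<close>.  By the decay estimate,
  \<open>b\<^sub>j\<^sub>+\<^sub>1 \<le> C b\<^sub>j\<^bsup>2/n\<^esup> e\<^sub>j\<close> with \<open>e\<^sub>j\<close> the Dirichlet energy between two consecutive levels; the
  exponent \<open>p\<close> is the one for which no power of the level remains.  Summation gives
  \<open>W \<le> b\<^sub>0 + C E W\<^bsup>2/n\<^esup>\<close>, hence a bound of \<open>W\<close> by \<open>E\<^bsup>p/2\<^esup>\<close>, up to \<open>b\<^sub>0\<close>, which vanishes as \<open>\<alpha>\<close> tends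
  to 0.\<close>

lemma sobolev_inequality:
  assumes n: "CARD('n::finite) \<ge> 3"
  obtains K where "K > 0" "\<And>\<Omega> \<phi>. \<phi> \<in> test_functions (\<Omega> :: (real ^ 'n) set)
     \<Longrightarrow> K * (\<integral>x. \<bar>\<phi> x\<bar> powr crit_exp CARD('n) \<partial>lebesgue) powr (2 / crit_exp CARD('n)) \<le> sqn lebesgue (grad \<phi>)"
proof -
  let ?n = "real CARD('n)"
  define p where "p = crit_exp CARD('n)"
  note pf = crit_exp_facts[OF n, folded p_def]
  define C1 where "C1 = 58 * (2 / unit_ball_vol ?n) powr (2 / ?n)"
  have "unit_ball_vol ?n \<noteq> 0"
    by (rule less_imp_neq[OF unit_ball_vol_pos[OF of_nat_0_le_iff], symmetric])
  then have C1: "C1 > 0" by (auto simp: C1_def)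
  define C2 where "C2 = 2 powr p * C1"
  have C2: "C2 > 0" using C1 by (simp add: C2_def)
  show ?thesis
  proof
    show "1 / (8 * C2) > 0" using C2 by simp
    fix \<Omega> \<phi> assume \<phi>: "\<phi> \<in> test_functions (\<Omega> :: (real ^ 'n) set)"
    have [measurable]: "\<phi> \<in> borel_measurable borel" "grad \<phi> \<in> borel_measurable borel"
      using test_borel[OF \<phi>] test_grad_borel[OF \<phi>] .
    obtain K where K: "compact K" "\<And>x. x \<notin> K \<Longrightarrow> \<phi> x = 0" "\<And>x. x \<notin> K \<Longrightarrow> grad \<phi> x = 0"
      using test_compactE[OF \<phi>] by metis
    have [measurable]: "K \<in> sets borel" using K(1) by (rule borel_compact)
    obtain B where B: "B > 0" "\<And>x. \<bar>\<phi> x\<bar> \<le> B" using test_bounded[OF \<phi>] by metis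
    define V where "V = measure lborel K"
    have Vf: "emeasure lborel K < \<infinity>" using emeasure_bounded_finite[OF compact_imp_bounded[OF K(1)]] by simp
    have iK: "integrable lborel (indicator K :: _ \<Rightarrow> real)" using Vf by (intro integrable_real_indicator) auto
    have V0: "0 \<le> V" by (simp add: V_def)
    define I where "I = (\<integral>x. \<bar>\<phi> x\<bar> powr p \<partial>lborel)"
    have iI: "integrable lborel (\<lambda>x. \<bar>\<phi> x\<bar> powr p)"
    proof (rule integrable_compact_support[OF K(1)])
      show "continuous_on UNIV (\<lambda>x. \<bar>\<phi> x\<bar> powr p)"
        using pf(1) by (intro continuous_on_powr' continuous_intros test_continuous[OF \<phi>]) auto
    qed (simp add: K(2))
    define E where "E = (\<integral>x. (norm (grad \<phi> x))\<^sup>2 \<partial>lborel)"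
    have iE: "integrable lborel (\<lambda>x. (norm (grad \<phi> x))\<^sup>2)"
      using K by (intro integrable_compact_support[OF K(1)] continuous_intros continuous_on_grad test_smooth[OF \<phi>]) auto
    have E0: "0 \<le> E" by (simp add: E_def)
    define m where "m a = measure lborel {x. a < \<bar>\<phi> x\<bar>}" for a
    have m0: "0 \<le> m a" for a by (simp add: m_def)
    have lev: "{x. a < \<bar>\<phi> x\<bar>} \<subseteq> K" if "a > 0" for a using K(2) that by force
    have levf: "emeasure lborel {x. a < \<bar>\<phi> x\<bar>} < \<infinity>" if "a > 0" for a
      using emeasure_mono[OF lev[OF that], of lborel] Vf by (simp add: le_less_trans)
    have mV: "m a \<le> V" if "a > 0" for a
      unfolding m_def V_def using lev[OF that] Vf by (intro measure_mono_fmeasurable) (auto simp: fmeasurable_def)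
    have key: "I \<le> (1 + 2 powr p * 2) * (\<alpha> powr p * V) + 2 powr p * (2 * (C2 * E)) powr (p / 2)" if \<alpha>: "\<alpha> > 0" for \<alpha>
    proof -
      \<comment> \<open>Finitely many levels suffice, as \<open>\<phi>\<close> is bounded.\<close>
      obtain M where M: "B / \<alpha> < 2 ^ M" using real_arch_pow[of 2 "B / \<alpha>"] by auto
      define a where "a j = \<alpha> * 2 ^ j" for j :: nat
      have a: "a j > 0" for j using \<alpha> by (simp add: a_def)
      define b where "b j = a j powr p * m (a j)" for j
      have b0: "0 \<le> b j" for j by (simp add: b_def m0)
      define L where "L j = {x. a j < \<bar>\<phi> x\<bar> \<and> \<bar>\<phi> x\<bar> < 2 * a j}" for j
      have [measurable]: "L j \<in> sets borel" for j unfolding L_def by measurable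
      define e where "e j = (\<integral>x. indicator (L j) x * (norm (grad \<phi> x))\<^sup>2 \<partial>lborel)" for j
      have ie: "integrable lborel (\<lambda>x. indicator (L j) x * (norm (grad \<phi> x))\<^sup>2)" for j
        using integrable_mult_indicator[OF _ iE, of "L j"] by simp
      have e0: "0 \<le> e j" for j unfolding e_def by (intro integral_nonneg_AE) auto
      have esum: "(\<Sum>j<M. e j) \<le> E"
      proof -
        have "(\<Sum>j<M. e j) = (\<integral>x. (\<Sum>j<M. indicator (L j) x * (norm (grad \<phi> x))\<^sup>2) \<partial>lborel)"
          unfolding e_def using ie by (subst Bochner_Integration.integral_sum) auto
        also have "\<dots> \<le> E"
          unfolding E_def
        proof (rule integral_mono[OF _ iE])
          show "integrable lborel (\<lambda>x. \<Sum>j<M. indicator (L j) x * (norm (grad \<phi> x))\<^sup>2)"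
            by (rule Bochner_Integration.integrable_sum[OF ie])
          fix x
          have disj: "i = j" if "x \<in> L i" "x \<in> L j" for i j
          proof (rule ccontr)
            have lt: False if "i < j" "x \<in> L i" "x \<in> L j" for i j
            proof -
              have "(2::real) ^ Suc i \<le> 2 ^ j" using that(1) by (intro power_increasing) auto
              then have "2 * a i \<le> a j" using \<alpha> by (simp add: a_def)
              then show False using that(2,3) by (auto simp: L_def)
            qed
            assume "i \<noteq> j"
            then show False using lt[of i j] lt[of j i] that by linarith
          qed
          have "(\<Sum>j<M. indicator (L j) x :: real) \<le> 1"
          proof (cases "\<exists>i<M. x \<in> L i")
            case True
            then obtain i where i: "i < M" "x \<in> L i" by blast
            have "(\<Sum>j<M. indicator (L j) x :: real) = (\<Sum>j<M. if j = i then 1 else 0)"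
              using disj i(2) by (intro sum.cong) (auto simp: indicator_def)
            then show ?thesis by simp
          qed (auto simp: indicator_def sum_nonpos)
          from mult_right_mono[OF this, of "(norm (grad \<phi> x))\<^sup>2"]
          show "(\<Sum>j<M. indicator (L j) x * (norm (grad \<phi> x))\<^sup>2) \<le> (norm (grad \<phi> x))\<^sup>2"
            by (simp add: sum_distrib_right)
        qed
        finally show ?thesis .
      qed
      define W where "W = (\<Sum>j\<le>M. b j)"
      have W0: "0 \<le> W" unfolding W_def by (intro sum_nonneg b0)
      have bW: "b j \<le> W" if "j \<le> M" for j unfolding W_def using that b0 by (intro member_le_sum) auto
      have rec: "b (Suc j) \<le> C2 * b j powr (2 / ?n) * e j" for j
      proof -
        have "m (2 * a j) \<le> C1 * m (a j) powr (2 / ?n) / (a j)\<^sup>2 * e j"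
          using superlevel_decay[OF \<phi> a[of j]] unfolding m_def C1_def e_def L_def .
        then have "(2 * a j) powr p * m (2 * a j) \<le> (2 * a j) powr p * (C1 * m (a j) powr (2 / ?n) / (a j)\<^sup>2 * e j)"
          by (intro mult_left_mono) auto
        also have "\<dots> = C2 * (a j powr p / (a j)\<^sup>2 * m (a j) powr (2 / ?n)) * e j"
          using a[of j] by (simp add: powr_mult C2_def)
        also have "a j powr p / (a j)\<^sup>2 = (a j powr p) powr (2 / ?n)"
          using a[of j] pf(2) by (simp add: powr_powr powr_diff)
        also have "\<dots> * m (a j) powr (2 / ?n) = b j powr (2 / ?n)"
          using a[of j] m0 by (simp add: b_def powr_mult)
        finally show ?thesis by (simp add: b_def a_def mult_ac)
      qed
      have "W = b 0 + (\<Sum>j<M. b (Suc j))"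
        unfolding W_def by (simp add: sum.atMost_shift)
      also have "\<dots> \<le> \<alpha> powr p * V + (\<Sum>j<M. (C2 * W powr (2 / ?n)) * e j)"
      proof (intro add_mono sum_mono)
        show "b 0 \<le> \<alpha> powr p * V" using \<alpha> mV[of \<alpha>] by (simp add: b_def a_def mult_left_mono)
        fix j assume "j \<in> {..<M}"
        then have "b j powr (2 / ?n) \<le> W powr (2 / ?n)" using b0 bW by (intro powr_mono2) auto
        then have "C2 * b j powr (2 / ?n) * e j \<le> C2 * W powr (2 / ?n) * e j"
          using C2 e0 by (intro mult_right_mono mult_left_mono) auto
        with rec[of j] show "b (Suc j) \<le> (C2 * W powr (2 / ?n)) * e j" by linarith
      qed
      also have "(\<Sum>j<M. (C2 * W powr (2 / ?n)) * e j) \<le> (C2 * W powr (2 / ?n)) * E"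
        unfolding sum_distrib_left[symmetric] using C2 by (intro mult_left_mono esum) auto
      finally have "W \<le> \<alpha> powr p * V + (C2 * E) * W powr (2 / ?n)" by (simp add: mult_ac)
      then have W: "W \<le> 2 * (\<alpha> powr p * V) + (2 * (C2 * E)) powr (p / 2)"
        using self_improving_bound[of W "\<alpha> powr p * V" "C2 * E" "2 / ?n"] W0 V0 C2 E0 n pf(3) by simp
      have ib: "integrable lborel (indicator {x. a j < \<bar>\<phi> x\<bar>} :: _ \<Rightarrow> real)" for j
        using levf[OF a] by (intro integrable_real_indicator) auto
      have "I \<le> (\<integral>x. \<alpha> powr p * indicator K x + (\<Sum>j\<le>M. (2 powr p * a j powr p) * indicator {x. a j < \<bar>\<phi> x\<bar>} x) \<partial>lborel)"
        unfolding I_def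
      proof (rule integral_mono[OF iI])
        show "integrable lborel (\<lambda>x. \<alpha> powr p * indicator K x + (\<Sum>j\<le>M. (2 powr p * a j powr p) * indicator {x. a j < \<bar>\<phi> x\<bar>} x))"
          using iK ib by (intro Bochner_Integration.integrable_add Bochner_Integration.integrable_sum integrable_mult_right) auto
        fix x
        let ?S = "\<Sum>j\<le>M. (2 powr p * a j powr p) * indicat_real {x. a j < \<bar>\<phi> x\<bar>} x"
        have S0: "0 \<le> ?S" by (intro sum_nonneg) auto
        show "\<bar>\<phi> x\<bar> powr p \<le> \<alpha> powr p * indicator K x + ?S"
        proof (cases "\<bar>\<phi> x\<bar> \<le> \<alpha>")
          case True
          have "\<bar>\<phi> x\<bar> powr p \<le> \<alpha> powr p * indicator K x"
          proof (cases "x \<in> K")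
            case True
            then show ?thesis using \<open>\<bar>\<phi> x\<bar> \<le> \<alpha>\<close> pf(1) by (simp add: powr_mono2)
          qed (simp add: K(2))
          with S0 show ?thesis by linarith
        next
          case False
          have "\<bar>\<phi> x\<bar> \<le> \<alpha> * 2 ^ M" using M B(2)[of x] \<alpha> by (simp add: field_simps)
          then obtain j where j: "j \<le> M" "a j < \<bar>\<phi> x\<bar>" "\<bar>\<phi> x\<bar> \<le> 2 * a j"
            using dyadic_cover[of \<alpha> "\<bar>\<phi> x\<bar>" M] \<alpha> False unfolding a_def by (metis not_le)
          have "\<bar>\<phi> x\<bar> powr p \<le> (2 * a j) powr p" using j(3) pf(1) by (intro powr_mono2) auto
          also have "\<dots> = (2 powr p * a j powr p) * indicat_real {x. a j < \<bar>\<phi> x\<bar>} x"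
            using a[of j] j(2) by (simp add: powr_mult)
          also have "\<dots> \<le> ?S" using j(1) by (intro member_le_sum) auto
          finally show ?thesis by (simp add: add_increasing)
        qed
      qed
      also have "\<dots> = \<alpha> powr p * V + 2 powr p * W"
        using iK ib by (simp add: Bochner_Integration.integral_add Bochner_Integration.integral_sum V_def W_def b_def m_def sum_distrib_left mult_ac)
      also have "\<dots> \<le> \<alpha> powr p * V + 2 powr p * (2 * (\<alpha> powr p * V) + (2 * (C2 * E)) powr (p / 2))"
        by (intro add_left_mono mult_left_mono W) auto
      finally show ?thesis by (simp add: algebra_simps)
    qed
    have "I \<le> 2 powr p * (2 * (C2 * E)) powr (p / 2)"
    proof (rule LIMSEQ_le_const)
      have "(\<lambda>k. (1 / real (Suc k)) powr p) \<longlonglongrightarrow> 0"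
        using pf(1) by (intro tendsto_zero_powrI[OF LIMSEQ_Suc[OF lim_1_over_n]] tendsto_const) auto
      then have "(\<lambda>k. (1 + 2 powr p * 2) * ((1 / real (Suc k)) powr p * V) + 2 powr p * (2 * (C2 * E)) powr (p / 2))
        \<longlonglongrightarrow> (1 + 2 powr p * 2) * (0 * V) + 2 powr p * (2 * (C2 * E)) powr (p / 2)"
        by (intro tendsto_intros)
      then show "(\<lambda>k. (1 + 2 powr p * 2) * ((1 / real (Suc k)) powr p * V) + 2 powr p * (2 * (C2 * E)) powr (p / 2))
        \<longlonglongrightarrow> 2 powr p * (2 * (C2 * E)) powr (p / 2)" by simp
      show "\<exists>N. \<forall>k\<ge>N. I \<le> (1 + 2 powr p * 2) * ((1 / real (Suc k)) powr p * V) + 2 powr p * (2 * (C2 * E)) powr (p / 2)"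
        using key by auto
    qed
    moreover have "0 \<le> I" unfolding I_def by (intro integral_nonneg_AE) auto
    ultimately have "I powr (2 / p) \<le> (2 powr p * (2 * (C2 * E)) powr (p / 2)) powr (2 / p)"
      using pf(1) by (intro powr_mono2) auto
    also have "\<dots> = 4 * (2 * (C2 * E))"
      using pf(1) C2 E0 by (simp add: powr_mult powr_powr)
    finally have "1 / (8 * C2) * I powr (2 / p) \<le> E" using C2 by (simp add: field_simps)
    then show "1 / (8 * C2) * (\<integral>x. \<bar>\<phi> x\<bar> powr crit_exp CARD('n) \<partial>lebesgue) powr (2 / crit_exp CARD('n)) \<le> sqn lebesgue (grad \<phi>)"
      by (simp add: I_def E_def sqn_def p_def integral_completion)
  qed
qed

section \<open>Compactness\<close>

definition cell :: "real \<Rightarrow> ('n \<Rightarrow> int) \<Rightarrow> (real ^ 'n) set" where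
  "cell h \<kappa> = {x. \<forall>i. \<lfloor>x $ i / h\<rfloor> = \<kappa> i}"

lemma cell_iff: "h > 0 \<Longrightarrow> x \<in> cell h \<kappa> \<longleftrightarrow> (\<forall>i. h * \<kappa> i \<le> x $ i \<and> x $ i < h * (\<kappa> i + 1))"
  by (auto simp: cell_def floor_eq_iff field_simps)

lemma cell_borel[measurable]: "cell h \<kappa> \<in> sets borel" for \<kappa> :: "'n::finite \<Rightarrow> int"
proof -
  have [measurable]: "(\<lambda>x::real^'n. x $ i) \<in> borel_measurable borel" for i
    by (intro borel_measurable_continuous_onI continuous_intros)
  have "cell h \<kappa> = (\<Inter>i. {x. \<lfloor>x $ i / h\<rfloor> = \<kappa> i})" by (auto simp: cell_def)
  moreover have "{x::real^'n. \<lfloor>x $ i / h\<rfloor> = \<kappa> i} \<in> sets borel" for i by measurable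
  ultimately show ?thesis by auto
qed

lemma cell_emeasure:
  fixes \<kappa> :: "'n::finite \<Rightarrow> int"
  assumes h: "h > 0"
  shows "emeasure lborel (cell h \<kappa>) = ennreal (h ^ CARD('n))"
proof -
  define a b :: "real ^ 'n" where "a = (\<chi> i. h * \<kappa> i)" and "b = (\<chi> i. h * (\<kappa> i + 1))"
  have ab: "(b - a) \<bullet> e = h" if "e \<in> Basis" for e
    using that by (auto simp: Basis_vec_def inner_axis a_def b_def algebra_simps)
  have le: "a \<bullet> e \<le> b \<bullet> e" if "e \<in> Basis" for e
    using ab[OF that] h by (simp add: inner_diff_left)
  have p: "(\<Prod>e\<in>Basis. (b - a) \<bullet> e) = h ^ CARD('n)"
    using ab by simp
  have "box a b \<subseteq> cell h \<kappa>" "cell h \<kappa> \<subseteq> cbox a b"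
    using h by (auto simp: cell_iff mem_box_cart a_def b_def less_imp_le)
  then have "emeasure lborel (box a b) \<le> emeasure lborel (cell h \<kappa>)"
    "emeasure lborel (cell h \<kappa>) \<le> emeasure lborel (cbox a b)"
    by (auto intro!: emeasure_mono)
  then show ?thesis using le p by (simp add: emeasure_lborel_box emeasure_lborel_cbox)
qed

lemma cell_diameter:
  fixes \<kappa> :: "'n::finite \<Rightarrow> int"
  assumes h: "h > 0" and "x \<in> cell h \<kappa>" "y \<in> cell h \<kappa>"
  shows "norm (x - y) \<le> real CARD('n) * h"
proof -
  have "\<bar>(x - y) $ i\<bar> \<le> h" for i
    using assms by (auto simp: cell_iff[OF h] algebra_simps abs_le_iff) (smt (verit, best))+
  then have "(\<Sum>i\<in>UNIV. \<bar>(x - y) $ i\<bar>) \<le> real CARD('n) * h"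
    using sum_bounded_above[of UNIV "\<lambda>i. \<bar>(x - y) $ i\<bar>" h] by simp
  then show ?thesis using norm_le_l1_cart[of "x - y"] by linarith
qed

text \<open>Expansion of the square.  The left-hand side is nonnegative and the right-hand side is twice the
  variance of \<open>w\<close> on \<open>Q\<close>, up to normalization.\<close>

lemma block_variance:
  fixes w :: "'a::euclidean_space \<Rightarrow> real"
  assumes [measurable]: "Q \<in> sets borel" "w \<in> borel_measurable borel"
    and c: "emeasure lborel Q = ennreal c" "c \<ge> 0"
    and iw: "integrable lborel w" and iw2: "integrable lborel (\<lambda>x. (w x)\<^sup>2)"
  shows "(\<integral>\<^sup>+x. \<integral>\<^sup>+y. ennreal (indicator Q x * indicator Q y * (w x - w y)\<^sup>2) \<partial>lborel \<partial>lborel)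
    = ennreal (2 * c * (\<integral>x. indicator Q x * (w x)\<^sup>2 \<partial>lborel) - 2 * (\<integral>x. indicator Q x * w x \<partial>lborel)\<^sup>2)"
    and "0 \<le> 2 * c * (\<integral>x. indicator Q x * (w x)\<^sup>2 \<partial>lborel) - 2 * (\<integral>x. indicator Q x * w x \<partial>lborel)\<^sup>2"
proof -
  let ?I = "\<integral>x. indicator Q x * w x \<partial>lborel" and ?J = "\<integral>x. indicator Q x * (w x)\<^sup>2 \<partial>lborel"
  have i0: "has_bochner_integral lborel (indicator Q :: _ \<Rightarrow> real) c"
    using c has_bochner_integral_real_indicator[of Q lborel] by (simp add: measure_def)
  have i1: "has_bochner_integral lborel (\<lambda>x. indicator Q x * w x) ?I"
    using integrable_mult_indicator[OF _ iw, of Q] by (simp add: has_bochner_integral_iff)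
  have i2: "has_bochner_integral lborel (\<lambda>x. indicator Q x * (w x)\<^sup>2) ?J"
    using integrable_mult_indicator[OF _ iw2, of Q] by (simp add: has_bochner_integral_iff)
  have inner: "has_bochner_integral lborel (\<lambda>y. indicator Q x * indicator Q y * (w x - w y)\<^sup>2)
     (indicator Q x * (c * (w x)\<^sup>2 - 2 * w x * ?I + ?J))" for x
  proof -
    have "has_bochner_integral lborel (\<lambda>y. indicator Q x * ((w x)\<^sup>2 * indicator Q y - (2 * w x) * (indicator Q y * w y)
        + indicator Q y * (w y)\<^sup>2)) (indicator Q x * ((w x)\<^sup>2 * c - (2 * w x) * ?I + ?J))"
      by (intro has_bochner_integral_mult_right has_bochner_integral_add has_bochner_integral_diff i0 i1 i2)
    moreover have "(\<lambda>y. indicator Q x * ((w x)\<^sup>2 * indicator Q y - (2 * w x) * (indicator Q y * w y)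
        + indicator Q y * (w y)\<^sup>2)) = (\<lambda>y. indicator Q x * indicator Q y * (w x - w y)\<^sup>2 :: real)"
      by (auto simp: fun_eq_iff power2_eq_square algebra_simps)
    ultimately show ?thesis by (simp add: mult.commute)
  qed
  have "has_bochner_integral lborel (\<lambda>x. c * (indicator Q x * (w x)\<^sup>2) - (2 * ?I) * (indicator Q x * w x)
      + ?J * indicator Q x) (c * ?J - (2 * ?I) * ?I + ?J * c)"
    by (intro has_bochner_integral_mult_right has_bochner_integral_add has_bochner_integral_diff i0 i1 i2)
  moreover have "(\<lambda>x. c * (indicator Q x * (w x)\<^sup>2) - (2 * ?I) * (indicator Q x * w x)
      + ?J * indicator Q x) = (\<lambda>x. indicator Q x * (c * (w x)\<^sup>2 - 2 * w x * ?I + ?J))"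
    by (auto simp: fun_eq_iff algebra_simps)
  ultimately have h: "has_bochner_integral lborel (\<lambda>x. indicator Q x * (c * (w x)\<^sup>2 - 2 * w x * ?I + ?J))
      (2 * c * ?J - 2 * ?I\<^sup>2)"
    by (simp add: power2_eq_square algebra_simps)
  have nonneg: "0 \<le> indicator Q x * (c * (w x)\<^sup>2 - 2 * w x * ?I + ?J)" for x
  proof -
    have "0 \<le> (\<integral>y. indicator Q x * indicator Q y * (w x - w y)\<^sup>2 \<partial>lborel)"
      by (intro integral_nonneg_AE) auto
    also have "\<dots> = indicator Q x * (c * (w x)\<^sup>2 - 2 * w x * ?I + ?J)"
      by (rule has_bochner_integral_integral_eq[OF inner])
    finally show ?thesis .
  qed
  show "0 \<le> 2 * c * ?J - 2 * ?I\<^sup>2"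
    unfolding has_bochner_integral_integral_eq[OF h, symmetric] by (rule integral_nonneg_AE, rule AE_I2, rule nonneg)
  have "(\<integral>\<^sup>+y. ennreal (indicator Q x * indicator Q y * (w x - w y)\<^sup>2) \<partial>lborel)
     = ennreal (indicator Q x * (c * (w x)\<^sup>2 - 2 * w x * ?I + ?J))" for x
    using inner[of x] by (subst nn_integral_eq_integral) (auto simp: has_bochner_integral_iff)
  then have "(\<integral>\<^sup>+x. \<integral>\<^sup>+y. ennreal (indicator Q x * indicator Q y * (w x - w y)\<^sup>2) \<partial>lborel \<partial>lborel)
     = (\<integral>\<^sup>+x. ennreal (indicator Q x * (c * (w x)\<^sup>2 - 2 * w x * ?I + ?J)) \<partial>lborel)" by simp
  also have "\<dots> = ennreal (2 * c * ?J - 2 * ?I\<^sup>2)"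
    using h nonneg by (subst nn_integral_eq_integral) (auto simp: has_bochner_integral_iff)
  finally show "(\<integral>\<^sup>+x. \<integral>\<^sup>+y. ennreal (indicator Q x * indicator Q y * (w x - w y)\<^sup>2) \<partial>lborel \<partial>lborel)
    = ennreal (2 * c * ?J - 2 * ?I\<^sup>2)" .
qed

text \<open>Decompose space into cubes of side \<open>h\<close>.  In each cube the squared \<open>L\<^sup>2\<close> norm splits into the
  squared mean and the variance, and the variance is a double integral of \<open>(w(x) - w(y))\<^sup>2\<close> over pairs of points at distance at most
  \<open>nh\<close>.  For these pairs the Gagliardo kernel is at least \<open>(nh)\<^sup>-\<^sup>n\<^sup>-\<^sup>2\<^sup>s\<close>.\<close>

lemma cell_estimate:
  fixes w :: "real ^ 'n \<Rightarrow> real"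
  assumes w: "w \<in> test_functions \<Omega>" and R: "\<And>x. x \<in> \<Omega> \<Longrightarrow> norm x \<le> R"
    and h: "h > 0" and s: "s > 0" and wL: "nl s w \<in> L2 lebesgue"
    and F: "finite F" "\<And>\<kappa>. (\<forall>i. \<bar>real_of_int (\<kappa> i)\<bar> \<le> R / h + 1) \<Longrightarrow> \<kappa> \<in> F"
  shows "h ^ CARD('n) * sqn lebesgue w \<le> (\<Sum>\<kappa>\<in>F. (\<integral>x. indicator (cell h \<kappa>) x * w x \<partial>lborel)\<^sup>2)
     + (real CARD('n) * h) powr (real CARD('n) + 2 * s) * sqn lebesgue (nl s w)"
proof -
  let ?n = "real CARD('n)" let ?\<alpha> = "?n + 2 * s"
  have [measurable]: "w \<in> borel_measurable borel" by (rule test_borel[OF w])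
  have [measurable]: "nl s w \<in> borel_measurable borel" by (rule nl_borel) measurable
  have iw: "integrable lborel w" using test_integrable(2)[OF w, of "\<lambda>_. 1"] by simp
  have iw2: "integrable lborel (\<lambda>x. (w x)\<^sup>2)"
    using test_integrable(2)[OF w test_continuous[OF w]] by (simp add: power2_eq_square)
  let ?c = "h ^ CARD('n)"
  define I where "I \<kappa> = (\<integral>x. indicator (cell h \<kappa>) x * w x \<partial>lborel)" for \<kappa> :: "'n \<Rightarrow> int"
  define J where "J \<kappa> = (\<integral>x. indicator (cell h \<kappa>) x * (w x)\<^sup>2 \<partial>lborel)" for \<kappa> :: "'n \<Rightarrow> int"
  define key where "key x = (\<lambda>i. \<lfloor>x $ i / h\<rfloor>)" for x :: "real ^ 'n"
  have key: "x \<in> cell h \<kappa> \<longleftrightarrow> \<kappa> = key x" for x \<kappa> by (auto simp: cell_def key_def)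
  have keyF: "key x \<in> F" if "w x \<noteq> 0" for x
  proof (rule F(2), intro allI)
    fix i
    have "x \<in> \<Omega>" using that test_support[OF w] by blast
    then have "\<bar>x $ i / h\<bar> \<le> R / h"
      using R[of x] component_le_norm_cart[of x i] h by (simp add: abs_divide divide_right_mono)
    then show "\<bar>real_of_int (key x i)\<bar> \<le> R / h + 1" unfolding key_def by linarith
  qed
  have sum_ind: "(\<Sum>\<kappa>\<in>F. indicator (cell h \<kappa>) x * f) = (if key x \<in> F then f else 0)" for x and f :: real
  proof -
    have "(\<Sum>\<kappa>\<in>F. indicator (cell h \<kappa>) x * f) = (\<Sum>\<kappa>\<in>F. if key x = \<kappa> then f else 0)"
      by (intro sum.cong) (auto simp: indicator_def key)
    then show ?thesis by (simp add: F(1))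
  qed
  have iJ: "integrable lborel (\<lambda>x. indicator (cell h \<kappa>) x * (w x)\<^sup>2)" for \<kappa>
    using integrable_mult_indicator[OF _ iw2, of "cell h \<kappa>"] by simp
  have "(\<Sum>\<kappa>\<in>F. J \<kappa>) = (\<integral>x. (\<Sum>\<kappa>\<in>F. indicator (cell h \<kappa>) x * (w x)\<^sup>2) \<partial>lborel)"
    unfolding J_def by (rule Bochner_Integration.integral_sum[symmetric]) (rule iJ)
  also have "\<dots> = (\<integral>x. (w x)\<^sup>2 \<partial>lborel)"
    unfolding sum_ind using keyF by (intro Bochner_Integration.integral_cong) auto
  also have "\<dots> = sqn lebesgue w" by (simp add: sqn_def integral_completion)
  finally have sumJ: "(\<Sum>\<kappa>\<in>F. J \<kappa>) = sqn lebesgue w" .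
  have bv: "(\<integral>\<^sup>+x. \<integral>\<^sup>+y. ennreal (indicator (cell h \<kappa>) x * indicator (cell h \<kappa>) y * (w x - w y)\<^sup>2) \<partial>lborel \<partial>lborel)
    = ennreal (2 * ?c * J \<kappa> - 2 * (I \<kappa>)\<^sup>2)" for \<kappa>
    unfolding I_def J_def
    by (rule block_variance(1)[OF _ _ cell_emeasure[OF h] _ iw iw2]) (use h in auto)
  have nnv: "0 \<le> 2 * ?c * J \<kappa> - 2 * (I \<kappa>)\<^sup>2" for \<kappa>
    unfolding I_def J_def
    by (rule block_variance(2)[OF _ _ cell_emeasure[OF h] _ iw iw2]) (use h in auto)
  have "ennreal (\<Sum>\<kappa>\<in>F. 2 * ?c * J \<kappa> - 2 * (I \<kappa>)\<^sup>2) = (\<Sum>\<kappa>\<in>F. ennreal (2 * ?c * J \<kappa> - 2 * (I \<kappa>)\<^sup>2))"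
    using nnv by (simp add: sum_ennreal)
  also have "\<dots> = (\<Sum>\<kappa>\<in>F. \<integral>\<^sup>+x. \<integral>\<^sup>+y. ennreal (indicator (cell h \<kappa>) x * indicator (cell h \<kappa>) y * (w x - w y)\<^sup>2) \<partial>lborel \<partial>lborel)"
    by (simp only: bv)
  also have "\<dots> = (\<integral>\<^sup>+x. (\<Sum>\<kappa>\<in>F. \<integral>\<^sup>+y. ennreal (indicator (cell h \<kappa>) x * indicator (cell h \<kappa>) y * (w x - w y)\<^sup>2) \<partial>lborel) \<partial>lborel)"
    by (rule nn_integral_sum[symmetric]) measurable
  also have "\<dots> = (\<integral>\<^sup>+x. \<integral>\<^sup>+y. (\<Sum>\<kappa>\<in>F. ennreal (indicator (cell h \<kappa>) x * indicator (cell h \<kappa>) y * (w x - w y)\<^sup>2)) \<partial>lborel \<partial>lborel)"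
    by (intro nn_integral_cong nn_integral_sum[symmetric]) measurable
  also have "\<dots> \<le> (\<integral>\<^sup>+x. \<integral>\<^sup>+y. ennreal ((?n * h) powr ?\<alpha>) * ennreal ((norm (nl s w (x, y)))\<^sup>2) \<partial>lborel \<partial>lborel)"
  proof (intro nn_integral_mono)
    fix x y
    have "(\<Sum>\<kappa>\<in>F. indicator (cell h \<kappa>) x * indicator (cell h \<kappa>) y * (w x - w y)\<^sup>2)
       \<le> (?n * h) powr ?\<alpha> * (norm (nl s w (x, y)))\<^sup>2"
    proof (cases "key x = key y \<and> x \<noteq> y")
      case True
      have "(\<Sum>\<kappa>\<in>F. indicator (cell h \<kappa>) x * indicator (cell h \<kappa>) y * (w x - w y)\<^sup>2)
        = (\<Sum>\<kappa>\<in>F. indicator (cell h \<kappa>) x * (w x - w y)\<^sup>2)"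
        using True by (intro sum.cong) (auto simp: indicator_def key)
      also have "\<dots> \<le> (w x - w y)\<^sup>2" unfolding sum_ind by simp
      also have "\<dots> \<le> (?n * h) powr ?\<alpha> * ((w x - w y)\<^sup>2 / norm (x - y) powr ?\<alpha>)"
      proof -
        have "norm (x - y) \<le> ?n * h" using True by (intro cell_diameter[OF h, of _ "key x"]) (auto simp: key)
        then have "norm (x - y) powr ?\<alpha> \<le> (?n * h) powr ?\<alpha>" using s by (intro powr_mono2) auto
        then have "norm (x - y) powr ?\<alpha> * (w x - w y)\<^sup>2 \<le> (?n * h) powr ?\<alpha> * (w x - w y)\<^sup>2"
          by (rule mult_right_mono) simp
        moreover have "0 < norm (x - y) powr ?\<alpha>" using True by simp
        ultimately show ?thesis by (simp add: field_simps)
      qed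
      finally show ?thesis by (simp add: nl_sq)
    next
      case False
      then have "(\<Sum>\<kappa>\<in>F. indicator (cell h \<kappa>) x * indicator (cell h \<kappa>) y * (w x - w y)\<^sup>2) = 0"
        by (intro sum.neutral) (auto simp: indicator_def key)
      then show ?thesis by simp
    qed
    then have "ennreal (\<Sum>\<kappa>\<in>F. indicator (cell h \<kappa>) x * indicator (cell h \<kappa>) y * (w x - w y)\<^sup>2)
       \<le> ennreal ((?n * h) powr ?\<alpha> * (norm (nl s w (x, y)))\<^sup>2)" by (rule ennreal_leI)
    moreover have "(\<Sum>\<kappa>\<in>F. ennreal (indicator (cell h \<kappa>) x * indicator (cell h \<kappa>) y * (w x - w y)\<^sup>2))
       = ennreal (\<Sum>\<kappa>\<in>F. indicator (cell h \<kappa>) x * indicator (cell h \<kappa>) y * (w x - w y)\<^sup>2)"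
      by (rule sum_ennreal) auto
    moreover have "ennreal ((?n * h) powr ?\<alpha> * (norm (nl s w (x, y)))\<^sup>2)
       = ennreal ((?n * h) powr ?\<alpha>) * ennreal ((norm (nl s w (x, y)))\<^sup>2)"
      by (rule ennreal_mult) auto
    ultimately show "(\<Sum>\<kappa>\<in>F. ennreal (indicator (cell h \<kappa>) x * indicator (cell h \<kappa>) y * (w x - w y)\<^sup>2))
       \<le> ennreal ((?n * h) powr ?\<alpha>) * ennreal ((norm (nl s w (x, y)))\<^sup>2)" by (simp only:)
  qed
  also have "\<dots> = (\<integral>\<^sup>+z. ennreal ((?n * h) powr ?\<alpha>) * ennreal ((norm (nl s w z))\<^sup>2) \<partial>(lborel \<Otimes>\<^sub>M lborel))"
    by (rule lborel.nn_integral_fst) (simp add: lborel_prod)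
  also have "\<dots> = ennreal ((?n * h) powr ?\<alpha>) * (\<integral>\<^sup>+z. ennreal ((norm (nl s w z))\<^sup>2) \<partial>lborel)"
    unfolding lborel_prod by (rule nn_integral_cmult) measurable
  also have "\<dots> = ennreal ((?n * h) powr ?\<alpha>) * ennreal (sqn lebesgue (nl s w))"
    using L2_nn[OF wL] by (simp add: nn_integral_completion)
  finally have "(\<Sum>\<kappa>\<in>F. 2 * ?c * J \<kappa> - 2 * (I \<kappa>)\<^sup>2) \<le> (?n * h) powr ?\<alpha> * sqn lebesgue (nl s w)"
    by (simp add: ennreal_mult[symmetric] sqn_nonneg)
  moreover have "(\<Sum>\<kappa>\<in>F. 2 * ?c * J \<kappa> - 2 * (I \<kappa>)\<^sup>2) = 2 * (?c * sqn lebesgue w) - 2 * (\<Sum>\<kappa>\<in>F. (I \<kappa>)\<^sup>2)"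
    unfolding sumJ[symmetric] by (simp add: sum_subtractf sum_distrib_left sum_distrib_right mult_ac)
  moreover have "0 \<le> (?n * h) powr ?\<alpha> * sqn lebesgue (nl s w)" by (simp add: sqn_nonneg)
  ultimately show ?thesis unfolding I_def by linarith
qed

text \<open>By Cantor's diagonal argument.\<close>

lemma countably_many_convergent_subsequence:
  fixes X :: "'i::countable \<Rightarrow> nat \<Rightarrow> real"
  assumes bdd: "\<And>i. \<exists>B. \<forall>k. \<bar>X i k\<bar> \<le> B"
  obtains r where "strict_mono (r :: nat \<Rightarrow> nat)" "\<And>i. convergent (\<lambda>k. X i (r k))"
proof -
  interpret subseqs "\<lambda>n r. convergent (\<lambda>k. X (from_nat n) (r k))"
  proof
    fix n and q :: "nat \<Rightarrow> nat" assume "strict_mono q"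
    obtain B where "\<And>k. \<bar>X (from_nat n) k\<bar> \<le> B" using bdd by blast
    then have "bounded (range (\<lambda>k. X (from_nat n) (q k)))" unfolding bounded_iff by auto
    from bounded_imp_convergent_subsequence[OF this]
    obtain l r' where "strict_mono r'" "((\<lambda>k. X (from_nat n) (q k)) \<circ> r') \<longlonglongrightarrow> l" by blast
    then show "\<exists>r'. strict_mono r' \<and> convergent (\<lambda>k. X (from_nat n) ((q \<circ> r') k))"
      by (auto simp: o_def convergent_def)
  qed
  have "convergent (\<lambda>k. X i (diagseq k))" for i
  proof -
    have "convergent (\<lambda>k. X (from_nat (to_nat i)) ((diagseq \<circ> ((+) (Suc (to_nat i)))) k))"
    proof (rule diagseq_holds)
      fix r q :: "nat \<Rightarrow> nat" and n
      assume "strict_mono r" and c: "convergent (\<lambda>k. X (from_nat n) (q k))"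
      from convergent_subseq_convergent[OF c \<open>strict_mono r\<close>]
      show "convergent (\<lambda>k. X (from_nat n) ((q \<circ> r) k))" by (simp add: o_def)
    qed
    then have "convergent (\<lambda>k. X i (diagseq (k + Suc (to_nat i))))" by (simp add: add.commute)
    then show ?thesis by (rule convergent_ignore_initial_segment[THEN iffD1])
  qed
  with subseq_diagseq that show ?thesis by blast
qed

text \<open>By the cell estimate for \<open>\<phi>\<^sub>k - \<phi>\<^sub>l\<close>, divided by \<open>h\<^sup>n\<close>, the \<open>L\<^sup>2\<close> distance is controlled by the
  differences of finitely many cell averages and an error of order \<open>h\<^sup>2\<^sup>s\<close>.  Along a subsequence all
  averages over all cells of side \<open>1/(m + 1)\<close> converge.\<close>

lemma rellich:
  fixes \<Omega> :: "(real ^ 'n) set" and \<phi> :: "nat \<Rightarrow> real ^ 'n \<Rightarrow> real"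
  assumes "bounded \<Omega>" and s: "0 < s" and \<phi>: "\<And>k. \<phi> k \<in> test_functions \<Omega>"
    and nlL: "\<And>k. nl s (\<phi> k) \<in> L2 lebesgue"
    and A: "\<And>k. sqn lebesgue (\<phi> k) \<le> A" "\<And>k. sqn lebesgue (nl s (\<phi> k)) \<le> A"
  obtains r where "strict_mono (r :: nat \<Rightarrow> nat)"
    "\<forall>e>0. \<exists>N. \<forall>k\<ge>N. \<forall>l\<ge>N. sqn lebesgue (\<lambda>x. \<phi> (r k) x - \<phi> (r l) x) < e"
proof -
  let ?n = "real CARD('n)"
  obtain R where R: "\<And>x. x \<in> \<Omega> \<Longrightarrow> norm x \<le> R" using assms(1) unfolding bounded_iff by blast
  define h where "h m = 1 / real (Suc m)" for m
  have h: "h m > 0" for m by (simp add: h_def)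
  define X where "X i k = (\<integral>x. indicator (cell (h (fst i)) (snd i)) x * \<phi> k x \<partial>lborel)" for i :: "nat \<times> ('n \<Rightarrow> int)" and k
  have A0: "0 \<le> A" using A(1) sqn_nonneg order_trans by blast
  have i1: "integrable lborel (\<phi> k)" for k using test_integrable(2)[OF \<phi>, of "\<lambda>_. 1"] by simp
  have i2: "integrable lborel (\<lambda>x. (\<phi> k x)\<^sup>2)" for k
    using test_integrable(2)[OF \<phi> test_continuous[OF \<phi>], of k k] by (simp add: power2_eq_square)
  have iX: "integrable lborel (\<lambda>x. indicator (cell (h m) \<kappa>) x * \<phi> k x)" for m \<kappa> k
    using integrable_mult_indicator[OF _ i1, of "cell (h m) \<kappa>" k] by simp
  have "\<exists>B. \<forall>k. \<bar>X i k\<bar> \<le> B" for i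
  proof (intro exI allI)
    fix k
    let ?Q = "cell (h (fst i)) (snd i)"
    have iQ: "integrable lborel (indicator ?Q :: _ \<Rightarrow> real)"
      using cell_emeasure[OF h, of "fst i" "snd i"] by (intro integrable_real_indicator) auto
    have "\<bar>X i k\<bar> \<le> (\<integral>x. \<bar>indicator ?Q x * \<phi> k x\<bar> \<partial>lborel)" unfolding X_def by (rule integral_abs_bound)
    also have "\<dots> \<le> (\<integral>x. indicator ?Q x + (\<phi> k x)\<^sup>2 \<partial>lborel)"
    proof (rule integral_mono)
      fix x
      have "2 * \<bar>\<phi> k x\<bar> \<le> 1 + (\<phi> k x)\<^sup>2" using sum_squares_bound[of 1 "\<bar>\<phi> k x\<bar>"] by simp
      then have "\<bar>\<phi> k x\<bar> \<le> 1 + (\<phi> k x)\<^sup>2" by linarith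
      then show "\<bar>indicator ?Q x * \<phi> k x\<bar> \<le> indicator ?Q x + (\<phi> k x)\<^sup>2" by (auto simp: indicator_def)
    qed (use iX[THEN integrable_abs] iQ i2 in auto)
    also have "\<dots> = measure lborel ?Q + sqn lebesgue (\<phi> k)"
      using iQ i2 test_borel[OF \<phi>] by (simp add: sqn_def integral_completion)
    finally show "\<bar>X i k\<bar> \<le> measure lborel ?Q + A" using A(1)[of k] by linarith
  qed
  then obtain r where r: "strict_mono r" "\<And>i. convergent (\<lambda>k. X i (r k))"
    using countably_many_convergent_subsequence[of X] by metis
  show ?thesis
  proof (rule that[OF r(1)], intro allI impI)
    fix e :: real assume e: "e > 0"
    define C where "C = ?n powr (?n + 2 * s) * (4 * A)"
    have "(\<lambda>m. C * h m powr (2 * s)) \<longlonglongrightarrow> C * 0"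
      unfolding h_def using s
      by (intro tendsto_mult tendsto_const tendsto_zero_powrI[where b = "2 * s", OF LIMSEQ_Suc[OF lim_1_over_n]]) auto
    then have "\<forall>\<^sub>F m in sequentially. C * h m powr (2 * s) < e / 2"
      using e by (intro order_tendstoD(2)) auto
    then obtain m where m: "C * h m powr (2 * s) < e / 2" by (auto simp: eventually_sequentially)
    define F where "F = {\<kappa> :: 'n \<Rightarrow> int. \<forall>i. \<bar>real_of_int (\<kappa> i)\<bar> \<le> R / h m + 1}"
    have finF: "finite F"
    proof (rule finite_subset)
      show "F \<subseteq> PiE UNIV (\<lambda>_. {- \<lceil>R / h m + 1\<rceil>..\<lceil>R / h m + 1\<rceil>})"
      proof
        fix \<kappa> assume "\<kappa> \<in> F"
        then have "\<bar>real_of_int (\<kappa> i)\<bar> \<le> R / h m + 1" for i by (simp add: F_def)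
        then have "- \<lceil>R / h m + 1\<rceil> \<le> \<kappa> i \<and> \<kappa> i \<le> \<lceil>R / h m + 1\<rceil>" for i
          using le_of_int_ceiling[of "R / h m + 1"] by (smt (verit) abs_le_iff of_int_le_iff of_int_minus)
        then show "\<kappa> \<in> PiE UNIV (\<lambda>_. {- \<lceil>R / h m + 1\<rceil>..\<lceil>R / h m + 1\<rceil>})" by auto
      qed
    qed (simp add: finite_PiE)
    have est: "sqn lebesgue (\<lambda>x. \<phi> k x - \<phi> l x) \<le> (\<Sum>\<kappa>\<in>F. (X (m, \<kappa>) k - X (m, \<kappa>) l)\<^sup>2) / h m ^ CARD('n) + e / 2" for k l
    proof -
      let ?w = "\<lambda>x. \<phi> k x - \<phi> l x"
      have w: "?w \<in> test_functions \<Omega>" by (rule test_diff[OF \<phi> \<phi>])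
      have wL: "nl s ?w \<in> L2 lebesgue" unfolding nl_diff by (rule L2_diff[OF nlL nlL])
      have "sqn lebesgue (nl s ?w) \<le> 2 * sqn lebesgue (nl s (\<phi> k)) + 2 * sqn lebesgue (nl s (\<phi> l))"
        using sqn_add_le[OF nlL L2_scale[OF nlL, of "-1"], of k l]
        by (simp add: nl_diff sqn_cmult[of _ "-1", simplified])
      then have w4: "sqn lebesgue (nl s ?w) \<le> 4 * A" using A(2)[of k] A(2)[of l] by linarith
      have Xw: "(\<integral>x. indicator (cell (h m) \<kappa>) x * ?w x \<partial>lborel) = X (m, \<kappa>) k - X (m, \<kappa>) l" for \<kappa>
        unfolding X_def using iX by (simp add: right_diff_distrib)
      have "h m ^ CARD('n) * sqn lebesgue ?w \<le> (\<Sum>\<kappa>\<in>F. (X (m, \<kappa>) k - X (m, \<kappa>) l)\<^sup>2)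
          + (?n * h m) powr (?n + 2 * s) * sqn lebesgue (nl s ?w)"
        unfolding Xw[symmetric] by (rule cell_estimate[OF w R h s wL finF]) (auto simp: F_def)
      also have "(?n * h m) powr (?n + 2 * s) * sqn lebesgue (nl s ?w) \<le> (?n * h m) powr (?n + 2 * s) * (4 * A)"
        by (intro mult_left_mono w4) auto
      also have "\<dots> = h m ^ CARD('n) * (C * h m powr (2 * s))"
        using h[of m] by (simp add: C_def powr_mult powr_add powr_realpow)
      also have "\<dots> \<le> h m ^ CARD('n) * (e / 2)" using m h[of m] by (intro mult_left_mono) auto
      finally show ?thesis using h[of m] by (simp add: field_simps)
    qed
    define Y where "Y k l = (\<Sum>\<kappa>\<in>F. (X (m, \<kappa>) (r k) - X (m, \<kappa>) (r l))\<^sup>2) / h m ^ CARD('n)" for k l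
    have "\<exists>N. \<forall>k\<ge>N. \<forall>l\<ge>N. Y k l < e / 2"
    proof -
      define c where "c = real (card F) + 1"
      have c: "c > 0" by (simp add: c_def)
      define d where "d = sqrt ((e / 2) * h m ^ CARD('n) / c)"
      have d: "d > 0" using e h[of m] c by (simp add: d_def)
      have "\<exists>N. \<forall>k\<ge>N. \<forall>l\<ge>N. \<bar>X (m, \<kappa>) (r k) - X (m, \<kappa>) (r l)\<bar> < d" for \<kappa>
        using convergent_Cauchy[OF r(2)[of "(m, \<kappa>)"]] d unfolding Cauchy_def dist_real_def by blast
      then obtain N where N: "\<And>\<kappa> k l. k \<ge> N \<kappa> \<Longrightarrow> l \<ge> N \<kappa> \<Longrightarrow> \<bar>X (m, \<kappa>) (r k) - X (m, \<kappa>) (r l)\<bar> < d" by metis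
      have "Y k l < e / 2" if "k \<ge> (\<Sum>\<kappa>\<in>F. N \<kappa>)" "l \<ge> (\<Sum>\<kappa>\<in>F. N \<kappa>)" for k l
      proof -
        have "(X (m, \<kappa>) (r k) - X (m, \<kappa>) (r l))\<^sup>2 \<le> d\<^sup>2" if "\<kappa> \<in> F" for \<kappa>
        proof -
          have "N \<kappa> \<le> (\<Sum>\<kappa>\<in>F. N \<kappa>)" using that finF by (intro member_le_sum) auto
          then have "\<bar>X (m, \<kappa>) (r k) - X (m, \<kappa>) (r l)\<bar> \<le> d"
            using N[of \<kappa> k l] \<open>k \<ge> _\<close> \<open>l \<ge> _\<close> by linarith
          then have "\<bar>X (m, \<kappa>) (r k) - X (m, \<kappa>) (r l)\<bar>\<^sup>2 \<le> d\<^sup>2" by (intro power_mono) auto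
          then show ?thesis by simp
        qed
        then have "(\<Sum>\<kappa>\<in>F. (X (m, \<kappa>) (r k) - X (m, \<kappa>) (r l))\<^sup>2) \<le> real (card F) * d\<^sup>2"
          using sum_bounded_above[of F "\<lambda>\<kappa>. (X (m, \<kappa>) (r k) - X (m, \<kappa>) (r l))\<^sup>2" "d\<^sup>2"] by simp
        also have "\<dots> < c * d\<^sup>2" using d by (simp add: c_def)
        also have "\<dots> = (e / 2) * h m ^ CARD('n)" using e h[of m] c by (simp add: d_def)
        finally show ?thesis using h[of m] by (simp add: Y_def divide_less_eq)
      qed
      then show ?thesis by blast
    qed
    then obtain N where N: "\<And>k l. k \<ge> N \<Longrightarrow> l \<ge> N \<Longrightarrow> Y k l < e / 2" by blast
    have "sqn lebesgue (\<lambda>x. \<phi> (r k) x - \<phi> (r l) x) < e" if "k \<ge> N" "l \<ge> N" for k l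
      using est[of "r k" "r l"] N[OF that] unfolding Y_def by linarith
    then show "\<exists>N. \<forall>k\<ge>N. \<forall>l\<ge>N. sqn lebesgue (\<lambda>x. \<phi> (r k) x - \<phi> (r l) x) < e" by blast
  qed
qed

section \<open>Elementary inequalities for powers\<close>

text \<open>A convex function lies above its tangents.\<close>

lemma powr_tangent:
  fixes a x q :: real
  assumes "0 \<le> a" "0 \<le> x" "1 < q"
  shows "a powr q + q * a powr (q - 1) * (x - a) \<le> x powr q"
proof -
  consider "a = 0" | "x = 0" | "a > 0" "x > 0" using assms by linarith
  then show ?thesis
  proof cases
    case 1
    then show ?thesis using assms by simp
  next
    case 2
    have "a powr (q - 1) * a = a powr q" if "a > 0" using that by (simp add: powr_diff)
    then have "q * a powr (q - 1) * (x - a) = - (q * a powr q)" using 2 assms(1) by (cases "a = 0") auto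
    moreover have "a powr q \<le> q * a powr q" using assms by (simp add: mult_le_cancel_right1)
    ultimately show ?thesis using powr_ge_zero[of x q] by linarith
  next
    case 3
    have d: "((\<lambda>t. t powr q) has_real_derivative q * t powr (q - 1)) (at t)" if "t > 0" for t
      using that by (auto intro!: derivative_eq_intros)
    consider "x = a" | "a < x" | "x < a" by linarith
    then show ?thesis
    proof cases
      case 2
      obtain z where z: "a < z" "x powr q - a powr q = (x - a) * (q * z powr (q - 1))"
        using MVT2[OF 2, of "\<lambda>t. t powr q" "\<lambda>t. q * t powr (q - 1)"] d 3 by (meson less_le_trans)
      have "a powr (q - 1) \<le> z powr (q - 1)" using z(1) 3 assms by (intro powr_mono2) auto
      then have "(x - a) * (q * a powr (q - 1)) \<le> (x - a) * (q * z powr (q - 1))"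
        using 2 assms by (intro mult_left_mono) auto
      then show ?thesis using z(2) by (simp add: mult_ac)
    next
      case x: 3
      obtain z where z: "x < z" "z < a" "a powr q - x powr q = (a - x) * (q * z powr (q - 1))"
        using MVT2[OF x, of "\<lambda>t. t powr q" "\<lambda>t. q * t powr (q - 1)"] d 3 by (meson less_le_trans)
      have "z powr (q - 1) \<le> a powr (q - 1)" using z 3 assms by (intro powr_mono2) auto
      then have "(a - x) * (q * z powr (q - 1)) \<le> (a - x) * (q * a powr (q - 1))"
        using x assms by (intro mult_left_mono) auto
      then show ?thesis using z(3) by (simp add: algebra_simps)
    qed simp
  qed
qed

lemma powr_abs_tangent:
  fixes a b q :: real
  assumes "0 \<le> a" "1 < q"
  shows "a powr q + q * a powr (q - 1) * b \<le> \<bar>a + b\<bar> powr q"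
proof -
  have "q * a powr (q - 1) * b \<le> q * a powr (q - 1) * (\<bar>a + b\<bar> - a)"
    using assms by (intro mult_left_mono) auto
  with powr_tangent[of a "\<bar>a + b\<bar>" q] assms show ?thesis by linarith
qed

text \<open>The product is at most the \<open>q\<close>-th power of the larger factor.\<close>

lemma powr_young_sq:
  fixes X Y q :: real
  assumes "0 \<le> X" "0 \<le> Y" "2 < q"
  shows "X powr (q - 2) * Y\<^sup>2 \<le> X powr q + Y powr q"
proof -
  have sq: "t powr (q - 2) * t\<^sup>2 = t powr q" if "0 \<le> t" for t :: real
    using that assms(3) by (cases "t = 0") (auto simp: powr_diff)
  show ?thesis
  proof (cases "Y \<le> X")
    case True
    then have "X powr (q - 2) * Y\<^sup>2 \<le> X powr (q - 2) * X\<^sup>2"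
      using assms by (intro mult_left_mono power_mono) auto
    then show ?thesis using sq[OF assms(1)] by (simp add: add_increasing2)
  next
    case False
    then have "X powr (q - 2) * Y\<^sup>2 \<le> Y powr (q - 2) * Y\<^sup>2"
      using assms by (intro mult_right_mono powr_mono2) auto
    then show ?thesis using sq[OF assms(2)] by (simp add: add_increasing)
  qed
qed

lemma powr_young_one:
  fixes X Y q :: real
  assumes "0 \<le> X" "0 \<le> Y" "2 < q"
  shows "X powr (q - 1) * Y \<le> X powr q + Y powr q"
proof -
  have sq: "t powr (q - 1) * t = t powr q" if "0 \<le> t" for t :: real
    using that assms(3) by (cases "t = 0") (auto simp: powr_diff)
  show ?thesis
  proof (cases "Y \<le> X")
    case True
    then have "X powr (q - 1) * Y \<le> X powr (q - 1) * X"
      using assms by (intro mult_left_mono) auto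
    then show ?thesis using sq[OF assms(1)] by (simp add: add_increasing2)
  next
    case False
    then have "X powr (q - 1) * Y \<le> Y powr (q - 1) * Y"
      using assms by (intro mult_right_mono powr_mono2) auto
    then show ?thesis using sq[OF assms(2)] by (simp add: add_increasing)
  qed
qed

lemma sq_le_one_plus_powr:
  fixes t q :: real
  assumes "2 < q"
  shows "t\<^sup>2 \<le> 1 + \<bar>t\<bar> powr q"
proof (cases "\<bar>t\<bar> \<le> 1")
  case True
  then have "t\<^sup>2 \<le> 1" by (simp add: abs_square_le_1)
  then show ?thesis by (simp add: add_increasing2)
next
  case False
  then have "\<bar>t\<bar> powr 2 \<le> \<bar>t\<bar> powr q" using assms by (intro powr_mono) auto
  then show ?thesis by simp
qed

text \<open>The midpoint value of a convex function falls short of the mean value; here the defect is bounded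
  from above.  It is at most a quarter of the distance times the difference of the slopes at \<open>a\<close> and \<open>b\<close>, by
  the tangents at both points.  As \<open>q > 2\<close>, the derivative is convex as well, and its tangent at the
  larger point bounds the difference of the slopes.\<close>

lemma powr_midpoint:
  fixes a b q :: real
  assumes "0 \<le> a" "0 \<le> b" "2 < q"
  shows "(a powr q + b powr q) / 2 - q * (q - 1) * (max a b powr (q - 2) * ((a - b) / 2)\<^sup>2) \<le> ((a + b) / 2) powr q"
proof -
  have main: "(a powr q + b powr q) / 2 - q * (q - 1) * (a powr (q - 2) * ((a - b) / 2)\<^sup>2) \<le> ((a + b) / 2) powr q"
    if "0 \<le> b" "b \<le> a" for a b :: real
  proof -
    define w where "w = (a - b) / 2"
    have w: "0 \<le> w" "(a + b) / 2 - a = - w" "(a + b) / 2 - b = w" "a - b = 2 * w"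
      using that by (auto simp: w_def field_simps)
    have 1: "a powr q - q * a powr (q - 1) * w \<le> ((a + b) / 2) powr q"
      using powr_tangent[of a "(a + b) / 2" q] that assms(3) unfolding w by simp
    have 2: "b powr q + q * b powr (q - 1) * w \<le> ((a + b) / 2) powr q"
      using powr_tangent[of b "(a + b) / 2" q] that assms(3) unfolding w by simp
    have "a powr (q - 1) + (q - 1) * a powr (q - 1 - 1) * (b - a) \<le> b powr (q - 1)"
      using powr_tangent[of a b "q - 1"] that assms(3) by simp
    then have "a powr (q - 1) - b powr (q - 1) \<le> (q - 1) * a powr (q - 2) * (2 * w)"
      using w(4) by (simp add: algebra_simps)
    from mult_left_mono[OF this, of "q / 2 * w"]
    have 3: "q / 2 * w * (a powr (q - 1) - b powr (q - 1)) \<le> q * (q - 1) * (a powr (q - 2) * w\<^sup>2)"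
      using w(1) assms(3) by (simp add: power2_eq_square mult_ac)
    define A B T where "A = q * a powr (q - 1) * w" and "B = q * b powr (q - 1) * w"
      and "T = q * (q - 1) * (a powr (q - 2) * w\<^sup>2)"
    have "q / 2 * w * (a powr (q - 1) - b powr (q - 1)) = A / 2 - B / 2"
      by (simp add: A_def B_def algebra_simps)
    with 1 2 3 show ?thesis unfolding w_def[symmetric] A_def[symmetric] B_def[symmetric] T_def[symmetric]
      by (simp add: field_simps)
  qed
  show ?thesis
  proof (cases "b \<le> a")
    case True
    then show ?thesis using main[of b a] assms by (simp add: max_def)
  next
    case False
    then show ?thesis using main[of a b] assms by (simp add: max_def add.commute power2_commute power_divide)
  qed
qed

section \<open>The eigenvalues and the Sobolev constant\<close>

text \<open>Infima in \<^typ>\<open>ennreal\<close> of real quantities are unwrapped once, so that afterwards only lower bounds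
  and almost minimizers are used.\<close>

lemma enn2real_INF:
  fixes g :: "'a \<Rightarrow> real"
  assumes "A \<noteq> {}" and pos: "\<And>u. u \<in> A \<Longrightarrow> 0 \<le> g u"
  defines "l \<equiv> enn2real (INF u\<in>A. ennreal (g u))"
  shows "0 \<le> l" "\<And>u. u \<in> A \<Longrightarrow> l \<le> g u" "\<And>e. e > 0 \<Longrightarrow> \<exists>u\<in>A. g u < l + e"
proof -
  show l0: "0 \<le> l" by (simp add: l_def)
  obtain u0 where u0: "u0 \<in> A" using assms(1) by blast
  have "(INF u\<in>A. ennreal (g u)) \<le> ennreal (g u0)" using u0 by (rule INF_lower)
  then have "(INF u\<in>A. ennreal (g u)) \<noteq> top" by (metis ennreal_less_top leD top.not_eq_extremum)
  then have "(INF u\<in>A. ennreal (g u)) < top" by (simp only: less_top)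
  then have eq: "(INF u\<in>A. ennreal (g u)) = ennreal l" unfolding l_def by (rule ennreal_enn2real[symmetric])
  show "l \<le> g u" if "u \<in> A" for u
    using INF_lower[OF that, of "\<lambda>u. ennreal (g u)"] pos[OF that] by (simp add: eq)
  show "\<exists>u\<in>A. g u < l + e" if "e > 0" for e
  proof -
    have "(INF u\<in>A. ennreal (g u)) < ennreal (l + e)"
      unfolding eq using that l0 by (simp add: ennreal_less_iff)
    then obtain u where "u \<in> A" "ennreal (g u) < ennreal (l + e)" by (auto simp: INF_less_iff)
    then show ?thesis using pos by (auto simp: ennreal_less_iff)
  qed
qed

text \<open>The standing assumptions; as a locale they can be instantiated with a second, larger domain.\<close>

locale mixed_problem =
  fixes \<Omega> :: "(real ^ 'n) set" and s :: real
  assumes n3: "CARD('n) \<ge> 3" and s0: "0 < s" and s1: "s < 1"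
    and ne: "\<Omega> \<noteq> {}" and op: "open \<Omega>" and bd: "bounded \<Omega>"
begin

definition p :: real where "p = crit_exp CARD('n)"

text \<open>The critical norm is used through its \<open>p\<close>-th power, which has simple lower bounds along lines;
  the squared norm is \<open>pint u powr (2 / p)\<close>.\<close>

definition pint :: "(real ^ 'n \<Rightarrow> real) \<Rightarrow> real" where
  "pint u = (\<integral>x. \<bar>u x\<bar> powr p \<partial>lebesgue)"

definition vol :: real where "vol = measure lebesgue \<Omega>"

lemma p2: "2 < p"
  using crit_exp_facts(1)[OF n3] by (simp add: p_def)

lemma \<Omega>_sets: "\<Omega> \<in> sets lebesgue"
  using op by (simp add: borel_open)

lemma vol_integrable: "integrable lebesgue (indicator \<Omega> :: _ \<Rightarrow> real)" "(\<integral>x. indicator \<Omega> x \<partial>lebesgue) = vol"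
proof -
  have "emeasure lborel \<Omega> < \<infinity>" using bd by (rule emeasure_bounded_finite)
  then have "emeasure lebesgue \<Omega> < \<infinity>" using op by (simp add: borel_open)
  then show "integrable lebesgue (indicator \<Omega> :: _ \<Rightarrow> real)" using \<Omega>_sets by (intro integrable_real_indicator)
  show "(\<integral>x. indicator \<Omega> x \<partial>lebesgue) = vol" by (simp add: vol_def)
qed

lemma vol_nonneg: "0 \<le> vol" by (simp add: vol_def)

lemma pint_nonneg: "0 \<le> pint u"
  unfolding pint_def by (intro integral_nonneg_AE) auto

lemma pint_scale: "pint (\<lambda>x. c * u x) = \<bar>c\<bar> powr p * pint u"
  by (simp add: pint_def abs_mult powr_mult)

lemma test_nl: "\<phi> \<in> test_functions \<Omega> \<Longrightarrow> nl s \<phi> \<in> L2 lebesgue"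
  using approx_nl[OF n3 s0 s1 test_approx] by (simp add: L2conv_def)

lemma test_pint: "\<phi> \<in> test_functions \<Omega>' \<Longrightarrow> integrable lebesgue (\<lambda>x. \<bar>\<phi> x\<bar> powr p)"
proof -
  assume \<phi>: "\<phi> \<in> test_functions \<Omega>'"
  obtain K where K: "compact K" "\<And>x. x \<notin> K \<Longrightarrow> \<phi> x = 0" using test_compactE[OF \<phi>] by metis
  show ?thesis
  proof (rule integrable_compact_support(2)[OF K(1)])
    show "continuous_on UNIV (\<lambda>x. \<bar>\<phi> x\<bar> powr p)"
      using p2 by (intro continuous_on_powr' continuous_intros test_continuous[OF \<phi>]) auto
  qed (simp add: K(2))
qed

lemma dirichlet_test: "\<phi> \<in> test_functions \<Omega>' \<Longrightarrow> dirichlet_sq \<phi> = ennreal (sqn lebesgue (grad \<phi>))"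
  unfolding dirichlet_sq_def by (rule L2_nn[OF test_L2(2)])

lemma gagliardo_test: "\<phi> \<in> test_functions \<Omega> \<Longrightarrow> gagliardo_sq s \<phi> = ennreal (sqn lebesgue (nl s \<phi>))"
  unfolding gagliardo_nl by (rule L2_nn[OF test_nl])

lemma Lp_norm2_test: "Lp_norm 2 UNIV \<phi> = sqrt (sqn lebesgue \<phi>)" for \<phi> :: "real ^ 'n \<Rightarrow> real"
  by (simp add: Lp_norm_def sqn_def set_lebesgue_integral_def powr_half_sqrt)

lemma Lp_normp: "Lp_norm p UNIV u = pint u powr (1 / p)" for u :: "real ^ 'n \<Rightarrow> real"
  by (simp add: Lp_norm_def pint_def set_lebesgue_integral_def)

lemma exists_nonzero_test:
  obtains \<phi> where "\<phi> \<in> test_functions \<Omega>" "sqn lebesgue \<phi> > 0" "pint \<phi> > 0"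
proof -
  obtain z where z: "z \<in> \<Omega>" using ne by blast
  obtain a b where ab: "z \<in> box a b" "cbox a b \<subseteq> \<Omega>"
    using op z open_contains_cbox by metis
  define \<phi> where "\<phi> = box_bump a b 0"
  have \<phi>: "\<phi> \<in> test_functions \<Omega>" unfolding \<phi>_def by (rule box_bump_test[OF ab(2)])
  have pos: "\<phi> x \<noteq> 0 \<longleftrightarrow> x \<in> box a b" for x unfolding \<phi>_def by (rule box_bump_pos)
  have notnull: "\<not> (AE x in lebesgue. x \<notin> box a b)"
  proof
    assume "AE x in lebesgue. x \<notin> box a b"
    then have "box a b \<in> null_sets lebesgue" by (simp add: completion.AE_iff_null_sets)
    then have "negligible (box a b)" by (simp add: negligible_iff_null_sets)
    then show False using open_not_negligible[of "box a b"] ab(1) by auto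
  qed
  have z: "AE x in lebesgue. x \<notin> box a b" if "(\<integral>x. f x \<partial>lebesgue) = 0" "integrable lebesgue f" "\<And>x. 0 \<le> f x" "\<And>x. f x = 0 \<longleftrightarrow> \<phi> x = 0" for f :: "_ \<Rightarrow> real"
  proof -
    have "AE x in lebesgue. f x = 0" using integral_nonneg_eq_0_iff_AE[OF that(2)] that(1,3) by simp
    then show ?thesis by eventually_elim (use that(4) pos in auto)
  qed
  have "sqn lebesgue \<phi> \<noteq> 0"
    using z[of "\<lambda>x. (norm (\<phi> x))\<^sup>2"] notnull L2_integrable[OF test_L2(1)[OF \<phi>]] by (auto simp: sqn_def)
  moreover have "pint \<phi> \<noteq> 0"
    using z[of "\<lambda>x. \<bar>\<phi> x\<bar> powr p"] notnull test_pint[OF \<phi>] by (auto simp: pint_def)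
  ultimately show ?thesis using that[OF \<phi>] sqn_nonneg[of lebesgue \<phi>] pint_nonneg[of \<phi>] by auto
qed

text \<open>The gradient is a separate argument, in order to apply the energy to limits of test functions.\<close>

definition energy :: "(real ^ 'n \<Rightarrow> real) \<Rightarrow> (real ^ 'n \<Rightarrow> real ^ 'n) \<Rightarrow> real" where
  "energy u G = sqn lebesgue G + sqn lebesgue (nl s u)"

lemma energy_nonneg: "0 \<le> energy u G"
  by (simp add: energy_def sqn_nonneg)

lemma grad_scale_test: "\<phi> \<in> test_functions \<Omega>' \<Longrightarrow> grad (\<lambda>x. c * \<phi> x) = (\<lambda>x. c *\<^sub>R grad \<phi> x)"
  using grad_cmult[OF test_smooth] by (auto simp: fun_eq_iff)

lemma test_scale:
  assumes "\<phi> \<in> test_functions \<Omega>'"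
  shows "sqn lebesgue (grad (\<lambda>x. c * \<phi> x)) = c\<^sup>2 * sqn lebesgue (grad \<phi>)"
    "sqn lebesgue (nl s (\<lambda>x. c * \<phi> x)) = c\<^sup>2 * sqn lebesgue (nl s \<phi>)"
    "energy (\<lambda>x. c * \<phi> x) (grad (\<lambda>x. c * \<phi> x)) = c\<^sup>2 * energy \<phi> (grad \<phi>)"
  using assms by (simp_all add: grad_scale_test sqn_scale nl_scale sqn_cmult energy_def algebra_simps)

definition unit2 :: "(real ^ 'n \<Rightarrow> real) set" where
  "unit2 = {\<phi> \<in> test_functions \<Omega>. sqn lebesgue \<phi> = 1}"

lemma unit2_eq: "{u \<in> test_functions \<Omega>. Lp_norm 2 UNIV u = 1} = unit2"
  by (auto simp: unit2_def Lp_norm2_test)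

lemma normalize2:
  assumes "\<phi> \<in> test_functions \<Omega>" "sqn lebesgue \<phi> > 0"
  shows "(\<lambda>x. inverse (sqrt (sqn lebesgue \<phi>)) * \<phi> x) \<in> unit2"
  using assms by (simp add: unit2_def test_cmult sqn_cmult power_inverse)

lemma unit2_nonempty: "unit2 \<noteq> {}"
  using exists_nonzero_test normalize2 by (metis empty_iff)

lemma lambda_1_eq: "lambda_1 s \<Omega> = enn2real (INF u\<in>unit2. ennreal (energy u (grad u)))"
  unfolding lambda_1_def unit2_eq
  by (intro arg_cong[where f = enn2real] INF_cong)
    (auto simp: unit2_def rho_sq_def energy_def dirichlet_test gagliardo_test ennreal_plus sqn_nonneg)

lemma lambda_1s_eq: "lambda_1s s \<Omega> = enn2real (INF u\<in>unit2. ennreal (sqn lebesgue (nl s u)))"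
  unfolding lambda_1s_def unit2_eq
  by (intro arg_cong[where f = enn2real] INF_cong) (auto simp: unit2_def gagliardo_test)

lemma unit2_to_all:
  assumes unit: "\<And>u. u \<in> unit2 \<Longrightarrow> l \<le> g u" and g: "\<And>c u. u \<in> test_functions \<Omega> \<Longrightarrow> g (\<lambda>x. c * u x) = c\<^sup>2 * g u"
    and pos: "\<And>u. 0 \<le> g u" and \<phi>: "\<phi> \<in> test_functions \<Omega>"
  shows "l * sqn lebesgue \<phi> \<le> g \<phi>"
proof (cases "sqn lebesgue \<phi> = 0")
  case False
  then have n: "sqn lebesgue \<phi> > 0" using sqn_nonneg[of lebesgue \<phi>] by simp
  have "l \<le> (inverse (sqrt (sqn lebesgue \<phi>)))\<^sup>2 * g \<phi>"
    using unit[OF normalize2[OF \<phi> n]] g[OF \<phi>] by simp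
  then have "l \<le> g \<phi> / sqn lebesgue \<phi>" using n by (simp add: power_inverse divide_inverse mult.commute)
  then show ?thesis using n by (simp add: field_simps)
qed (simp add: pos)

lemma lambda_1_test:
  shows "0 \<le> lambda_1 s \<Omega>"
    and "\<phi> \<in> test_functions \<Omega> \<Longrightarrow> lambda_1 s \<Omega> * sqn lebesgue \<phi> \<le> energy \<phi> (grad \<phi>)"
    and "e > 0 \<Longrightarrow> \<exists>\<phi>\<in>test_functions \<Omega>. sqn lebesgue \<phi> = 1 \<and> energy \<phi> (grad \<phi>) < lambda_1 s \<Omega> + e"
proof -
  note I = enn2real_INF[OF unit2_nonempty, of "\<lambda>u. energy u (grad u)", OF energy_nonneg, folded lambda_1_eq]
  show "0 \<le> lambda_1 s \<Omega>" by (rule I(1))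
  show "\<phi> \<in> test_functions \<Omega> \<Longrightarrow> lambda_1 s \<Omega> * sqn lebesgue \<phi> \<le> energy \<phi> (grad \<phi>)"
    by (rule unit2_to_all[of "lambda_1 s \<Omega>" "\<lambda>u. energy u (grad u)"]) (auto intro: I(2) energy_nonneg test_scale(3))
  show "e > 0 \<Longrightarrow> \<exists>\<phi>\<in>test_functions \<Omega>. sqn lebesgue \<phi> = 1 \<and> energy \<phi> (grad \<phi>) < lambda_1 s \<Omega> + e"
    using I(3)[of e] by (auto simp: unit2_def)
qed

lemma lambda_1s_test:
  shows "0 \<le> lambda_1s s \<Omega>"
    and "\<phi> \<in> test_functions \<Omega> \<Longrightarrow> lambda_1s s \<Omega> * sqn lebesgue \<phi> \<le> sqn lebesgue (nl s \<phi>)"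
proof -
  note I = enn2real_INF[OF unit2_nonempty, of "\<lambda>u. sqn lebesgue (nl s u)", OF sqn_nonneg, folded lambda_1s_eq]
  show "0 \<le> lambda_1s s \<Omega>" by (rule I(1))
  show "\<phi> \<in> test_functions \<Omega> \<Longrightarrow> lambda_1s s \<Omega> * sqn lebesgue \<phi> \<le> sqn lebesgue (nl s \<phi>)"
    by (rule unit2_to_all[of "lambda_1s s \<Omega>" "\<lambda>u. sqn lebesgue (nl s u)"]) (auto intro: I(2) sqn_nonneg test_scale(2))
qed

lemma normalizep:
  assumes "pint \<phi> > 0"
  shows "pint (\<lambda>x. inverse (pint \<phi> powr (1 / p)) * \<phi> x) = 1"
proof -
  have "inverse (pint \<phi> powr (1 / p)) = pint \<phi> powr (- (1 / p))" by (simp add: powr_minus)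
  moreover have "(pint \<phi> powr (- (1 / p))) powr p = pint \<phi> powr (- 1)" using p2 by (simp add: powr_powr)
  moreover have "pint \<phi> powr (- 1) = inverse (pint \<phi>)" using assms by (simp add: powr_minus)
  ultimately show ?thesis using assms by (simp add: pint_scale)
qed

lemma sobolev_const_test:
  shows "0 \<le> sobolev_const TYPE('n)"
    and "\<phi> \<in> test_functions UNIV \<Longrightarrow> sobolev_const TYPE('n) * pint \<phi> powr (2 / p) \<le> sqn lebesgue (grad \<phi>)"
    and "(\<And>\<phi>. \<phi> \<in> test_functions UNIV \<Longrightarrow> K * pint \<phi> powr (2 / p) \<le> sqn lebesgue (grad \<phi>)) \<Longrightarrow> K \<le> sobolev_const TYPE('n)"
proof -
  define A where "A = {u \<in> test_functions (UNIV :: (real ^ 'n) set). pint u = 1}"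
  have A: "{u \<in> test_functions (UNIV :: (real ^ 'n) set). Lp_norm (crit_exp CARD('n)) UNIV u = 1} = A"
  proof -
    have "pint u powr (1 / p) = 1 \<longleftrightarrow> pint u = 1" for u
    proof
      assume "pint u powr (1 / p) = 1"
      then have "(pint u powr (1 / p)) powr p = 1" by simp
      then show "pint u = 1" using p2 pint_nonneg[of u] by (simp add: powr_powr)
    qed simp
    then show ?thesis by (simp add: A_def p_def[symmetric] Lp_normp)
  qed
  have eq: "sobolev_const TYPE('n) = enn2real (INF u\<in>A. ennreal (sqn lebesgue (grad u)))"
    unfolding sobolev_const_def A
    by (intro arg_cong[where f = enn2real] INF_cong) (auto simp: A_def dirichlet_test)
  have Ane: "A \<noteq> {}"
  proof -
    obtain \<phi> where \<phi>: "\<phi> \<in> test_functions \<Omega>" "pint \<phi> > 0" using exists_nonzero_test by metis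
    then have "(\<lambda>x. inverse (pint \<phi> powr (1 / p)) * \<phi> x) \<in> A"
      by (simp add: A_def normalizep test_cmult test_UNIV)
    then show ?thesis by blast
  qed
  note I = enn2real_INF[OF Ane, of "\<lambda>u. sqn lebesgue (grad u)", OF sqn_nonneg, folded eq]
  show "0 \<le> sobolev_const TYPE('n)" by (rule I(1))
  show "sobolev_const TYPE('n) * pint \<phi> powr (2 / p) \<le> sqn lebesgue (grad \<phi>)" if \<phi>: "\<phi> \<in> test_functions UNIV" for \<phi>
  proof (cases "pint \<phi> = 0")
    case False
    then have n: "pint \<phi> > 0" using pint_nonneg[of \<phi>] by simp
    define t where "t = pint \<phi> powr (1 / p)"
    have t: "t > 0" "t\<^sup>2 = pint \<phi> powr (2 / p)" using n by (auto simp: t_def power2_eq_square powr_add[symmetric])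
    have "(\<lambda>x. inverse t * \<phi> x) \<in> A" using normalizep[OF n] \<phi> by (simp add: A_def test_cmult t_def)
    from I(2)[OF this] have "sobolev_const TYPE('n) \<le> (inverse t)\<^sup>2 * sqn lebesgue (grad \<phi>)"
      using test_scale(1)[OF \<phi>] by simp
    then show ?thesis using t(1) unfolding t(2)[symmetric] by (simp add: field_simps)
  qed (simp add: sqn_nonneg)
  show "K \<le> sobolev_const TYPE('n)"
    if K: "\<And>\<phi>. \<phi> \<in> test_functions UNIV \<Longrightarrow> K * pint \<phi> powr (2 / p) \<le> sqn lebesgue (grad \<phi>)"
  proof (rule ccontr)
    assume "\<not> ?thesis"
    then obtain u where u: "u \<in> A" "sqn lebesgue (grad u) < sobolev_const TYPE('n) + (K - sobolev_const TYPE('n))"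
      using I(3)[of "K - sobolev_const TYPE('n)"] by auto
    then show False using K[of u] by (simp add: A_def)
  qed
qed

lemma sobolev_const_pos: "0 < sobolev_const TYPE('n)"
proof -
  obtain K where K: "K > 0" "\<And>\<Omega> \<phi>. \<phi> \<in> test_functions (\<Omega> :: (real ^ 'n) set)
     \<Longrightarrow> K * (\<integral>x. \<bar>\<phi> x\<bar> powr crit_exp CARD('n) \<partial>lebesgue) powr (2 / crit_exp CARD('n)) \<le> sqn lebesgue (grad \<phi>)"
    using sobolev_inequality[where ?'n = 'n, OF n3] by metis
  have "K \<le> sobolev_const TYPE('n)"
    by (rule sobolev_const_test(3)) (use K(2) in \<open>auto simp: pint_def p_def\<close>)
  with K(1) show ?thesis by linarith
qed

text \<open>The inequality \<open>t\<^sup>2 \<le> 1 + |t|\<^sup>p\<close>, applied to \<open>\<phi>\<close> divided by its critical norm and integrated over \<open>\<Omega>\<close>.\<close>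

lemma sqn_le_pint:
  assumes \<phi>: "\<phi> \<in> test_functions \<Omega>"
  shows "sqn lebesgue \<phi> \<le> (vol + 1) * pint \<phi> powr (2 / p)"
proof (cases "pint \<phi> = 0")
  case True
  then have "AE x in lebesgue. \<bar>\<phi> x\<bar> powr p = 0"
    using integral_nonneg_eq_0_iff_AE[OF test_pint[OF \<phi>]] by (simp add: pint_def)
  then have "AE x in lebesgue. (norm (\<phi> x))\<^sup>2 = 0" by eventually_elim simp
  then have "sqn lebesgue \<phi> = 0" unfolding sqn_def by (rule integral_eq_zero_AE)
  then show ?thesis by (simp add: vol_nonneg)
next
  case False
  then have n: "pint \<phi> > 0" using pint_nonneg[of \<phi>] by simp
  define t where "t = pint \<phi> powr (1 / p)"
  have t: "t > 0" "t\<^sup>2 = pint \<phi> powr (2 / p)" "t powr p = pint \<phi>"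
    using n p2 by (auto simp: t_def power2_eq_square powr_add[symmetric] powr_powr)
  have "sqn lebesgue \<phi> \<le> (\<integral>x. t\<^sup>2 * (indicator \<Omega> x + \<bar>\<phi> x\<bar> powr p / pint \<phi>) \<partial>lebesgue)"
    unfolding sqn_def
  proof (rule integral_mono[OF L2_integrable[OF test_L2(1)[OF \<phi>]]])
    show "integrable lebesgue (\<lambda>x. t\<^sup>2 * (indicator \<Omega> x + \<bar>\<phi> x\<bar> powr p / pint \<phi>))"
      using vol_integrable(1) test_pint[OF \<phi>] by auto
    fix x
    show "(norm (\<phi> x))\<^sup>2 \<le> t\<^sup>2 * (indicator \<Omega> x + \<bar>\<phi> x\<bar> powr p / pint \<phi>)"
    proof (cases "x \<in> \<Omega>")
      case True
      have "(\<phi> x / t)\<^sup>2 \<le> 1 + \<bar>\<phi> x / t\<bar> powr p" by (rule sq_le_one_plus_powr[OF p2])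
      also have "\<bar>\<phi> x / t\<bar> powr p = \<bar>\<phi> x\<bar> powr p / pint \<phi>"
        using t(1) by (simp add: powr_divide t(3))
      finally show ?thesis using True t(1) by (simp add: power_divide divide_le_eq mult.commute)
    qed (simp add: test_support[OF \<phi>] n less_imp_le)
  qed
  also have "\<dots> = t\<^sup>2 * (vol + pint \<phi> / pint \<phi>)"
    using vol_integrable test_pint[OF \<phi>] by (simp add: pint_def)
  finally show ?thesis using n by (simp add: t(2) mult.commute)
qed

text \<open>On \<open>L\<^sup>2\<close>-normalized test functions the critical norm, and by Sobolev's inequality also the Dirichlet
  energy, is bounded below.\<close>

lemma lambda_gap: "lambda_1s s \<Omega> < lambda_1 s \<Omega>"
proof -
  define c where "c = sobolev_const TYPE('n) / (vol + 1)"
  have c: "c > 0" using sobolev_const_pos vol_nonneg by (simp add: c_def)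
  obtain \<phi> where \<phi>: "\<phi> \<in> test_functions \<Omega>" "sqn lebesgue \<phi> = 1" "energy \<phi> (grad \<phi>) < lambda_1 s \<Omega> + c"
    using lambda_1_test(3)[OF c] by blast
  have "1 / (vol + 1) \<le> pint \<phi> powr (2 / p)" using sqn_le_pint[OF \<phi>(1)] \<phi>(2) vol_nonneg by (simp add: field_simps)
  then have "c \<le> sobolev_const TYPE('n) * pint \<phi> powr (2 / p)"
    using mult_left_mono[of "1 / (vol + 1)" _ "sobolev_const TYPE('n)"] sobolev_const_pos by (simp add: c_def)
  also have "\<dots> \<le> sqn lebesgue (grad \<phi>)" by (rule sobolev_const_test(2)[OF test_UNIV[OF \<phi>(1)]])
  finally have "c \<le> sqn lebesgue (grad \<phi>)" .
  moreover have "lambda_1s s \<Omega> \<le> sqn lebesgue (nl s \<phi>)" using lambda_1s_test(2)[OF \<phi>(1)] \<phi>(2) by simp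
  ultimately show ?thesis using \<phi>(3) by (simp add: energy_def)
qed

lemma lambda_1_pos: "0 < lambda_1 s \<Omega>"
  using lambda_gap lambda_1s_test(1) by linarith

subsection \<open>Passage to the limit\<close>

lemma approx_tendsto:
  assumes "approx \<Omega> u G \<phi>"
  shows "(\<lambda>k. sqn lebesgue (\<phi> k)) \<longlonglongrightarrow> sqn lebesgue u"
    "(\<lambda>k. sqn lebesgue (grad (\<phi> k))) \<longlonglongrightarrow> sqn lebesgue G"
    "(\<lambda>k. sqn lebesgue (nl s (\<phi> k))) \<longlonglongrightarrow> sqn lebesgue (nl s u)"
    "(\<lambda>k. energy (\<phi> k) (grad (\<phi> k))) \<longlonglongrightarrow> energy u G"
proof -
  show 1: "(\<lambda>k. sqn lebesgue (\<phi> k)) \<longlonglongrightarrow> sqn lebesgue u"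
    by (rule sqn_tendsto[OF approxD(2)[OF assms]])
  show 2: "(\<lambda>k. sqn lebesgue (grad (\<phi> k))) \<longlonglongrightarrow> sqn lebesgue G"
    by (rule sqn_tendsto[OF approxD(3)[OF assms]])
  show 3: "(\<lambda>k. sqn lebesgue (nl s (\<phi> k))) \<longlonglongrightarrow> sqn lebesgue (nl s u)"
    by (rule sqn_tendsto[OF approx_nl[OF n3 s0 s1 assms]])
  show "(\<lambda>k. energy (\<phi> k) (grad (\<phi> k))) \<longlonglongrightarrow> energy u G"
    unfolding energy_def by (intro tendsto_add 2 3)
qed

lemma approx_nl_L2: "approx \<Omega> u G \<phi> \<Longrightarrow> nl s u \<in> L2 lebesgue"
  using approx_nl[OF n3 s0 s1] by (simp add: L2conv_def)

lemma lambda_1s_approx: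
  assumes "approx \<Omega> u G \<phi>"
  shows "lambda_1s s \<Omega> * sqn lebesgue u \<le> sqn lebesgue (nl s u)"
  by (rule LIMSEQ_le[OF tendsto_mult_left[OF approx_tendsto(1)[OF assms]] approx_tendsto(3)[OF assms]])
    (use lambda_1s_test(2) approxD(1)[OF assms] in auto)

text \<open>Lower bounds of quadratic energies in terms of the critical norm pass to the limit: the energies
  converge, and the critical norm is lower semicontinuous.  The coefficients \<open>b\<close> and \<open>l\<close> cover the
  Sobolev inequality as well as its variant for the energy shifted by \<open>\<lambda>\<close>.\<close>

lemma pint_approx:
  assumes a: "approx \<Omega> u G \<phi>" and c: "c > 0"
    and test: "\<And>\<psi>. \<psi> \<in> test_functions \<Omega> \<Longrightarrow> c * pint \<psi> powr (2 / p)
       \<le> sqn lebesgue (grad \<psi>) + b * sqn lebesgue (nl s \<psi>) - l * sqn lebesgue \<psi>"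
  shows "integrable lebesgue (\<lambda>x. \<bar>u x\<bar> powr p)"
    "c * pint u powr (2 / p) \<le> sqn lebesgue G + b * sqn lebesgue (nl s u) - l * sqn lebesgue u"
proof -
  define Q where "Q k = sqn lebesgue (grad (\<phi> k)) + b * sqn lebesgue (nl s (\<phi> k)) - l * sqn lebesgue (\<phi> k)" for k
  define Qu where "Qu = sqn lebesgue G + b * sqn lebesgue (nl s u) - l * sqn lebesgue u"
  have Q: "Q \<longlonglongrightarrow> Qu"
    unfolding Q_def Qu_def by (intro tendsto_diff tendsto_add tendsto_mult tendsto_const approx_tendsto[OF a])
  have Qk: "c * pint (\<phi> k) powr (2 / p) \<le> Q k" for k unfolding Q_def by (rule test[OF approxD(1)[OF a]])
  have Q0: "0 \<le> Q k" for k
  proof -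
    have "0 \<le> c * pint (\<phi> k) powr (2 / p)" using c by simp
    then show ?thesis using Qk[of k] by linarith
  qed
  have Qu0: "0 \<le> Qu" by (rule LIMSEQ_le_const[OF Q]) (use Q0 in auto)
  have pk: "pint (\<phi> k) \<le> (Q k / c) powr (p / 2)" for k
  proof -
    have "pint (\<phi> k) powr (2 / p) \<le> Q k / c" using Qk[of k] c by (simp add: field_simps)
    then have "(pint (\<phi> k) powr (2 / p)) powr (p / 2) \<le> (Q k / c) powr (p / 2)" using p2 by (intro powr_mono2) auto
    then show ?thesis using p2 pint_nonneg[of "\<phi> k"] by (simp add: powr_powr)
  qed
  obtain r where r: "strict_mono r" "AE x in lebesgue. (\<lambda>k. \<phi> (r k) x) \<longlonglongrightarrow> u x"
    by (rule L2conv_AE_subseq[OF approxD(2)[OF a]])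
  have le: "(\<integral>\<^sup>+x. ennreal (\<bar>u x\<bar> powr p) \<partial>lebesgue) \<le> ennreal ((Qu / c) powr (p / 2))"
  proof (rule nn_integral_fatou_limit)
    show "(\<lambda>x. \<bar>\<phi> (r j) x\<bar> powr p) \<in> borel_measurable lebesgue" for j
      by (rule borel_measurable_integrable[OF test_pint[OF approxD(1)[OF a]]])
    show "AE x in lebesgue. (\<lambda>j. \<bar>\<phi> (r j) x\<bar> powr p) \<longlonglongrightarrow> \<bar>u x\<bar> powr p"
      using r(2)
    proof eventually_elim
      case (elim x)
      show ?case using p2 by (intro tendsto_powr' tendsto_rabs elim tendsto_const) auto
    qed
    show "(\<integral>\<^sup>+x. ennreal (\<bar>\<phi> (r j) x\<bar> powr p) \<partial>lebesgue) \<le> ennreal ((Q (r j) / c) powr (p / 2))" for j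
    proof -
      have "(\<integral>\<^sup>+x. ennreal (\<bar>\<phi> (r j) x\<bar> powr p) \<partial>lebesgue) = ennreal (pint (\<phi> (r j)))"
        unfolding pint_def by (rule nn_integral_eq_integral[OF test_pint[OF approxD(1)[OF a]]]) auto
      then show ?thesis using pk[of "r j"] by (simp add: ennreal_leI)
    qed
    have "(\<lambda>j. Q (r j)) \<longlonglongrightarrow> Qu" using LIMSEQ_subseq_LIMSEQ[OF Q r(1)] by (simp add: o_def)
    then show "(\<lambda>j. (Q (r j) / c) powr (p / 2)) \<longlonglongrightarrow> (Qu / c) powr (p / 2)"
      using Q0 c p2 by (intro tendsto_powr' tendsto_divide tendsto_const) (auto intro!: always_eventually divide_nonneg_pos)
  qed
  have m: "(\<lambda>x. \<bar>u x\<bar> powr p) \<in> borel_measurable lebesgue"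
    using L2_measurable[OF approxD(4)[OF a]] by measurable
  show i: "integrable lebesgue (\<lambda>x. \<bar>u x\<bar> powr p)"
  proof (rule integrableI_nonneg[OF m])
    show "(\<integral>\<^sup>+x. ennreal (\<bar>u x\<bar> powr p) \<partial>lebesgue) < \<infinity>" using le by (rule order_le_less_trans) simp
  qed simp
  have "ennreal (pint u) \<le> ennreal ((Qu / c) powr (p / 2))"
    using le nn_integral_eq_integral[OF i] by (simp add: pint_def)
  then have "pint u \<le> (Qu / c) powr (p / 2)" by simp
  then have "pint u powr (2 / p) \<le> ((Qu / c) powr (p / 2)) powr (2 / p)"
    using p2 pint_nonneg[of u] by (intro powr_mono2) auto
  also have "\<dots> = Qu / c" using p2 Qu0 c by (simp add: powr_powr)
  finally show "c * pint u powr (2 / p) \<le> sqn lebesgue G + b * sqn lebesgue (nl s u) - l * sqn lebesgue u"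
    using c by (simp add: Qu_def field_simps)
qed

lemma sobolev_approx:
  assumes "approx \<Omega> u G \<phi>"
  shows "integrable lebesgue (\<lambda>x. \<bar>u x\<bar> powr p)"
    "sobolev_const TYPE('n) * pint u powr (2 / p) \<le> sqn lebesgue G"
  using pint_approx[OF assms sobolev_const_pos, of 0 0] sobolev_const_test(2)[OF test_UNIV] by auto

text \<open>By Young's inequality \<open>|u|\<^sup>p\<^sup>-\<^sup>1|v| \<le> |u|\<^sup>p + |v|\<^sup>p\<close>.\<close>

lemma power_pairing_integrable:
  assumes u: "u \<in> borel_measurable lebesgue" "integrable lebesgue (\<lambda>x. \<bar>u x\<bar> powr p)"
    and v: "v \<in> borel_measurable lebesgue" "integrable lebesgue (\<lambda>x. \<bar>v x\<bar> powr p)"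
  shows "integrable lebesgue (\<lambda>x. \<bar>u x\<bar> powr (p - 1) * v x)"
proof (rule Bochner_Integration.integrable_bound[OF Bochner_Integration.integrable_add[OF u(2) v(2)]])
  show "(\<lambda>x. \<bar>u x\<bar> powr (p - 1) * v x) \<in> borel_measurable lebesgue" using u(1) v(1) by measurable
  show "AE x in lebesgue. norm (\<bar>u x\<bar> powr (p - 1) * v x) \<le> norm (\<bar>u x\<bar> powr p + \<bar>v x\<bar> powr p)"
  proof (rule AE_I2)
    fix x
    show "norm (\<bar>u x\<bar> powr (p - 1) * v x) \<le> norm (\<bar>u x\<bar> powr p + \<bar>v x\<bar> powr p)"
      using powr_young_one[of "\<bar>u x\<bar>" "\<bar>v x\<bar>" p] p2 by (simp add: abs_mult)
  qed
qed

end

section \<open>Weak form of the equation\<close>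

text \<open>Split \<open>a\<^sub>k g\<^sub>k - A G\<close> into \<open>a\<^sub>k(g\<^sub>k - G)\<close> and \<open>(a\<^sub>k - A)G\<close>; the second term is treated by dominated
  convergence.\<close>

lemma L2conv_mult_bounded:
  fixes g :: "nat \<Rightarrow> 'a \<Rightarrow> 'b::euclidean_space" and a :: "nat \<Rightarrow> 'a \<Rightarrow> real"
  assumes g: "L2conv M g G" and am: "\<And>k. a k \<in> borel_measurable M" "A \<in> borel_measurable M"
    and bd: "\<And>k x. \<bar>a k x\<bar> \<le> B" "\<And>x. \<bar>A x\<bar> \<le> B" and lim: "AE x in M. (\<lambda>k. a k x) \<longlonglongrightarrow> A x"
  shows "L2conv M (\<lambda>k x. a k x *\<^sub>R g k x) (\<lambda>x. A x *\<^sub>R G x)"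
proof -
  have B0: "0 \<le> B" using bd(2) abs_ge_zero order_trans by blast
  have mult: "(\<lambda>x. c x *\<^sub>R h x) \<in> L2 M \<and> sqn M (\<lambda>x. c x *\<^sub>R h x) \<le> B\<^sup>2 * sqn M h"
    if "h \<in> L2 M" "c \<in> borel_measurable M" "\<And>x. \<bar>c x\<bar> \<le> B" for c :: "'a \<Rightarrow> real" and h :: "'a \<Rightarrow> 'b"
  proof -
    have le: "(norm (c x *\<^sub>R h x))\<^sup>2 \<le> B\<^sup>2 * (norm (h x))\<^sup>2" for x
      using power_mono[OF that(3)[of x], of 2] by (simp add: power_mult_distrib mult_right_mono)
    have m: "(\<lambda>x. c x *\<^sub>R h x) \<in> borel_measurable M"
      using that(2) L2_measurable[OF that(1)] by (rule borel_measurable_scaleR)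
    have i: "integrable M (\<lambda>x. B\<^sup>2 * (norm (h x))\<^sup>2)" using L2_integrable[OF that(1)] by simp
    have i2: "integrable M (\<lambda>x. (norm (c x *\<^sub>R h x))\<^sup>2)"
    proof (rule Bochner_Integration.integrable_bound[OF i])
      show "(\<lambda>x. (norm (c x *\<^sub>R h x))\<^sup>2) \<in> borel_measurable M" using m by measurable
    qed (use le in auto)
    have "sqn M (\<lambda>x. c x *\<^sub>R h x) \<le> B\<^sup>2 * sqn M h"
      unfolding sqn_def integral_mult_right_zero[symmetric] by (rule integral_mono[OF i2 i le])
    with m i2 show ?thesis by (simp add: L2_def)
  qed
  note gL = L2convD(1,2)[OF g]
  have diffL: "(\<lambda>x. (a k x - A x) *\<^sub>R G x) \<in> L2 M" for k
    using L2_diff[of "\<lambda>x. a k x *\<^sub>R G x" M "\<lambda>x. A x *\<^sub>R G x"] mult[OF gL(2) am(1) bd(1), of k] mult[OF gL(2) am(2) bd(2)]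
    by (simp add: scaleR_diff_left)
  have "(\<lambda>k. sqn M (\<lambda>x. (a k x - A x) *\<^sub>R G x)) \<longlonglongrightarrow> (\<integral>x. 0 \<partial>M)"
    unfolding sqn_def
  proof (rule integral_dominated_convergence[where w = "\<lambda>x. (2 * B)\<^sup>2 * (norm (G x))\<^sup>2"])
    show "integrable M (\<lambda>x. (2 * B)\<^sup>2 * (norm (G x))\<^sup>2)" using L2_integrable[OF gL(2)] by simp
    show "(\<lambda>x. (norm ((a k x - A x) *\<^sub>R G x))\<^sup>2) \<in> borel_measurable M" for k
      using L2_measurable[OF diffL[of k]] by measurable
    show "AE x in M. norm ((norm ((a k x - A x) *\<^sub>R G x))\<^sup>2) \<le> (2 * B)\<^sup>2 * (norm (G x))\<^sup>2" for k
    proof (rule AE_I2)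
      fix x
      have "\<bar>a k x - A x\<bar> \<le> 2 * B" using bd(1)[of k x] bd(2)[of x] by linarith
      from power_mono[OF this, of 2]
      show "norm ((norm ((a k x - A x) *\<^sub>R G x))\<^sup>2) \<le> (2 * B)\<^sup>2 * (norm (G x))\<^sup>2"
        by (simp add: power_mult_distrib mult_right_mono)
    qed
    show "AE x in M. (\<lambda>k. (norm ((a k x - A x) *\<^sub>R G x))\<^sup>2) \<longlonglongrightarrow> 0"
      using lim
    proof eventually_elim
      case (elim x)
      have "(\<lambda>k. (norm ((a k x - A x) *\<^sub>R G x))\<^sup>2) \<longlonglongrightarrow> (norm ((A x - A x) *\<^sub>R G x))\<^sup>2"
        by (intro tendsto_power tendsto_norm tendsto_scaleR tendsto_diff elim tendsto_const)
      then show ?case by simp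
    qed
  qed simp
  then have z2: "(\<lambda>k. sqn M (\<lambda>x. (a k x - A x) *\<^sub>R G x)) \<longlonglongrightarrow> 0" by simp
  have mg: "(\<lambda>x. a k x *\<^sub>R (g k x - G x)) \<in> L2 M \<and> sqn M (\<lambda>x. a k x *\<^sub>R (g k x - G x)) \<le> B\<^sup>2 * sqn M (\<lambda>x. g k x - G x)" for k
    by (rule mult[OF L2_diff[OF gL] am(1) bd(1)])
  have "(\<lambda>k. sqn M (\<lambda>x. a k x *\<^sub>R g k x - A x *\<^sub>R G x)) \<longlonglongrightarrow> 0"
  proof (rule tendsto_sandwich[OF _ _ tendsto_const])
    show "\<forall>\<^sub>F k in sequentially. 0 \<le> sqn M (\<lambda>x. a k x *\<^sub>R g k x - A x *\<^sub>R G x)" by (simp add: sqn_nonneg)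
    have "sqn M (\<lambda>x. a k x *\<^sub>R g k x - A x *\<^sub>R G x)
       \<le> 2 * (B\<^sup>2 * sqn M (\<lambda>x. g k x - G x)) + 2 * sqn M (\<lambda>x. (a k x - A x) *\<^sub>R G x)" for k
    proof -
      have "sqn M (\<lambda>x. a k x *\<^sub>R (g k x - G x) + (a k x - A x) *\<^sub>R G x)
        \<le> 2 * sqn M (\<lambda>x. a k x *\<^sub>R (g k x - G x)) + 2 * sqn M (\<lambda>x. (a k x - A x) *\<^sub>R G x)"
        using mg diffL by (intro sqn_add_le) auto
      moreover have "a k x *\<^sub>R (g k x - G x) + (a k x - A x) *\<^sub>R G x = a k x *\<^sub>R g k x - A x *\<^sub>R G x" for x
        by (simp add: algebra_simps)
      ultimately show ?thesis using mg[of k] by simp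
    qed
    then show "\<forall>\<^sub>F k in sequentially. sqn M (\<lambda>x. a k x *\<^sub>R g k x - A x *\<^sub>R G x)
       \<le> 2 * (B\<^sup>2 * sqn M (\<lambda>x. g k x - G x)) + 2 * sqn M (\<lambda>x. (a k x - A x) *\<^sub>R G x)"
      by (rule always_eventually[OF allI])
    have "(\<lambda>k. 2 * (B\<^sup>2 * sqn M (\<lambda>x. g k x - G x)) + 2 * sqn M (\<lambda>x. (a k x - A x) *\<^sub>R G x)) \<longlonglongrightarrow> 2 * (B\<^sup>2 * 0) + 2 * 0"
      by (intro tendsto_add tendsto_mult tendsto_const L2convD(3)[OF g] z2)
    then show "(\<lambda>k. 2 * (B\<^sup>2 * sqn M (\<lambda>x. g k x - G x)) + 2 * sqn M (\<lambda>x. (a k x - A x) *\<^sub>R G x)) \<longlonglongrightarrow> 0" by simp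
  qed
  then show ?thesis
    using mult[OF gL(1) am(1) bd(1)] mult[OF gL(2) am(2) bd(2)] by (simp add: L2conv_def)
qed

context mixed_problem
begin

lemma set_integral_UNIV:
  fixes f g :: "real ^ 'n \<Rightarrow> real"
  assumes "AE x in lebesgue. x \<in> \<Omega> \<longrightarrow> f x = g x" "AE x in lebesgue. x \<notin> \<Omega> \<longrightarrow> g x = 0"
    and g: "g \<in> borel_measurable lebesgue"
  shows "(LINT x:\<Omega>|lebesgue. f x) = (\<integral>x. g x \<partial>lebesgue)"
proof -
  have ae: "AE x in lebesgue. g x = indicator \<Omega> x *\<^sub>R f x"
    using assms(1,2) by eventually_elim (auto simp: indicator_def)
  have "(\<lambda>x. indicator \<Omega> x *\<^sub>R f x) \<in> borel_measurable lebesgue"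
    by (rule borel_measurable_AE[OF g ae])
  with g ae show ?thesis
    unfolding set_lebesgue_integral_def by (intro integral_cong_AE) (auto elim: eventually_mono)
qed

text \<open>The equation in terms of inner products on the whole space.  The modulus in \<open>|u|\<^sup>p\<^sup>-\<^sup>1\<close> matches
  the one in \<open>pint\<close>; on the nonnegative functions of interest it has no effect.\<close>

definition weak_form :: "real \<Rightarrow> (real ^ 'n \<Rightarrow> real) \<Rightarrow> (real ^ 'n \<Rightarrow> real ^ 'n) \<Rightarrow> bool" where
  "weak_form lam u G \<longleftrightarrow> (\<forall>v H \<psi>. approx \<Omega> v H \<psi> \<longrightarrow>
     ip lebesgue G H + ip lebesgue (nl s u) (nl s v)
       = (\<integral>x. \<bar>u x\<bar> powr (p - 1) * v x \<partial>lebesgue) + lam * ip lebesgue u v)"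

lemma weak_formD:
  assumes "weak_form lam u G" "approx \<Omega> v H \<psi>"
  shows "ip lebesgue G H + ip lebesgue (nl s u) (nl s v)
       = (\<integral>x. \<bar>u x\<bar> powr (p - 1) * v x \<partial>lebesgue) + lam * ip lebesgue u v"
  using assms unfolding weak_form_def by blast

lemma right_hand_side:
  assumes a: "approx \<Omega> u G \<phi>" and b: "approx \<Omega> v H \<psi>"
    and pos: "AE x in lebesgue. x \<in> \<Omega> \<longrightarrow> u x \<ge> 0"
  shows "(LINT x:\<Omega>|lebesgue. (u x powr (crit_exp CARD('n) - 1) + lam * u x) * v x)
     = (\<integral>x. \<bar>u x\<bar> powr (p - 1) * v x \<partial>lebesgue) + lam * ip lebesgue u v"
proof -
  have um: "u \<in> borel_measurable lebesgue" and vm: "v \<in> borel_measurable lebesgue"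
    using approxD(4)[OF a] approxD(4)[OF b] by (auto simp: L2_def)
  have "(LINT x:\<Omega>|lebesgue. (u x powr (crit_exp CARD('n) - 1) + lam * u x) * v x)
     = (\<integral>x. \<bar>u x\<bar> powr (p - 1) * v x + lam * (u x * v x) \<partial>lebesgue)"
  proof (rule set_integral_UNIV)
    show "AE x in lebesgue. x \<in> \<Omega> \<longrightarrow> (u x powr (crit_exp CARD('n) - 1) + lam * u x) * v x
        = \<bar>u x\<bar> powr (p - 1) * v x + lam * (u x * v x)"
      using pos by eventually_elim (auto simp: p_def algebra_simps)
    show "AE x in lebesgue. x \<notin> \<Omega> \<longrightarrow> \<bar>u x\<bar> powr (p - 1) * v x + lam * (u x * v x) = 0"
      using approx_AE_outside(1)[OF b] by eventually_elim auto
    show "(\<lambda>x. \<bar>u x\<bar> powr (p - 1) * v x + lam * (u x * v x)) \<in> borel_measurable lebesgue"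
      using um vm by measurable
  qed
  also have "\<dots> = (\<integral>x. \<bar>u x\<bar> powr (p - 1) * v x \<partial>lebesgue) + lam * ip lebesgue u v"
    using power_pairing_integrable[OF um sobolev_approx(1)[OF a] vm sobolev_approx(1)[OF b]]
      L2_ip[OF approxD(4)[OF a] approxD(4)[OF b]]
    by (simp add: ip_def)
  finally show ?thesis .
qed

lemma local_form:
  assumes a: "approx \<Omega> u G \<phi>" and b: "approx \<Omega> v H \<psi>"
  shows "(LINT x:\<Omega>|lebesgue. wgrad UNIV u x \<bullet> wgrad UNIV v x) = ip lebesgue G H"
  unfolding ip_def
proof (rule set_integral_UNIV)
  show "AE x in lebesgue. x \<in> \<Omega> \<longrightarrow> wgrad UNIV u x \<bullet> wgrad UNIV v x = G x \<bullet> H x"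
    using approx_wgrad[OF a] approx_wgrad[OF b] by eventually_elim simp
  show "AE x in lebesgue. x \<notin> \<Omega> \<longrightarrow> G x \<bullet> H x = 0"
    using approx_AE_outside(2)[OF a] by eventually_elim simp
  show "(\<lambda>x. G x \<bullet> H x) \<in> borel_measurable lebesgue"
    by (rule borel_measurable_integrable[OF L2_ip[OF approxD(5)[OF a] approxD(5)[OF b]]])
qed

text \<open>All integrals over \<open>\<Omega>\<close> extend to the whole space because \<open>u\<close>, \<open>v\<close> and their gradients vanish
  outside, almost everywhere.\<close>

lemma solution_iff_weak_form:
  "is_solution s \<Omega> lam u \<longleftrightarrow> (\<exists>G \<phi>. approx \<Omega> u G \<phi> \<and> (AE x in lebesgue. u x \<ge> 0)
     \<and> \<not> (AE x in lebesgue. u x = 0) \<and> weak_form lam u G)"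
proof
  assume sol: "is_solution s \<Omega> lam u"
  then obtain \<phi> where a: "approx \<Omega> u (wgrad UNIV u) \<phi>"
    using X12_imp_approx[OF op, of u] unfolding is_solution_def by metis
  have pos: "AE x in lebesgue. x \<in> \<Omega> \<longrightarrow> u x \<ge> 0" using sol by (simp add: is_solution_def)
  have pos': "AE x in lebesgue. u x \<ge> 0" using pos approx_AE_outside(1)[OF a] by eventually_elim auto
  have "\<not> (AE x in lebesgue. u x = 0)"
  proof
    assume "AE x in lebesgue. u x = 0"
    then have "AE x in lebesgue. \<not> (x \<in> \<Omega> \<and> u x > 0)" by eventually_elim simp
    then have "{x \<in> \<Omega>. u x > 0} \<in> null_sets lebesgue" by (simp add: completion.AE_iff_null_sets)
    then show False using sol by (auto simp: is_solution_def null_sets_def)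
  qed
  moreover have "weak_form lam u (wgrad UNIV u)"
    unfolding weak_form_def
  proof (intro allI impI)
    fix v H \<psi> assume b: "approx \<Omega> v H \<psi>"
    have "(LINT x:\<Omega>|lebesgue. wgrad UNIV u x \<bullet> wgrad UNIV v x)
        + (LINT (x, y)|lebesgue. (u x - u y) * (v x - v y) / norm (x - y) powr (real CARD('n) + 2 * s))
        = (LINT x:\<Omega>|lebesgue. (u x powr (crit_exp CARD('n) - 1) + lam * u x) * v x)"
      using sol approx_imp_X12[OF op b] by (auto simp: is_solution_def)
    then show "ip lebesgue (wgrad UNIV u) H + ip lebesgue (nl s u) (nl s v)
       = (\<integral>x. \<bar>u x\<bar> powr (p - 1) * v x \<partial>lebesgue) + lam * ip lebesgue u v"
      unfolding nl_ip local_form[OF a b] right_hand_side[OF a b pos] .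
  qed
  ultimately show "\<exists>G \<phi>. approx \<Omega> u G \<phi> \<and> (AE x in lebesgue. u x \<ge> 0)
     \<and> \<not> (AE x in lebesgue. u x = 0) \<and> weak_form lam u G" using a pos' by blast
next
  assume "\<exists>G \<phi>. approx \<Omega> u G \<phi> \<and> (AE x in lebesgue. u x \<ge> 0)
     \<and> \<not> (AE x in lebesgue. u x = 0) \<and> weak_form lam u G"
  then obtain G \<phi> where a: "approx \<Omega> u G \<phi>" and pos: "AE x in lebesgue. u x \<ge> 0"
    and nz: "\<not> (AE x in lebesgue. u x = 0)" and w: "weak_form lam u G" by blast
  have pos': "AE x in lebesgue. x \<in> \<Omega> \<longrightarrow> u x \<ge> 0" using pos by eventually_elim simp
  have "emeasure lebesgue {x \<in> \<Omega>. u x > 0} \<noteq> 0"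
  proof
    assume z: "emeasure lebesgue {x \<in> \<Omega>. u x > 0} = 0"
    have m: "u \<in> borel_measurable lebesgue" by (rule L2_measurable[OF approxD(4)[OF a]])
    have "{x \<in> \<Omega>. u x > 0} = \<Omega> \<inter> {x \<in> space lebesgue. 0 < u x}" by auto
    moreover have "{x \<in> space lebesgue. 0 < u x} \<in> sets lebesgue"
      by (rule borel_measurable_less[OF borel_measurable_const m])
    ultimately have "{x \<in> \<Omega>. u x > 0} \<in> sets lebesgue" using \<Omega>_sets by auto
    with z have "{x \<in> \<Omega>. u x > 0} \<in> null_sets lebesgue" by auto
    then have "AE x in lebesgue. \<not> (x \<in> \<Omega> \<and> u x > 0)" by (simp add: completion.AE_iff_null_sets)
    then have "AE x in lebesgue. u x = 0" using pos approx_AE_outside(1)[OF a]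
      by eventually_elim (auto simp: not_less order_antisym)
    with nz show False by simp
  qed
  moreover have "(LINT x:\<Omega>|lebesgue. wgrad UNIV u x \<bullet> wgrad UNIV v x)
        + (LINT (x, y)|lebesgue. (u x - u y) * (v x - v y) / norm (x - y) powr (real CARD('n) + 2 * s))
        = (LINT x:\<Omega>|lebesgue. (u x powr (crit_exp CARD('n) - 1) + lam * u x) * v x)"
    if v: "v \<in> X12 \<Omega>" for v
  proof -
    obtain \<psi> where b: "approx \<Omega> v (wgrad UNIV v) \<psi>" using X12_imp_approx[OF op v] .
    show ?thesis unfolding nl_ip local_form[OF a b] right_hand_side[OF a b pos']
      by (rule weak_formD[OF w b])
  qed
  ultimately show "is_solution s \<Omega> lam u"
    unfolding is_solution_def using approx_imp_X12[OF op a] pos' by (auto simp: zero_less_iff_neq_zero)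
qed

lemma pint_pos:
  assumes "\<not> (AE x in lebesgue. u x = 0)" "integrable lebesgue (\<lambda>x. \<bar>u x\<bar> powr p)"
  shows "0 < pint u"
proof (rule ccontr)
  assume "\<not> ?thesis"
  then have "pint u = 0" using pint_nonneg[of u] by simp
  then have "AE x in lebesgue. \<bar>u x\<bar> powr p = 0"
    using integral_nonneg_eq_0_iff_AE[OF assms(2)] by (simp add: pint_def)
  then have "AE x in lebesgue. u x = 0" by eventually_elim simp
  with assms(1) show False by simp
qed

section \<open>The Sobolev constant is not attained on bounded sets\<close>

text \<open>The tangent inequality of \<open>t \<mapsto> |t|\<^sup>p\<close>, integrated: the critical norm grows at least linearly along
  lines.\<close>

lemma pint_increment:
  assumes u: "u \<in> borel_measurable lebesgue" "integrable lebesgue (\<lambda>x. \<bar>u x\<bar> powr p)" "AE x in lebesgue. u x \<ge> 0"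
    and v: "v \<in> borel_measurable lebesgue" "integrable lebesgue (\<lambda>x. \<bar>v x\<bar> powr p)"
    and uv: "integrable lebesgue (\<lambda>x. \<bar>u x + t * v x\<bar> powr p)"
  shows "pint u + t * (p * (\<integral>x. \<bar>u x\<bar> powr (p - 1) * v x \<partial>lebesgue)) \<le> pint (\<lambda>x. u x + t * v x)"
proof -
  have "pint u + t * (p * (\<integral>x. \<bar>u x\<bar> powr (p - 1) * v x \<partial>lebesgue))
     = (\<integral>x. \<bar>u x\<bar> powr p + t * (p * (\<bar>u x\<bar> powr (p - 1) * v x)) \<partial>lebesgue)"
    using power_pairing_integrable[OF u(1,2) v] u(2) by (simp add: pint_def)
  also have "\<dots> \<le> pint (\<lambda>x. u x + t * v x)"
    unfolding pint_def
  proof (rule integral_mono_AE[OF _ uv])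
    show "integrable lebesgue (\<lambda>x. \<bar>u x\<bar> powr p + t * (p * (\<bar>u x\<bar> powr (p - 1) * v x)))"
      using power_pairing_integrable[OF u(1,2) v] u(2) by simp
    show "AE x in lebesgue. \<bar>u x\<bar> powr p + t * (p * (\<bar>u x\<bar> powr (p - 1) * v x)) \<le> \<bar>u x + t * v x\<bar> powr p"
      using u(3)
    proof eventually_elim
      case (elim x)
      then show ?case using powr_abs_tangent[of "u x" p "t * v x"] p2 by (simp add: mult_ac)
    qed
  qed
  finally show ?thesis .
qed

text \<open>Otherwise \<open>u\<close> would attain the Sobolev constant.  Let \<open>\<eta> = 1\<close> on \<open>\<Omega>\<close>.  As \<open>\<nabla>\<eta> = 0\<close> where \<open>\<nabla>u\<close> lives, the
  Dirichlet energy of \<open>u + t\<eta>\<close> is that of \<open>u\<close> plus a multiple of \<open>t\<^sup>2\<close>, whereas the integral of its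
  \<open>p\<close>-th power grows at least like \<open>tp\<integral>u\<^sup>p\<^sup>-\<^sup>1\<close>.  This violates the Sobolev inequality for small \<open>t > 0\<close>.\<close>

lemma sobolev_strict:
  assumes a: "approx \<Omega> u G \<phi>" and pos: "AE x in lebesgue. u x \<ge> 0" and nz: "\<not> (AE x in lebesgue. u x = 0)"
  shows "sobolev_const TYPE('n) * pint u powr (2 / p) < sqn lebesgue G"
proof (rule ccontr)
  let ?S = "sobolev_const TYPE('n)"
  assume "\<not> ?thesis"
  then have eq: "sqn lebesgue G \<le> ?S * pint u powr (2 / p)" by simp
  obtain \<eta> where \<eta>: "\<eta> \<in> test_functions UNIV" "\<And>x. x \<in> \<Omega> \<Longrightarrow> \<eta> x = 1" "\<And>x. x \<in> \<Omega> \<Longrightarrow> grad \<eta> x = 0" "\<And>x. 0 \<le> \<eta> x"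
    by (rule cutoff_exists[OF bd]) blast
  obtain K where K: "compact K" "\<And>x. x \<notin> K \<Longrightarrow> \<eta> x = 0" using test_compactE[OF \<eta>(1)] by metis
  obtain R where R: "\<And>x. x \<in> K \<union> \<Omega> \<Longrightarrow> norm x < R"
  proof -
    have "bounded (K \<union> \<Omega>)" using bd compact_imp_bounded[OF K(1)] by simp
    then show ?thesis using that unfolding bounded_pos_less by blast
  qed
  \<comment> \<open>The perturbed function is admissible on a larger ball only.\<close>
  define \<Omega>' where "\<Omega>' = ball (0 :: real ^ 'n) R"
  have sub: "\<Omega> \<subseteq> \<Omega>'" using R by (auto simp: \<Omega>'_def)
  interpret B: mixed_problem \<Omega>' s
  proof unfold_locales
    show "\<Omega>' \<noteq> {}" using ne sub by blast
  qed (use n3 s0 s1 in \<open>auto simp: \<Omega>'_def\<close>)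
  have \<eta>': "\<eta> \<in> test_functions \<Omega>'"
    by (rule testI[OF test_smooth[OF \<eta>(1)] K(1) _ K(2)]) (use R in \<open>auto simp: \<Omega>'_def\<close>)
  have a': "approx \<Omega>' u G \<phi>" using a test_mono[OF _ sub] by (auto simp: approx_def)
  note i = sobolev_approx(1)[OF a]
  have um: "u \<in> borel_measurable lebesgue" by (rule L2_measurable[OF approxD(4)[OF a]])
  have \<eta>m: "\<eta> \<in> borel_measurable lebesgue" by (rule test_measurable(1)[OF \<eta>(1)])
  define P where "P = pint u"
  define c where "c = (\<integral>x. \<bar>u x\<bar> powr (p - 1) * \<eta> x \<partial>lebesgue)"
  define D where "D = sqn lebesgue (grad \<eta>)"
  have P: "P > 0" unfolding P_def by (rule pint_pos[OF nz i])
  have ci: "integrable lebesgue (\<lambda>x. \<bar>u x\<bar> powr (p - 1) * \<eta> x)"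
    by (rule power_pairing_integrable[OF um i \<eta>m test_pint[OF \<eta>']])
  have c: "c > 0"
  proof (rule ccontr)
    have c0: "0 \<le> c" unfolding c_def using \<eta>(4) by (intro integral_nonneg_AE) auto
    assume "\<not> c > 0"
    then have "c = 0" using c0 by simp
    then have "AE x in lebesgue. \<bar>u x\<bar> powr (p - 1) * \<eta> x = 0"
      using integral_nonneg_eq_0_iff_AE[OF ci] \<eta>(4) by (simp add: c_def)
    then have "AE x in lebesgue. u x = 0" using approx_AE_outside(1)[OF a]
    proof eventually_elim
      case (elim x)
      then show ?case using \<eta>(2)[of x] by (cases "x \<in> \<Omega>") auto
    qed
    with nz show False by simp
  qed
  have ortho: "ip lebesgue G (grad \<eta>) = 0"
    unfolding ip_def
  proof (rule integral_eq_zero_AE)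
    show "AE x in lebesgue. G x \<bullet> grad \<eta> x = 0"
      using approx_AE_outside(2)[OF a]
    proof eventually_elim
      case (elim x)
      then show ?case using \<eta>(3)[of x] by (cases "x \<in> \<Omega>") auto
    qed
  qed
  have key: "?S * (P + t * (p * c)) powr (2 / p) - t\<^sup>2 * D \<le> ?S * P powr (2 / p)" if t: "t > 0" for t
  proof -
    note b = approx_add_scaled[OF a' test_approx[OF \<eta>'], of t]
    have "P + t * (p * c) \<le> pint (\<lambda>x. u x + t * \<eta> x)"
      unfolding P_def c_def
      by (rule pint_increment[OF um i pos \<eta>m test_pint[OF \<eta>'] B.sobolev_approx(1)[OF b, folded p_def B.p_def]])
    then have "(P + t * (p * c)) powr (2 / p) \<le> pint (\<lambda>x. u x + t * \<eta> x) powr (2 / p)"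
      using P c t p2 by (intro powr_mono2) auto
    then have "?S * (P + t * (p * c)) powr (2 / p) \<le> ?S * pint (\<lambda>x. u x + t * \<eta> x) powr (2 / p)"
      using sobolev_const_pos by (intro mult_left_mono) auto
    also have "\<dots> \<le> sqn lebesgue (\<lambda>x. G x + t *\<^sub>R grad \<eta> x)"
      using B.sobolev_approx(2)[OF b] by simp
    also have "\<dots> = sqn lebesgue G + t\<^sup>2 * D"
      using sqn_add_scaled[OF approxD(5)[OF a] test_L2(2)[OF \<eta>(1)], of t] by (simp add: ortho D_def)
    finally show ?thesis using eq by (simp add: P_def)
  qed
  have "((\<lambda>t. ?S * (P + t * (p * c)) powr (2 / p) - t\<^sup>2 * D) has_real_derivative
     ?S * ((p * c) * ((2 / p) * P powr (2 / p - 1)))) (at 0)"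
    using P by (auto intro!: derivative_eq_intros)
  moreover have "0 < ?S * ((p * c) * ((2 / p) * P powr (2 / p - 1)))"
    using P c p2 sobolev_const_pos by auto
  ultimately obtain d where d: "d > 0" "\<And>h. 0 < h \<Longrightarrow> h < d \<Longrightarrow>
      ?S * (P + 0 * (p * c)) powr (2 / p) - 0\<^sup>2 * D < ?S * (P + (0 + h) * (p * c)) powr (2 / p) - (0 + h)\<^sup>2 * D"
    using DERIV_pos_inc_right by blast
  from d(2)[of "d / 2"] key[of "d / 2"] d(1) show False by simp
qed

text \<open>Testing with \<open>u\<close> gives \<open>\<parallel>\<nabla>u\<parallel>\<^sup>2 \<le> \<integral>u\<^sup>p\<close> for \<open>\<lambda> \<le> \<lambda>\<^sub>1\<^sub>s\<close>.  The bound on the norm says that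
  \<open>\<parallel>u\<parallel>\<^sub>p\<^bsup>p - 2\<^esup> \<le> S\<close>, so \<open>u\<close> would attain the Sobolev constant.\<close>

lemma no_small_solution:
  assumes lam: "lam \<le> lambda_1s s \<Omega>" and sol: "is_solution s \<Omega> lam u"
    and small: "Lp_norm p UNIV u \<le> sobolev_const TYPE('n) powr ((real CARD('n) - 2) / 4)"
  shows False
proof -
  let ?S = "sobolev_const TYPE('n)"
  obtain G \<phi> where a: "approx \<Omega> u G \<phi>" and pos: "AE x in lebesgue. u x \<ge> 0"
    and nz: "\<not> (AE x in lebesgue. u x = 0)" and w: "weak_form lam u G"
    using sol unfolding solution_iff_weak_form by blast
  define P where "P = pint u"
  have P: "P > 0" unfolding P_def by (rule pint_pos[OF nz sobolev_approx(1)[OF a]])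
  have "sqn lebesgue G + sqn lebesgue (nl s u) = (\<integral>x. \<bar>u x\<bar> powr (p - 1) * u x \<partial>lebesgue) + lam * sqn lebesgue u"
    using w a unfolding weak_form_def ip_self[symmetric] by blast
  also have "(\<integral>x. \<bar>u x\<bar> powr (p - 1) * u x \<partial>lebesgue) = P"
    unfolding P_def pint_def
  proof (rule integral_cong_AE)
    show "AE x in lebesgue. \<bar>u x\<bar> powr (p - 1) * u x = \<bar>u x\<bar> powr p"
      using pos
    proof eventually_elim
      case (elim x)
      then show ?case by (cases "u x = 0") (auto simp: powr_diff)
    qed
  qed (use L2_measurable[OF approxD(4)[OF a]] in measurable)
  finally have "sqn lebesgue G + sqn lebesgue (nl s u) = P + lam * sqn lebesgue u" .
  moreover have "lam * sqn lebesgue u \<le> sqn lebesgue (nl s u)"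
    using lambda_1s_approx[OF a] mult_right_mono[OF lam sqn_nonneg[of lebesgue u]] by linarith
  ultimately have "sqn lebesgue G \<le> P" by linarith
  moreover have "P \<le> ?S * P powr (2 / p)"
  proof -
    have n: "real CARD('n) \<ge> 3" using n3 by simp
    have "(P powr (1 / p)) powr (p - 2) \<le> (?S powr ((real CARD('n) - 2) / 4)) powr (p - 2)"
      using small p2 by (intro powr_mono2) (auto simp: Lp_normp P_def)
    also have "\<dots> = ?S"
    proof -
      \<comment> \<open>As \<open>p - 2 = 4/(n - 2)\<close>, the radius is \<open>S\<^bsup>1/(p - 2)\<^esup>\<close>.\<close>
      have "(real CARD('n) - 2) / 4 * (p - 2) = 1" using n by (simp add: p_def crit_exp_def field_simps)
      then show ?thesis using sobolev_const_pos by (simp add: powr_powr)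
    qed
    finally have "P powr (1 / p * (p - 2)) \<le> ?S" by (simp add: powr_powr)
    then have "P powr (1 / p * (p - 2)) * P powr (2 / p) \<le> ?S * P powr (2 / p)" by (intro mult_right_mono) auto
    moreover have "1 / p * (p - 2) + 2 / p = 1" using p2 by (simp add: field_simps)
    then have "P powr (1 / p * (p - 2)) * P powr (2 / p) = P" using P by (simp only: powr_add[symmetric]) simp
    ultimately show ?thesis by simp
  qed
  ultimately show False using sobolev_strict[OF a pos nz] by (simp add: P_def)
qed

end

section \<open>Picone's inequality\<close>

text \<open>A smooth substitute for \<open>t + \<epsilon>\<close> that is at least \<open>\<epsilon>\<close> on all of \<open>\<real>\<close>, since the approximating test
  functions may be negative.  Picone's inequality requires that the substitute increases at least as
  fast as \<open>t\<close> for \<open>t \<ge> 0\<close>; the square root alone increases too slowly, and the arctangent makes up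
  for the loss.  The last summand outweighs the negative values of the arctangent, which exceed
  \<open>-\<pi>/2 > -2\<close>.\<close>

definition reg :: "real \<Rightarrow> real \<Rightarrow> real" where
  "reg e t = sqrt (t\<^sup>2 + e\<^sup>2) + e * arctan (t / e) + 2 * e"

definition reg' :: "real \<Rightarrow> real \<Rightarrow> real" where
  "reg' e t = t / sqrt (t\<^sup>2 + e\<^sup>2) + 1 / (1 + (t / e)\<^sup>2)"

lemma arctan_bounds2: "-2 < arctan y" "arctan y < 2"
  using arctan_lbound[of y] arctan_ubound[of y] pi_less_4 by linarith+

context
  fixes e :: real
  assumes e: "0 < e"
begin

lemma sq_pos: "0 < t\<^sup>2 + e\<^sup>2"
  using e by (simp add: add_nonneg_pos)

lemma reg_DERIV: "(reg e has_real_derivative reg' e t) (at t)"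
proof -
  have "((\<lambda>t. sqrt (t\<^sup>2 + e\<^sup>2)) has_real_derivative (t / sqrt (t\<^sup>2 + e\<^sup>2))) (at t)"
    using sq_pos[of t] by (auto intro!: derivative_eq_intros simp: field_simps)
  moreover have "((\<lambda>t. arctan (t / e)) has_real_derivative (inverse (1 + (t / e)\<^sup>2) * (1 / e))) (at t)"
    by (rule DERIV_chain2[OF DERIV_arctan]) (use e in \<open>auto intro!: derivative_eq_intros\<close>)
  ultimately have "((\<lambda>t. sqrt (t\<^sup>2 + e\<^sup>2) + e * arctan (t / e) + 2 * e) has_real_derivative
     (t / sqrt (t\<^sup>2 + e\<^sup>2) + e * (inverse (1 + (t / e)\<^sup>2) * (1 / e)) + 0)) (at t)"
    by (intro DERIV_add DERIV_cmult DERIV_const)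
  then show ?thesis unfolding reg_def[abs_def]
    by (rule DERIV_cong) (use e in \<open>simp add: reg'_def divide_inverse\<close>)
qed

lemma reg_lower: "e \<le> reg e t" "\<bar>t\<bar> \<le> reg e t"
proof -
  have 1: "- (2 * e) \<le> e * arctan (t / e)"
    using mult_left_mono[of "-2" "arctan (t / e)" e] arctan_bounds2(1)[of "t / e"] e by simp
  have "e \<le> sqrt (t\<^sup>2 + e\<^sup>2)" by (rule real_le_rsqrt) simp
  with 1 show "e \<le> reg e t" unfolding reg_def by linarith
  have "\<bar>t\<bar> \<le> sqrt (t\<^sup>2 + e\<^sup>2)" by (rule real_le_rsqrt) simp
  with 1 show "\<bar>t\<bar> \<le> reg e t" unfolding reg_def by linarith
qed

lemma reg_pos: "0 < reg e t" using reg_lower(1) e by (rule less_le_trans[rotated])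

lemma reg_upper: "reg e t \<le> \<bar>t\<bar> + 5 * e"
proof -
  have "sqrt (t\<^sup>2 + e\<^sup>2) \<le> \<bar>t\<bar> + e"
    using e by (intro real_le_lsqrt) (auto simp: power2_sum)
  moreover have "e * arctan (t / e) \<le> e * 2"
    using arctan_bounds2(2)[of "t / e"] e by (intro mult_left_mono) auto
  ultimately show ?thesis unfolding reg_def by linarith
qed

lemma reg_zero: "reg e 0 = 3 * e" using e by (simp add: reg_def)

lemma reg'_bounds: "\<bar>reg' e t\<bar> \<le> 2" "0 \<le> t \<Longrightarrow> 1 \<le> reg' e t"
proof -
  have r: "sqrt (t\<^sup>2 + e\<^sup>2) > 0" using sq_pos[of t] by simp
  have "\<bar>t\<bar> \<le> sqrt (t\<^sup>2 + e\<^sup>2)" by (rule real_le_rsqrt) simp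
  then have q: "\<bar>t / sqrt (t\<^sup>2 + e\<^sup>2)\<bar> \<le> 1" using r by (simp add: abs_divide)
  have "0 \<le> 1 / (1 + (t / e)\<^sup>2)" "1 / (1 + (t / e)\<^sup>2) \<le> 1" by (auto simp: divide_le_eq add_pos_nonneg)
  with q show "\<bar>reg' e t\<bar> \<le> 2" unfolding reg'_def by linarith
  assume t: "0 \<le> t"
  define z where "z = t / sqrt (t\<^sup>2 + e\<^sup>2)"
  have "0 \<le> z" "z \<le> 1" using q t r by (auto simp: z_def)
  then have "z\<^sup>2 \<le> z" by (simp add: power2_eq_square mult_left_le_one_le)
  moreover have "z\<^sup>2 = t\<^sup>2 / (t\<^sup>2 + e\<^sup>2)" using sq_pos[of t] by (simp add: z_def power_divide)
  moreover have "1 + (t / e)\<^sup>2 = (t\<^sup>2 + e\<^sup>2) / e\<^sup>2" using e by (simp add: power_divide add_divide_distrib)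
  then have "1 / (1 + (t / e)\<^sup>2) = e\<^sup>2 / (t\<^sup>2 + e\<^sup>2)" by simp
  moreover have "t\<^sup>2 / (t\<^sup>2 + e\<^sup>2) + e\<^sup>2 / (t\<^sup>2 + e\<^sup>2) = 1"
    by (simp only: add_divide_distrib[symmetric] divide_self[OF less_imp_neq[OF sq_pos, symmetric]])
  ultimately show "1 \<le> reg' e t" unfolding reg'_def z_def by linarith
qed

lemma reg_expanding:
  assumes "0 \<le> b" "b \<le> a"
  shows "a - b \<le> reg e a - reg e b"
proof -
  have "reg e b - b \<le> reg e a - a"
  proof (rule DERIV_nonneg_imp_nondecreasing[OF assms(2)])
    fix t assume "b \<le> t" "t \<le> a"
    then show "\<exists>y. ((\<lambda>t. reg e t - t) has_real_derivative y) (at t) \<and> 0 \<le> y"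
      using DERIV_diff[OF reg_DERIV DERIV_ident, of t] reg'_bounds(2)[of t] assms(1) by (intro exI[of _ "reg' e t - 1"]) auto
  qed
  then show ?thesis by simp
qed

lemma inverse_reg_DERIV: "((\<lambda>t. inverse (reg e t)) has_real_derivative - reg' e t * (inverse (reg e t))\<^sup>2) (at t)"
  using DERIV_chain2[OF DERIV_inverse reg_DERIV, of t] reg_pos[of t]
  by (simp add: power2_eq_square mult_ac)

lemma inverse_reg_bounds:
  "\<bar>inverse (reg e t)\<bar> \<le> 1 / e" "\<bar>- reg' e t * (inverse (reg e t))\<^sup>2\<bar> \<le> 2 / e\<^sup>2"
proof -
  show 1: "\<bar>inverse (reg e t)\<bar> \<le> 1 / e"
    using reg_lower(1)[of t] reg_pos[of t] e by (simp add: divide_inverse le_imp_inverse_le)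
  have "(inverse (reg e t))\<^sup>2 \<le> (1 / e)\<^sup>2" using power_mono[OF 1 abs_ge_zero, of 2] by (simp only: power2_abs)
  then have "\<bar>reg' e t\<bar> * (inverse (reg e t))\<^sup>2 \<le> 2 * (1 / e)\<^sup>2"
    using reg'_bounds(1)[of t] by (intro mult_mono) auto
  then show "\<bar>- reg' e t * (inverse (reg e t))\<^sup>2\<bar> \<le> 2 / e\<^sup>2" by (simp add: abs_mult power_divide)
qed

lemma smooth_inverse_reg: "smooth g \<Longrightarrow> smooth (\<lambda>x. inverse (reg e (g x)))"
proof -
  assume g: "smooth g"
  have "smooth (\<lambda>x. sqrt ((g x)\<^sup>2 + e\<^sup>2) + e * arctan (inverse e * g x) + 2 * e)"
    by (intro smooth_intros smooth_power2 g sq_pos)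
  then have "smooth (\<lambda>x. reg e (g x))" by (simp add: reg_def divide_inverse mult.commute)
  then show ?thesis by (rule smooth_intros) (use reg_pos in \<open>auto simp: less_imp_neq[symmetric]\<close>)
qed

text \<open>Let \<open>a \<ge> b\<close>, and let the second factor be positive, as there is nothing to show otherwise.  Then the
  left-hand side increases when \<open>a - b\<close> is replaced by \<open>A - B\<close> with \<open>A = reg \<epsilon> a\<close> and \<open>B = reg \<epsilon> b\<close>, and
  the claim becomes the discrete Picone identity
  \<open>(P - Q)\<^sup>2 - (A - B)(P\<^sup>2/A - Q\<^sup>2/B) = (BP - AQ)\<^sup>2/(AB)\<close>.\<close>

lemma picone_nonlocal:
  assumes "0 \<le> a" "0 \<le> b"
  shows "(a - b) * (P\<^sup>2 * inverse (reg e a) - Q\<^sup>2 * inverse (reg e b)) \<le> (P - Q)\<^sup>2"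
proof -
  have main: "(a - b) * (P\<^sup>2 * inverse (reg e a) - Q\<^sup>2 * inverse (reg e b)) \<le> (P - Q)\<^sup>2" if "0 \<le> b" "b \<le> a" for a b P Q :: real
  proof -
    define A B where "A = reg e a" and "B = reg e b"
    have pos: "A > 0" "B > 0" by (auto simp: A_def B_def reg_pos)
    define T where "T = P\<^sup>2 * inverse A - Q\<^sup>2 * inverse B"
    show ?thesis
    proof (cases "T \<le> 0")
      case True
      then have "(a - b) * T \<le> 0" using that by (simp add: mult_nonneg_nonpos)
      then show ?thesis unfolding T_def A_def B_def by (rule order_trans) simp
    next
      case False
      then have "(a - b) * T \<le> (A - B) * T"
        using reg_expanding[OF that] by (intro mult_right_mono) (auto simp: A_def B_def)
      also have "\<dots> = (P - Q)\<^sup>2 - (B * P - A * Q)\<^sup>2 / (A * B)"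
        using pos by (simp add: T_def field_simps power2_eq_square)
      also have "\<dots> \<le> (P - Q)\<^sup>2" using pos by simp
      finally show ?thesis by (simp add: T_def A_def B_def)
    qed
  qed
  show ?thesis
  proof (cases "b \<le> a")
    case True
    then show ?thesis using main[of b a P Q] assms by simp
  next
    case False
    then have "(b - a) * (Q\<^sup>2 * inverse (reg e b) - P\<^sup>2 * inverse (reg e a)) \<le> (Q - P)\<^sup>2" using assms by (intro main) auto
    then show ?thesis by (simp add: power2_commute algebra_simps)
  qed
qed

text \<open>Completing the square, with \<open>reg' \<ge> 1\<close> on the half line.\<close>

lemma picone_local:
  fixes G N :: "'a::real_inner"
  assumes "0 \<le> t"
  shows "G \<bullet> ((2 * P * inverse (reg e t)) *\<^sub>R N + (P\<^sup>2 * (- reg' e t * (inverse (reg e t))\<^sup>2)) *\<^sub>R G) \<le> (norm N)\<^sup>2"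
proof -
  define f where "f = inverse (reg e t)"
  have "P\<^sup>2 * f\<^sup>2 * (G \<bullet> G) \<le> reg' e t * (P\<^sup>2 * f\<^sup>2 * (G \<bullet> G))"
    using mult_right_mono[OF reg'_bounds(2)[OF assms], of "P\<^sup>2 * f\<^sup>2 * (G \<bullet> G)"] by simp
  moreover have "0 \<le> (norm (N - (P * f) *\<^sub>R G))\<^sup>2" by simp
  then have "2 * (P * f) * (N \<bullet> G) \<le> (norm N)\<^sup>2 + P\<^sup>2 * f\<^sup>2 * (G \<bullet> G)"
    unfolding power2_norm_eq_inner by (simp add: inner_simps inner_commute power2_eq_square algebra_simps)
  ultimately show ?thesis
    unfolding f_def[symmetric] by (simp add: inner_add_right inner_commute algebra_simps)
qed

end

context mixed_problem
begin

text \<open>The quotient \<open>\<phi>\<^sup>2/reg \<epsilon> u\<close> is an admissible comparison function: the same quotients formed with the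
  test functions that approximate \<open>u\<close> are test functions, and their factors are bounded and converge
  almost everywhere along a subsequence.\<close>

lemma approx_picone:
  assumes a: "approx \<Omega> u G \<psi>" and \<phi>: "\<phi> \<in> test_functions \<Omega>" and e: "0 < e"
  defines "v \<equiv> \<lambda>x. (\<phi> x)\<^sup>2 * inverse (reg e (u x))"
    and "H \<equiv> \<lambda>x. (2 * \<phi> x * inverse (reg e (u x))) *\<^sub>R grad \<phi> x
       + ((\<phi> x)\<^sup>2 * (- reg' e (u x) * (inverse (reg e (u x)))\<^sup>2)) *\<^sub>R G x"
  obtains \<chi>s where "approx \<Omega> v H \<chi>s"
proof -
  obtain M where M: "M > 0" "\<And>x. \<bar>\<phi> x\<bar> \<le> M" using test_bounded[OF \<phi>] by metis
  obtain r where r: "strict_mono r" "AE x in lebesgue. (\<lambda>k. \<psi> (r k) x) \<longlonglongrightarrow> u x"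
    by (rule L2conv_AE_subseq[OF approxD(2)[OF a]])
  note \<psi> = approxD(1)[OF a]
  let ?f = "\<lambda>t. inverse (reg e t)" and ?f' = "\<lambda>t. - reg' e t * (inverse (reg e t))\<^sup>2"
  have cf: "continuous_on UNIV ?f"
    using inverse_reg_DERIV[OF e] by (intro DERIV_continuous_on) (auto intro: has_field_derivative_at_within)
  have "sqrt (x\<^sup>2 + e\<^sup>2) \<noteq> 0" "1 + (x / e)\<^sup>2 \<noteq> 0" for x :: real
    using sq_pos[OF e, of x] add_pos_nonneg[OF zero_less_one zero_le_power2[of "x / e"]] by auto
  then have cr: "continuous_on UNIV (reg' e)"
    unfolding reg'_def[abs_def] using e by (intro continuous_intros) auto
  have cf': "continuous_on UNIV ?f'"
    by (intro continuous_on_mult continuous_on_minus continuous_on_power cr cf)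
  have fm: "(\<lambda>x. ?f (w x)) \<in> borel_measurable lebesgue" "(\<lambda>x. ?f' (w x)) \<in> borel_measurable lebesgue"
    if "w \<in> borel_measurable lebesgue" for w :: "real ^ 'n \<Rightarrow> real"
    using measurable_compose[OF that borel_measurable_continuous_onI[OF cf]]
      measurable_compose[OF that borel_measurable_continuous_onI[OF cf']] by auto
  have um: "u \<in> borel_measurable lebesgue" by (rule L2_measurable[OF approxD(4)[OF a]])
  have \<psi>m: "\<psi> k \<in> borel_measurable lebesgue" for k by (rule test_measurable(1)[OF \<psi>])
  have [measurable]: "\<phi> \<in> borel_measurable lebesgue" by (rule test_measurable(1)[OF \<phi>])
  have lf: "AE x in lebesgue. (\<lambda>k. ?f (\<psi> (r k) x)) \<longlonglongrightarrow> ?f (u x)"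
    using r(2) by eventually_elim (auto intro: continuous_on_tendsto_compose[OF cf])
  have lf': "AE x in lebesgue. (\<lambda>k. ?f' (\<psi> (r k) x)) \<longlonglongrightarrow> ?f' (u x)"
    using r(2) by eventually_elim (rule continuous_on_tendsto_compose[OF cf'], auto)
  have b1: "\<bar>\<phi> x * ?f t\<bar> \<le> M * (1 / e)" for x t
    unfolding abs_mult by (intro mult_mono M(2) inverse_reg_bounds(1)[OF e]) (use M(1) in auto)
  have b2: "\<bar>(\<phi> x)\<^sup>2 * ?f' t\<bar> \<le> M\<^sup>2 * (2 / e\<^sup>2)" for x t
  proof -
    have "\<bar>(\<phi> x)\<^sup>2\<bar> \<le> M\<^sup>2" using power_mono[OF M(2)[of x] abs_ge_zero, of 2] by simp
    from mult_mono[OF this inverse_reg_bounds(2)[OF e, of t]] show ?thesis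
      by (simp only: abs_mult[symmetric] abs_ge_zero zero_le_power2)
  qed
  define w where "w k x = ((\<phi> x)\<^sup>2 * ?f (\<psi> (r k) x))" for k x
  have wt: "w k \<in> test_functions \<Omega>" for k
  proof -
    have "(\<lambda>x. (\<phi> x * ?f (\<psi> (r k) x)) * \<phi> x) \<in> test_functions \<Omega>"
      by (intro test_mult[OF \<phi>] smooth_intros(4) test_smooth[OF \<phi>] smooth_inverse_reg[OF e] test_smooth[OF \<psi>])
    then show ?thesis by (simp add: w_def[abs_def] power2_eq_square mult_ac)
  qed
  have gw: "grad (w k) x = (2 * \<phi> x * ?f (\<psi> (r k) x)) *\<^sub>R grad \<phi> x + ((\<phi> x)\<^sup>2 * ?f' (\<psi> (r k) x)) *\<^sub>R grad (\<psi> (r k)) x" for k x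
  proof -
    have "grad (\<lambda>x. \<phi> x * \<phi> x * ?f (\<psi> (r k) x)) x = (\<phi> x * \<phi> x) *\<^sub>R grad (\<lambda>x. ?f (\<psi> (r k) x)) x
       + ?f (\<psi> (r k) x) *\<^sub>R grad (\<lambda>x. \<phi> x * \<phi> x) x"
      by (rule grad_mult[OF smooth_intros(4)[OF test_smooth[OF \<phi>] test_smooth[OF \<phi>]] smooth_inverse_reg[OF e test_smooth[OF \<psi>]]])
    also have "grad (\<lambda>x. ?f (\<psi> (r k) x)) x = ?f' (\<psi> (r k) x) *\<^sub>R grad (\<psi> (r k)) x"
      by (rule grad_chain[OF test_smooth[OF \<psi>] inverse_reg_DERIV[OF e]])
    also have "grad (\<lambda>x. \<phi> x * \<phi> x) x = \<phi> x *\<^sub>R grad \<phi> x + \<phi> x *\<^sub>R grad \<phi> x"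
      by (rule grad_mult[OF test_smooth[OF \<phi>] test_smooth[OF \<phi>]])
    finally show ?thesis
      by (simp add: w_def[abs_def] power2_eq_square scaleR_add_left[symmetric] scaleR_add_right[symmetric] mult_ac)
  qed
  have "L2conv lebesgue (\<lambda>k x. (\<phi> x * ?f (\<psi> (r k) x)) *\<^sub>R \<phi> x) (\<lambda>x. (\<phi> x * ?f (u x)) *\<^sub>R \<phi> x)"
  proof (rule L2conv_mult_bounded[OF L2conv_const[OF test_L2(1)[OF \<phi>]] _ _ b1 b1])
    show "AE x in lebesgue. (\<lambda>k. \<phi> x * ?f (\<psi> (r k) x)) \<longlonglongrightarrow> \<phi> x * ?f (u x)"
      using lf by eventually_elim (intro tendsto_mult tendsto_const)
  qed (use fm(1)[OF um] fm(1)[OF \<psi>m] in measurable)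
  then have c1: "L2conv lebesgue w v"
    by (simp add: w_def[abs_def] v_def power2_eq_square mult_ac)
  have c2: "L2conv lebesgue (\<lambda>k x. (2 * (\<phi> x * ?f (\<psi> (r k) x))) *\<^sub>R grad \<phi> x) (\<lambda>x. (2 * (\<phi> x * ?f (u x))) *\<^sub>R grad \<phi> x)"
  proof (rule L2conv_mult_bounded[OF L2conv_const[OF test_L2(2)[OF \<phi>]]])
    show "AE x in lebesgue. (\<lambda>k. 2 * (\<phi> x * ?f (\<psi> (r k) x))) \<longlonglongrightarrow> 2 * (\<phi> x * ?f (u x))"
      using lf by eventually_elim (intro tendsto_mult tendsto_const)
    show "\<bar>2 * (\<phi> x * ?f (\<psi> (r k) x))\<bar> \<le> 2 * (M * (1 / e))" for k x using b1[of x "\<psi> (r k) x"] by simp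
    show "\<bar>2 * (\<phi> x * ?f (u x))\<bar> \<le> 2 * (M * (1 / e))" for x using b1[of x "u x"] by simp
  qed (use fm(1)[OF um] fm(1)[OF \<psi>m] in measurable)
  have c3: "L2conv lebesgue (\<lambda>k x. ((\<phi> x)\<^sup>2 * ?f' (\<psi> (r k) x)) *\<^sub>R grad (\<psi> (r k)) x) (\<lambda>x. ((\<phi> x)\<^sup>2 * ?f' (u x)) *\<^sub>R G x)"
  proof (rule L2conv_mult_bounded[OF L2conv_subseq[OF approxD(3)[OF a] r(1)] _ _ b2 b2])
    show "AE x in lebesgue. (\<lambda>k. (\<phi> x)\<^sup>2 * ?f' (\<psi> (r k) x)) \<longlonglongrightarrow> (\<phi> x)\<^sup>2 * ?f' (u x)"
      using lf'
    proof eventually_elim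
      case (elim x)
      show ?case by (rule tendsto_mult[OF tendsto_const elim])
    qed
    show "(\<lambda>x. (\<phi> x)\<^sup>2 * ?f' (\<psi> (r k) x)) \<in> borel_measurable lebesgue" for k
      by (rule borel_measurable_times[OF _ fm(2)[OF \<psi>m]]) measurable
    show "(\<lambda>x. (\<phi> x)\<^sup>2 * ?f' (u x)) \<in> borel_measurable lebesgue"
      by (rule borel_measurable_times[OF _ fm(2)[OF um]]) measurable
  qed
  have "L2conv lebesgue (\<lambda>k. grad (w k)) H"
  proof -
    have "(\<lambda>k. grad (w k)) = (\<lambda>k x. (2 * (\<phi> x * ?f (\<psi> (r k) x))) *\<^sub>R grad \<phi> x + ((\<phi> x)\<^sup>2 * ?f' (\<psi> (r k) x)) *\<^sub>R grad (\<psi> (r k)) x)"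
      unfolding fun_eq_iff gw by (simp add: mult.assoc)
    moreover have "H = (\<lambda>x. (2 * (\<phi> x * ?f (u x))) *\<^sub>R grad \<phi> x + ((\<phi> x)\<^sup>2 * ?f' (u x)) *\<^sub>R G x)"
      unfolding H_def by (simp add: mult.assoc)
    ultimately show ?thesis using L2conv_add[OF c2 c3] by simp
  qed
  then have "approx \<Omega> v H w" using wt c1 by (simp add: approx_def)
  then show ?thesis by (rule that)
qed

text \<open>Testing the equation with \<open>\<phi>\<^sup>2/reg \<epsilon> u\<close> writes \<open>\<rho>(\<phi>)\<^sup>2\<close> as a sum of the right-hand side, the local and
  the nonlocal remainder.  All three are nonnegative, hence each is bounded by \<open>\<rho>(\<phi>)\<^sup>2\<close>.\<close>

lemma picone_remainder:
  assumes a: "approx \<Omega> u G \<psi>" and pos: "AE x in lebesgue. u x \<ge> 0" and w: "weak_form lam u G"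
    and lam: "0 \<le> lam" and \<phi>: "\<phi> \<in> test_functions \<Omega>" and e: "0 < e"
  defines "v \<equiv> \<lambda>x. (\<phi> x)\<^sup>2 * inverse (reg e (u x))"
  shows "(\<integral>\<^sup>+z. ennreal ((nl s \<phi> z)\<^sup>2 - nl s u z * nl s v z) \<partial>lebesgue) \<le> ennreal (energy \<phi> (grad \<phi>))"
    and "(\<integral>\<^sup>+x. ennreal ((\<bar>u x\<bar> powr (p - 1) + lam * u x) * v x) \<partial>lebesgue) \<le> ennreal (energy \<phi> (grad \<phi>))"
    and "(\<lambda>z. (nl s \<phi> z)\<^sup>2 - nl s u z * nl s v z) \<in> borel_measurable lebesgue"
    and "AE z in lebesgue. 0 \<le> (nl s \<phi> z)\<^sup>2 - nl s u z * nl s v z"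
proof -
  define H where "H = (\<lambda>x. (2 * \<phi> x * inverse (reg e (u x))) *\<^sub>R grad \<phi> x
       + ((\<phi> x)\<^sup>2 * (- reg' e (u x) * (inverse (reg e (u x)))\<^sup>2)) *\<^sub>R G x)"
  obtain \<chi>s where b: "approx \<Omega> v H \<chi>s"
  proof -
    have "\<exists>\<chi>s. approx \<Omega> v H \<chi>s"
      unfolding v_def H_def by (rule approx_picone[OF a \<phi> e]) (rule exI)
    then show ?thesis using that by blast
  qed
  define RHS where "RHS = (\<integral>x. \<bar>u x\<bar> powr (p - 1) * v x \<partial>lebesgue) + lam * ip lebesgue u v"
  have eq: "ip lebesgue G H + ip lebesgue (nl s u) (nl s v) = RHS"
    unfolding RHS_def by (rule weak_formD[OF w b])
  have um: "u \<in> borel_measurable lebesgue" and vm: "v \<in> borel_measurable lebesgue"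
    using approxD(4)[OF a] approxD(4)[OF b] by (auto simp: L2_def)
  have i1: "integrable lebesgue (\<lambda>x. \<bar>u x\<bar> powr (p - 1) * v x)"
    by (rule power_pairing_integrable[OF um sobolev_approx(1)[OF a] vm sobolev_approx(1)[OF b]])
  have i2: "integrable lebesgue (\<lambda>x. u x * v x)" using L2_ip[OF approxD(4)[OF a] approxD(4)[OF b]] by simp
  have i12: "integrable lebesgue (\<lambda>x. (\<bar>u x\<bar> powr (p - 1) + lam * u x) * v x)"
    using Bochner_Integration.integrable_add[OF i1 integrable_mult_right[OF i2, of lam]] by (simp add: algebra_simps)
  have R: "RHS = (\<integral>x. (\<bar>u x\<bar> powr (p - 1) + lam * u x) * v x \<partial>lebesgue)"
    using i1 i2 by (simp add: RHS_def ip_def algebra_simps)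
  have rn: "AE x in lebesgue. 0 \<le> (\<bar>u x\<bar> powr (p - 1) + lam * u x) * v x"
    using pos
  proof eventually_elim
    case (elim x)
    have "0 \<le> v x" using reg_pos[OF e, of "u x"] by (simp add: v_def)
    then show ?case using elim lam by (intro mult_nonneg_nonneg add_nonneg_nonneg) auto
  qed
  have R0: "0 \<le> RHS" unfolding R by (rule integral_nonneg_AE[OF rn])
  have loc: "ip lebesgue G H \<le> sqn lebesgue (grad \<phi>)"
    unfolding ip_def sqn_def
  proof (rule integral_mono_AE[OF L2_ip[OF approxD(5)[OF a] approxD(5)[OF b]] L2_integrable[OF test_L2(2)[OF \<phi>]]])
    show "AE x in lebesgue. G x \<bullet> H x \<le> (norm (grad \<phi> x))\<^sup>2"
      using pos by eventually_elim (unfold H_def, rule picone_local[OF e])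
  qed
  note nlL = test_nl[OF \<phi>] approx_nl_L2[OF a] approx_nl_L2[OF b]
  show m: "(\<lambda>z. (nl s \<phi> z)\<^sup>2 - nl s u z * nl s v z) \<in> borel_measurable lebesgue"
    using nlL[THEN L2_measurable] by measurable
  show nn: "AE z in lebesgue. 0 \<le> (nl s \<phi> z)\<^sup>2 - nl s u z * nl s v z"
    using AE_product[OF pos pos]
  proof eventually_elim
    case (elim z)
    obtain x y where z: "z = (x, y)" by (cases z)
    have "(u x - u y) * (v x - v y) \<le> (\<phi> x - \<phi> y)\<^sup>2"
      unfolding v_def using elim by (intro picone_nonlocal[OF e]) (auto simp: z)
    then show ?case by (simp add: z nl_sq nl_mult divide_right_mono)
  qed
  have inl: "integrable lebesgue (\<lambda>z. (nl s \<phi> z)\<^sup>2)" "integrable lebesgue (\<lambda>z. nl s u z * nl s v z)"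
    using L2_integrable[OF nlL(1)] L2_ip[OF nlL(2,3)] by auto
  have int: "(\<integral>z. (nl s \<phi> z)\<^sup>2 - nl s u z * nl s v z \<partial>lebesgue) = sqn lebesgue (nl s \<phi>) - ip lebesgue (nl s u) (nl s v)"
    using inl by (simp add: sqn_def ip_def)
  then have int0: "0 \<le> sqn lebesgue (nl s \<phi>) - ip lebesgue (nl s u) (nl s v)"
    using integral_nonneg_AE[OF nn] by simp
  have "(\<integral>\<^sup>+z. ennreal ((nl s \<phi> z)\<^sup>2 - nl s u z * nl s v z) \<partial>lebesgue)
     = ennreal (sqn lebesgue (nl s \<phi>) - ip lebesgue (nl s u) (nl s v))"
    using inl nn by (subst nn_integral_eq_integral) (auto simp: int)
  also have "\<dots> \<le> ennreal (energy \<phi> (grad \<phi>))"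
    using eq loc R0 by (intro ennreal_leI) (simp add: energy_def)
  finally show "(\<integral>\<^sup>+z. ennreal ((nl s \<phi> z)\<^sup>2 - nl s u z * nl s v z) \<partial>lebesgue) \<le> ennreal (energy \<phi> (grad \<phi>))" .
  have "(\<integral>\<^sup>+x. ennreal ((\<bar>u x\<bar> powr (p - 1) + lam * u x) * v x) \<partial>lebesgue) = ennreal RHS"
    unfolding R by (rule nn_integral_eq_integral[OF i12 rn])
  also have "\<dots> \<le> ennreal (energy \<phi> (grad \<phi>))"
    using eq loc int0 by (intro ennreal_leI) (simp add: energy_def)
  finally show "(\<integral>\<^sup>+x. ennreal ((\<bar>u x\<bar> powr (p - 1) + lam * u x) * v x) \<partial>lebesgue) \<le> ennreal (energy \<phi> (grad \<phi>))" .
qed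

section \<open>Nonexistence above the first eigenvalue\<close>

lemma AE_product_null:
  fixes A B :: "(real ^ 'm) set"
  assumes "A \<in> sets borel" "B \<in> sets borel" and ae: "AE z in lebesgue. \<not> (fst z \<in> A \<and> snd z \<in> B)"
  shows "emeasure lborel A = 0 \<or> emeasure lborel B = 0"
proof -
  have s: "A \<times> B \<in> sets (lborel \<Otimes>\<^sub>M lborel)" using assms(1,2) by auto
  have "AE z in lborel. \<not> (fst z \<in> A \<and> snd z \<in> B)" using ae by (simp only: AE_completion_iff)
  then have "AE z in (lborel \<Otimes>\<^sub>M lborel). z \<notin> A \<times> B" unfolding lborel_prod by eventually_elim auto
  then have "emeasure (lborel \<Otimes>\<^sub>M lborel) (A \<times> B) = 0"
    using AE_iff_null_sets[OF s] by auto
  moreover have "emeasure (lborel \<Otimes>\<^sub>M lborel) (A \<times> B) = emeasure lborel A * emeasure lborel B"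
    using assms(1,2) by (intro lborel.emeasure_pair_measure_Times) auto
  ultimately show ?thesis by simp
qed

text \<open>Multiply the nonlocal remainder by \<open>\<epsilon>\<close> and let \<open>\<epsilon>\<close> tend to 0.  At pairs with \<open>u(x) = 0 < u(y)\<close> the
  comparison function at \<open>x\<close> is \<open>\<phi>(x)\<^sup>2/(3\<epsilon>)\<close>, because \<open>reg \<epsilon> 0 = 3\<epsilon>\<close>, and the limit is a positive
  multiple of \<open>u(y)\<phi>(x)\<^sup>2\<close>.  But the integral of the remainder stays bounded, so the integral of the
  limit vanishes, and one of the sets \<open>{u = 0, \<phi> \<noteq> 0}\<close> and \<open>{u > 0}\<close> is null.\<close>

lemma positive_on_test:
  assumes a: "approx \<Omega> u G \<psi>" and pos: "AE x in lebesgue. u x \<ge> 0" and nz: "\<not> (AE x in lebesgue. u x = 0)"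
    and w: "weak_form lam u G" and lam: "0 \<le> lam" and \<phi>: "\<phi> \<in> test_functions \<Omega>"
  shows "AE x in lebesgue. \<phi> x \<noteq> 0 \<longrightarrow> u x > 0"
proof -
  let ?\<alpha> = "real CARD('n) + 2 * s"
  define ee where "ee j = 1 / real (Suc j)" for j
  have ee: "ee j > 0" for j by (simp add: ee_def)
  have ee0: "ee \<longlonglongrightarrow> 0" unfolding ee_def by (rule LIMSEQ_Suc[OF lim_1_over_n])
  define v where "v j = (\<lambda>x. (\<phi> x)\<^sup>2 * inverse (reg (ee j) (u x)))" for j
  note P = picone_remainder[OF a pos w lam \<phi> ee, folded v_def]
  have um: "u \<in> borel_measurable lebesgue" by (rule L2_measurable[OF approxD(4)[OF a]])
  obtain u' where u'[measurable]: "u' \<in> borel_measurable borel" and uu': "AE x in lebesgue. u x = u' x"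
    using borel_representative[OF um] .
  have \<phi>m[measurable]: "\<phi> \<in> borel_measurable borel" by (rule test_borel[OF \<phi>])
  define A where "A = {x. u' x = 0 \<and> \<phi> x \<noteq> 0}"
  define B where "B = {x. u' x > 0}"
  have AB[measurable]: "A \<in> sets borel" "B \<in> sets borel" unfolding A_def B_def by measurable
  define ind where "ind z = (indicator (A \<times> B) z :: real)" for z
  have indm: "ind \<in> borel_measurable lebesgue"
  proof (rule borel_lebesgue)
    have "A \<times> B \<in> sets (borel \<Otimes>\<^sub>M borel)" by measurable
    then have "A \<times> B \<in> sets borel" by (simp only: borel_prod)
    then show "ind \<in> borel_measurable borel" unfolding ind_def[abs_def] by simp
  qed
  define f where "f j z = ind z * (ee j * ((nl s \<phi> z)\<^sup>2 - nl s u z * nl s (v j) z))" for j z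
  define F where "F z = ind z * (u (snd z) * (\<phi> (fst z))\<^sup>2 / 3 / norm (fst z - snd z) powr ?\<alpha>)" for z
  have "(\<integral>\<^sup>+z. ennreal (F z) \<partial>lebesgue) \<le> ennreal (0 * energy \<phi> (grad \<phi>))"
  proof (rule nn_integral_fatou_limit)
    show "f j \<in> borel_measurable lebesgue" for j
      unfolding f_def[abs_def] by (intro borel_measurable_times indm borel_measurable_const P(3))
    show "(\<integral>\<^sup>+z. ennreal (f j z) \<partial>lebesgue) \<le> ennreal (ee j * energy \<phi> (grad \<phi>))" for j
    proof -
      have "(\<integral>\<^sup>+z. ennreal (f j z) \<partial>lebesgue) \<le> (\<integral>\<^sup>+z. ennreal (ee j) * ennreal ((nl s \<phi> z)\<^sup>2 - nl s u z * nl s (v j) z) \<partial>lebesgue)"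
      proof (rule nn_integral_mono)
        fix z
        show "ennreal (f j z) \<le> ennreal (ee j) * ennreal ((nl s \<phi> z)\<^sup>2 - nl s u z * nl s (v j) z)"
          using ee[of j] by (auto simp: f_def ind_def indicator_def ennreal_mult'[symmetric])
      qed
      also have "\<dots> = ennreal (ee j) * (\<integral>\<^sup>+z. ennreal ((nl s \<phi> z)\<^sup>2 - nl s u z * nl s (v j) z) \<partial>lebesgue)"
        by (rule nn_integral_cmult[OF measurable_compose[OF P(3) measurable_ennreal]])
      also have "\<dots> \<le> ennreal (ee j) * ennreal (energy \<phi> (grad \<phi>))" by (intro mult_left_mono P(1)) simp
      also have "\<dots> = ennreal (ee j * energy \<phi> (grad \<phi>))"
        using ee[of j] energy_nonneg by (intro ennreal_mult[symmetric]) auto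
      finally show ?thesis .
    qed
    show "(\<lambda>j. ee j * energy \<phi> (grad \<phi>)) \<longlonglongrightarrow> 0 * energy \<phi> (grad \<phi>)"
      by (intro tendsto_mult ee0 tendsto_const)
    show "AE z in lebesgue. (\<lambda>j. f j z) \<longlonglongrightarrow> F z"
      using AE_product[OF uu' uu']
    proof eventually_elim
      case (elim z)
      obtain x y where z: "z = (x, y)" by (cases z)
      show ?case
      proof (cases "z \<in> A \<times> B")
        case True
        then have ux: "u x = 0" and uy: "u y > 0" using elim by (auto simp: z A_def B_def)
        define N where "N = norm (x - y) powr ?\<alpha>"
        have id: "f j z = (ee j * (\<phi> x - \<phi> y)\<^sup>2 + u y * ((\<phi> x)\<^sup>2 / 3 - ee j * ((\<phi> y)\<^sup>2 * inverse (reg (ee j) (u y))))) / N" for j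
        proof -
          have "ee j * inverse (reg (ee j) (u x)) = 1 / 3" using ee[of j] by (simp add: ux reg_zero)
          then have i: "ee j * ((\<phi> x)\<^sup>2 * inverse (reg (ee j) (u x))) = (\<phi> x)\<^sup>2 / 3" by simp
          have "f j z = ee j * ((\<phi> x - \<phi> y)\<^sup>2 / N - (u x - u y) * (v j x - v j y) / N)"
            using True by (simp add: f_def ind_def z nl_sq nl_mult N_def)
          also have "\<dots> = (ee j * (\<phi> x - \<phi> y)\<^sup>2 + u y * (ee j * ((\<phi> x)\<^sup>2 * inverse (reg (ee j) (u x))) - ee j * ((\<phi> y)\<^sup>2 * inverse (reg (ee j) (u y))))) / N"
            unfolding v_def by (simp add: ux diff_divide_distrib add_divide_distrib algebra_simps)
          finally have "f j z = (ee j * (\<phi> x - \<phi> y)\<^sup>2 + u y * (ee j * ((\<phi> x)\<^sup>2 * inverse (reg (ee j) (u x))) - ee j * ((\<phi> y)\<^sup>2 * inverse (reg (ee j) (u y))))) / N" .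
          then show ?thesis unfolding i .
        qed
        have "(\<lambda>j. ee j * ((\<phi> y)\<^sup>2 * inverse (reg (ee j) (u y)))) \<longlonglongrightarrow> 0"
        proof (rule tendsto_sandwich[OF _ _ tendsto_const])
          show "\<forall>\<^sub>F j in sequentially. 0 \<le> ee j * ((\<phi> y)\<^sup>2 * inverse (reg (ee j) (u y)))"
            using ee reg_pos[OF ee] by (intro always_eventually allI mult_nonneg_nonneg) (auto intro: less_imp_le)
          have "inverse (reg (ee j) (u y)) \<le> inverse (u y)" for j
            using reg_lower(2)[OF ee, of "u y" j] uy by (intro le_imp_inverse_le) auto
          then show "\<forall>\<^sub>F j in sequentially. ee j * ((\<phi> y)\<^sup>2 * inverse (reg (ee j) (u y))) \<le> ee j * ((\<phi> y)\<^sup>2 * inverse (u y))"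
            using ee by (intro always_eventually allI mult_left_mono) (auto intro: less_imp_le)
          show "(\<lambda>j. ee j * ((\<phi> y)\<^sup>2 * inverse (u y))) \<longlonglongrightarrow> 0"
            using tendsto_mult[OF ee0 tendsto_const, of "(\<phi> y)\<^sup>2 * inverse (u y)"] by simp
        qed
        then have "(\<lambda>j. (ee j * (\<phi> x - \<phi> y)\<^sup>2 + u y * ((\<phi> x)\<^sup>2 / 3 - ee j * ((\<phi> y)\<^sup>2 * inverse (reg (ee j) (u y))))) * inverse N)
           \<longlonglongrightarrow> (0 * (\<phi> x - \<phi> y)\<^sup>2 + u y * ((\<phi> x)\<^sup>2 / 3 - 0)) * inverse N"
          by (intro tendsto_mult tendsto_add tendsto_diff tendsto_const ee0)
        moreover have "F z = (0 * (\<phi> x - \<phi> y)\<^sup>2 + u y * ((\<phi> x)\<^sup>2 / 3 - 0)) * inverse N"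
        proof -
          have "F z = u y * (\<phi> x)\<^sup>2 / 3 / N" using True by (simp add: F_def ind_def z N_def)
          then show ?thesis by (simp add: inverse_eq_divide)
        qed
        ultimately show ?thesis unfolding id divide_inverse[of _ N] by (simp only:)
      next
        case False
        then show ?thesis by (simp add: f_def F_def ind_def)
      qed
    qed
  qed
  then have int0: "(\<integral>\<^sup>+z. ennreal (F z) \<partial>lebesgue) = 0" by simp
  define F' where "F' z = ind z * (u' (snd z) * (\<phi> (fst z))\<^sup>2 / 3 / norm (fst z - snd z) powr ?\<alpha>)" for z
  have FF': "AE z in lebesgue. F z = F' z"
    using AE_product[OF uu' uu'] by eventually_elim (simp add: F_def F'_def)
  have "(\<lambda>z. u' (snd z) * (\<phi> (fst z))\<^sup>2 / 3 / norm (fst z - snd z) powr ?\<alpha>) \<in> borel_measurable (borel \<Otimes>\<^sub>M borel)"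
    by measurable
  then have "(\<lambda>z. u' (snd z) * (\<phi> (fst z))\<^sup>2 / 3 / norm (fst z - snd z) powr ?\<alpha>) \<in> borel_measurable lebesgue"
    by (intro borel_lebesgue) (simp add: borel_prod)
  then have F'm: "F' \<in> borel_measurable lebesgue" unfolding F'_def[abs_def] using indm by measurable
  have "(\<integral>\<^sup>+z. ennreal (F' z) \<partial>lebesgue) = 0"
  proof -
    have "(\<integral>\<^sup>+z. ennreal (F' z) \<partial>lebesgue) = (\<integral>\<^sup>+z. ennreal (F z) \<partial>lebesgue)"
    proof (rule nn_integral_cong_AE)
      show "AE z in lebesgue. ennreal (F' z) = ennreal (F z)" using FF' by eventually_elim simp
    qed
    then show ?thesis using int0 by simp
  qed
  then have "AE z in lebesgue. ennreal (F' z) = 0"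
    using F'm by (subst (asm) nn_integral_0_iff_AE) auto
  then have "AE z in lebesgue. \<not> (fst z \<in> A \<and> snd z \<in> B)"
  proof eventually_elim
    case (elim z)
    show ?case
    proof
      assume z: "fst z \<in> A \<and> snd z \<in> B"
      then have "fst z \<noteq> snd z" by (auto simp: A_def B_def)
      then have "0 < F' z" using z by (cases z) (auto simp: F'_def ind_def A_def B_def)
      with elim show False by (simp add: ennreal_eq_0_iff)
    qed
  qed
  from AE_product_null[OF AB this] have "emeasure lborel A = 0 \<or> emeasure lborel B = 0" .
  moreover have "emeasure lborel B \<noteq> 0"
  proof
    assume "emeasure lborel B = 0"
    then have "AE x in lborel. x \<notin> B" by (intro AE_not_in) auto
    then have "AE x in lebesgue. x \<notin> B" by (rule AE_completion)
    then have "AE x in lebesgue. u x = 0" using uu' pos by eventually_elim (auto simp: B_def)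
    with nz show False by simp
  qed
  ultimately have "AE x in lborel. x \<notin> A" by (intro AE_not_in) auto
  then have "AE x in lebesgue. x \<notin> A" by (rule AE_completion)
  then show ?thesis using uu' pos by eventually_elim (auto simp: A_def)
qed

lemma positive_in_domain:
  assumes a: "approx \<Omega> u G \<psi>" and pos: "AE x in lebesgue. u x \<ge> 0" and nz: "\<not> (AE x in lebesgue. u x = 0)"
    and w: "weak_form lam u G" and lam: "0 \<le> lam"
  shows "AE x in lebesgue. x \<in> \<Omega> \<longrightarrow> u x > 0"
proof (rule AE_zero_on_open_if_local[OF op])
  fix c d :: "real ^ 'n" assume "cbox c d \<subseteq> \<Omega>"
  from positive_on_test[OF a pos nz w lam box_bump_test[OF this, of 0]]
  show "AE x in lebesgue. x \<in> box c d \<longrightarrow> u x > 0" by (simp add: box_bump_pos)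
qed

text \<open>The limit \<open>\<epsilon> \<rightarrow> 0\<close> of Picone's inequality, by Fatou's lemma; the quotients converge to \<open>\<phi>\<^sup>2/u\<close> because
  \<open>u > 0\<close>.\<close>

lemma linearized_bound:
  assumes a: "approx \<Omega> u G \<psi>" and pos: "AE x in lebesgue. u x \<ge> 0" and nz: "\<not> (AE x in lebesgue. u x = 0)"
    and w: "weak_form lam u G" and lam: "0 \<le> lam" and \<phi>: "\<phi> \<in> test_functions \<Omega>"
  shows "(\<integral>\<^sup>+x. ennreal ((u x powr (p - 2) + lam) * (\<phi> x)\<^sup>2) \<partial>lebesgue) \<le> ennreal (energy \<phi> (grad \<phi>))"
proof -
  define ee where "ee j = 1 / real (Suc j)" for j
  have ee: "ee j > 0" for j by (simp add: ee_def)
  have ee0: "ee \<longlonglongrightarrow> 0" unfolding ee_def by (rule LIMSEQ_Suc[OF lim_1_over_n])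
  define v where "v j = (\<lambda>x. (\<phi> x)\<^sup>2 * inverse (reg (ee j) (u x)))" for j
  have um: "u \<in> borel_measurable lebesgue" by (rule L2_measurable[OF approxD(4)[OF a]])
  have vm: "v j \<in> borel_measurable lebesgue" for j
  proof -
    have "continuous_on UNIV (\<lambda>t. inverse (reg (ee j) t))"
      using inverse_reg_DERIV[OF ee] by (intro DERIV_continuous_on) (auto intro: has_field_derivative_at_within)
    from measurable_compose[OF um borel_measurable_continuous_onI[OF this]] test_measurable(1)[OF \<phi>]
    show ?thesis unfolding v_def by measurable
  qed
  show ?thesis
  proof (rule nn_integral_fatou_limit[where f = "\<lambda>j x. (\<bar>u x\<bar> powr (p - 1) + lam * u x) * v j x" and c = "\<lambda>_. energy \<phi> (grad \<phi>)"])
    show "(\<lambda>x. (\<bar>u x\<bar> powr (p - 1) + lam * u x) * v j x) \<in> borel_measurable lebesgue" for j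
      using um vm[of j] by measurable
    show "(\<integral>\<^sup>+x. ennreal ((\<bar>u x\<bar> powr (p - 1) + lam * u x) * v j x) \<partial>lebesgue) \<le> ennreal (energy \<phi> (grad \<phi>))" for j
      unfolding v_def by (rule picone_remainder(2)[OF a pos w lam \<phi> ee])
    show "AE x in lebesgue. (\<lambda>j. (\<bar>u x\<bar> powr (p - 1) + lam * u x) * v j x) \<longlonglongrightarrow> (u x powr (p - 2) + lam) * (\<phi> x)\<^sup>2"
      using positive_in_domain[OF a pos nz w lam]
    proof eventually_elim
      case (elim x)
      show ?case
      proof (cases "x \<in> \<Omega>")
        case True
        then have ux: "u x > 0" using elim by simp
        have "(\<lambda>j. reg (ee j) (u x)) \<longlonglongrightarrow> u x"
        proof (rule tendsto_sandwich[OF _ _ tendsto_const])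
          show "\<forall>\<^sub>F j in sequentially. u x \<le> reg (ee j) (u x)" using reg_lower(2)[OF ee, where t = "u x"] ux by simp
          show "\<forall>\<^sub>F j in sequentially. reg (ee j) (u x) \<le> u x + 5 * ee j" using reg_upper[OF ee, where t = "u x"] ux by simp
          show "(\<lambda>j. u x + 5 * ee j) \<longlonglongrightarrow> u x" using tendsto_add[OF tendsto_const tendsto_mult_left[OF ee0, of 5], of "u x"] by simp
        qed
        then have "(\<lambda>j. (\<bar>u x\<bar> powr (p - 1) + lam * u x) * v j x) \<longlonglongrightarrow> (\<bar>u x\<bar> powr (p - 1) + lam * u x) * ((\<phi> x)\<^sup>2 * inverse (u x))"
          unfolding v_def using ux by (intro tendsto_mult tendsto_const tendsto_inverse) auto
        moreover have "(\<bar>u x\<bar> powr (p - 1) + lam * u x) * ((\<phi> x)\<^sup>2 * inverse (u x)) = (u x powr (p - 2) + lam) * (\<phi> x)\<^sup>2"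
        proof -
          have "u x powr (p - 1) = u x powr (p - 2) * u x" using ux by (simp add: powr_diff power2_eq_square)
          then show ?thesis using ux by (simp add: field_simps)
        qed
        ultimately show ?thesis by (simp only:)
      next
        case False
        then show ?thesis using test_support[OF \<phi>] by (simp add: v_def)
      qed
    qed
  qed auto
qed

text \<open>Apply the linearized bound to a minimizing sequence of \<open>\<lambda>\<^sub>1\<close>.  It converges in \<open>L\<^sup>2\<close> to some \<open>E\<close> of norm 1
  along a subsequence, and \<open>\<integral>u\<^sup>p\<^sup>-\<^sup>2E\<^sup>2 = 0\<close> by Fatou's lemma.\<close>

lemma no_solution_above:
  assumes lam: "lambda_1 s \<Omega> \<le> lam" and sol: "is_solution s \<Omega> lam u"
  shows False
proof -
  obtain G \<psi> where a: "approx \<Omega> u G \<psi>" and pos: "AE x in lebesgue. u x \<ge> 0"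
    and nz: "\<not> (AE x in lebesgue. u x = 0)" and w: "weak_form lam u G"
    using sol unfolding solution_iff_weak_form by blast
  have lam0: "0 \<le> lam" using lam lambda_1_pos by linarith
  have um: "u \<in> borel_measurable lebesgue" by (rule L2_measurable[OF approxD(4)[OF a]])
  define ee where "ee k = 1 / real (Suc k)" for k
  have ee: "ee k > 0" "ee k \<le> 1" for k by (auto simp: ee_def)
  have ee0: "ee \<longlonglongrightarrow> 0" unfolding ee_def by (rule LIMSEQ_Suc[OF lim_1_over_n])
  obtain \<phi> where \<phi>: "\<And>k. \<phi> k \<in> test_functions \<Omega>" "\<And>k. sqn lebesgue (\<phi> k) = 1"
    "\<And>k. energy (\<phi> k) (grad (\<phi> k)) < lambda_1 s \<Omega> + ee k"
    using lambda_1_test(3)[OF ee(1)] by metis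
  have small: "(\<integral>\<^sup>+x. ennreal (u x powr (p - 2) * (\<phi> k x)\<^sup>2) \<partial>lebesgue) \<le> ennreal (ee k)" for k
  proof -
    let ?I = "\<integral>\<^sup>+x. ennreal (u x powr (p - 2) * (\<phi> k x)\<^sup>2) \<partial>lebesgue"
    have m: "(\<lambda>x. u x powr (p - 2) * (\<phi> k x)\<^sup>2) \<in> borel_measurable lebesgue" "(\<lambda>x. lam * (\<phi> k x)\<^sup>2) \<in> borel_measurable lebesgue"
      using um test_measurable(1)[OF \<phi>(1)[of k]] by measurable
    have "?I + ennreal lam = ?I + (\<integral>\<^sup>+x. ennreal (lam * (\<phi> k x)\<^sup>2) \<partial>lebesgue)"
    proof -
      have "(\<integral>\<^sup>+x. ennreal (lam * (\<phi> k x)\<^sup>2) \<partial>lebesgue) = ennreal (\<integral>x. lam * (\<phi> k x)\<^sup>2 \<partial>lebesgue)"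
        using L2_integrable[OF test_L2(1)[OF \<phi>(1)[of k]]] lam0 by (intro nn_integral_eq_integral) auto
      also have "(\<integral>x. lam * (\<phi> k x)\<^sup>2 \<partial>lebesgue) = lam" using \<phi>(2)[of k] by (simp add: sqn_def)
      finally show ?thesis by simp
    qed
    also have "\<dots> = (\<integral>\<^sup>+x. ennreal (u x powr (p - 2) * (\<phi> k x)\<^sup>2) + ennreal (lam * (\<phi> k x)\<^sup>2) \<partial>lebesgue)"
      using m by (intro nn_integral_add[symmetric]) auto
    also have "\<dots> = (\<integral>\<^sup>+x. ennreal ((u x powr (p - 2) + lam) * (\<phi> k x)\<^sup>2) \<partial>lebesgue)"
      using lam0 by (intro nn_integral_cong) (simp add: distrib_right ennreal_plus)
    also have "\<dots> \<le> ennreal (energy (\<phi> k) (grad (\<phi> k)))" by (rule linearized_bound[OF a pos nz w lam0 \<phi>(1)])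
    also have "\<dots> \<le> ennreal (ee k + lam)" using \<phi>(3)[of k] lam by (intro ennreal_leI) linarith
    also have "\<dots> = ennreal (ee k) + ennreal lam" using ee(1)[of k] lam0 by (intro ennreal_plus) auto
    finally show ?thesis by (simp add: ennreal_add_left_cancel_le add.commute)
  qed
  have bnd0: "sqn lebesgue (\<phi> k) \<le> max 1 (lambda_1 s \<Omega> + 1)" for k by (simp add: \<phi>(2))
  have bnd: "sqn lebesgue (nl s (\<phi> k)) \<le> max 1 (lambda_1 s \<Omega> + 1)" for k
    using \<phi>(3)[of k] ee(2)[of k] sqn_nonneg[of lebesgue "grad (\<phi> k)"] by (simp add: energy_def)
  obtain r where r: "strict_mono (r :: nat \<Rightarrow> nat)" "\<forall>e>0. \<exists>N. \<forall>k\<ge>N. \<forall>l\<ge>N. sqn lebesgue (\<lambda>x. \<phi> (r k) x - \<phi> (r l) x) < e"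
    by (rule rellich[where \<phi> = \<phi>, OF bd s0 \<phi>(1) test_nl[OF \<phi>(1)] bnd0 bnd])
  obtain E where E: "L2conv lebesgue (\<lambda>k. \<phi> (r k)) E"
    using L2_complete[of "\<lambda>k. \<phi> (r k)" lebesgue, OF test_L2(1)[OF \<phi>(1)] r(2)[rule_format]] by metis
  have E1: "sqn lebesgue E = 1" using sqn_tendsto[OF E] by (simp add: \<phi>(2) LIMSEQ_const_iff)
  obtain q where q: "strict_mono q" "AE x in lebesgue. (\<lambda>k. \<phi> (r (q k)) x) \<longlonglongrightarrow> E x"
    by (rule L2conv_AE_subseq[OF E])
  have Em: "E \<in> borel_measurable lebesgue" by (rule L2_measurable[OF L2convD(2)[OF E]])
  have "(\<integral>\<^sup>+x. ennreal (u x powr (p - 2) * (E x)\<^sup>2) \<partial>lebesgue) \<le> ennreal 0"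
  proof (rule nn_integral_fatou_limit)
    show "(\<lambda>x. u x powr (p - 2) * (\<phi> (r (q j)) x)\<^sup>2) \<in> borel_measurable lebesgue" for j
      using um test_measurable(1)[OF \<phi>(1)[of "r (q j)"]] by measurable
    show "AE x in lebesgue. (\<lambda>j. u x powr (p - 2) * (\<phi> (r (q j)) x)\<^sup>2) \<longlonglongrightarrow> u x powr (p - 2) * (E x)\<^sup>2"
      using q(2) by eventually_elim (intro tendsto_mult tendsto_power tendsto_const)
    show "(\<integral>\<^sup>+x. ennreal (u x powr (p - 2) * (\<phi> (r (q j)) x)\<^sup>2) \<partial>lebesgue) \<le> ennreal (ee (r (q j)))" for j
      by (rule small)
    show "(\<lambda>j. ee (r (q j))) \<longlonglongrightarrow> 0"
      using LIMSEQ_subseq_LIMSEQ[OF LIMSEQ_subseq_LIMSEQ[OF ee0 r(1)] q(1)] by (simp add: o_def)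
  qed
  then have "AE x in lebesgue. ennreal (u x powr (p - 2) * (E x)\<^sup>2) = 0"
    using um Em by (subst nn_integral_0_iff_AE[symmetric]) auto
  then have "AE x in lebesgue. (norm (E x))\<^sup>2 = 0"
    using positive_in_domain[OF a pos nz w lam0] q(2)
  proof eventually_elim
    case (elim x)
    show ?case
    proof (cases "x \<in> \<Omega>")
      case True
      then have "0 < u x powr (p - 2)" using elim(2) by simp
      then show ?thesis using elim(1) by (simp add: ennreal_eq_0_iff mult_le_0_iff)
    next
      case False
      then have "(\<lambda>k. \<phi> (r (q k)) x) = (\<lambda>k. 0)" using test_support[OF \<phi>(1)] by auto
      then show ?thesis using elim(3) by (simp add: LIMSEQ_const_iff)
    qed
  qed
  then have "sqn lebesgue E = 0" unfolding sqn_def by (rule integral_eq_zero_AE)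
  with E1 show False by simp
qed

end

section \<open>Existence just below the first eigenvalue\<close>

lemma sqrt_sq_lipschitz: "\<bar>sqrt (a\<^sup>2 + e\<^sup>2) - sqrt (b\<^sup>2 + e\<^sup>2)\<bar> \<le> \<bar>a - b\<bar>" for a b e :: real
proof -
  have "sqrt (a\<^sup>2 + e\<^sup>2) \<le> sqrt (b\<^sup>2 + e\<^sup>2) + \<bar>a - b\<bar>" for a b :: real
    using real_sqrt_sum_squares_triangle_ineq[of b "a - b" e 0] by simp
  from this[of a b] this[of b a] show ?thesis by linarith
qed

lemma approx_scale:
  assumes "approx \<Omega> u G \<phi>"
  shows "approx \<Omega> (\<lambda>x. c * u x) (\<lambda>x. c *\<^sub>R G x) (\<lambda>k x. c * \<phi> k x)"
proof -
  have "grad (\<lambda>x. 0) x = 0" for x :: "real ^ 'a" by (simp add: grad_def partial_const zero_vec_def)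
  then show ?thesis using approx_add_scaled[OF test_approx[OF test_zero] assms, of c] by simp
qed

lemma sqn_parallelogram:
  assumes "f \<in> L2 M" "g \<in> L2 M"
  shows "sqn M (\<lambda>x. f x + g x) + sqn M (\<lambda>x. f x - g x) = 2 * sqn M f + 2 * sqn M g"
  using sqn_add[OF assms] sqn_diff[OF assms] by simp

context mixed_problem
begin

definition shifted_energy :: "real \<Rightarrow> (real ^ 'n \<Rightarrow> real) \<Rightarrow> (real ^ 'n \<Rightarrow> real ^ 'n) \<Rightarrow> real" where
  "shifted_energy lam u G = energy u G - lam * sqn lebesgue u"

text \<open>Test functions are not stable under taking the modulus.  This regularization is 1-Lipschitz in the
  values and fixes 0, so it preserves the support and does not increase either energy.\<close>

definition smooth_abs :: "real \<Rightarrow> (real ^ 'n \<Rightarrow> real) \<Rightarrow> real ^ 'n \<Rightarrow> real" where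
  "smooth_abs e \<phi> x = sqrt ((\<phi> x)\<^sup>2 + e\<^sup>2) - e"

lemma smooth_abs_test:
  assumes \<phi>: "\<phi> \<in> test_functions \<Omega>" and e: "0 < e"
  shows "smooth_abs e \<phi> \<in> test_functions \<Omega>"
proof -
  obtain K where K: "compact K" "K \<subseteq> \<Omega>" "\<And>x. x \<notin> K \<Longrightarrow> \<phi> x = 0" using test_compactE[OF \<phi>] by metis
  show ?thesis
  proof (rule testI[OF _ K(1,2)])
    show "smooth (smooth_abs e \<phi>)" unfolding smooth_abs_def[abs_def]
      by (intro smooth_diff smooth_intros smooth_power2 test_smooth[OF \<phi>] sq_pos[OF e])
  qed (use K(3) e in \<open>simp add: smooth_abs_def\<close>)
qed

lemma smooth_abs_bounds:
  assumes e: "0 < e"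
  shows "0 \<le> smooth_abs e \<phi> x" "smooth_abs e \<phi> x \<le> \<bar>\<phi> x\<bar>" "\<bar>\<phi> x\<bar> - e \<le> smooth_abs e \<phi> x"
proof -
  have "e \<le> sqrt ((\<phi> x)\<^sup>2 + e\<^sup>2)" "\<bar>\<phi> x\<bar> \<le> sqrt ((\<phi> x)\<^sup>2 + e\<^sup>2)" by (auto intro: real_le_rsqrt)
  moreover have "sqrt ((\<phi> x)\<^sup>2 + e\<^sup>2) \<le> \<bar>\<phi> x\<bar> + e"
    using e by (intro real_le_lsqrt) (auto simp: power2_sum)
  ultimately show "0 \<le> smooth_abs e \<phi> x" "smooth_abs e \<phi> x \<le> \<bar>\<phi> x\<bar>" "\<bar>\<phi> x\<bar> - e \<le> smooth_abs e \<phi> x"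
    by (auto simp: smooth_abs_def)
qed

lemma smooth_abs_energy:
  assumes \<phi>: "\<phi> \<in> test_functions \<Omega>" and e: "0 < e"
  shows "energy (smooth_abs e \<phi>) (grad (smooth_abs e \<phi>)) \<le> energy \<phi> (grad \<phi>)"
proof -
  note t = smooth_abs_test[OF \<phi> e]
  have "sqn lebesgue (grad (smooth_abs e \<phi>)) \<le> sqn lebesgue (grad \<phi>)"
    unfolding sqn_def
  proof (rule integral_mono[OF L2_integrable[OF test_L2(2)[OF t]] L2_integrable[OF test_L2(2)[OF \<phi>]]])
    fix x
    have d: "((\<lambda>t. sqrt (t\<^sup>2 + e\<^sup>2) - e) has_real_derivative (\<phi> x / sqrt ((\<phi> x)\<^sup>2 + e\<^sup>2))) (at (\<phi> x))"
      using sq_pos[OF e, of "\<phi> x"] by (auto intro!: derivative_eq_intros simp: field_simps)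
    have g: "grad (smooth_abs e \<phi>) x = (\<phi> x / sqrt ((\<phi> x)\<^sup>2 + e\<^sup>2)) *\<^sub>R grad \<phi> x"
      unfolding smooth_abs_def[abs_def] by (rule grad_chain[OF test_smooth[OF \<phi>] d])
    have "\<bar>\<phi> x\<bar> \<le> sqrt ((\<phi> x)\<^sup>2 + e\<^sup>2)" by (rule real_le_rsqrt) simp
    then have "\<bar>\<phi> x / sqrt ((\<phi> x)\<^sup>2 + e\<^sup>2)\<bar> \<le> 1" using sq_pos[OF e, of "\<phi> x"] by (simp add: abs_divide)
    then have "norm (grad (smooth_abs e \<phi>) x) \<le> norm (grad \<phi> x)"
      using mult_right_mono[OF _ norm_ge_zero[of "grad \<phi> x"]] unfolding g norm_scaleR by fastforce
    then show "(norm (grad (smooth_abs e \<phi>) x))\<^sup>2 \<le> (norm (grad \<phi> x))\<^sup>2" by (rule power_mono) simp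
  qed
  moreover have "sqn lebesgue (nl s (smooth_abs e \<phi>)) \<le> sqn lebesgue (nl s \<phi>)"
    unfolding sqn_def
  proof (rule integral_mono[OF L2_integrable[OF test_nl[OF t]] L2_integrable[OF test_nl[OF \<phi>]]])
    fix z :: "(real ^ 'n) \<times> (real ^ 'n)"
    obtain x y where z: "z = (x, y)" by (cases z)
    have "\<bar>smooth_abs e \<phi> x - smooth_abs e \<phi> y\<bar> \<le> \<bar>\<phi> x - \<phi> y\<bar>"
      using sqrt_sq_lipschitz[of "\<phi> x" e "\<phi> y"] by (simp add: smooth_abs_def)
    then have "(smooth_abs e \<phi> x - smooth_abs e \<phi> y)\<^sup>2 \<le> (\<phi> x - \<phi> y)\<^sup>2" by (simp add: abs_le_square_iff)
    then show "(norm (nl s (smooth_abs e \<phi>) z))\<^sup>2 \<le> (norm (nl s \<phi> z))\<^sup>2"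
      by (simp add: z nl_sq divide_right_mono)
  qed
  ultimately show ?thesis by (simp add: energy_def)
qed

definition unitp :: "(real ^ 'n \<Rightarrow> real) set" where
  "unitp = {\<phi> \<in> test_functions \<Omega>. pint \<phi> = 1}"

lemma unitp_nonempty: "unitp \<noteq> {}"
proof -
  obtain \<phi> where "\<phi> \<in> test_functions \<Omega>" "pint \<phi> > 0" using exists_nonzero_test by metis
  then have "(\<lambda>x. inverse (pint \<phi> powr (1 / p)) * \<phi> x) \<in> unitp"
    by (simp add: unitp_def normalizep test_cmult)
  then show ?thesis by blast
qed

lemma shifted_energy_scale: "\<phi> \<in> test_functions \<Omega> \<Longrightarrow> shifted_energy lam (\<lambda>x. c * \<phi> x) (grad (\<lambda>x. c * \<phi> x)) = c\<^sup>2 * shifted_energy lam \<phi> (grad \<phi>)"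
  by (simp add: shifted_energy_def test_scale(3) sqn_cmult algebra_simps)

definition level :: "real \<Rightarrow> real" where
  "level lam = enn2real (INF \<phi>\<in>unitp. ennreal (shifted_energy lam \<phi> (grad \<phi>)))"

context
  fixes lam :: real
  assumes lam: "0 < lam" "lam < lambda_1 s \<Omega>"
begin

lemma shifted_energy_coercive:
  assumes "lambda_1 s \<Omega> * sqn lebesgue u \<le> energy u G"
  shows "(1 - lam / lambda_1 s \<Omega>) * energy u G \<le> shifted_energy lam u G"
proof -
  have "lam * sqn lebesgue u \<le> lam * (energy u G / lambda_1 s \<Omega>)"
    using assms lam lambda_1_pos by (intro mult_left_mono) (auto simp: field_simps)
  then show ?thesis by (simp add: shifted_energy_def algebra_simps)
qed

lemma coercivity_pos: "0 < 1 - lam / lambda_1 s \<Omega>"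
  using lam lambda_1_pos by simp

lemma shifted_energy_test_nonneg: "\<phi> \<in> test_functions \<Omega> \<Longrightarrow> 0 \<le> shifted_energy lam \<phi> (grad \<phi>)"
  using shifted_energy_coercive[OF lambda_1_test(2)] mult_nonneg_nonneg[OF less_imp_le[OF coercivity_pos] energy_nonneg]
  by (rule order_trans[rotated])

lemma level_facts:
  shows "\<phi> \<in> unitp \<Longrightarrow> level lam \<le> shifted_energy lam \<phi> (grad \<phi>)"
    and "e > 0 \<Longrightarrow> \<exists>\<phi>\<in>unitp. shifted_energy lam \<phi> (grad \<phi>) < level lam + e"
  using enn2real_INF[OF unitp_nonempty, of "\<lambda>\<phi>. shifted_energy lam \<phi> (grad \<phi>)"] shifted_energy_test_nonneg
  unfolding level_def unitp_def by auto

lemma level_pos: "0 < level lam"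
proof -
  define c where "c = (1 - lam / lambda_1 s \<Omega>) * sobolev_const TYPE('n)"
  have c: "c > 0" unfolding c_def using coercivity_pos sobolev_const_pos by simp
  obtain \<phi> where \<phi>: "\<phi> \<in> test_functions \<Omega>" "pint \<phi> = 1" "shifted_energy lam \<phi> (grad \<phi>) < level lam + c"
    using level_facts(2)[OF c] by (auto simp: unitp_def)
  have "sobolev_const TYPE('n) \<le> energy \<phi> (grad \<phi>)"
    using sobolev_const_test(2)[OF test_UNIV[OF \<phi>(1)]] \<phi>(2) sqn_nonneg[of lebesgue "nl s \<phi>"] by (simp add: energy_def)
  then have "c \<le> (1 - lam / lambda_1 s \<Omega>) * energy \<phi> (grad \<phi>)"
    unfolding c_def using coercivity_pos by (intro mult_left_mono) auto
  also have "\<dots> \<le> shifted_energy lam \<phi> (grad \<phi>)" by (rule shifted_energy_coercive[OF lambda_1_test(2)[OF \<phi>(1)]])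
  finally show ?thesis using \<phi>(3) by simp
qed

lemma level_test:
  assumes \<phi>: "\<phi> \<in> test_functions \<Omega>"
  shows "level lam * pint \<phi> powr (2 / p) \<le> shifted_energy lam \<phi> (grad \<phi>)"
proof (cases "pint \<phi> = 0")
  case False
  then have n: "pint \<phi> > 0" using pint_nonneg[of \<phi>] by simp
  define t where "t = pint \<phi> powr (1 / p)"
  have t: "t > 0" "t\<^sup>2 = pint \<phi> powr (2 / p)" using n by (auto simp: t_def power2_eq_square powr_add[symmetric])
  have "(\<lambda>x. inverse t * \<phi> x) \<in> unitp" using normalizep[OF n] \<phi> by (simp add: unitp_def test_cmult t_def)
  from level_facts(1)[OF this] have "level lam \<le> (inverse t)\<^sup>2 * shifted_energy lam \<phi> (grad \<phi>)"
    using shifted_energy_scale[OF \<phi>] by simp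
  then show ?thesis using t(1) unfolding t(2)[symmetric] by (simp add: field_simps)
qed (simp add: shifted_energy_test_nonneg[OF \<phi>])

lemma level_approx:
  assumes a: "approx \<Omega> u G \<phi>"
  shows "level lam * pint u powr (2 / p) \<le> shifted_energy lam u G"
  using pint_approx(2)[OF a level_pos, of 1 lam] level_test by (simp add: shifted_energy_def energy_def)

text \<open>Insert an almost minimizer of \<open>\<lambda>\<^sub>1\<close>, whose critical norm is bounded below.\<close>

lemma level_small: "level lam \<le> (lambda_1 s \<Omega> - lam) * (vol + 1)"
proof (rule field_le_epsilon)
  fix e :: real assume e: "e > 0"
  define e' where "e' = e / (vol + 1)"
  have e': "e' > 0" using e vol_nonneg by (simp add: e'_def)
  obtain \<phi> where \<phi>: "\<phi> \<in> test_functions \<Omega>" "sqn lebesgue \<phi> = 1" "energy \<phi> (grad \<phi>) < lambda_1 s \<Omega> + e'"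
    using lambda_1_test(3)[OF e'] by blast
  have "1 \<le> (vol + 1) * pint \<phi> powr (2 / p)" using sqn_le_pint[OF \<phi>(1)] \<phi>(2) by simp
  then have "level lam * 1 \<le> level lam * ((vol + 1) * pint \<phi> powr (2 / p))"
    using level_pos by (intro mult_left_mono) auto
  also have "\<dots> \<le> (vol + 1) * shifted_energy lam \<phi> (grad \<phi>)"
    using mult_left_mono[OF level_test[OF \<phi>(1)], of "vol + 1"] vol_nonneg by (simp add: mult_ac)
  also have "\<dots> \<le> (vol + 1) * (lambda_1 s \<Omega> + e' - lam)"
    using \<phi>(2,3) vol_nonneg by (intro mult_left_mono) (auto simp: shifted_energy_def)
  also have "\<dots> = (lambda_1 s \<Omega> - lam) * (vol + 1) + e"
    using vol_nonneg by (simp add: e'_def field_simps)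
  finally show "level lam \<le> (lambda_1 s \<Omega> - lam) * (vol + 1) + e" by simp
qed

text \<open>Replace an almost minimizer by its regularized modulus and renormalize; for small regularization
  parameter neither the energy nor the critical norm gets worse by much.\<close>

lemma nonneg_minimizing:
  assumes e: "e > 0"
  shows "\<exists>\<psi>\<in>unitp. (\<forall>x. 0 \<le> \<psi> x) \<and> shifted_energy lam \<psi> (grad \<psi>) < level lam + e"
proof -
  obtain \<phi> where \<phi>: "\<phi> \<in> test_functions \<Omega>" "pint \<phi> = 1" "shifted_energy lam \<phi> (grad \<phi>) < level lam + e"
    using level_facts(2)[OF e] by (auto simp: unitp_def)
  define d where "d j = 1 / real (Suc j)" for j
  have d: "d j > 0" for j by (simp add: d_def)
  have d0: "d \<longlonglongrightarrow> 0" unfolding d_def by (rule LIMSEQ_Suc[OF lim_1_over_n])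
  define \<psi> where "\<psi> j = smooth_abs (d j) \<phi>" for j
  have \<psi>: "\<psi> j \<in> test_functions \<Omega>" for j unfolding \<psi>_def by (rule smooth_abs_test[OF \<phi>(1) d])
  have b: "0 \<le> \<psi> j x" "\<psi> j x \<le> \<bar>\<phi> x\<bar>" "\<bar>\<phi> x\<bar> - d j \<le> \<psi> j x" for j x
    unfolding \<psi>_def using smooth_abs_bounds[OF d] by auto
  have lim: "(\<lambda>j. \<psi> j x) \<longlonglongrightarrow> \<bar>\<phi> x\<bar>" for x
  proof (rule tendsto_sandwich[OF _ _ _ tendsto_const])
    show "(\<lambda>j. \<bar>\<phi> x\<bar> - d j) \<longlonglongrightarrow> \<bar>\<phi> x\<bar>" using tendsto_diff[OF tendsto_const d0, of "\<bar>\<phi> x\<bar>"] by simp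
  qed (use b in auto)
  have l1: "(\<lambda>j. sqn lebesgue (\<psi> j)) \<longlonglongrightarrow> sqn lebesgue \<phi>"
    unfolding sqn_def
  proof (rule integral_dominated_convergence[OF _ _ L2_integrable[OF test_L2(1)[OF \<phi>(1)]]])
    show "(\<lambda>x. (norm (\<psi> j x))\<^sup>2) \<in> borel_measurable lebesgue" for j
      by (rule borel_measurable_integrable[OF L2_integrable[OF test_L2(1)[OF \<psi>]]])
    show "(\<lambda>x. (norm (\<phi> x))\<^sup>2) \<in> borel_measurable lebesgue"
      by (rule borel_measurable_integrable[OF L2_integrable[OF test_L2(1)[OF \<phi>(1)]]])
    show "AE x in lebesgue. (\<lambda>j. (norm (\<psi> j x))\<^sup>2) \<longlonglongrightarrow> (norm (\<phi> x))\<^sup>2"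
      using tendsto_power[OF lim, of _ 2] by simp
    show "AE x in lebesgue. norm ((norm (\<psi> j x))\<^sup>2) \<le> (norm (\<phi> x))\<^sup>2" for j
      using power_mono[OF b(2) b(1), of j _ 2] by simp
  qed
  have l2: "(\<lambda>j. pint (\<psi> j)) \<longlonglongrightarrow> pint \<phi>"
    unfolding pint_def
  proof (rule integral_dominated_convergence[OF _ _ test_pint[OF \<phi>(1)]])
    show "(\<lambda>x. \<bar>\<psi> j x\<bar> powr p) \<in> borel_measurable lebesgue" for j
      by (rule borel_measurable_integrable[OF test_pint[OF \<psi>]])
    show "(\<lambda>x. \<bar>\<phi> x\<bar> powr p) \<in> borel_measurable lebesgue"
      by (rule borel_measurable_integrable[OF test_pint[OF \<phi>(1)]])
    show "AE x in lebesgue. (\<lambda>j. \<bar>\<psi> j x\<bar> powr p) \<longlonglongrightarrow> \<bar>\<phi> x\<bar> powr p"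
    proof (rule AE_I2)
      fix x
      have "(\<lambda>j. \<bar>\<psi> j x\<bar> powr p) \<longlonglongrightarrow> \<bar>\<bar>\<phi> x\<bar>\<bar> powr p"
        using p2 by (intro tendsto_powr' tendsto_rabs lim tendsto_const) auto
      then show "(\<lambda>j. \<bar>\<psi> j x\<bar> powr p) \<longlonglongrightarrow> \<bar>\<phi> x\<bar> powr p" by simp
    qed
    show "AE x in lebesgue. norm (\<bar>\<psi> j x\<bar> powr p) \<le> \<bar>\<phi> x\<bar> powr p" for j
      using b p2 by (auto intro!: AE_I2 powr_mono2)
  qed
  have "(\<lambda>j. (level lam + e) * pint (\<psi> j) powr (2 / p) - (energy \<phi> (grad \<phi>) - lam * sqn lebesgue (\<psi> j)))
    \<longlonglongrightarrow> (level lam + e) * pint \<phi> powr (2 / p) - (energy \<phi> (grad \<phi>) - lam * sqn lebesgue \<phi>)"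
    using \<phi>(2) by (intro tendsto_diff tendsto_mult tendsto_const l1 tendsto_powr[OF l2]) auto
  then have "\<forall>\<^sub>F j in sequentially. 0 < (level lam + e) * pint (\<psi> j) powr (2 / p) - (energy \<phi> (grad \<phi>) - lam * sqn lebesgue (\<psi> j))"
    by (rule order_tendstoD(1)) (use \<phi>(2,3) in \<open>simp add: shifted_energy_def\<close>)
  moreover have "\<forall>\<^sub>F j in sequentially. 0 < pint (\<psi> j)"
    by (rule order_tendstoD(1)[OF l2]) (simp add: \<phi>(2))
  ultimately have "\<forall>\<^sub>F j in sequentially. 0 < (level lam + e) * pint (\<psi> j) powr (2 / p) - (energy \<phi> (grad \<phi>) - lam * sqn lebesgue (\<psi> j)) \<and> 0 < pint (\<psi> j)"
    by (rule eventually_conj)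
  then obtain j where j: "0 < (level lam + e) * pint (\<psi> j) powr (2 / p) - (energy \<phi> (grad \<phi>) - lam * sqn lebesgue (\<psi> j))" "0 < pint (\<psi> j)"
    by (auto simp: eventually_sequentially)
  have Qj: "shifted_energy lam (\<psi> j) (grad (\<psi> j)) < (level lam + e) * pint (\<psi> j) powr (2 / p)"
    using j(1) smooth_abs_energy[OF \<phi>(1) d[of j]] by (simp add: shifted_energy_def \<psi>_def)
  define t where "t = pint (\<psi> j) powr (1 / p)"
  have t: "t > 0" "t\<^sup>2 = pint (\<psi> j) powr (2 / p)" using j(2) by (auto simp: t_def power2_eq_square powr_add[symmetric])
  have 1: "(\<lambda>x. inverse t * \<psi> j x) \<in> unitp" using normalizep[OF j(2)] \<psi>[of j] by (simp add: unitp_def test_cmult t_def)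
  have 2: "\<forall>x. 0 \<le> inverse t * \<psi> j x" using t(1) b(1) by simp
  have 3: "shifted_energy lam (\<lambda>x. inverse t * \<psi> j x) (grad (\<lambda>x. inverse t * \<psi> j x)) < level lam + e"
  proof -
    have "(inverse t)\<^sup>2 * shifted_energy lam (\<psi> j) (grad (\<psi> j)) < (inverse t)\<^sup>2 * ((level lam + e) * t\<^sup>2)"
      using Qj t by (intro mult_strict_left_mono) auto
    also have "\<dots> = level lam + e" using t(1) by (simp add: field_simps)
    finally show ?thesis by (simp add: shifted_energy_scale[OF \<psi>])
  qed
  show ?thesis by (rule bexI[OF _ 1]) (intro conjI 2 3)
qed

text \<open>The pointwise midpoint estimate contains the mixed term \<open>max(a, b)\<^sup>p\<^sup>-\<^sup>2w\<^sup>2\<close> with \<open>w = (a - b)/2\<close>.  Young's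
  inequality for \<open>w/B\<close> bounds it by \<open>B\<^sup>2(a\<^sup>p + b\<^sup>p + |w|\<^sup>p/B\<^sup>p)\<close>, whose integral is at most \<open>3B\<^sup>2\<close>.\<close>

lemma pint_midpoint:
  assumes a: "a \<in> test_functions \<Omega>" "pint a = 1" "\<And>x. 0 \<le> a x"
    and b: "b \<in> test_functions \<Omega>" "pint b = 1" "\<And>x. 0 \<le> b x"
    and B: "B > 0" "pint (\<lambda>x. (1/2) * (a x - b x)) \<le> B powr p"
  shows "1 - 3 * p * (p - 1) * B\<^sup>2 \<le> pint (\<lambda>x. (1/2) * (a x + b x))"
proof -
  let ?w = "\<lambda>x. (1/2) * (a x - b x)" and ?m = "\<lambda>x. (1/2) * (a x + b x)"
  have w: "?w \<in> test_functions \<Omega>" by (intro test_cmult test_diff a(1) b(1))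
  have m: "?m \<in> test_functions \<Omega>" by (intro test_cmult test_add a(1) b(1))
  note i = test_pint[OF a(1)] test_pint[OF b(1)] test_pint[OF w] test_pint[OF m]
  let ?f = "\<lambda>x. (\<bar>a x\<bar> powr p + \<bar>b x\<bar> powr p) / 2
     - p * (p - 1) * B\<^sup>2 * (\<bar>a x\<bar> powr p + \<bar>b x\<bar> powr p + \<bar>?w x\<bar> powr p / B powr p)"
  have if0: "integrable lebesgue ?f" using i by auto
  have "(\<integral>x. ?f x \<partial>lebesgue) \<le> pint ?m"
    unfolding pint_def
  proof (rule integral_mono[OF if0 i(4)])
    fix x
    define M where "M = max (a x) (b x)"
    have M0: "0 \<le> M" using a(3)[of x] by (simp add: M_def)
    have y: "M powr (p - 2) * (\<bar>?w x\<bar> / B)\<^sup>2 \<le> M powr p + (\<bar>?w x\<bar> / B) powr p"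
      using M0 B(1) p2 by (intro powr_young_sq) auto
    have "M powr (p - 2) * (?w x)\<^sup>2 = B\<^sup>2 * (M powr (p - 2) * (\<bar>?w x\<bar> / B)\<^sup>2)"
      using B(1) by (simp add: power_divide)
    also have "\<dots> \<le> B\<^sup>2 * (M powr p + (\<bar>?w x\<bar> / B) powr p)"
      by (rule mult_left_mono[OF y]) simp
    also have "\<dots> \<le> B\<^sup>2 * (\<bar>a x\<bar> powr p + \<bar>b x\<bar> powr p + \<bar>?w x\<bar> powr p / B powr p)"
    proof -
      have "M powr p \<le> \<bar>a x\<bar> powr p + \<bar>b x\<bar> powr p"
        using a(3)[of x] b(3)[of x] by (auto simp: M_def max_def)
      moreover have "(\<bar>?w x\<bar> / B) powr p = \<bar>?w x\<bar> powr p / B powr p"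
        by (rule powr_divide)
      ultimately have "M powr p + (\<bar>?w x\<bar> / B) powr p \<le> \<bar>a x\<bar> powr p + \<bar>b x\<bar> powr p + \<bar>?w x\<bar> powr p / B powr p"
        by linarith
      then show ?thesis by (rule mult_left_mono) simp
    qed
    finally have "p * (p - 1) * (M powr (p - 2) * (?w x)\<^sup>2) \<le> p * (p - 1) * (B\<^sup>2 * (\<bar>a x\<bar> powr p + \<bar>b x\<bar> powr p + \<bar>?w x\<bar> powr p / B powr p))"
      using p2 by (intro mult_left_mono) auto
    moreover have "(a x powr p + b x powr p) / 2 - p * (p - 1) * (M powr (p - 2) * ((a x - b x) / 2)\<^sup>2) \<le> ((a x + b x) / 2) powr p"
      unfolding M_def by (rule powr_midpoint[OF a(3) b(3) p2])
    moreover have "(a x - b x) / 2 = ?w x" "(a x + b x) / 2 = \<bar>?m x\<bar>" "\<bar>a x\<bar> = a x" "\<bar>b x\<bar> = b x"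
      using a(3)[of x] b(3)[of x] by auto
    ultimately show "?f x \<le> \<bar>?m x\<bar> powr p" by (simp only: mult.assoc)
  qed
  moreover have "(\<integral>x. ?f x \<partial>lebesgue) = (pint a + pint b) / 2 - p * (p - 1) * B\<^sup>2 * (pint a + pint b + pint ?w / B powr p)"
    unfolding pint_def using i by simp
  moreover have "p * (p - 1) * B\<^sup>2 * (pint a + pint b + pint ?w / B powr p) \<le> p * (p - 1) * B\<^sup>2 * 3"
    using p2 B by (intro mult_left_mono) (auto simp: a(2) b(2) divide_le_eq)
  moreover have "(pint a + pint b) / 2 = 1" by (simp add: a(2) b(2))
  moreover have "p * (p - 1) * B\<^sup>2 * 3 = 3 * p * (p - 1) * B\<^sup>2" by simp
  ultimately show ?thesis by linarith
qed

text \<open>Let \<open>m\<close> be the midpoint and \<open>w\<close> half the difference.  By the parallelogram identity the shifted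
  energies of \<open>m\<close> and \<open>w\<close> add up to at most \<open>level + e\<close>, and that of \<open>m\<close> is at least
  \<open>level (1 - C\<parallel>w\<parallel>\<^sub>p\<^sup>2)\<close> by the midpoint estimate.  Hence that of \<open>w\<close> is at most
  \<open>e + level \<sqdot> C\<parallel>w\<parallel>\<^sub>p\<^sup>2\<close>.  By the smallness assumption and the Sobolev inequality the last term is
  at most half the energy of \<open>w\<close>.\<close>

lemma almost_minimizers_close:
  assumes small: "level lam * (3 * p * (p - 1)) \<le> sobolev_const TYPE('n) / 2"
    and a: "a \<in> test_functions \<Omega>" "pint a = 1" "\<And>x. 0 \<le> a x" "shifted_energy lam a (grad a) \<le> level lam + e"
    and b: "b \<in> test_functions \<Omega>" "pint b = 1" "\<And>x. 0 \<le> b x" "shifted_energy lam b (grad b) \<le> level lam + e"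
  shows "energy (\<lambda>x. a x - b x) (grad (\<lambda>x. a x - b x)) \<le> 2 * lam * sqn lebesgue (\<lambda>x. a x - b x) + 8 * e"
proof -
  let ?K = "sobolev_const TYPE('n)"
  define C where "C = 3 * p * (p - 1)"
  have C0: "0 \<le> C" using p2 by (simp add: C_def)
  define w where "w = (\<lambda>x. (1/2) * (a x - b x))"
  define m where "m = (\<lambda>x. (1/2) * (a x + b x))"
  have wt: "w \<in> test_functions \<Omega>" unfolding w_def by (intro test_cmult test_diff a(1) b(1))
  have mt: "m \<in> test_functions \<Omega>" unfolding m_def by (intro test_cmult test_add a(1) b(1))
  have dt: "(\<lambda>x. a x - b x) \<in> test_functions \<Omega>" by (rule test_diff[OF a(1) b(1)])
  have st: "(\<lambda>x. a x + b x) \<in> test_functions \<Omega>" by (rule test_add[OF a(1) b(1)])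
  define Ew where "Ew = energy w (grad w)"
  have par: "shifted_energy lam m (grad m) + shifted_energy lam w (grad w) = (shifted_energy lam a (grad a) + shifted_energy lam b (grad b)) / 2"
  proof -
    have g: "grad (\<lambda>x. a x + b x) = (\<lambda>x. grad a x + grad b x)" "grad (\<lambda>x. a x - b x) = (\<lambda>x. grad a x - grad b x)"
      using grad_add grad_diff test_smooth[OF a(1)] test_smooth[OF b(1)] by (auto simp: fun_eq_iff)
    have n: "nl s (\<lambda>x. a x + b x) = (\<lambda>z. nl s a z + nl s b z)" using nl_add_scaled[of s a 1 b] by simp
    have combine: "(A1 + A2 - lam * A3) + (B1 + B2 - lam * B3) = 2 * (C1 + C2 - lam * C3) + 2 * (D1 + D2 - lam * D3)"
      if "A3 + B3 = 2 * C3 + 2 * D3" "A1 + B1 = 2 * C1 + 2 * D1" "A2 + B2 = 2 * C2 + 2 * D2"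
      for A1 A2 A3 B1 B2 B3 C1 C2 C3 D1 D2 D3 :: real
    proof -
      have "lam * A3 + lam * B3 = lam * (2 * C3 + 2 * D3)" using that(1) by (metis distrib_left)
      then show ?thesis using that(2,3) by (simp add: algebra_simps)
    qed
    have "shifted_energy lam (\<lambda>x. a x + b x) (grad (\<lambda>x. a x + b x)) + shifted_energy lam (\<lambda>x. a x - b x) (grad (\<lambda>x. a x - b x))
       = 2 * shifted_energy lam a (grad a) + 2 * shifted_energy lam b (grad b)"
      using sqn_parallelogram[OF test_L2(1)[OF a(1)] test_L2(1)[OF b(1)]]
        sqn_parallelogram[OF test_L2(2)[OF a(1)] test_L2(2)[OF b(1)]]
        sqn_parallelogram[OF test_nl[OF a(1)] test_nl[OF b(1)]]
      unfolding shifted_energy_def energy_def g n nl_diff by (rule combine)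
    then show ?thesis
      unfolding m_def w_def shifted_energy_scale[OF st] shifted_energy_scale[OF dt] by (simp add: power2_eq_square)
  qed
  have bound: "shifted_energy lam w (grad w) \<le> e + level lam * C * B\<^sup>2" if B: "B > 0" "pint w \<le> B powr p" for B
  proof -
    have y: "1 - C * B\<^sup>2 \<le> pint m"
      unfolding C_def m_def by (rule pint_midpoint[OF a(1-3) b(1-3) B(1)]) (use B(2) in \<open>simp add: w_def\<close>)
    have "level lam * (1 - C * B\<^sup>2) \<le> shifted_energy lam m (grad m)"
    proof (cases "1 - C * B\<^sup>2 \<le> 0")
      case True
      then have "level lam * (1 - C * B\<^sup>2) \<le> 0" using level_pos by (simp add: mult_nonneg_nonpos)
      then show ?thesis using shifted_energy_test_nonneg[OF mt] by linarith
    next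
      case False
      have "(1 - C * B\<^sup>2) powr 1 \<le> (1 - C * B\<^sup>2) powr (2 / p)"
        using False C0 p2 by (intro powr_mono') auto
      also have "\<dots> \<le> pint m powr (2 / p)" using False y p2 by (intro powr_mono2) auto
      finally have "1 - C * B\<^sup>2 \<le> pint m powr (2 / p)" using False by simp
      then have "level lam * (1 - C * B\<^sup>2) \<le> level lam * pint m powr (2 / p)"
        using level_pos by (intro mult_left_mono) auto
      then show ?thesis using level_test[OF mt] by linarith
    qed
    then show ?thesis using par a(4) b(4) by (simp add: algebra_simps)
  qed
  have half: "Ew / 2 \<le> lam * sqn lebesgue w + e"
  proof (rule field_le_epsilon)
    fix d :: real assume d: "d > 0"
    \<comment> \<open>An upper bound for the critical norm of \<open>w\<close>, made positive by the second summand.\<close>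
    define B where "B = sqrt (Ew / ?K + 2 * d / ?K)"
    have arg: "0 < Ew / ?K + 2 * d / ?K"
      using d sobolev_const_pos energy_nonneg[of w "grad w"] by (simp add: Ew_def add_nonneg_pos)
    have B: "B > 0" "B\<^sup>2 = Ew / ?K + 2 * d / ?K" using arg by (auto simp: B_def)
    have "?K * pint w powr (2 / p) \<le> sqn lebesgue (grad w)" by (rule sobolev_const_test(2)[OF test_UNIV[OF wt]])
    also have "\<dots> \<le> Ew" by (simp add: Ew_def energy_def sqn_nonneg)
    finally have "pint w powr (2 / p) \<le> Ew / ?K" using sobolev_const_pos by (simp add: field_simps)
    also have "\<dots> \<le> B\<^sup>2" using d sobolev_const_pos by (simp add: B(2))
    finally have "(pint w powr (2 / p)) powr (p / 2) \<le> (B\<^sup>2) powr (p / 2)" using p2 by (intro powr_mono2) auto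
    moreover have "(B\<^sup>2) powr (p / 2) = B powr p"
    proof -
      have "B\<^sup>2 = B powr 2" using B(1) by simp
      then show ?thesis by (simp only: powr_powr) simp
    qed
    ultimately have pw: "pint w \<le> B powr p" using p2 pint_nonneg[of w] by (simp add: powr_powr)
    have "level lam * C * B\<^sup>2 \<le> ?K / 2 * B\<^sup>2" using small by (intro mult_right_mono) (auto simp: C_def)
    also have "\<dots> = Ew / 2 + d" using sobolev_const_pos by (simp add: B(2) field_simps)
    finally have "shifted_energy lam w (grad w) \<le> e + (Ew / 2 + d)" using bound[OF B(1) pw] by linarith
    then show "Ew / 2 \<le> lam * sqn lebesgue w + e + d" by (simp add: shifted_energy_def Ew_def)
  qed
  have "Ew = (1/4) * energy (\<lambda>x. a x - b x) (grad (\<lambda>x. a x - b x))"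
    unfolding Ew_def w_def test_scale(3)[OF dt] by (simp add: power2_eq_square)
  moreover have "lam * sqn lebesgue w = (1/4) * (lam * sqn lebesgue (\<lambda>x. a x - b x))"
    unfolding w_def sqn_cmult by (simp add: power2_eq_square)
  ultimately show ?thesis using half unfolding mult.assoc by linarith
qed

text \<open>A subsequence of a nonnegative minimizing sequence is Cauchy in \<open>L\<^sup>2\<close> by compactness, hence its gradients
  are Cauchy as well.  That no mass is lost in \<open>L\<^sup>p\<close> follows from the tangent inequality at \<open>\<phi>\<^sub>k\<close> and the
  convergence of \<open>u - \<phi>\<^sub>k\<close> to 0 in \<open>L\<^sup>p\<close>, which Sobolev's inequality provides.\<close>

lemma minimizer_exists:
  assumes small: "level lam * (3 * p * (p - 1)) \<le> sobolev_const TYPE('n) / 2"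
  obtains u G \<phi> where "approx \<Omega> u G \<phi>" "AE x in lebesgue. 0 \<le> u x" "1 \<le> pint u" "shifted_energy lam u G \<le> level lam"
proof -
  let ?K = "sobolev_const TYPE('n)"
  define ee where "ee k = 1 / real (Suc k)" for k
  have ee: "ee k > 0" "ee k \<le> 1" for k by (auto simp: ee_def)
  have ee0: "ee \<longlonglongrightarrow> 0" unfolding ee_def by (rule LIMSEQ_Suc[OF lim_1_over_n])
  obtain \<phi>0 where \<phi>0: "\<And>k. \<phi>0 k \<in> unitp" "\<And>k x. 0 \<le> \<phi>0 k x" "\<And>k. shifted_energy lam (\<phi>0 k) (grad (\<phi>0 k)) < level lam + ee k"
    using nonneg_minimizing[OF ee(1)] by metis
  have t0: "\<phi>0 k \<in> test_functions \<Omega>" for k using \<phi>0(1) by (simp add: unitp_def)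
  define A where "A = (level lam + 1) / (1 - lam / lambda_1 s \<Omega>)"
  have EA: "energy (\<phi>0 k) (grad (\<phi>0 k)) \<le> A" for k
  proof -
    have "(1 - lam / lambda_1 s \<Omega>) * energy (\<phi>0 k) (grad (\<phi>0 k)) \<le> level lam + 1"
      using shifted_energy_coercive[OF lambda_1_test(2)[OF t0, of k]] \<phi>0(3)[of k] ee(2)[of k] by linarith
    then show ?thesis using coercivity_pos by (simp add: A_def le_divide_eq mult.commute)
  qed
  have b1: "sqn lebesgue (\<phi>0 k) \<le> max A (A / lambda_1 s \<Omega>)" for k
  proof -
    have "lambda_1 s \<Omega> * sqn lebesgue (\<phi>0 k) \<le> A" using lambda_1_test(2)[OF t0, of k] EA[of k] by linarith
    then have "sqn lebesgue (\<phi>0 k) \<le> A / lambda_1 s \<Omega>" using lambda_1_pos by (simp add: le_divide_eq mult.commute)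
    then show ?thesis by simp
  qed
  have b2: "sqn lebesgue (nl s (\<phi>0 k)) \<le> max A (A / lambda_1 s \<Omega>)" for k
    using EA[of k] sqn_nonneg[of lebesgue "grad (\<phi>0 k)"] by (simp add: energy_def)
  obtain r where r: "strict_mono (r :: nat \<Rightarrow> nat)"
    "\<forall>e>0. \<exists>N. \<forall>k\<ge>N. \<forall>l\<ge>N. sqn lebesgue (\<lambda>x. \<phi>0 (r k) x - \<phi>0 (r l) x) < e"
    by (rule rellich[where \<phi> = \<phi>0, OF bd s0 t0 test_nl[OF t0] b1 b2])
  define \<phi> where "\<phi> k = \<phi>0 (r k)" for k
  have t: "\<phi> k \<in> test_functions \<Omega>" "pint (\<phi> k) = 1" "0 \<le> \<phi> k x" for k x
    using \<phi>0(1)[of "r k"] \<phi>0(2) by (auto simp: \<phi>_def unitp_def)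
  have er: "ee (r k) \<le> ee k" for k
    using seq_suble[OF r(1), of k] by (simp add: ee_def field_simps)
  have Qk: "shifted_energy lam (\<phi> k) (grad (\<phi> k)) \<le> level lam + ee k" for k
    using \<phi>0(3)[of "r k"] er[of k] by (simp add: \<phi>_def)
  obtain u where u: "L2conv lebesgue \<phi> u"
    using L2_complete[of \<phi> lebesgue, OF test_L2(1)[OF t(1)]] r(2) unfolding \<phi>_def by blast
  have "\<exists>N. \<forall>k\<ge>N. \<forall>l\<ge>N. sqn lebesgue (\<lambda>x. grad (\<phi> k) x - grad (\<phi> l) x) < e" if e: "e > 0" for e
  proof -
    have "e / (4 * lam) > 0" using e lam by simp
    then obtain N1 where N1: "\<And>k l. k \<ge> N1 \<Longrightarrow> l \<ge> N1 \<Longrightarrow> sqn lebesgue (\<lambda>x. \<phi> k x - \<phi> l x) < e / (4 * lam)"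
      using r(2) unfolding \<phi>_def by blast
    have "\<forall>\<^sub>F k in sequentially. ee k < e / 16" using e by (intro order_tendstoD(2)[OF ee0]) simp
    then obtain N2 where N2: "\<And>k. k \<ge> N2 \<Longrightarrow> ee k < e / 16" by (auto simp: eventually_sequentially)
    have "sqn lebesgue (\<lambda>x. grad (\<phi> k) x - grad (\<phi> l) x) < e" if "k \<ge> max N1 N2" "l \<ge> max N1 N2" for k l
    proof -
      have "energy (\<lambda>x. \<phi> k x - \<phi> l x) (grad (\<lambda>x. \<phi> k x - \<phi> l x)) \<le> 2 * lam * sqn lebesgue (\<lambda>x. \<phi> k x - \<phi> l x) + 8 * (e / 16)"
      proof (rule almost_minimizers_close[OF small t(1,2,3) _ t(1,2,3)])
        show "shifted_energy lam (\<phi> k) (grad (\<phi> k)) \<le> level lam + e / 16" using Qk[of k] N2[of k] that by simp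
        show "shifted_energy lam (\<phi> l) (grad (\<phi> l)) \<le> level lam + e / 16" using Qk[of l] N2[of l] that by simp
      qed
      moreover have "2 * lam * sqn lebesgue (\<lambda>x. \<phi> k x - \<phi> l x) < 2 * lam * (e / (4 * lam))"
        using N1[of k l] that lam by (intro mult_strict_left_mono) auto
      moreover have "2 * lam * (e / (4 * lam)) = e / 2" using lam by simp
      moreover have "grad (\<lambda>x. \<phi> k x - \<phi> l x) = (\<lambda>x. grad (\<phi> k) x - grad (\<phi> l) x)"
        using grad_diff[OF test_smooth[OF t(1)] test_smooth[OF t(1)]] by (auto simp: fun_eq_iff)
      ultimately show ?thesis
        using sqn_nonneg[of lebesgue "nl s (\<lambda>x. \<phi> k x - \<phi> l x)"] by (simp add: energy_def)
    qed
    then show ?thesis by blast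
  qed
  from L2_complete[of "\<lambda>k. grad (\<phi> k)" lebesgue, OF test_L2(2)[OF t(1)] this]
  obtain G where G: "L2conv lebesgue (\<lambda>k. grad (\<phi> k)) G" by blast
  have a: "approx \<Omega> u G \<phi>" using t(1) u G by (simp add: approx_def)
  obtain q where q: "strict_mono q" "AE x in lebesgue. (\<lambda>k. \<phi> (q k) x) \<longlonglongrightarrow> u x"
    by (rule L2conv_AE_subseq[OF u])
  have pos: "AE x in lebesgue. 0 \<le> u x"
    using q(2)
  proof eventually_elim
    case (elim x)
    show ?case by (rule LIMSEQ_le_const[OF elim]) (use t(3) in auto)
  qed
  have Qu: "shifted_energy lam u G \<le> level lam"
  proof (rule LIMSEQ_le)
    show "(\<lambda>k. shifted_energy lam (\<phi> k) (grad (\<phi> k))) \<longlonglongrightarrow> shifted_energy lam u G"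
      unfolding shifted_energy_def by (intro tendsto_diff tendsto_mult tendsto_const approx_tendsto[OF a])
    show "(\<lambda>k. level lam + ee k) \<longlonglongrightarrow> level lam" using tendsto_add[OF tendsto_const ee0, of "level lam"] by simp
  qed (use Qk in auto)
  define B where "B k = sqrt (sqn lebesgue (\<lambda>x. grad (\<phi> k) x - G x) / ?K) + ee k" for k
  have B: "B k > 0" for k using ee(1)[of k] sobolev_const_pos by (simp add: B_def add_nonneg_pos sqn_nonneg)
  have B0: "B \<longlonglongrightarrow> 0"
  proof -
    have "B \<longlonglongrightarrow> sqrt (0 / ?K) + 0"
      unfolding B_def using sobolev_const_pos
      by (intro tendsto_add tendsto_real_sqrt tendsto_divide tendsto_const L2convD(3)[OF G] ee0) auto
    then show ?thesis by simp
  qed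
  have "1 - p * (2 * B k) \<le> pint u" for k
  proof -
    let ?v = "\<lambda>x. u x - \<phi> k x"
    note b = approx_diff[OF a test_approx[OF t(1)[of k]]]
    have vm: "?v \<in> borel_measurable lebesgue" by (rule L2_measurable[OF approxD(4)[OF b]])
    note iv = sobolev_approx(1)[OF b]
    have \<phi>m: "\<phi> k \<in> borel_measurable lebesgue" by (rule test_measurable(1)[OF t(1)])
    have "pint ?v powr (2 / p) \<le> sqn lebesgue (\<lambda>x. grad (\<phi> k) x - G x) / ?K"
      using sobolev_approx(2)[OF b] sobolev_const_pos by (simp add: field_simps sqn_diff_commute[of _ G])
    from real_sqrt_le_mono[OF this] have "sqrt (pint ?v powr (2 / p)) \<le> B k"
      using ee(1)[of k] unfolding B_def by linarith
    moreover have "sqrt (pint ?v powr (2 / p)) = pint ?v powr (1 / p)"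
      using powr_half_sqrt[of "pint ?v powr (2 / p)"] by (simp add: powr_powr)
    ultimately have "(pint ?v powr (1 / p)) powr p \<le> B k powr p" using p2 by (intro powr_mono2) auto
    then have pv: "pint ?v \<le> B k powr p" using p2 pint_nonneg[of ?v] by (simp add: powr_powr)
    have "- (\<integral>x. \<bar>\<phi> k x\<bar> powr (p - 1) * ?v x \<partial>lebesgue) \<le> (\<integral>x. B k * (\<bar>\<phi> k x\<bar> powr p + \<bar>?v x\<bar> powr p / B k powr p) \<partial>lebesgue)"
      unfolding Bochner_Integration.integral_minus[symmetric]
    proof (rule integral_mono)
      show "integrable lebesgue (\<lambda>x. - (\<bar>\<phi> k x\<bar> powr (p - 1) * ?v x))"
        using power_pairing_integrable[OF \<phi>m test_pint[OF t(1)] vm iv] by simp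
      show "integrable lebesgue (\<lambda>x. B k * (\<bar>\<phi> k x\<bar> powr p + \<bar>?v x\<bar> powr p / B k powr p))"
        using test_pint[OF t(1)[of k]] iv by auto
      fix x
      have "\<bar>\<phi> k x\<bar> powr (p - 1) * (\<bar>?v x\<bar> / B k) \<le> \<bar>\<phi> k x\<bar> powr p + (\<bar>?v x\<bar> / B k) powr p"
        using B[of k] p2 by (intro powr_young_one) auto
      then have "B k * (\<bar>\<phi> k x\<bar> powr (p - 1) * (\<bar>?v x\<bar> / B k)) \<le> B k * (\<bar>\<phi> k x\<bar> powr p + \<bar>?v x\<bar> powr p / B k powr p)"
        using B[of k] by (intro mult_left_mono) (auto simp: powr_divide)
      moreover have "B k * (\<bar>\<phi> k x\<bar> powr (p - 1) * (\<bar>?v x\<bar> / B k)) = \<bar>\<phi> k x\<bar> powr (p - 1) * \<bar>?v x\<bar>"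
        using B[of k] by simp
      moreover have "- (\<bar>\<phi> k x\<bar> powr (p - 1) * ?v x) \<le> \<bar>\<phi> k x\<bar> powr (p - 1) * \<bar>?v x\<bar>"
        using abs_ge_minus_self[of "\<bar>\<phi> k x\<bar> powr (p - 1) * ?v x"] by (simp add: abs_mult)
      ultimately show "- (\<bar>\<phi> k x\<bar> powr (p - 1) * ?v x) \<le> B k * (\<bar>\<phi> k x\<bar> powr p + \<bar>?v x\<bar> powr p / B k powr p)" by linarith
    qed
    also have "\<dots> = B k * (pint (\<phi> k) + pint ?v / B k powr p)"
      unfolding pint_def using test_pint[OF t(1)[of k]] iv by simp
    also have "\<dots> \<le> B k * 2"
    proof (rule mult_left_mono)
      have "pint ?v / B k powr p \<le> 1" using pv B[of k] by (simp add: divide_le_eq)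
      then show "pint (\<phi> k) + pint ?v / B k powr p \<le> 2" by (simp add: t(2))
    qed (use B[of k] in simp)
    finally have "p * (- (\<integral>x. \<bar>\<phi> k x\<bar> powr (p - 1) * ?v x \<partial>lebesgue)) \<le> p * (B k * 2)"
      using p2 by (intro mult_left_mono) auto
    moreover have "pint (\<phi> k) + 1 * (p * (\<integral>x. \<bar>\<phi> k x\<bar> powr (p - 1) * ?v x \<partial>lebesgue)) \<le> pint (\<lambda>x. \<phi> k x + 1 * ?v x)"
      by (rule pint_increment[OF \<phi>m test_pint[OF t(1)] _ vm iv]) (use t(3) sobolev_approx(1)[OF a] in auto)
    ultimately show ?thesis by (simp add: t(2) algebra_simps)
  qed
  then have "1 - p * (2 * 0) \<le> pint u"
    by (intro LIMSEQ_le_const2[OF tendsto_diff[OF tendsto_const tendsto_mult[OF tendsto_const tendsto_mult[OF tendsto_const B0]]]]) auto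
  then have "1 \<le> pint u" by simp
  with a pos Qu that show ?thesis by blast
qed

text \<open>The function \<open>g(t)\<close>, the shifted energy of \<open>u + tv\<close> minus \<open>level \<sqdot> (1 + tpc)\<^bsup>2/p\<^esup>\<close>, is nonnegative for small
  \<open>t\<close>, because \<open>1 + tpc\<close> bounds the integral of \<open>|u + tv|\<^sup>p\<close> from below.  It vanishes at 0, so its
  derivative vanishes there.\<close>

lemma euler_lagrange:
  assumes a: "approx \<Omega> u G \<phi>" and pos: "AE x in lebesgue. 0 \<le> u x" and P: "1 \<le> pint u" and Qu: "shifted_energy lam u G \<le> level lam"
    and b: "approx \<Omega> v H \<psi>"
  shows "ip lebesgue G H + ip lebesgue (nl s u) (nl s v)
     = level lam * (\<integral>x. \<bar>u x\<bar> powr (p - 1) * v x \<partial>lebesgue) + lam * ip lebesgue u v"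
proof -
  let ?S = "level lam"
  have um: "u \<in> borel_measurable lebesgue" and vm: "v \<in> borel_measurable lebesgue"
    using approxD(4)[OF a] approxD(4)[OF b] by (auto simp: L2_def)
  have "?S * pint u powr (2 / p) \<le> ?S * 1" using level_approx[OF a] Qu by simp
  then have "pint u powr (2 / p) \<le> 1" using level_pos by simp
  then have "(pint u powr (2 / p)) powr (p / 2) \<le> 1 powr (p / 2)" using p2 by (intro powr_mono2) auto
  then have P1: "pint u = 1" using P p2 by (simp add: powr_powr)
  then have QS: "shifted_energy lam u G = ?S" using level_approx[OF a] Qu by simp
  define c where "c = (\<integral>x. \<bar>u x\<bar> powr (p - 1) * v x \<partial>lebesgue)"
  define B where "B = ip lebesgue G H + ip lebesgue (nl s u) (nl s v) - lam * ip lebesgue u v"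
  define g where "g t = ?S + 2 * t * B + t\<^sup>2 * shifted_energy lam v H - ?S * (1 + t * (p * c)) powr (2 / p)" for t
  have g0: "g 0 = 0" by (simp add: g_def)
  have gpos: "0 \<le> g t" if t: "0 < 1 + t * (p * c)" for t
  proof -
    note ab = approx_add_scaled[OF a b, of t]
    have "1 + t * (p * c) \<le> pint (\<lambda>x. u x + t * v x)"
      using pint_increment[OF um sobolev_approx(1)[OF a] pos vm sobolev_approx(1)[OF b] sobolev_approx(1)[OF ab]]
      by (simp add: P1 c_def)
    then have "?S * (1 + t * (p * c)) powr (2 / p) \<le> ?S * pint (\<lambda>x. u x + t * v x) powr (2 / p)"
      using t p2 level_pos by (intro mult_left_mono powr_mono2) auto
    also have "\<dots> \<le> shifted_energy lam (\<lambda>x. u x + t * v x) (\<lambda>x. G x + t *\<^sub>R H x)" by (rule level_approx[OF ab])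
    also have "\<dots> = shifted_energy lam u G + 2 * t * B + t\<^sup>2 * shifted_energy lam v H"
      using sqn_add_scaled[OF approxD(4)[OF a] approxD(4)[OF b], of t]
        sqn_add_scaled[OF approxD(5)[OF a] approxD(5)[OF b], of t]
        sqn_add_scaled[OF approx_nl_L2[OF a] approx_nl_L2[OF b], of t]
      by (simp add: shifted_energy_def energy_def nl_add_scaled B_def algebra_simps)
    finally show ?thesis by (simp add: g_def QS)
  qed
  have der: "(g has_real_derivative (2 * B - ?S * ((p * c) * (2 / p)))) (at 0)"
    unfolding g_def[abs_def] by (auto intro!: derivative_eq_intros)
  define d where "d = 1 / (1 + \<bar>p * c\<bar>)"
  have d: "d > 0" by (simp add: d_def add_pos_nonneg)
  have "2 * B - ?S * ((p * c) * (2 / p)) = 0"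
  proof (rule DERIV_local_min[OF der d])
    show "\<forall>y. \<bar>0 - y\<bar> < d \<longrightarrow> g 0 \<le> g y"
    proof (intro allI impI)
      fix y assume y: "\<bar>0 - y\<bar> < d"
      have "\<bar>y * (p * c)\<bar> \<le> \<bar>y\<bar> * (1 + \<bar>p * c\<bar>)" unfolding abs_mult[of y] by (intro mult_left_mono) auto
      also have "\<dots> < d * (1 + \<bar>p * c\<bar>)" using y by (intro mult_strict_right_mono) (auto simp: add_pos_nonneg)
      also have "\<dots> = 1" by (simp add: d_def add_pos_nonneg less_imp_neq[symmetric])
      finally have "0 < 1 + y * (p * c)" by linarith
      then show "g 0 \<le> g y" using gpos g0 by simp
    qed
  qed
  then have "B = ?S * c" using p2 by simp
  then show ?thesis by (simp add: B_def c_def)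
qed

text \<open>The Lagrange multiplier is removed by scaling: \<open>\<alpha>\<^bsup>p - 2\<^esup> = level\<close>.\<close>

lemma solution_exists:
  assumes small: "level lam * (3 * p * (p - 1)) \<le> sobolev_const TYPE('n) / 2"
  shows "\<exists>u. is_solution s \<Omega> lam u"
proof -
  obtain u G \<phi> where a: "approx \<Omega> u G \<phi>" and pos: "AE x in lebesgue. 0 \<le> u x" and P: "1 \<le> pint u" and Qu: "shifted_energy lam u G \<le> level lam"
    by (rule minimizer_exists[OF small])
  define \<alpha> where "\<alpha> = level lam powr (1 / (p - 2))"
  have \<alpha>: "\<alpha> > 0" using level_pos by (simp add: \<alpha>_def)
  have \<alpha>S: "\<alpha> powr (p - 1) = \<alpha> * level lam"
  proof -
    have "\<alpha> powr (p - 2) = level lam" using p2 level_pos by (simp add: \<alpha>_def powr_powr)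
    moreover have "\<alpha> powr (p - 1) = \<alpha> powr 1 * \<alpha> powr (p - 2)" unfolding powr_add[symmetric] by simp
    ultimately show ?thesis using \<alpha> by simp
  qed
  have "weak_form lam (\<lambda>x. \<alpha> * u x) (\<lambda>x. \<alpha> *\<^sub>R G x)"
    unfolding weak_form_def
  proof (intro allI impI)
    fix v H \<psi> assume b: "approx \<Omega> v H \<psi>"
    have 1: "(\<integral>x. \<bar>\<alpha> * u x\<bar> powr (p - 1) * v x \<partial>lebesgue) = \<alpha> powr (p - 1) * (\<integral>x. \<bar>u x\<bar> powr (p - 1) * v x \<partial>lebesgue)"
      using \<alpha> by (simp add: abs_mult powr_mult mult.assoc)
    have 2: "ip lebesgue (nl s (\<lambda>x. \<alpha> * u x)) (nl s v) = \<alpha> * ip lebesgue (nl s u) (nl s v)"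
      unfolding nl_scale using ip_scale[of lebesgue \<alpha> "nl s u" "nl s v"] by simp
    have 3: "ip lebesgue (\<lambda>x. \<alpha> * u x) v = \<alpha> * ip lebesgue u v"
      using ip_scale[of lebesgue \<alpha> u v] by simp
    show "ip lebesgue (\<lambda>x. \<alpha> *\<^sub>R G x) H + ip lebesgue (nl s (\<lambda>x. \<alpha> * u x)) (nl s v)
       = (\<integral>x. \<bar>\<alpha> * u x\<bar> powr (p - 1) * v x \<partial>lebesgue) + lam * ip lebesgue (\<lambda>x. \<alpha> * u x) v"
      unfolding 1 2 3 ip_scale \<alpha>S using arg_cong[OF euler_lagrange[OF a pos P Qu b], of "\<lambda>t. \<alpha> * t"]
      by (simp add: algebra_simps)
  qed
  moreover have "AE x in lebesgue. 0 \<le> \<alpha> * u x" using pos by eventually_elim (use \<alpha> in simp)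
  moreover have "\<not> (AE x in lebesgue. \<alpha> * u x = 0)"
  proof
    assume "AE x in lebesgue. \<alpha> * u x = 0"
    then have "AE x in lebesgue. \<bar>u x\<bar> powr p = 0" by eventually_elim (use \<alpha> in simp)
    then have "pint u = 0" unfolding pint_def by (rule integral_eq_zero_AE)
    with P show False by simp
  qed
  ultimately show ?thesis using approx_scale[OF a, of \<alpha>] solution_iff_weak_form by blast
qed

end

lemma solutions_near_lambda_1:
  "\<exists>lam_star. lambda_1s s \<Omega> \<le> lam_star \<and> lam_star < lambda_1 s \<Omega> \<and>
     (\<forall>lam. lam_star < lam \<and> lam < lambda_1 s \<Omega> \<longrightarrow> (\<exists>u. is_solution s \<Omega> lam u))"
proof -
  define C where "C = 3 * p * (p - 1)"
  have C: "C > 0" using p2 by (simp add: C_def)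
  define \<delta> where "\<delta> = sobolev_const TYPE('n) / (2 * C * (vol + 1))"
  have vol1: "vol + 1 \<noteq> 0" using vol_nonneg by linarith
  have \<delta>: "\<delta> > 0" using sobolev_const_pos C vol_nonneg by (simp add: \<delta>_def)
  show ?thesis
  proof (intro exI[of _ "max (lambda_1s s \<Omega>) (lambda_1 s \<Omega> - \<delta>)"] conjI allI impI)
    show "max (lambda_1s s \<Omega>) (lambda_1 s \<Omega> - \<delta>) < lambda_1 s \<Omega>" using lambda_gap \<delta> by simp
    fix lam assume l: "max (lambda_1s s \<Omega>) (lambda_1 s \<Omega> - \<delta>) < lam \<and> lam < lambda_1 s \<Omega>"
    then have lam: "0 < lam" "lam < lambda_1 s \<Omega>" using lambda_1s_test(1) by auto
    have "level lam \<le> (lambda_1 s \<Omega> - lam) * (vol + 1)" by (rule level_small[OF lam])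
    also have "\<dots> \<le> \<delta> * (vol + 1)" using l vol_nonneg by (intro mult_right_mono) auto
    finally have "level lam * C \<le> \<delta> * (vol + 1) * C" using C by (intro mult_right_mono) auto
    also have "\<dots> = sobolev_const TYPE('n) / 2" using C vol1 by (simp add: \<delta>_def)
    finally show "\<exists>u. is_solution s \<Omega> lam u"
      by (intro solution_exists[OF lam]) (simp add: C_def)
  qed simp
qed

end

theorem theorem1p4:
  fixes \<Omega> :: "(real ^ 'n) set" and s :: real
  assumes "CARD('n) \<ge> 3"
    and "0 < s" and "s < 1"
    and "\<Omega> \<noteq> {}" and "open \<Omega>" and "bounded \<Omega>"
  shows "(\<exists>lam_star. lambda_1s s \<Omega> \<le> lam_star \<and> lam_star < lambda_1 s \<Omega> \<and>
            (\<forall>lam. lam_star < lam \<and> lam < lambda_1 s \<Omega> \<longrightarrow> (\<exists>u. is_solution s \<Omega> lam u)))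
       \<and> (\<forall>lam. lam \<ge> lambda_1 s \<Omega> \<longrightarrow> \<not> (\<exists>u. is_solution s \<Omega> lam u))
       \<and> (\<forall>lam. 0 < lam \<and> lam \<le> lambda_1s s \<Omega> \<longrightarrow>
            \<not> (\<exists>u. is_solution s \<Omega> lam u
                   \<and> u \<in> Lp (crit_exp CARD('n)) UNIV
                   \<and> Lp_norm (crit_exp CARD('n)) UNIV u
                       \<le> sobolev_const TYPE('n) powr ((real CARD('n) - 2) / 4)))"
proof -
  interpret mixed_problem \<Omega> s by unfold_locales (use assms in auto)
  show ?thesis
    using solutions_near_lambda_1 no_solution_above no_small_solution by (auto simp: p_def)
qed

end
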